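(* For $g\in\mathcal P_\dagger$ and $\Phi_t^g(\eta):=\langle g(t),\eta\rangle_K$, $\eta\in K$, $$\int_0^T\int_{\mathbb R^N}g(t,x)\,M_E(dt,dx)=\int_0^Tg(t)\,d\tilde W_{E_t}=\int_0^T\Phi_t^g\circ J^{-1}\,dW_{E_t},$$ where $M_{E_t}$ is the time-changed martingale measure $M_{E_t}(A)=F(1_{[0,E_t]}(\cdot)1_A( * ))$, $\tilde W_{E_t}$ is the time-changed cylindrical Wiener process $\tilde W_{E_t}(\varphi)=F(1_{[0,E_t]}(\cdot)\varphi( * ))$, $J$ is the operator $J(h)=\sum_j\lambda_j^{1/2}\langle h,f_j\rangle_Kf_j$ on $K$, and $W_{E_t}=\sum_jw_j(E_t)J(f_j)$ is the time-changed $Q$-Wiener process with $w_j(E_t)=\tilde W_{E_t}(f_j)$.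
   Context: Random field and Hilbert space. $\{F(\phi):\phi\in C_0^\infty(\mathbb R^+\times\mathbb R^N)\}$ is a family of mean zero (jointly) Gaussian random variables with $\mathbb E(F(\phi)F(\psi))=\int_{\mathbb R^+}\int_{\mathbb R^N}\int_{\mathbb R^N}\phi(s,x)f(x-y)\psi(s,y)\,dy\,dx\,ds$, where $f$ is a non-negative, non-negative definite continuous function on $\mathbb R^N\setminus\{0\}$, integrable near $0$, and there is a tempered measure $\mu$ on $\mathbb R^N$ such that $\int(1+|\xi|^2)^{-m}\mu(d\xi)<\infty$ for any $m\in\mathbb N^+$ and $\int f(x)\gamma(x)\,dx=\int\widehat\gamma(\xi)\,\mu(d\xi)$ for all $\gamma\in\mathcal S(\mathbb R^N)$ ($\widehat\gamma$ the Fourier transform). $K$ is the Hilbert space completion of $\mathcal S(\mathbb R^N)$ for $\langle\gamma,\psi\rangle_K=\int\int\gamma(x)f(x-y)\psi(y)\,dy\,dx=\int\widehat\gamma(\xi)\overline{\widehat\psi(\xi)}\,\mu(d\xi)$. $F$ extends by isometry to $L^2([0,T];K)$ (all $T>0$), in particular to $1_{[0,t]}(\cdot)\varphi( * )$, $\varphi\in K$, and $1_{[0,t]}(\cdot)1_A( * )$, $A$ bounded Borel. $\{f_j\}\subset\mathcal S(\mathbb R^N)$ is a complete orthonormal basis of $K$. The processes $w_j(t)=F(1_{[0,t]}(\cdot)f_j( * ))$ are independent standard Brownian motions. Time change. For $\beta\in(0,1)$, $E_t=\inf\{\tau>0:U_\beta(\tau)>t\}$, $U_\beta$ a $\beta$-stable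 subordinator with $\mathbb E(e^{-uU_\beta(\tau)})=e^{-\tau u^\beta}$, $E$ independent of $F$. $\tilde{\mathcal F}_t=\bigcap_{u>t}\{\sigma[w_j(s):0\le s\le u,\ j\ge1]\vee\sigma[E_s:s\ge0]\}$ (completed), $\mathcal G_t=\tilde{\mathcal F}_{E_t}$ (the $\sigma$-field at the stopping time $E_t$); predictability is with respect to $\{\mathcal G_t\}$. $F(1_{[0,E_t]}\cdots)$ denotes $F(1_{[0,\tau]}\cdots)$ evaluated at $\tau=E_t$. Operators. $\lambda_j>0$ with $\sum_j\lambda_j<\infty$, and $Q=JJ^*$ so that $Qf_j=\lambda_jf_j$. $K_Q=Q^{1/2}K$ has orthonormal basis $\{\lambda_j^{1/2}f_j\}$, and $J^{-1}:K_Q\to K$ is an isometry. Integrals. $\mathcal P_\dagger$ is the set of predictable $(\omega,t,x)\mapsto g(t,x;\omega)$ with $\|g\|_\dagger^2=\mathbb E\int_0^T\int_{\mathbb R^N}\int_{\mathbb R^N}|g(t,x)|f(x-y)|g(t,y)|\,dy\,dx\,dE_t<\infty$; $g(t)$ denotes $g(t,\cdot)\in K$. The integral against $M_E$ is defined for $g=1_{(a,b]}(s)1_A(x)X(\omega)$ ($0\le a<b\le T$, $A$ bounded Borel, $X$ bounded $\mathcal G_a$-measurable) by $\int_0^T\int_{\mathbb R^N}g\,dM_E=X(M_{E_b}(A)-M_{E_a}(A))$, and extended by linearity and $\|\cdot\|_\dagger$-limits to $\mathcal P_\dagger$. Further, $\int_0^Tg(t)\,d\tilde W_{E_t}:=\sum_j\int_0^T\langle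 g(t),f_j\rangle_K\,d\tilde W_{E_t}(f_j)$ (limit in $L^2(\Omega)$), and for $\mathcal L_2(K_Q,\mathbb R)$-valued $\Phi$ (Hilbert–Schmidt operators), $\int_0^T\Phi(t)\,dW_{E_t}=\sum_j\int_0^T\Phi(t)(\lambda_j^{1/2}f_j)\,dw_j(E_t)$. *)

theory Defs
  imports "HOL-Probability.Probability"
begin

fun iter_deriv :: "'v::euclidean_space list \<Rightarrow> ('v \<Rightarrow> real) \<Rightarrow> 'v \<Rightarrow> real" where
  "iter_deriv [] g = g"
| "iter_deriv (v # vs) g = (\<lambda>x. frechet_derivative (iter_deriv vs g) (at x) v)"

definition smooth :: "('v::euclidean_space \<Rightarrow> real) \<Rightarrow> bool" where
  "smooth g \<longleftrightarrow> (\<forall>vs. set vs \<subseteq> Basis \<longrightarrow> (\<forall>x. iter_deriv vs g differentiable (at x)))"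

definition schwartz :: "('v::euclidean_space \<Rightarrow> real) set" where
  "schwartz = {g. smooth g \<and>
     (\<forall>vs k. set vs \<subseteq> Basis \<longrightarrow> (\<exists>C. \<forall>x. (1 + norm x) ^ k * \<bar>iter_deriv vs g x\<bar> \<le> C))}"

text \<open>The support is taken inside the open half space. A random field indexed by the smooth
  compactly supported functions on the closed half space restricts to one indexed by
  \<open>test_functions\<close>, and both have the same isometric extension.\<close>

definition test_functions :: "(real \<times> (real ^ 'n) \<Rightarrow> real) set" where
  "test_functions = {\<phi>. smooth \<phi> \<and> compact (closure {z. \<phi> z \<noteq> 0}) \<and>
     closure {z. \<phi> z \<noteq> 0} \<subseteq> {0<..} \<times> UNIV}"

definition fourier :: "(real ^ 'n \<Rightarrow> real) \<Rightarrow> real ^ 'n \<Rightarrow> complex" where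
  "fourier \<gamma> \<xi> = (\<integral>x. cis (- (\<xi> \<bullet> x)) * complex_of_real (\<gamma> x) \<partial>lborel)"

definition kform :: "(real ^ 'n \<Rightarrow> real) \<Rightarrow> (real ^ 'n \<Rightarrow> real) \<Rightarrow> (real ^ 'n \<Rightarrow> real) \<Rightarrow> real" where
  "kform f \<gamma> \<psi> = (\<integral>x. (\<integral>y. \<gamma> x * f (x - y) * \<psi> y \<partial>lborel) \<partial>lborel)"

definition abs_form :: "(real ^ 'n \<Rightarrow> real) \<Rightarrow> (real ^ 'n \<Rightarrow> real) \<Rightarrow> ennreal" where
  "abs_form f h = (\<integral>\<^sup>+x. (\<integral>\<^sup>+y. ennreal (\<bar>h x\<bar> * f (x - y) * \<bar>h y\<bar>) \<partial>lborel) \<partial>lborel)"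

text \<open>The kernel lives on the complement of the origin, so its value at 0 is unconstrained, and
  non-negative definiteness is meant in the sense of the quadratic form.\<close>

definition covariance_kernel :: "(real ^ 'n \<Rightarrow> real) \<Rightarrow> bool" where
  "covariance_kernel f \<longleftrightarrow>
     continuous_on (- {0}) f \<and>
     (\<forall>x. x \<noteq> 0 \<longrightarrow> 0 \<le> f x) \<and>
     (\<forall>\<gamma>\<in>schwartz. 0 \<le> kform f \<gamma> \<gamma>) \<and>
     (\<exists>r>0. set_integrable lborel (ball 0 r) f) \<and>
     (\<exists>\<mu> :: (real ^ 'n) measure. sets \<mu> = sets borel \<and>
        (\<forall>m::nat. 1 \<le> m \<longrightarrow> (\<integral>\<^sup>+\<xi>. ennreal (1 / (1 + (norm \<xi>)\<^sup>2) ^ m) \<partial>\<mu>) < \<infinity>) \<and>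
        (\<forall>\<gamma>\<in>schwartz. integrable lborel (\<lambda>x. f x * \<gamma> x) \<and> integrable \<mu> (fourier \<gamma>) \<and>
           complex_of_real (\<integral>x. f x * \<gamma> x \<partial>lborel) = (\<integral>\<xi>. fourier \<gamma> \<xi> \<partial>\<mu>)))"

text \<open>A Hilbert space together with a linear map \<open>\<iota>\<close> from the Schwartz functions that preserves the
  semi-inner product and has dense range, i.e. the completion up to isometric isomorphism.\<close>

definition schwartz_completion ::
    "(real ^ 'n \<Rightarrow> real) \<Rightarrow> ((real ^ 'n \<Rightarrow> real) \<Rightarrow> 'k::{real_inner, complete_space}) \<Rightarrow> bool" where
  "schwartz_completion f \<iota> \<longleftrightarrow>
     (\<forall>\<gamma>\<in>schwartz. \<forall>\<psi>\<in>schwartz. \<forall>a b. \<iota> (\<lambda>x. a * \<gamma> x + b * \<psi> x) = a *\<^sub>R \<iota> \<gamma> + b *\<^sub>R \<iota> \<psi>) \<and>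
     (\<forall>\<gamma>\<in>schwartz. \<forall>\<psi>\<in>schwartz. \<iota> \<gamma> \<bullet> \<iota> \<psi> = kform f \<gamma> \<psi>) \<and>
     closure (\<iota> ` schwartz) = UNIV"

text \<open>The element of K that a Borel function \<open>h\<close> with finite \<open>abs_form\<close> represents: its inner product
  with every Schwartz function is the double integral against \<open>f\<close>. By density there is at most one.\<close>

definition K_elem ::
    "(real ^ 'n \<Rightarrow> real) \<Rightarrow> ((real ^ 'n \<Rightarrow> real) \<Rightarrow> 'k::{real_inner, complete_space})
      \<Rightarrow> (real ^ 'n \<Rightarrow> real) \<Rightarrow> 'k" where
  "K_elem f \<iota> h =
     (if h \<in> borel_measurable borel \<and> abs_form f h < \<infinity>
      then THE k. \<forall>\<psi>\<in>schwartz. k \<bullet> \<iota> \<psi> = kform f h \<psi> else 0)"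

definition complete_orthonormal_basis :: "nat set \<Rightarrow> (nat \<Rightarrow> 'k::{real_inner, complete_space}) \<Rightarrow> bool" where
  "complete_orthonormal_basis I e \<longleftrightarrow>
     (\<forall>i\<in>I. \<forall>j\<in>I. e i \<bullet> e j = (if i = j then 1 else 0)) \<and> closure (span (e ` I)) = UNIV"

definition L2_limit :: "'a measure \<Rightarrow> (nat \<Rightarrow> 'a \<Rightarrow> real) \<Rightarrow> ('a \<Rightarrow> real) \<Rightarrow> bool" where
  "L2_limit P X Z \<longleftrightarrow> Z \<in> borel_measurable P \<and> (\<forall>n. X n \<in> borel_measurable P) \<and>
     (\<lambda>n. \<integral>\<^sup>+\<omega>. ennreal ((X n \<omega> - Z \<omega>)\<^sup>2) \<partial>P) \<longlonglongrightarrow> 0"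

text \<open>Degenerate normal distributions are allowed.\<close>

definition gaussian_rv :: "'a measure \<Rightarrow> ('a \<Rightarrow> real) \<Rightarrow> bool" where
  "gaussian_rv P X \<longleftrightarrow> X \<in> borel_measurable P \<and>
     (\<exists>m. (AE \<omega> in P. X \<omega> = m) \<or> (\<exists>\<sigma>>0. distributed P lborel X (normal_density m \<sigma>)))"

definition gaussian_noise ::
    "'a measure \<Rightarrow> (real ^ 'n \<Rightarrow> real) \<Rightarrow> ((real \<times> (real ^ 'n) \<Rightarrow> real) \<Rightarrow> 'a \<Rightarrow> real) \<Rightarrow> bool" where
  "gaussian_noise P f F \<longleftrightarrow>
     (\<forall>S a. finite S \<and> S \<subseteq> test_functions \<longrightarrow> gaussian_rv P (\<lambda>\<omega>. \<Sum>\<phi>\<in>S. a \<phi> * F \<phi> \<omega>)) \<and>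
     (\<forall>\<phi>\<in>test_functions. (\<integral>\<omega>. F \<phi> \<omega> \<partial>P) = 0) \<and>
     (\<forall>\<phi>\<in>test_functions. \<forall>\<psi>\<in>test_functions.
        (\<integral>\<omega>. F \<phi> \<omega> * F \<psi> \<omega> \<partial>P) =
        (LINT s:{0..}|lborel. kform f (\<lambda>x. \<phi> (s, x)) (\<lambda>x. \<psi> (s, x))))"

text \<open>\<open>X\<close> is (a version of) the value at \<open>h \<in> L\<^sup>2(\<real>\<^sup>+; K)\<close> of the isometric extension of \<open>F\<close>; functions
  on \<open>[0, T]\<close> are extended by 0.\<close>

definition noise_extension ::
    "'a measure \<Rightarrow> ((real ^ 'n \<Rightarrow> real) \<Rightarrow> 'k::{real_inner, complete_space})
      \<Rightarrow> ((real \<times> (real ^ 'n) \<Rightarrow> real) \<Rightarrow> 'a \<Rightarrow> real) \<Rightarrow> (real \<Rightarrow> 'k) \<Rightarrow> ('a \<Rightarrow> real) \<Rightarrow> bool" where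
  "noise_extension P \<iota> F h X \<longleftrightarrow>
     (\<exists>\<phi>. (\<forall>n::nat. \<phi> n \<in> test_functions) \<and>
        (\<lambda>n. \<integral>\<^sup>+s\<in>{0..}. ennreal ((norm (\<iota> (\<lambda>x. \<phi> n (s, x)) - h s))\<^sup>2) \<partial>lborel) \<longlonglongrightarrow> 0 \<and>
        L2_limit P (\<lambda>n. F (\<phi> n)) X)"

text \<open>\<open>B k t\<close> is \<open>F(1\<^bsub>[0,t]\<^esub> k)\<close>. Continuous versions in \<open>t\<close> are chosen, which gives evaluation at a random time
  a meaning.\<close>

definition noise_process ::
    "'a measure \<Rightarrow> ((real ^ 'n \<Rightarrow> real) \<Rightarrow> 'k::{real_inner, complete_space})
      \<Rightarrow> ((real \<times> (real ^ 'n) \<Rightarrow> real) \<Rightarrow> 'a \<Rightarrow> real) \<Rightarrow> ('k \<Rightarrow> real \<Rightarrow> 'a \<Rightarrow> real) \<Rightarrow> bool" where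
  "noise_process P \<iota> F B \<longleftrightarrow>
     (\<forall>k. (\<forall>t\<ge>0. noise_extension P \<iota> F (\<lambda>s. indicator {0..t} s *\<^sub>R k) (B k t)) \<and>
          (AE \<omega> in P. continuous_on {0..} (\<lambda>t. B k t \<omega>)))"

definition subordinator :: "'a measure \<Rightarrow> (real \<Rightarrow> 'a \<Rightarrow> real) \<Rightarrow> bool" where
  "subordinator P U \<longleftrightarrow>
     (\<forall>t\<ge>0. U t \<in> borel_measurable P) \<and>
     (AE \<omega> in P. U 0 \<omega> = 0) \<and>
     (\<forall>t (n::nat). 0 \<le> t 0 \<and> (\<forall>i<n. t i \<le> t (Suc i)) \<longrightarrow>
        prob_space.indep_vars P (\<lambda>_. borel) (\<lambda>i \<omega>. U (t (Suc i)) \<omega> - U (t i) \<omega>) {..<n}) \<and>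
     (\<forall>s\<ge>0. \<forall>h\<ge>0. distr P borel (\<lambda>\<omega>. U (s + h) \<omega> - U s \<omega>) = distr P borel (U h)) \<and>
     (AE \<omega> in P. mono_on {0..} (\<lambda>t. U t \<omega>) \<and> (\<forall>t\<ge>0. continuous (at_right t) (\<lambda>t. U t \<omega>)))"

definition stable_subordinator :: "'a measure \<Rightarrow> real \<Rightarrow> (real \<Rightarrow> 'a \<Rightarrow> real) \<Rightarrow> bool" where
  "stable_subordinator P \<beta> U \<longleftrightarrow> subordinator P U \<and>
     (\<forall>u\<ge>0. \<forall>\<tau>\<ge>0. (\<integral>\<omega>. exp (- u * U \<tau> \<omega>) \<partial>P) = exp (- \<tau> * u powr \<beta>))"

definition inverse_process :: "(real \<Rightarrow> 'a \<Rightarrow> real) \<Rightarrow> real \<Rightarrow> 'a \<Rightarrow> real" where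
  "inverse_process U t \<omega> = Inf {\<tau>. 0 < \<tau> \<and> t < U \<tau> \<omega>}"

definition independent_families ::
    "'a measure \<Rightarrow> 'i set \<Rightarrow> ('i \<Rightarrow> 'a \<Rightarrow> real) \<Rightarrow> 'j set \<Rightarrow> ('j \<Rightarrow> 'a \<Rightarrow> real) \<Rightarrow> bool" where
  "independent_families P A X B Y \<longleftrightarrow> prob_space.indep_set P
     (sigma_sets (space P) {X i -` S \<inter> space P |i S. i \<in> A \<and> S \<in> sets borel})
     (sigma_sets (space P) {Y j -` S \<inter> space P |j S. j \<in> B \<and> S \<in> sets borel})"

definition noise_filtration ::
    "'a measure \<Rightarrow> nat set \<Rightarrow> (nat \<Rightarrow> real \<Rightarrow> 'a \<Rightarrow> real) \<Rightarrow> (real \<Rightarrow> 'a \<Rightarrow> real) \<Rightarrow> real \<Rightarrow> 'a measure" where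
  "noise_filtration P I w E t = sigma (space P)
     (\<Inter>u\<in>{t<..}. sigma_sets (space P)
        ({w j s -` S \<inter> space P |j s S. j \<in> I \<and> 0 \<le> s \<and> s \<le> u \<and> S \<in> sets borel} \<union>
         {E s -` S \<inter> space P |s S. 0 \<le> s \<and> S \<in> sets borel} \<union> null_sets P))"

definition time_changed_filtration ::
    "'a measure \<Rightarrow> nat set \<Rightarrow> (nat \<Rightarrow> real \<Rightarrow> 'a \<Rightarrow> real) \<Rightarrow> (real \<Rightarrow> 'a \<Rightarrow> real) \<Rightarrow> real \<Rightarrow> 'a measure" where
  "time_changed_filtration P I w E t =
     filtration.pre_sigma (space P) (noise_filtration P I w E) (E t)"

definition time_changed_cylindrical_wiener ::
    "('k \<Rightarrow> real \<Rightarrow> 'a \<Rightarrow> real) \<Rightarrow> (real \<Rightarrow> 'a \<Rightarrow> real) \<Rightarrow> 'k \<Rightarrow> real \<Rightarrow> 'a \<Rightarrow> real" where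
  "time_changed_cylindrical_wiener B E k t \<omega> = B k (E t \<omega>) \<omega>"

definition time_changed_martingale_measure ::
    "(real ^ 'n \<Rightarrow> real) \<Rightarrow> ((real ^ 'n \<Rightarrow> real) \<Rightarrow> 'k::{real_inner, complete_space})
      \<Rightarrow> ('k \<Rightarrow> real \<Rightarrow> 'a \<Rightarrow> real) \<Rightarrow> (real \<Rightarrow> 'a \<Rightarrow> real) \<Rightarrow> (real ^ 'n) set \<Rightarrow> real \<Rightarrow> 'a \<Rightarrow> real" where
  "time_changed_martingale_measure f \<iota> B E A t \<omega> = B (K_elem f \<iota> (indicator A)) (E t \<omega>) \<omega>"

text \<open>\<open>J\<close> is self-adjoint and positive, so \<open>Q = J J\<^sup>*\<close> has square root \<open>J\<close> and \<open>K\<^sub>Q = range J\<close>; since \<open>J\<close> is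
  injective, its inverse on \<open>K\<^sub>Q\<close> is \<open>inv J\<close>.\<close>

definition J_op :: "nat set \<Rightarrow> (nat \<Rightarrow> real) \<Rightarrow> (nat \<Rightarrow> 'k) \<Rightarrow> 'k \<Rightarrow> 'k::{real_inner, complete_space}" where
  "J_op I lam e h = (\<Sum>\<^sub>\<infinity>j\<in>I. (sqrt (lam j) * (h \<bullet> e j)) *\<^sub>R e j)"

definition Q_wiener ::
    "nat set \<Rightarrow> (nat \<Rightarrow> 'k) \<Rightarrow> ('k \<Rightarrow> 'k) \<Rightarrow> ('k \<Rightarrow> real \<Rightarrow> 'a \<Rightarrow> real) \<Rightarrow> real \<Rightarrow> 'a
      \<Rightarrow> 'k::{real_inner, complete_space}" where
  "Q_wiener I e J Wt t \<omega> = (\<Sum>\<^sub>\<infinity>j\<in>I. Wt (e j) t \<omega> *\<^sub>R J (e j))"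

text \<open>Linear functionals on \<open>K\<^sub>Q = range J\<close>, normed so that \<open>J : K \<rightarrow> K\<^sub>Q\<close> is an isometry: boundedness
  on \<open>K\<^sub>Q\<close> is boundedness of \<open>\<Phi> \<circ> J\<close>, and \<open>sqrt (lam j) *\<^sub>R e j\<close> is an orthonormal basis of \<open>K\<^sub>Q\<close>.\<close>

definition hilbert_schmidt_KQ ::
    "nat set \<Rightarrow> (nat \<Rightarrow> real) \<Rightarrow> (nat \<Rightarrow> 'k::{real_inner, complete_space}) \<Rightarrow> ('k \<Rightarrow> real) \<Rightarrow> bool" where
  "hilbert_schmidt_KQ I lam e \<Phi> \<longleftrightarrow> bounded_linear (\<Phi> \<circ> J_op I lam e) \<and>
     (\<lambda>j. (\<Phi> (sqrt (lam j) *\<^sub>R e j))\<^sup>2) summable_on I"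

text \<open>Stochastic integrals are random variables up to almost sure equality and are therefore
  introduced as relations between integrand and integral. The time interval is \<open>(0, T]\<close>: the
  time change is continuous and vanishes at 0 almost surely, so time 0 carries no mass.\<close>

definition predictable_sigma :: "'a measure \<Rightarrow> (real \<Rightarrow> 'a measure) \<Rightarrow> real \<Rightarrow> ('a \<times> real) measure" where
  "predictable_sigma P G T = sigma (space P \<times> {0<..T})
     {A \<times> {a<..b} |a b A. 0 \<le> a \<and> a < b \<and> b \<le> T \<and> A \<in> sets (G a)}"

definition dagger_sq ::
    "'a measure \<Rightarrow> (real \<Rightarrow> 'a \<Rightarrow> real) \<Rightarrow> (real ^ 'n \<Rightarrow> real) \<Rightarrow> real
      \<Rightarrow> (real \<Rightarrow> real ^ 'n \<Rightarrow> 'a \<Rightarrow> real) \<Rightarrow> ennreal" where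
  "dagger_sq P E f T g =
     (\<integral>\<^sup>+\<omega>. (\<integral>\<^sup>+t\<in>{0<..T}. abs_form f (\<lambda>x. g t x \<omega>) \<partial>interval_measure (\<lambda>t. E t \<omega>)) \<partial>P)"

definition P_dagger ::
    "'a measure \<Rightarrow> (real \<Rightarrow> 'a measure) \<Rightarrow> (real \<Rightarrow> 'a \<Rightarrow> real) \<Rightarrow> (real ^ 'n \<Rightarrow> real) \<Rightarrow> real
      \<Rightarrow> (real \<Rightarrow> real ^ 'n \<Rightarrow> 'a \<Rightarrow> real) set" where
  "P_dagger P G E f T =
     {g. (\<lambda>((\<omega>, t), x). g t x \<omega>) \<in> borel_measurable (predictable_sigma P G T \<Otimes>\<^sub>M borel) \<and>
         dagger_sq P E f T g < \<infinity>}"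

text \<open>A quadruple \<open>(a, b, A, X)\<close> stands for the elementary field \<open>1\<^bsub>(a,b]\<^esub>(t) 1\<^bsub>A\<^esub>(x) X(\<omega>)\<close>, a list
  for the sum of its entries.\<close>

type_synonym ('n, 'a) simple_field = "(real \<times> real \<times> (real ^ 'n) set \<times> ('a \<Rightarrow> real)) list"

definition simple_field :: "'a measure \<Rightarrow> (real \<Rightarrow> 'a measure) \<Rightarrow> real \<Rightarrow> ('n::finite, 'a) simple_field \<Rightarrow> bool" where
  "simple_field P G T gs \<longleftrightarrow> (\<forall>(a, b, A, X)\<in>set gs. 0 \<le> a \<and> a < b \<and> b \<le> T \<and>
     bounded A \<and> A \<in> sets borel \<and> X \<in> borel_measurable (G a) \<and> (\<exists>C. \<forall>\<omega>\<in>space P. \<bar>X \<omega>\<bar> \<le> C))"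

definition simple_field_fun :: "('n::finite, 'a) simple_field \<Rightarrow> real \<Rightarrow> real ^ 'n \<Rightarrow> 'a \<Rightarrow> real" where
  "simple_field_fun gs t x \<omega> =
     (\<Sum>(a, b, A, X)\<leftarrow>gs. indicator {a<..b} t * indicator A x * X \<omega>)"

definition simple_field_integral ::
    "((real ^ 'n) set \<Rightarrow> real \<Rightarrow> 'a \<Rightarrow> real) \<Rightarrow> ('n::finite, 'a) simple_field \<Rightarrow> 'a \<Rightarrow> real" where
  "simple_field_integral ME gs \<omega> = (\<Sum>(a, b, A, X)\<leftarrow>gs. X \<omega> * (ME A b \<omega> - ME A a \<omega>))"

definition has_martingale_measure_integral ::
    "'a measure \<Rightarrow> (real \<Rightarrow> 'a measure) \<Rightarrow> (real \<Rightarrow> 'a \<Rightarrow> real) \<Rightarrow> (real ^ 'n \<Rightarrow> real) \<Rightarrow> real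
      \<Rightarrow> ((real ^ 'n) set \<Rightarrow> real \<Rightarrow> 'a \<Rightarrow> real) \<Rightarrow> (real \<Rightarrow> real ^ 'n \<Rightarrow> 'a \<Rightarrow> real)
      \<Rightarrow> ('a \<Rightarrow> real) \<Rightarrow> bool" where
  "has_martingale_measure_integral P G E f T ME g Z \<longleftrightarrow> g \<in> P_dagger P G E f T \<and>
     (\<exists>gs. (\<forall>n::nat. simple_field P G T (gs n)) \<and>
        (\<lambda>n. dagger_sq P E f T (\<lambda>t x \<omega>. simple_field_fun (gs n) t x \<omega> - g t x \<omega>)) \<longlonglongrightarrow> 0 \<and>
        L2_limit P (\<lambda>n. simple_field_integral ME (gs n)) Z)"

text \<open>A triple \<open>(a, b, X)\<close> stands for \<open>1\<^bsub>(a,b]\<^esub>(t) X(\<omega>)\<close>. The integrator \<open>Y\<close> is a square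
  integrable martingale with quadratic variation \<open>A\<close>; the integral of simple processes is extended by
  the isometry with \<open>L\<^sup>2(P(d\<omega>) A(dt))\<close>.\<close>

definition simple_process ::
    "'a measure \<Rightarrow> (real \<Rightarrow> 'a measure) \<Rightarrow> real \<Rightarrow> (real \<times> real \<times> ('a \<Rightarrow> real)) list \<Rightarrow> bool" where
  "simple_process P G T hs \<longleftrightarrow> (\<forall>(a, b, X)\<in>set hs. 0 \<le> a \<and> a < b \<and> b \<le> T \<and>
     X \<in> borel_measurable (G a) \<and> (\<exists>C. \<forall>\<omega>\<in>space P. \<bar>X \<omega>\<bar> \<le> C))"

definition simple_process_fun :: "(real \<times> real \<times> ('a \<Rightarrow> real)) list \<Rightarrow> real \<Rightarrow> 'a \<Rightarrow> real" where
  "simple_process_fun hs t \<omega> = (\<Sum>(a, b, X)\<leftarrow>hs. indicator {a<..b} t * X \<omega>)"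

definition simple_process_integral ::
    "(real \<Rightarrow> 'a \<Rightarrow> real) \<Rightarrow> (real \<times> real \<times> ('a \<Rightarrow> real)) list \<Rightarrow> 'a \<Rightarrow> real" where
  "simple_process_integral Y hs \<omega> = (\<Sum>(a, b, X)\<leftarrow>hs. X \<omega> * (Y b \<omega> - Y a \<omega>))"

definition L2_sq :: "'a measure \<Rightarrow> (real \<Rightarrow> 'a \<Rightarrow> real) \<Rightarrow> real \<Rightarrow> (real \<Rightarrow> 'a \<Rightarrow> real) \<Rightarrow> ennreal" where
  "L2_sq P A T h =
     (\<integral>\<^sup>+\<omega>. (\<integral>\<^sup>+t\<in>{0<..T}. ennreal ((h t \<omega>)\<^sup>2) \<partial>interval_measure (\<lambda>t. A t \<omega>)) \<partial>P)"

definition has_ito_integral ::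
    "'a measure \<Rightarrow> (real \<Rightarrow> 'a measure) \<Rightarrow> (real \<Rightarrow> 'a \<Rightarrow> real) \<Rightarrow> real \<Rightarrow> (real \<Rightarrow> 'a \<Rightarrow> real)
      \<Rightarrow> (real \<Rightarrow> 'a \<Rightarrow> real) \<Rightarrow> ('a \<Rightarrow> real) \<Rightarrow> bool" where
  "has_ito_integral P G A T Y h Z \<longleftrightarrow>
     (\<lambda>(\<omega>, t). h t \<omega>) \<in> borel_measurable (predictable_sigma P G T) \<and> L2_sq P A T h < \<infinity> \<and>
     (\<exists>hs. (\<forall>n::nat. simple_process P G T (hs n)) \<and>
        (\<lambda>n. L2_sq P A T (\<lambda>t \<omega>. simple_process_fun (hs n) t \<omega> - h t \<omega>)) \<longlonglongrightarrow> 0 \<and>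
        L2_limit P (\<lambda>n. simple_process_integral Y (hs n)) Z)"

definition has_cylindrical_integral ::
    "'a measure \<Rightarrow> (real \<Rightarrow> 'a measure) \<Rightarrow> (real \<Rightarrow> 'a \<Rightarrow> real) \<Rightarrow> real \<Rightarrow> nat set
      \<Rightarrow> (nat \<Rightarrow> 'k::{real_inner, complete_space}) \<Rightarrow> ('k \<Rightarrow> real \<Rightarrow> 'a \<Rightarrow> real)
      \<Rightarrow> (real \<Rightarrow> 'a \<Rightarrow> 'k) \<Rightarrow> ('a \<Rightarrow> real) \<Rightarrow> bool" where
  "has_cylindrical_integral P G E T I e Wt v Z \<longleftrightarrow>
     (\<exists>Y. (\<forall>j\<in>I. has_ito_integral P G E T (Wt (e j)) (\<lambda>t \<omega>. v t \<omega> \<bullet> e j) (Y j)) \<and>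
          L2_limit P (\<lambda>n \<omega>. \<Sum>j\<in>I \<inter> {..<n}. Y j \<omega>) Z)"

text \<open>The integrator \<open>W\<close> is a K-valued process with an expansion \<open>W\<^sub>t = \<Sum> b\<^sub>j(t) J(e\<^sub>j)\<close>. As
  \<open>J(e\<^sub>j) = sqrt (lam j) *\<^sub>R e\<^sub>j\<close>, \<open>W\<close> determines the coordinates \<open>b\<^sub>j(t)\<close> up to null sets.\<close>

definition has_Q_wiener_integral ::
    "'a measure \<Rightarrow> (real \<Rightarrow> 'a measure) \<Rightarrow> (real \<Rightarrow> 'a \<Rightarrow> real) \<Rightarrow> real \<Rightarrow> nat set \<Rightarrow> (nat \<Rightarrow> real)
      \<Rightarrow> (nat \<Rightarrow> 'k::{real_inner, complete_space}) \<Rightarrow> (real \<Rightarrow> 'a \<Rightarrow> 'k)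
      \<Rightarrow> (real \<Rightarrow> 'a \<Rightarrow> 'k \<Rightarrow> real) \<Rightarrow> ('a \<Rightarrow> real) \<Rightarrow> bool" where
  "has_Q_wiener_integral P G E T I lam e W \<Phi> Z \<longleftrightarrow>
     (\<forall>t\<in>{0<..T}. \<forall>\<omega>\<in>space P. hilbert_schmidt_KQ I lam e (\<Phi> t \<omega>)) \<and>
     (\<exists>b Y. (\<forall>t\<in>{0..T}. AE \<omega> in P. ((\<lambda>j. b j t \<omega> *\<^sub>R J_op I lam e (e j)) has_sum W t \<omega>) I) \<and>
        (\<forall>j\<in>I. has_ito_integral P G E T (b j) (\<lambda>t \<omega>. \<Phi> t \<omega> (sqrt (lam j) *\<^sub>R e j)) (Y j)) \<and>
        L2_limit P (\<lambda>n \<omega>. \<Sum>j\<in>I \<inter> {..<n}. Y j \<omega>) Z)"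

end

theory Submission
  imports Defs
begin

text \<open>All three integrals are limits of elementary integrals, and an elementary field
  \<open>1\<^bsub>(a,b]\<^esub>(t) 1\<^bsub>A\<^esub>(x) X\<close> enters each of them only through the element \<open>k\<close> of \<open>K\<close> represented by \<open>1\<^bsub>A\<^esub>\<close>: its
  integral against the martingale measure is \<open>X (M\<^sub>b k - M\<^sub>a k)\<close> with \<open>M\<^sub>t k = B k (E\<^sub>t)\<close>. Hence the
  theorem is about integrals of \<open>K\<close>-valued step functions against \<open>M\<close>, and everything follows from one
  isometry, \<open>Kint_isometry\<close>: the second moment of such an integral is the integral of the squared
  norm of the integrand with respect to \<open>P(d\<omega>) dE\<^sub>t\<close>.

  The norm of \<open>K\<close> is dominated by the form defining the norm of \<open>P_dagger\<close>, and elementary fields are dense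
  for the latter (\<open>simple_fields_dense\<close>); so the integral against the martingale measure exists and depends
  on \<open>g\<close> only through the \<open>K\<close>-valued process \<open>g(t)\<close>. Replacing each \<open>k\<close> by its projection onto the span of
  the first \<open>N\<close> basis vectors turns an elementary integral into the sum of the elementary coordinate
  integrals. By the isometry the error is at most a multiple of the integral of \<open>\<parallel>g(t) - proj N (g(t))\<parallel>\<^sup>2\<close>,
  which tends to 0 by dominated convergence. This is the first equality (\<open>coordinate_sum_limit\<close>). For the
  second, \<open>J e\<^sub>j = sqrt (lam j) e\<^sub>j\<close>: the expansion of \<open>W\<close> determines the processes \<open>w\<^sub>j\<close> up to null sets, and
  the functional \<open>\<Phi>\<^sub>t \<circ> J\<^sup>-\<^sup>1\<close> takes the value \<open>g(t) \<bullet> e\<^sub>j\<close> at \<open>sqrt (lam j) e\<^sub>j\<close>, so both integrals are sums of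
  the same coordinate integrals.

  The isometry needs two moment formulas for the increments of \<open>M\<close>, \<open>M_increment_square\<close> and
  \<open>M_increment_orthogonal\<close>. At deterministic times an increment of the noise is independent of the
  \<open>\<sigma>\<close>-field \<open>past\<close> generated by the earlier noise, the whole time change and the null sets
  (\<open>past_indep\<close>), because the joint characteristic functions factorise. The random times \<open>E\<^sub>t\<close> are reduced
  to this case by dyadic approximation from above. Finally, for \<open>K\<close> to contain the indicators of bounded
  sets and the sections of \<open>g\<close>, the form with kernel \<open>f\<close> has to be positive on all Borel functions with
  finite absolute form and not only on Schwartz functions; this is shown by approximation with sums of
  Gaussian functions (\<open>q_psd\<close>).\<close>

lemmas integral_eqI = Bochner_Integration.integral_cong[OF refl]
lemmas integrable_dominated = Bochner_Integration.integrable_bound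

section \<open>Schwartz functions\<close>

lemma smooth_imp_borel: "smooth g \<Longrightarrow> g \<in> borel_measurable borel"
proof -
 assume "smooth g"
 then have "\<forall>x. iter_deriv [] g differentiable (at x)" unfolding smooth_def by (metis empty_subsetI list.set(1))
 then have "continuous_on UNIV g"
  by (auto intro!: differentiable_imp_continuous_on simp: differentiable_on_def)
 then show ?thesis by (rule borel_measurable_continuous_onI)
qed

lemma schwartz_borel: "g \<in> schwartz \<Longrightarrow> g \<in> borel_measurable borel"
 by (auto simp: schwartz_def intro: smooth_imp_borel)

lemma schwartz_decay:
 assumes "g \<in> schwartz"
 obtains C where "0 \<le> C" "\<And>x. \<bar>g x\<bar> \<le> C / (1 + norm x) ^ k"
proof -
 have "\<exists>C. \<forall>x. (1 + norm x) ^ k * \<bar>iter_deriv [] g x\<bar> \<le> C"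
  using assms unfolding schwartz_def by (auto dest: spec[of _ "[]"])
 then obtain C where C: "\<And>x. (1 + norm x) ^ k * \<bar>iter_deriv [] g x\<bar> \<le> C" by blast
 have pos: "0 < (1 + norm x) ^ k" for x :: 'a
  by (simp add: add_pos_nonneg)
 have "0 \<le> C" using C[of 0] pos[of 0] by (smt (verit) abs_ge_zero mult_nonneg_nonneg)
 moreover have "\<bar>g x\<bar> \<le> C / (1 + norm x) ^ k" for x
  using C[of x] pos[of x] by (simp add: pos_le_divide_eq mult.commute)
 ultimately show ?thesis using that by blast
qed

lemma real_polynomial_derivative:
 fixes p :: "'v::euclidean_space \<Rightarrow> real"
 assumes "real_polynomial_function p"
 shows "\<exists>D. (\<forall>x. (p has_derivative D x) (at x)) \<and> (\<forall>v. real_polynomial_function (\<lambda>x. D x v))"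
 using assms
proof induction
 case (linear p)
 then show ?case
  by (intro exI[of _ "\<lambda>_. p"]) (auto intro: bounded_linear_imp_has_derivative real_polynomial_function.intros)
next
 case (const c)
 then show ?case
  by (intro exI[of _ "\<lambda>_ _. 0"]) (auto intro: real_polynomial_function.intros)
next
 case (add p q)
 then obtain D1 D2 where
  D: "\<forall>x. (p has_derivative D1 x) (at x)" "\<forall>v. real_polynomial_function (\<lambda>x. D1 x v)"
    "\<forall>x. (q has_derivative D2 x) (at x)" "\<forall>v. real_polynomial_function (\<lambda>x. D2 x v)" by blast
 then show ?case
  by (intro exI[of _ "\<lambda>x v. D1 x v + D2 x v"])
    (auto intro!: has_derivative_add real_polynomial_function.intros(3))
next
 case (mult p q)
 then obtain D1 D2 where
  D: "\<forall>x. (p has_derivative D1 x) (at x)" "\<forall>v. real_polynomial_function (\<lambda>x. D1 x v)"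
    "\<forall>x. (q has_derivative D2 x) (at x)" "\<forall>v. real_polynomial_function (\<lambda>x. D2 x v)" by blast
 with mult.hyps show ?case
  by (intro exI[of _ "\<lambda>x v. p x * D2 x v + D1 x v * q x"])
    (auto intro!: has_derivative_mult real_polynomial_function.intros(3,4))
qed

lemma real_polynomial_growth:
 fixes p :: "'v::euclidean_space \<Rightarrow> real"
 assumes "real_polynomial_function p"
 shows "\<exists>C m. 0 \<le> C \<and> (\<forall>x. \<bar>p x\<bar> \<le> C * (1 + norm x) ^ m)"
 using assms
proof induction
 case (linear p)
 then obtain K where K: "\<And>x. norm (p x) \<le> norm x * K" "0 \<le> K"
  using bounded_linear.nonneg_bounded by blast
 have "\<bar>p x\<bar> \<le> K * (1 + norm x) ^ 1" for x
  using K(1)[of x] K(2) by (simp add: algebra_simps)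
 then show ?case using K(2) by blast
next
 case (const c)
 have "\<forall>x::'v. \<bar>c\<bar> \<le> \<bar>c\<bar> * (1 + norm x) ^ 0" by simp
 then show ?case by (metis abs_ge_zero)
next
 case (add p q)
 then obtain C1 m1 C2 m2 where C: "0 \<le> C1" "0 \<le> C2"
   "\<And>x. \<bar>p x\<bar> \<le> C1 * (1 + norm x) ^ m1" "\<And>x. \<bar>q x\<bar> \<le> C2 * (1 + norm x) ^ m2" by blast
 have "\<bar>p x + q x\<bar> \<le> (C1 + C2) * (1 + norm x) ^ (m1 + m2)" for x
 proof -
  have "(1 + norm x) ^ m1 \<le> (1 + norm x) ^ (m1 + m2)" "(1 + norm x) ^ m2 \<le> (1 + norm x) ^ (m1 + m2)"
   by (auto intro!: power_increasing)
  then have "C1 * (1 + norm x) ^ m1 \<le> C1 * (1 + norm x) ^ (m1 + m2)"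
    "C2 * (1 + norm x) ^ m2 \<le> C2 * (1 + norm x) ^ (m1 + m2)"
   using C(1,2) by (auto intro: mult_left_mono)
  then show ?thesis using C(3)[of x] C(4)[of x] by (simp add: distrib_right)
 qed
 then show ?case using C by (metis add_nonneg_nonneg)
next
 case (mult p q)
 then obtain C1 m1 C2 m2 where C: "0 \<le> C1" "0 \<le> C2"
   "\<And>x. \<bar>p x\<bar> \<le> C1 * (1 + norm x) ^ m1" "\<And>x. \<bar>q x\<bar> \<le> C2 * (1 + norm x) ^ m2" by blast
 have "\<bar>p x * q x\<bar> \<le> (C1 * C2) * (1 + norm x) ^ (m1 + m2)" for x
  using mult_mono[OF C(3)[of x] C(4)[of x]] C(1,2)
  by (simp add: abs_mult power_add mult_ac)
 then show ?case using C by (metis mult_nonneg_nonneg)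
qed

lemma polynomial_times_gaussian_decay:
 fixes c r :: real
 assumes "0 < c" "0 \<le> r"
 shows "(1 + r) ^ m * exp (- (c * r^2)) \<le> (max 2 (Suc m / c)) ^ Suc m"
proof -
 let ?K = "max 2 (Suc m / c)"
 have K: "?K \<ge> 2" "?K * (c / Suc m) \<ge> 1" using assms
  by (auto simp: max_def field_simps)
 have "1 + r \<le> 2 + r^2"
 proof -
  have "0 \<le> (r - 1/2)^2" by simp
  then show ?thesis by (simp add: power2_eq_square algebra_simps)
 qed
 also have "\<dots> \<le> ?K * 1 + ?K * (c / Suc m) * r^2"
  using K mult_right_mono[OF K(2), of "r^2"] by (intro add_mono) auto
 also have "\<dots> = ?K * (1 + (c * r^2) / Suc m)" by (simp add: field_simps)
 finally have 1: "1 + r \<le> ?K * (1 + (c * r^2) / Suc m)" .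
 have "(1 + r) ^ m \<le> (1 + r) ^ Suc m" using assms by (intro power_increasing) auto
 also have "\<dots> \<le> (?K * (1 + (c * r^2) / Suc m)) ^ Suc m" using 1 assms by (intro power_mono) auto
 also have "\<dots> = ?K ^ Suc m * (1 + (c * r^2) / Suc m) ^ Suc m" by (rule power_mult_distrib)
 also have "\<dots> \<le> ?K ^ Suc m * exp (c * r^2)"
 proof (intro mult_left_mono exp_ge_one_plus_x_over_n_power_n)
  have "0 \<le> c * r^2" using assms by simp
  then show "- real (Suc m) \<le> c * r^2" by linarith
 qed (use K in auto)
 finally show ?thesis by (simp add: exp_minus divide_inverse[symmetric] pos_divide_le_eq)
qed

lemma has_derivative_gaussian:
 fixes a x :: "'v::euclidean_space"
 shows "((\<lambda>x. exp (- (c * (norm (x - a))^2))) has_derivative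
   (\<lambda>v. - (2 * c * ((x - a) \<bullet> v)) * exp (- (c * (norm (x - a))^2)))) (at x)"
 unfolding power2_norm_eq_inner
 by (auto intro!: derivative_eq_intros simp: inner_commute algebra_simps)

text \<open>Differentiation preserves the class of polynomials times a fixed Gaussian, so all derivatives of a
  Gaussian can be bounded at once.\<close>

lemma iter_deriv_polynomial_times_gaussian:
 fixes a :: "'v::euclidean_space"
 assumes "real_polynomial_function p"
 shows "\<exists>q. real_polynomial_function q \<and>
  iter_deriv vs (\<lambda>x. p x * exp (- (c * (norm (x - a))^2))) = (\<lambda>x. q x * exp (- (c * (norm (x - a))^2)))"
proof (induction vs)
 case Nil
 then show ?case using assms by auto
next
 case (Cons v vs)
 then obtain q where q: "real_polynomial_function q"
  "iter_deriv vs (\<lambda>x. p x * exp (- (c * (norm (x - a))^2))) = (\<lambda>x. q x * exp (- (c * (norm (x - a))^2)))" by blast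
 obtain D where D: "\<And>x. (q has_derivative D x) (at x)" "\<And>v. real_polynomial_function (\<lambda>x. D x v)"
  using real_polynomial_derivative[OF q(1)] by blast
 let ?q = "\<lambda>x. D x v + q x * (- (2 * c * ((x - a) \<bullet> v)))"
 have "((\<lambda>x. q x * exp (- (c * (norm (x - a))^2))) has_derivative
   (\<lambda>v. q x * (- (2 * c * ((x - a) \<bullet> v)) * exp (- (c * (norm (x - a))^2)))
    + D x v * exp (- (c * (norm (x - a))^2)))) (at x)" for x
  by (rule has_derivative_mult[OF D(1) has_derivative_gaussian])
 from frechet_derivative_at[OF this]
 have "frechet_derivative (\<lambda>x. q x * exp (- (c * (norm (x - a))^2))) (at x) v
  = ?q x * exp (- (c * (norm (x - a))^2))" for x
  by (simp add: fun_eq_iff algebra_simps)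
 then have *: "iter_deriv (v # vs) (\<lambda>x. p x * exp (- (c * (norm (x - a))^2))) = (\<lambda>x. ?q x * exp (- (c * (norm (x - a))^2)))"
  by (simp add: q(2))
 have lin: "real_polynomial_function (\<lambda>x. x \<bullet> v)"
  by (rule real_polynomial_function.intros(1)[OF bounded_linear_inner_left])
 have "real_polynomial_function (\<lambda>x. D x v + q x * ((-(2*c)) * (x \<bullet> v) + 2 * c * (a \<bullet> v)))"
  by (intro real_polynomial_function.intros(3,4) D q lin real_polynomial_function.intros(2))
 moreover have "(\<lambda>x. D x v + q x * ((-(2*c)) * (x \<bullet> v) + 2 * c * (a \<bullet> v))) = ?q"
  by (auto simp: fun_eq_iff inner_diff_left algebra_simps)
 ultimately have "real_polynomial_function ?q" by simp
 with * show ?case by blast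
qed

lemma gaussian_schwartz:
 fixes a :: "'v::euclidean_space"
 assumes "0 < c"
 shows "(\<lambda>x. exp (- (c * (norm (x - a))^2))) \<in> schwartz"
proof -
 let ?g = "\<lambda>x. exp (- (c * (norm (x - a))^2))"
 have *: "\<exists>q. real_polynomial_function q \<and> iter_deriv vs ?g = (\<lambda>x. q x * ?g x)" for vs
  using iter_deriv_polynomial_times_gaussian[of "\<lambda>_. 1" vs c a] by (simp add: real_polynomial_function.intros(2))
 have "smooth ?g" unfolding smooth_def
 proof safe
  fix vs :: "'v list" and x
  obtain q where q: "real_polynomial_function q" "iter_deriv vs ?g = (\<lambda>x. q x * ?g x)" using * by blast
  obtain D where D: "\<And>x. (q has_derivative D x) (at x)"
   using real_polynomial_derivative[OF q(1)] by blast
  show "iter_deriv vs ?g differentiable (at x)"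
   unfolding q(2) differentiable_def using has_derivative_mult[OF D has_derivative_gaussian] by blast
 qed
 moreover have "\<exists>C. \<forall>x. (1 + norm x) ^ k * \<bar>iter_deriv vs ?g x\<bar> \<le> C" for vs k
 proof -
  obtain q where q: "real_polynomial_function q" "iter_deriv vs ?g = (\<lambda>x. q x * ?g x)" using * by blast
  obtain C m where C: "0 \<le> C" "\<And>x. \<bar>q x\<bar> \<le> C * (1 + norm x) ^ m"
   using real_polynomial_growth[OF q(1)] by blast
  let ?K = "C * ((1 + norm a) ^ (k + m) * (max 2 (Suc (k + m) / c)) ^ Suc (k + m))"
  have "(1 + norm x) ^ k * \<bar>iter_deriv vs ?g x\<bar> \<le> ?K" for x
  proof -
   have nx: "1 + norm x \<le> (1 + norm a) * (1 + norm (x - a))"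
   proof -
    have "norm x \<le> norm a + norm (x - a)" using norm_triangle_ineq[of a "x - a"] by simp
    moreover have "0 \<le> norm a * norm (x - a)" by simp
    moreover have "(1 + norm a) * (1 + norm (x - a)) = 1 + norm a + norm (x - a) + norm a * norm (x - a)"
     by (simp add: algebra_simps)
    ultimately show ?thesis by linarith
   qed
   have "(1 + norm x) ^ k * \<bar>iter_deriv vs ?g x\<bar> = (1 + norm x) ^ k * \<bar>q x\<bar> * ?g x"
    by (simp add: q(2) abs_mult)
   also have "\<dots> \<le> (1 + norm x) ^ k * (C * (1 + norm x) ^ m) * ?g x"
    by (intro mult_right_mono mult_left_mono C) auto
   also have "\<dots> = C * ((1 + norm x) ^ (k + m) * ?g x)" by (simp add: power_add)
   also have "\<dots> \<le> C * (((1 + norm a) * (1 + norm (x - a))) ^ (k + m) * ?g x)"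
    using C nx by (intro mult_left_mono mult_right_mono power_mono) auto
   also have "\<dots> = C * ((1 + norm a) ^ (k + m) * ((1 + norm (x - a)) ^ (k + m) * ?g x))"
    by (simp add: power_mult_distrib)
   also have "\<dots> \<le> ?K"
    using C polynomial_times_gaussian_decay[OF assms, of "norm (x - a)" "k + m"]
    by (intro mult_left_mono) auto
   finally show ?thesis .
  qed
  then show ?thesis by blast
 qed
 ultimately show ?thesis unfolding schwartz_def by blast
qed

lemma iter_deriv_slice:
 fixes \<phi> :: "real \<times> 'v::euclidean_space \<Rightarrow> real"
 assumes "smooth \<phi>" "set vs \<subseteq> Basis"
 shows "iter_deriv vs (\<lambda>x. \<phi> (s, x)) = (\<lambda>x. iter_deriv (map (\<lambda>v. (0, v)) vs) \<phi> (s, x))"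
  and "iter_deriv vs (\<lambda>x. \<phi> (s, x)) differentiable (at x)"
proof -
 have emb: "((\<lambda>x. (s, x)) has_derivative (\<lambda>v. (0, v))) (at x)" for x :: 'v
  by (auto intro!: derivative_eq_intros)
 have der: "iter_deriv (map (\<lambda>v. (0, v)) vs) \<phi> differentiable (at z)" if "set vs \<subseteq> Basis" for vs :: "'v list" and z
 proof -
  have "set (map (\<lambda>v. (0::real, v)) vs) \<subseteq> Basis" using that by (auto simp: Basis_prod_def)
  then show ?thesis using assms(1) unfolding smooth_def by blast
 qed
 have chain: "((\<lambda>x. iter_deriv (map (\<lambda>v. (0, v)) vs) \<phi> (s, x)) has_derivative
   (\<lambda>v. frechet_derivative (iter_deriv (map (\<lambda>v. (0, v)) vs) \<phi>) (at (s, x)) (0, v))) (at x)"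
  if "set vs \<subseteq> Basis" for vs :: "'v list" and x
  using diff_chain_at[OF emb, of "iter_deriv (map (\<lambda>v. (0, v)) vs) \<phi>"
   "frechet_derivative (iter_deriv (map (\<lambda>v. (0, v)) vs) \<phi>) (at (s, x))" x] der[OF that, of "(s, x)"]
  by (simp add: frechet_derivative_works o_def)
 show eq: "iter_deriv vs (\<lambda>x. \<phi> (s, x)) = (\<lambda>x. iter_deriv (map (\<lambda>v. (0, v)) vs) \<phi> (s, x))"
  using assms(2)
 proof (induction vs)
  case (Cons v vs)
  then have IH: "iter_deriv vs (\<lambda>x. \<phi> (s, x)) = (\<lambda>x. iter_deriv (map (\<lambda>v. (0, v)) vs) \<phi> (s, x))"
   and vs: "set vs \<subseteq> Basis" by auto
  show ?case
   using frechet_derivative_at[OF chain[OF vs], symmetric] by (simp add: IH)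
 qed simp
 show "iter_deriv vs (\<lambda>x. \<phi> (s, x)) differentiable (at x)"
  unfolding eq differentiable_def using chain[OF assms(2)] by blast
qed

lemma iter_deriv_zero_on_open:
 fixes g :: "'v::euclidean_space \<Rightarrow> real"
 assumes "open S" "\<And>x. x \<in> S \<Longrightarrow> g x = 0" "x \<in> S"
 shows "iter_deriv vs g x = 0"
 using assms(3)
proof (induction vs arbitrary: x)
 case (Cons v vs)
 have "((\<lambda>_. 0::real) has_derivative (\<lambda>_. 0)) (at x)" by simp
 then have "(iter_deriv vs g has_derivative (\<lambda>_. 0)) (at x)"
  by (rule has_derivative_transform_within_open[OF _ assms(1) Cons.prems]) (simp add: Cons.IH)
 from frechet_derivative_at[OF this] show ?case by (metis iter_deriv.simps(2))
qed (use assms in auto)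

text \<open>Spatial derivatives of a slice are slices of derivatives along the vectors \<open>(0, v)\<close>,
  and they vanish off the projection of the compact support.\<close>

lemma test_function_slice_schwartz:
 fixes \<phi> :: "real \<times> (real ^ 'n) \<Rightarrow> real"
 assumes "\<phi> \<in> test_functions"
 shows "(\<lambda>x. \<phi> (s, x)) \<in> schwartz"
proof -
 have sm: "smooth \<phi>" and cpt: "compact (closure {z. \<phi> z \<noteq> 0})"
  using assms by (auto simp: test_functions_def)
 have "smooth (\<lambda>x. \<phi> (s, x))"
  unfolding smooth_def using iter_deriv_slice(2)[OF sm] by blast
 moreover have "\<exists>C. \<forall>x. (1 + norm x) ^ k * \<bar>iter_deriv vs (\<lambda>x. \<phi> (s, x)) x\<bar> \<le> C"
  if vs: "set vs \<subseteq> Basis" for vs k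
 proof -
  let ?S = "closure {z. \<phi> z \<noteq> 0}"
  let ?D = "iter_deriv (map (\<lambda>v. (0, v)) vs) \<phi>"
  let ?h = "\<lambda>z. (1 + norm (snd z)) ^ k * \<bar>?D z\<bar>"
  have "set (map (\<lambda>v. (0::real, v)) vs) \<subseteq> Basis" using vs by (auto simp: Basis_prod_def)
  then have "\<forall>z. ?D differentiable (at z)" using sm unfolding smooth_def by blast
  then have "continuous_on UNIV ?D"
   by (auto intro!: differentiable_imp_continuous_on simp: differentiable_on_def)
  then have "continuous_on ?S ?h"
   by (auto intro!: continuous_intros intro: continuous_on_subset)
  then have "compact (?h ` ?S)" using cpt by (rule compact_continuous_image)
  then have "bdd_above (?h ` ?S)" by (intro bounded_imp_bdd_above compact_imp_bounded)
  then obtain C where C: "\<And>z. z \<in> ?S \<Longrightarrow> ?h z \<le> C"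
   unfolding bdd_above_def by blast
  have "?h z \<le> max 0 C" for z
  proof (cases "z \<in> ?S")
   case True
   then show ?thesis using C by (simp add: le_max_iff_disj)
  next
   case False
   have "?D z = 0"
   proof (rule iter_deriv_zero_on_open[of "- ?S"])
    show "\<phi> x = 0" if "x \<in> - ?S" for x
     using that closure_subset[of "{z. \<phi> z \<noteq> 0}"] by auto
   qed (use False in auto)
   then show ?thesis by simp
  qed
  from this[of "(s, _)"] show ?thesis
   unfolding iter_deriv_slice(1)[OF sm vs] by (intro exI[of _ "max 0 C"]) auto
 qed
 ultimately show ?thesis unfolding schwartz_def by blast
qed

section \<open>The quadratic form of the covariance kernel\<close>

lemma nn_integral_lborel_shift:
 fixes g :: "'v::euclidean_space \<Rightarrow> ennreal"
 assumes [measurable]: "g \<in> borel_measurable borel"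
 shows "(\<integral>\<^sup>+x. g (x - y) \<partial>lborel) = (\<integral>\<^sup>+x. g x \<partial>lborel)"
proof -
 have "(\<integral>\<^sup>+x. g x \<partial>lborel) = (\<integral>\<^sup>+x. g x \<partial>distr lborel borel ((+) (- y)))"
  by (simp add: lborel_distr_plus)
 also have "\<dots> = (\<integral>\<^sup>+x. g (x - y) \<partial>lborel)"
  by (subst nn_integral_distr) simp_all
 finally show ?thesis by simp
qed

lemma nn_integral_polynomial_decay_finite:
 "(\<integral>\<^sup>+(x::'v::euclidean_space). ennreal (1 / (1 + norm x) ^ (2 * DIM('v))) \<partial>lborel) < \<infinity>"
proof -
 have 1: "(\<integral>\<^sup>+(x::real). ennreal (1 / (1 + x^2)) \<partial>lborel) < \<infinity>"
  using integrable_inverse_1_plus_square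
  by (simp add: set_integrable_def integrable_iff_bounded einterval_eq_UNIV inverse_eq_divide)
 have "1 / (1 + norm x) ^ (2 * DIM('v)) \<le> (\<Prod>b\<in>Basis. 1 / (1 + (x \<bullet> b)^2))" for x :: 'v
 proof -
  have "(\<Prod>b\<in>(Basis::'v set). 1 + (x \<bullet> b)^2) \<le> (\<Prod>b\<in>(Basis::'v set). (1 + norm x)^2)"
  proof (intro prod_mono conjI)
   fix b :: 'v assume b: "b \<in> Basis"
   have "(x \<bullet> b)^2 \<le> (norm x)^2"
    using Basis_le_norm[OF b, of x] by (intro power2_le_iff_abs_le[THEN iffD2]) auto
   moreover have "0 \<le> norm x" by simp
   moreover have "(1 + norm x)^2 = 1 + 2 * norm x + (norm x)^2" by (simp add: power2_sum)
   ultimately show "1 + (x \<bullet> b)^2 \<le> (1 + norm x)^2"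
    by linarith
  qed simp
  also have "\<dots> = (1 + norm x) ^ (2 * DIM('v))" by (simp add: power_mult)
  finally have "(\<Prod>b\<in>(Basis::'v set). 1 + (x \<bullet> b)^2) \<le> (1 + norm x) ^ (2 * DIM('v))" .
  moreover have "0 < (\<Prod>b\<in>(Basis::'v set). 1 + (x \<bullet> b)^2)"
   by (intro prod_pos) (simp add: add_pos_nonneg)
  ultimately show ?thesis
   by (simp add: prod_dividef frac_le)
 qed
 then have "(\<integral>\<^sup>+(x::'v). ennreal (1 / (1 + norm x) ^ (2 * DIM('v))) \<partial>lborel)
   \<le> (\<integral>\<^sup>+(x::'v). (\<Prod>b\<in>Basis. ennreal (1 / (1 + (x \<bullet> b)^2))) \<partial>lborel)"
  by (intro nn_integral_mono) (simp add: prod_ennreal ennreal_leI)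
 also have "\<dots> = (\<Prod>b\<in>(Basis::'v set). (\<integral>\<^sup>+(x::real). ennreal (1 / (1 + x^2)) \<partial>lborel))"
  by (rule nn_integral_lborel_prod) auto
 also have "\<dots> < \<infinity>" using 1
  by (simp add: power_less_top_ennreal)
 finally show ?thesis .
qed

lemma schwartz_nn_integral_finite:
 fixes g :: "'v::euclidean_space \<Rightarrow> real"
 assumes "g \<in> schwartz"
 shows "(\<integral>\<^sup>+x. ennreal \<bar>g x\<bar> \<partial>lborel) < \<infinity>"
proof -
 obtain C where C: "0 \<le> C" "\<And>x. \<bar>g x\<bar> \<le> C / (1 + norm x) ^ (2 * DIM('v))"
  using schwartz_decay[OF assms] by blast
 have "(\<integral>\<^sup>+x. ennreal \<bar>g x\<bar> \<partial>lborel) \<le> (\<integral>\<^sup>+(x::'v). ennreal C * ennreal (1 / (1 + norm x) ^ (2 * DIM('v))) \<partial>lborel)"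
 proof (intro nn_integral_mono)
  fix x show "ennreal \<bar>g x\<bar> \<le> ennreal C * ennreal (1 / (1 + norm x) ^ (2 * DIM('v)))"
   using C(2)[of x] C(1) by (simp add: ennreal_mult'[symmetric] ennreal_leI)
 qed
 also have "\<dots> = ennreal C * (\<integral>\<^sup>+(x::'v). ennreal (1 / (1 + norm x) ^ (2 * DIM('v))) \<partial>lborel)"
  by (rule nn_integral_cmult) auto
 also have "\<dots> < \<infinity>"
  using nn_integral_polynomial_decay_finite[where ?'v='v] by (simp add: ennreal_mult_less_top)
 finally show ?thesis .
qed

lemma gaussian_integrable:
 "0 < c \<Longrightarrow> integrable lborel (\<lambda>x::'v::euclidean_space. exp (- (c * (norm x)^2)))"
 using schwartz_nn_integral_finite[OF gaussian_schwartz[of c "0::'v"]]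
 by (intro integrableI_bounded) auto

text \<open>Symmetry and positivity are assumed on Schwartz functions only; both are extended to all functions
  with finite absolute form. The kernel is non-negative everywhere, so a value at the origin has to be fixed
  before this locale applies.\<close>

locale pd_kernel =
 fixes f :: "real ^ 'n \<Rightarrow> real"
 assumes borel_f [measurable]: "f \<in> borel_measurable borel"
  and nonneg: "0 \<le> f x"
  and integrable_schwartz: "\<gamma> \<in> schwartz \<Longrightarrow> integrable lborel (\<lambda>x. f x * \<gamma> x)"
  and sym_schwartz: "\<gamma> \<in> schwartz \<Longrightarrow> \<psi> \<in> schwartz \<Longrightarrow> kform f \<gamma> \<psi> = kform f \<psi> \<gamma>"
  and psd_schwartz: "finite S \<Longrightarrow> S \<subseteq> schwartz \<Longrightarrow> 0 \<le> (\<Sum>\<gamma>\<in>S. \<Sum>\<psi>\<in>S. a \<gamma> * a \<psi> * kform f \<gamma> \<psi>)"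
begin

text \<open>The form is integration of \<open>h(x) k(y)\<close> against this measure on pairs, which gives
  access to dominated convergence.\<close>

definition \<kappa> :: "((real ^ 'n) \<times> (real ^ 'n)) measure" where
 "\<kappa> = density (lborel \<Otimes>\<^sub>M lborel) (\<lambda>z. ennreal (f (fst z - snd z)))"

lemma sets_kappa [simp, measurable_cong]: "sets \<kappa> = sets (borel \<Otimes>\<^sub>M borel)"
 by (simp add: \<kappa>_def cong: sets_pair_measure_cong)

lemma nn_integral_kappa:
 assumes [measurable]: "u \<in> borel_measurable (borel \<Otimes>\<^sub>M borel)"
 shows "(\<integral>\<^sup>+z. u z \<partial>\<kappa>) = (\<integral>\<^sup>+x. (\<integral>\<^sup>+y. ennreal (f (x - y)) * u (x, y) \<partial>lborel) \<partial>lborel)"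
 unfolding \<kappa>_def by (subst nn_integral_density) (simp_all add: lborel.nn_integral_fst[symmetric])

lemma abs_form_kappa:
 assumes [measurable]: "h \<in> borel_measurable borel"
 shows "abs_form f h = (\<integral>\<^sup>+z. ennreal (\<bar>h (fst z)\<bar> * \<bar>h (snd z)\<bar>) \<partial>\<kappa>)"
 unfolding abs_form_def
 by (subst nn_integral_kappa) (auto simp: ennreal_mult[symmetric] nonneg intro!: nn_integral_cong arg_cong[where f=ennreal])

lemma kform_kappa:
 assumes [measurable]: "h \<in> borel_measurable borel" "k \<in> borel_measurable borel"
  and "integrable \<kappa> (\<lambda>z. h (fst z) * k (snd z))"
 shows "kform f h k = (\<integral>z. h (fst z) * k (snd z) \<partial>\<kappa>)"
proof -
 have *: "(\<integral>z. h (fst z) * k (snd z) \<partial>\<kappa>) = (\<integral>z. f (fst z - snd z) *\<^sub>R (h (fst z) * k (snd z)) \<partial>(lborel \<Otimes>\<^sub>M lborel))"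
  unfolding \<kappa>_def by (rule integral_density) (auto simp: nonneg)
 have "integrable (lborel \<Otimes>\<^sub>M lborel) (\<lambda>z. f (fst z - snd z) *\<^sub>R (h (fst z) * k (snd z)))"
  using assms(3) unfolding \<kappa>_def by (subst (asm) integrable_density) (auto simp: nonneg)
 from lborel_pair.integral_fst'[OF this] show ?thesis
  unfolding * kform_def by (simp add: mult_ac)
qed

lemma AE_kappa:
 assumes "AE x in lborel. R x"
 shows "AE z in \<kappa>. R (fst z) \<and> R (snd z)"
proof -
 obtain N where N: "N \<in> null_sets lborel" "{x. \<not> R x} \<subseteq> N"
  using assms unfolding eventually_ae_filter by auto
 then have [measurable]: "N \<in> sets borel" by auto
 have "AE x in lborel. x \<notin> N" using N(1) by (rule AE_not_in)
 then have "AE x in lborel. AE y in lborel. fst (x, y) \<notin> N \<and> snd (x, y) \<notin> N" by auto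
 moreover have "{z \<in> space (lborel \<Otimes>\<^sub>M lborel). fst z \<notin> N \<and> snd z \<notin> N} \<in> sets (lborel \<Otimes>\<^sub>M lborel)"
  by measurable
 ultimately have "AE z in lborel \<Otimes>\<^sub>M lborel. fst z \<notin> N \<and> snd z \<notin> N"
  by (intro lborel_pair.AE_pair_measure)
 then have "AE z in \<kappa>. fst z \<notin> N \<and> snd z \<notin> N"
  unfolding \<kappa>_def by (subst AE_density) auto
 then show ?thesis using N(2) by auto
qed

definition fin :: "(real ^ 'n \<Rightarrow> real) \<Rightarrow> bool" where
 "fin h \<longleftrightarrow> h \<in> borel_measurable borel \<and> abs_form f h < \<infinity>"

text \<open>The absolute form polarised; it takes the role of the integrable majorant in limits of the
  form.\<close>

definition cross :: "(real ^ 'n \<Rightarrow> real) \<Rightarrow> (real ^ 'n \<Rightarrow> real) \<Rightarrow> ennreal" where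
 "cross u v = (\<integral>\<^sup>+z. ennreal (\<bar>u (fst z)\<bar> * \<bar>v (snd z)\<bar>) \<partial>\<kappa>)"

definition q :: "(real ^ 'n \<Rightarrow> real) \<Rightarrow> (real ^ 'n \<Rightarrow> real) \<Rightarrow> real" where
 "q h k = (\<integral>z. h (fst z) * k (snd z) \<partial>\<kappa>)"

lemma fin_borel [measurable_dest]: "fin h \<Longrightarrow> h \<in> borel_measurable borel"
 by (simp add: fin_def)

lemma cross_mono: "(\<And>x. \<bar>u x\<bar> \<le> \<bar>u' x\<bar>) \<Longrightarrow> (\<And>x. \<bar>v x\<bar> \<le> \<bar>v' x\<bar>) \<Longrightarrow> cross u v \<le> cross u' v'"
 unfolding cross_def by (intro nn_integral_mono ennreal_leI mult_mono) auto

lemma cross_self: "h \<in> borel_measurable borel \<Longrightarrow> cross h h = abs_form f h"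
 by (simp add: cross_def abs_form_kappa)

lemma integrable_cross:
 assumes [measurable]: "u \<in> borel_measurable borel" "v \<in> borel_measurable borel" and "cross u v < \<infinity>"
 shows "integrable \<kappa> (\<lambda>z. u (fst z) * v (snd z))"
 using assms(3) by (intro integrableI_bounded) (auto simp: cross_def abs_mult)

lemma cross_scale:
 assumes [measurable]: "u \<in> borel_measurable borel" "v \<in> borel_measurable borel"
 shows "cross (\<lambda>x. a * u x) (\<lambda>x. b * v x) = ennreal \<bar>a * b\<bar> * cross u v"
 unfolding cross_def
 by (subst nn_integral_cmult[symmetric])
   (auto simp: abs_mult ennreal_mult[symmetric] mult_ac intro!: nn_integral_cong arg_cong[where f=ennreal])

lemma fin_mono:
 assumes "h \<in> borel_measurable borel" "fin w" "\<And>x. \<bar>h x\<bar> \<le> \<bar>w x\<bar>"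
 shows "fin h"
 using assms cross_mono[of h w h w] cross_self[of h] cross_self[of w] unfolding fin_def
 by (auto simp: less_top top.extremum_unique)

lemma fin_scale: "fin h \<Longrightarrow> fin (\<lambda>x. a * h x)"
proof -
 assume h: "fin h"
 then have [measurable]: "h \<in> borel_measurable borel" by (rule fin_borel)
 have "abs_form f (\<lambda>x. a * h x) = ennreal \<bar>a * a\<bar> * abs_form f h"
  using cross_scale[of h h a a] cross_self[of h] cross_self[of "\<lambda>x. a * h x"] by simp
 also have "\<dots> < \<infinity>" using h by (simp add: fin_def ennreal_mult_less_top)
 finally show ?thesis by (simp add: fin_def)
qed

text \<open>The product of the Gaussians in \<open>x\<close> and \<open>y\<close> is at most a Gaussian in
  \<open>x - y\<close>, which \<open>f\<close> integrates, times one in \<open>y\<close>.\<close>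

lemma fin_gaussian:
 assumes "0 < c"
 shows "fin (\<lambda>x. exp (- (c * (norm x)^2)))"
proof -
 let ?k = "\<lambda>z::real^'n. ennreal (f z * exp (- (c / 4 * (norm z)^2)))" and ?g = "\<lambda>y::real^'n. ennreal (exp (- (c / 2 * (norm y)^2)))"
 have pt: "exp (- (c * (norm x)^2)) * f (x - y) * exp (- (c * (norm y)^2))
   \<le> (f (x - y) * exp (- (c / 4 * (norm (x - y))^2))) * exp (- (c / 2 * (norm y)^2))" for x y :: "real ^ 'n"
 proof -
  have "(norm (x - y))^2 + (norm (x + y))^2 = 2 * (norm x)^2 + 2 * (norm y)^2"
   unfolding power2_norm_eq_inner by (simp add: algebra_simps inner_commute)
  then have "(norm (x - y))^2 \<le> 2 * (norm x)^2 + 2 * (norm y)^2"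
   using zero_le_power2[of "norm (x + y)"] by linarith
  then have "c * (norm (x - y))^2 \<le> c * (2 * (norm x)^2 + 2 * (norm y)^2)"
   using assms by (intro mult_left_mono) auto
  moreover have "0 \<le> c * (norm x)^2" using assms by simp
  ultimately have "- (c * (norm x)^2) + - (c * (norm y)^2) \<le> - (c / 4 * (norm (x - y))^2) + - (c / 2 * (norm y)^2)"
   by (simp add: algebra_simps)
  then have "exp (- (c * (norm x)^2)) * exp (- (c * (norm y)^2)) \<le> exp (- (c / 4 * (norm (x - y))^2)) * exp (- (c / 2 * (norm y)^2))"
   unfolding mult_exp_exp by simp
  from mult_left_mono[OF this nonneg[of "x - y"]] show ?thesis by (simp add: mult_ac)
 qed
 have "abs_form f (\<lambda>x. exp (- (c * (norm x)^2))) \<le> (\<integral>\<^sup>+x. (\<integral>\<^sup>+y. ?k (x - y) * ?g y \<partial>lborel) \<partial>lborel)"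
  unfolding abs_form_def
  by (intro nn_integral_mono) (use pt in \<open>simp add: ennreal_mult[symmetric] nonneg ennreal_leI\<close>)
 also have "\<dots> = (\<integral>\<^sup>+y. (\<integral>\<^sup>+x. ?k (x - y) * ?g y \<partial>lborel) \<partial>lborel)"
  by (rule lborel_pair.Fubini') measurable
 also have "\<dots> = (\<integral>\<^sup>+y. (\<integral>\<^sup>+x. ?k x \<partial>lborel) * ?g y \<partial>lborel)"
 proof (intro nn_integral_cong)
  fix y
  have "(\<integral>\<^sup>+x. ?k (x - y) * ?g y \<partial>lborel) = (\<integral>\<^sup>+x. ?k (x - y) \<partial>lborel) * ?g y"
   by (rule nn_integral_multc) measurable
  also have "(\<integral>\<^sup>+x. ?k (x - y) \<partial>lborel) = (\<integral>\<^sup>+x. ?k x \<partial>lborel)"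
   by (rule nn_integral_lborel_shift) measurable
  finally show "(\<integral>\<^sup>+x. ?k (x - y) * ?g y \<partial>lborel) = (\<integral>\<^sup>+x. ?k x \<partial>lborel) * ?g y" .
 qed
 also have "\<dots> = (\<integral>\<^sup>+x. ?k x \<partial>lborel) * (\<integral>\<^sup>+y. ?g y \<partial>lborel)"
  by (rule nn_integral_cmult) simp
 also have "\<dots> < \<infinity>"
 proof -
  have "(\<integral>\<^sup>+x. ?k x \<partial>lborel) < \<infinity>"
   using integrable_schwartz[OF gaussian_schwartz[of "c / 4" 0]] assms
   by (simp add: integrable_iff_bounded nonneg)
  moreover have "(\<integral>\<^sup>+x. ?g x \<partial>lborel) < \<infinity>"
   using gaussian_integrable[of "c / 2", where ?'v="real ^ 'n"] assms by (simp add: integrable_iff_bounded)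
  ultimately show ?thesis by (simp add: ennreal_mult_less_top)
 qed
 finally show ?thesis by (simp add: fin_def)
qed

lemma fin_bounded:
 assumes [measurable]: "h \<in> borel_measurable borel" and "\<And>x. \<bar>h x\<bar> \<le> C" and "\<And>x. R < norm x \<Longrightarrow> h x = 0"
 shows "fin h"
proof (rule fin_mono)
 show "fin (\<lambda>x. (C * exp (R^2)) * exp (- (1 * (norm x)^2)))"
  by (intro fin_scale fin_gaussian) simp
 fix x
 have C: "0 \<le> C" using assms(2)[of x] by linarith
 show "\<bar>h x\<bar> \<le> \<bar>(C * exp (R^2)) * exp (- (1 * (norm x)^2))\<bar>"
 proof (cases "R < norm x")
  case False
  then have "(norm x)^2 \<le> R^2" by (intro power_mono) auto
  then have "1 \<le> exp (R^2) * exp (- (1 * (norm x)^2))" unfolding mult_exp_exp by simp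
  from mult_left_mono[OF this C] assms(2)[of x] show ?thesis using C by (simp add: abs_mult mult_ac)
 qed (simp add: assms(3))
qed fact

lemma gaussian_recenter:
 fixes x v :: "'v::real_inner"
 assumes "0 \<le> c"
 shows "exp (- (c * (norm (x - v))^2)) \<le> exp (c * (norm v)^2) * exp (- (c / 2 * (norm x)^2))"
proof -
 have "2 * (norm (x - v))^2 + 2 * (norm v)^2 = (norm x)^2 + (norm (x - 2 *\<^sub>R v))^2"
  unfolding power2_norm_eq_inner by (simp add: algebra_simps inner_commute)
 then have "(norm x)^2 \<le> 2 * (norm (x - v))^2 + 2 * (norm v)^2"
  using zero_le_power2[of "norm (x - 2 *\<^sub>R v)"] by linarith
 from mult_left_mono[OF this assms]
 have "- (c * (norm (x - v))^2) \<le> c * (norm v)^2 + - (c / 2 * (norm x)^2)" by (simp add: algebra_simps)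
 then show ?thesis unfolding mult_exp_exp by simp
qed

text \<open>Approximation of every function with finite absolute form by finite sums of Gaussians of equal
  width: sums of translates tend to the convolution of a compactly supported function with a Gaussian, narrow
  Gaussians recover continuous functions, these are dense almost everywhere in the bounded Borel functions,
  and truncation gives the rest. Each limit is dominated by a function with finite absolute form, which is
  what makes the form continuous along it.\<close>

lemma
 assumes gauss: "\<And>c V a. finite V \<Longrightarrow> 0 < c \<Longrightarrow> R (\<lambda>x. \<Sum>v\<in>V. a v * exp (- (c * (norm (x - v))^2)))"
  and scale: "\<And>r u. R u \<Longrightarrow> R (\<lambda>x. r * u x)"
  and limit: "\<And>u U w. (\<And>n::nat. R (U n)) \<Longrightarrow> (\<And>n. U n \<in> borel_measurable borel) \<Longrightarrow> u \<in> borel_measurable borel \<Longrightarrow>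
    fin w \<Longrightarrow> (\<And>n x. \<bar>U n x\<bar> \<le> \<bar>w x\<bar>) \<Longrightarrow> AE x in lborel. (\<lambda>n. U n x) \<longlonglongrightarrow> u x \<Longrightarrow> R u"
 shows convolution_induct: "\<And>h C r c. h \<in> borel_measurable borel \<Longrightarrow> (\<And>x. \<bar>h x\<bar> \<le> C) \<Longrightarrow> (\<And>x. r < norm x \<Longrightarrow> h x = 0)
    \<Longrightarrow> 0 < c \<Longrightarrow> R (\<lambda>x. \<integral>y. h y * exp (- (c * (norm (x - y))^2)) \<partial>lborel)"
  and continuous_induct: "\<And>h C r. continuous_on UNIV h \<Longrightarrow> (\<And>x. \<bar>h x\<bar> \<le> C) \<Longrightarrow> (\<And>x. r < norm x \<Longrightarrow> h x = 0) \<Longrightarrow> R h"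
  and fin_induct: "fin h \<Longrightarrow> R h"
proof -
 show conv: "R (\<lambda>x. \<integral>y. h y * exp (- (c * (norm (x - y))^2)) \<partial>lborel)"
  if h [measurable]: "h \<in> borel_measurable borel" "\<And>x. \<bar>h x\<bar> \<le> C" "\<And>x. r < norm x \<Longrightarrow> h x = 0" and c: "0 < c" for h C r c
 proof -
  have C: "0 \<le> C" using h(2)[of 0] by linarith
  have int_h: "integrable lborel h"
  proof (rule integrable_dominated)
   show "integrable lborel (\<lambda>x::real^'n. C * indicator (cball 0 r) x)"
    by (intro integrable_mult_right integrable_real_indicator) (use emeasure_bounded_finite[OF bounded_cball, of "0::real^'n" r] in auto)
   show "AE x in lborel. norm (h x) \<le> norm (C * indicator (cball 0 r) x)"
    using h(2,3) C by (auto split: split_indicator simp: not_le)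
  qed simp
  obtain F where F: "\<And>i. simple_function lborel (F i)" "\<And>x::real^'n. (\<lambda>i. F i x) \<longlonglongrightarrow> x" "\<And>i x::real^'n. dist (F i x) 0 \<le> 2 * dist x 0"
   using borel_measurable_implies_sequence_metric[of "\<lambda>x::real^'n. x" lborel 0] by auto
  have [measurable]: "F i \<in> borel_measurable borel" for i
   using borel_measurable_simple_function[OF F(1)] by simp
  define U where "U i x = (\<integral>y. h y * exp (- (c * (norm (x - F i y))^2)) \<partial>lborel)" for i x
  have int: "integrable lborel (\<lambda>y. h y * exp (- (c * (norm (x - F i y))^2)))" for x i
   using int_h by (rule integrable_dominated) (use c in \<open>auto simp: abs_mult mult_left_le\<close>)
  let ?g = "\<lambda>x::real^'n. exp (- (c / 2 * (norm x)^2))"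
  let ?B = "exp (c * (2 * r)^2) * (\<integral>y. \<bar>h y\<bar> \<partial>lborel)"
  show ?thesis
  proof (rule limit)
   fix i
   have fin: "finite (range (F i))" using simple_functionD(1)[OF F(1)] by simp
   have "U i x = (\<Sum>v\<in>range (F i). (\<integral>y. h y * indicator {y. F i y = v} y \<partial>lborel) * exp (- (c * (norm (x - v))^2)))" for x
   proof -
    have "h y * exp (- (c * (norm (x - F i y))^2)) =
     (\<Sum>v\<in>range (F i). h y * indicator {y. F i y = v} y * exp (- (c * (norm (x - v))^2)))" for y
     by (subst sum.remove[OF fin, of "F i y"]) (auto intro!: sum.neutral simp: indicator_def)
    moreover have "integrable lborel (\<lambda>y. h y * indicator {y. F i y = v} y * exp (- (c * (norm (x - v))^2)))" for v
     using int_h by (intro integrable_mult_left integrable_real_mult_indicator) (auto)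
    ultimately show ?thesis unfolding U_def by (simp add: Bochner_Integration.integral_sum)
   qed
   then have "U i = (\<lambda>x. \<Sum>v\<in>range (F i). (\<integral>y. h y * indicator {y. F i y = v} y \<partial>lborel) * exp (- (c * (norm (x - v))^2)))"
    by (rule ext)
   then show "R (U i)" using gauss[OF fin c, of "\<lambda>v. \<integral>y. h y * indicator {y. F i y = v} y \<partial>lborel"] by (simp only:)
   show "U i \<in> borel_measurable borel" unfolding U_def by measurable
  next
   show "fin (\<lambda>x. ?B * ?g x)" using c by (intro fin_scale fin_gaussian) auto
  next
   fix i x
   have "\<bar>U i x\<bar> \<le> (\<integral>y. \<bar>h y * exp (- (c * (norm (x - F i y))^2))\<bar> \<partial>lborel)"
    unfolding U_def by (rule integral_abs_bound)
   also have "\<dots> \<le> (\<integral>y. \<bar>h y\<bar> * (exp (c * (2 * r)^2) * ?g x) \<partial>lborel)"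
   proof (rule integral_mono)
    show "integrable lborel (\<lambda>y. \<bar>h y * exp (- (c * (norm (x - F i y))^2))\<bar>)" using int by simp
    show "integrable lborel (\<lambda>y. \<bar>h y\<bar> * (exp (c * (2 * r)^2) * ?g x))" using int_h by simp
    fix y
    show "\<bar>h y * exp (- (c * (norm (x - F i y))^2))\<bar> \<le> \<bar>h y\<bar> * (exp (c * (2 * r)^2) * ?g x)"
    proof (cases "r < norm y")
     case False
     then have "norm (F i y) \<le> 2 * r" using F(3)[of i y] by (simp add: dist_norm)
     then have "(norm (F i y))^2 \<le> (2 * r)^2" by (intro power_mono) auto
     then have "exp (c * (norm (F i y))^2) \<le> exp (c * (2 * r)^2)" using c by simp
     then have "exp (- (c * (norm (x - F i y))^2)) \<le> exp (c * (2 * r)^2) * ?g x"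
      using gaussian_recenter[of c x "F i y"] c by (meson exp_ge_zero less_imp_le mult_right_mono order_trans)
     then show ?thesis by (simp add: abs_mult mult_left_mono)
    qed (simp add: h(3))
   qed
   also have "\<dots> = ?B * ?g x" by simp
   finally show "\<bar>U i x\<bar> \<le> \<bar>?B * ?g x\<bar>" by linarith
  next
   show "AE x in lborel. (\<lambda>i. U i x) \<longlonglongrightarrow> (\<integral>y. h y * exp (- (c * (norm (x - y))^2)) \<partial>lborel)"
   proof (rule AE_I2)
    fix x
    show "(\<lambda>i. U i x) \<longlonglongrightarrow> (\<integral>y. h y * exp (- (c * (norm (x - y))^2)) \<partial>lborel)"
     unfolding U_def
    proof (rule integral_dominated_convergence[where w="\<lambda>y. \<bar>h y\<bar>"])
     show "AE y in lborel. (\<lambda>i. h y * exp (- (c * (norm (x - F i y))^2))) \<longlonglongrightarrow> h y * exp (- (c * (norm (x - y))^2))"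
      by (intro AE_I2 tendsto_intros F)
     show "AE y in lborel. norm (h y * exp (- (c * (norm (x - F i y))^2))) \<le> \<bar>h y\<bar>" for i
      using c by (auto simp: abs_mult mult_left_le)
    qed (use int_h in auto)
   qed
  qed measurable
 qed

 show cont: "R h" if h: "continuous_on UNIV h" "\<And>x. \<bar>h x\<bar> \<le> C" "\<And>x. r < norm x \<Longrightarrow> h x = 0" for h C r
 proof -
  have [measurable]: "h \<in> borel_measurable borel" using h(1) by (rule borel_measurable_continuous_onI)
  have C: "0 \<le> C" using h(2)[of 0] by linarith
  define g :: "real^'n \<Rightarrow> real" where "g z = exp (- (1 * (norm z)^2))" for z
  have [measurable]: "g \<in> borel_measurable borel" unfolding g_def by measurable
  have int_g: "integrable lborel g" unfolding g_def by (rule gaussian_integrable) simp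
  have g0: "0 < g z" for z by (simp add: g_def)
  define M where "M = (\<integral>z. g z \<partial>lborel)"
  have "M \<noteq> 0"
  proof
   assume "M = 0"
   then have "AE z in lborel. g z = 0" using g0 int_g unfolding M_def
    by (subst (asm) integral_nonneg_eq_0_iff_AE) (auto simp: less_imp_le)
   then have "AE z::real^'n in lborel. False" using g0 by (auto simp: less_le)
   then show False by (simp add: AE_iff_measurable[OF _ refl] emeasure_lborel_UNIV)
  qed
  define \<epsilon> where "\<epsilon> n = 1 / real (Suc n)" for n
  have eps: "0 < \<epsilon> n" "\<epsilon> n \<le> 1" for n by (auto simp: \<epsilon>_def)
  have eps0: "\<epsilon> \<longlonglongrightarrow> 0" unfolding \<epsilon>_def using LIMSEQ_inverse_real_of_nat by (simp add: inverse_eq_divide)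
  define U where "U n x = (\<integral>z. h (x - \<epsilon> n *\<^sub>R z) * g z \<partial>lborel)" for n x
  have U_eq: "(\<integral>y. h y * exp (- ((1 / (\<epsilon> n)^2) * (norm (x - y))^2)) \<partial>lborel) = (\<epsilon> n) ^ CARD('n) * U n x" for n x
  proof -
   have "(\<integral>y. h y * exp (- ((1 / (\<epsilon> n)^2) * (norm (x - y))^2)) \<partial>lborel) =
    (\<integral>y. h y * exp (- ((1 / (\<epsilon> n)^2) * (norm (x - y))^2))
     \<partial>density (distr lborel borel (\<lambda>z. x + (- \<epsilon> n) *\<^sub>R z)) (\<lambda>_. ennreal (\<bar>- \<epsilon> n\<bar> ^ DIM(real^'n))))"
    using lborel_affine[of "- \<epsilon> n" x] eps(1)[of n] by simp
   also have "\<dots> = (\<integral>z. (\<epsilon> n) ^ CARD('n) * (h (x - \<epsilon> n *\<^sub>R z) * g z) \<partial>lborel)"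
    using eps(1)[of n]
    by (subst integral_density) (auto simp: integral_distr g_def less_imp_le power_mult_distrib intro!: Bochner_Integration.integral_cong)
   finally show ?thesis unfolding U_def by simp
  qed
  let ?G = "\<lambda>x::real^'n. exp (- (1/4 * (norm x)^2))"
  define D where "D = C * exp (r^2 / 2) * (\<integral>(z::real^'n). exp (- (1/2 * (norm z)^2)) \<partial>lborel)"
  have "R (\<lambda>x. M * h x)"
  proof (rule limit)
   fix n
   have "0 < 1 / (\<epsilon> n)^2" using eps(1)[of n] by simp
   from conv[OF \<open>h \<in> borel_measurable borel\<close> h(2,3) this]
   have "R (\<lambda>x. \<integral>y. h y * exp (- ((1 / (\<epsilon> n)^2) * (norm (x - y))^2)) \<partial>lborel)" .
   from scale[OF this, where r="1 / (\<epsilon> n) ^ CARD('n)"]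
   show "R (U n)" unfolding U_eq using eps(1)[of n] by simp
   show "U n \<in> borel_measurable borel" unfolding U_def by measurable
  next
   show "fin (\<lambda>x. D * ?G x)" by (intro fin_scale fin_gaussian) simp
  next
   fix n x
   have "\<bar>U n x\<bar> \<le> (\<integral>z. \<bar>h (x - \<epsilon> n *\<^sub>R z) * g z\<bar> \<partial>lborel)"
    unfolding U_def by (rule integral_abs_bound)
   also have "\<dots> \<le> (\<integral>(z::real^'n). (C * exp (r^2 / 2)) * ?G x * exp (- (1/2 * (norm z)^2)) \<partial>lborel)"
   proof (rule integral_mono)
    show "integrable lborel (\<lambda>z. \<bar>h (x - \<epsilon> n *\<^sub>R z) * g z\<bar>)"
     by (rule integrable_dominated[where f="\<lambda>z. C * g z"])
       (use int_g h(2) C in \<open>auto simp: abs_mult intro!: mult_mono\<close>)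
    show "integrable lborel (\<lambda>z::real^'n. (C * exp (r^2 / 2)) * ?G x * exp (- (1/2 * (norm z)^2)))"
     by (intro integrable_mult_right gaussian_integrable) simp
    fix z
    show "\<bar>h (x - \<epsilon> n *\<^sub>R z) * g z\<bar> \<le> (C * exp (r^2 / 2)) * ?G x * exp (- (1/2 * (norm z)^2))"
    proof (cases "r < norm (x - \<epsilon> n *\<^sub>R z)")
     case True then show ?thesis using C by (simp add: h(3))
    next
     case False
     have "norm x \<le> norm (x - \<epsilon> n *\<^sub>R z) + norm (\<epsilon> n *\<^sub>R z)"
      using norm_triangle_ineq[of "x - \<epsilon> n *\<^sub>R z" "\<epsilon> n *\<^sub>R z"] by simp
     moreover have "norm (\<epsilon> n *\<^sub>R z) \<le> norm z" using eps[of n] by (simp add: mult_left_le_one_le)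
     ultimately have "norm x \<le> r + norm z" using False by linarith
     then have "(norm x)^2 \<le> (r + norm z)^2" by (intro power_mono) auto
     also have "\<dots> \<le> 2 * r^2 + 2 * (norm z)^2"
      using zero_le_power2[of "r - norm z"] by (simp add: power2_eq_square algebra_simps)
     finally have "- (norm z)\<^sup>2 \<le> r^2 / 2 + - (1/4 * (norm x)^2) + - (1/2 * (norm z)^2)" by simp
     then have "g z \<le> exp (r^2 / 2) * ?G x * exp (- (1/2 * (norm z)^2))"
      unfolding g_def mult_exp_exp by simp
     then show ?thesis using h(2)[of "x - \<epsilon> n *\<^sub>R z"] g0[of z] C
      by (auto simp: abs_mult mult.assoc intro!: mult_mono)
    qed
   qed
   also have "\<dots> = D * ?G x" by (simp add: D_def)
   finally show "\<bar>U n x\<bar> \<le> \<bar>D * ?G x\<bar>" by linarith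
  next
   show "AE x in lborel. (\<lambda>n. U n x) \<longlonglongrightarrow> M * h x"
   proof (rule AE_I2)
    fix x
    have "(\<lambda>n. U n x) \<longlonglongrightarrow> (\<integral>z. h x * g z \<partial>lborel)"
     unfolding U_def
    proof (rule integral_dominated_convergence[where w="\<lambda>z. C * g z"])
     have "isCont h x" using h(1) by (simp add: continuous_on_eq_continuous_at)
     moreover have "(\<lambda>n. x - \<epsilon> n *\<^sub>R z) \<longlonglongrightarrow> x" for z
      using tendsto_diff[OF tendsto_const tendsto_scaleR[OF eps0 tendsto_const[of z]], of x] by simp
     ultimately have "(\<lambda>n. h (x - \<epsilon> n *\<^sub>R z)) \<longlonglongrightarrow> h x" for z
      by (rule isCont_tendsto_compose)
     then show "AE z in lborel. (\<lambda>n. h (x - \<epsilon> n *\<^sub>R z) * g z) \<longlonglongrightarrow> h x * g z"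
      by (intro AE_I2 tendsto_mult tendsto_const)
     show "AE z in lborel. norm (h (x - \<epsilon> n *\<^sub>R z) * g z) \<le> C * g z" for n
      using h(2) g0 by (auto simp: abs_mult less_imp_le intro!: mult_right_mono)
    qed (use int_g in auto)
    then show "(\<lambda>n. U n x) \<longlonglongrightarrow> M * h x" by (simp add: M_def mult.commute)
   qed
  qed measurable
  from scale[OF this, where r="1 / M"] \<open>M \<noteq> 0\<close> show "R h" by simp
 qed

 have bdd: "R h" if [measurable]: "h \<in> borel_measurable borel" and h: "\<And>x. \<bar>h x\<bar> \<le> C" "\<And>x. r < norm x \<Longrightarrow> h x = 0" for h C r
 proof -
  have C: "0 \<le> C" using h(1)[of 0] by linarith
  have "h measurable_on UNIV"
   by (rule lebesgue_measurable_imp_measurable_on) (auto intro: measurable_completion)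
  then obtain N g where N: "negligible N" and g: "\<And>n. continuous_on UNIV (g n)"
   "\<And>x. x \<notin> N \<Longrightarrow> (\<lambda>n. g n x) \<longlonglongrightarrow> h x"
   unfolding measurable_on_def by auto
  define cut where "cut x = max 0 (min 1 (r + 1 - norm x))" for x :: "real^'n"
  define H where "H n x = max (- C) (min C (g n x)) * cut x" for n x
  have chi: "0 \<le> cut x" "cut x \<le> 1" "r + 1 < norm x \<Longrightarrow> cut x = 0" "norm x \<le> r \<Longrightarrow> cut x = 1" for x by (auto simp: cut_def)
  have cH: "continuous_on UNIV (H n)" for n
   unfolding H_def cut_def by (intro continuous_intros g)
  have bH: "\<bar>H n x\<bar> \<le> C" for n x
   using chi[of x] C unfolding H_def abs_mult by (intro order_trans[OF mult_left_le]) auto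
  have zH: "r + 1 < norm x \<Longrightarrow> H n x = 0" for n x by (simp add: H_def chi)
  show "R h"
  proof (rule limit)
   show "R (H n)" for n by (rule cont[OF cH bH zH])
   show "H n \<in> borel_measurable borel" for n using cH by (rule borel_measurable_continuous_onI)
   show "fin (\<lambda>x. C * indicator (cball 0 (r + 1)) x)"
   proof (rule fin_bounded[where C=C and R="r+1"])
    show "(\<lambda>x::real^'n. C * indicator (cball 0 (r + 1)) x) \<in> borel_measurable borel"
     by (intro borel_measurable_times borel_measurable_const borel_measurable_indicator borel_closed closed_cball)
   qed (use C in \<open>auto split: split_indicator\<close>)
   show "\<bar>H n x\<bar> \<le> \<bar>C * indicator (cball 0 (r + 1)) x\<bar>" for n x
    using bH[of n x] zH[of x n] C by (auto split: split_indicator)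
   have "AE x in lebesgue. x \<notin> N" using N by (simp add: negligible_iff_null_sets AE_not_in)
   then have "AE x in lborel. x \<notin> N" by (simp add: AE_completion_iff)
   then show "AE x in lborel. (\<lambda>n. H n x) \<longlonglongrightarrow> h x"
   proof eventually_elim
    fix x assume "x \<notin> N"
    then have "(\<lambda>n. H n x) \<longlonglongrightarrow> max (- C) (min C (h x)) * cut x"
     unfolding H_def by (intro tendsto_intros g)
    moreover have "max (- C) (min C (h x)) * cut x = h x"
     using h(1)[of x] h(2)[of x] chi(4)[of x] by (cases "norm x \<le> r") (auto simp: abs_le_iff)
    ultimately show "(\<lambda>n. H n x) \<longlonglongrightarrow> h x" by simp
   qed
  qed measurable
 qed

 show "R h" if fin: "fin h"
 proof (rule limit)
  have [measurable]: "h \<in> borel_measurable borel" using fin by (rule fin_borel)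
  let ?H = "\<lambda>n x. if norm x \<le> real n \<and> \<bar>h x\<bar> \<le> real n then h x else 0"
  show mH: "?H n \<in> borel_measurable borel" for n by measurable
  show "R (?H n)" for n by (rule bdd[OF mH, of n "real n" "real n"]) auto
  show "h \<in> borel_measurable borel" by fact
  show "fin h" by fact
  show "\<bar>?H n x\<bar> \<le> \<bar>h x\<bar>" for n x by simp
  have "(\<lambda>n. ?H n x) \<longlonglongrightarrow> h x" for x
  proof (rule tendsto_eventually)
   obtain n0 where "max (norm x) \<bar>h x\<bar> \<le> real n0" using real_arch_simple by blast
   then show "\<forall>\<^sub>F n in sequentially. ?H n x = h x"
    unfolding eventually_sequentially by (intro exI[of _ n0]) auto
  qed
  then show "AE x in lborel. (\<lambda>n. ?H n x) \<longlonglongrightarrow> h x" by simp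
 qed
qed

lemma fin_dense_induct [consumes 1, case_names gaussian scale limit]:
 assumes "fin h"
  and "\<And>c V a. finite V \<Longrightarrow> 0 < c \<Longrightarrow> R (\<lambda>x. \<Sum>v\<in>V. a v * exp (- (c * (norm (x - v))^2)))"
  and "\<And>r u. R u \<Longrightarrow> R (\<lambda>x. r * u x)"
  and "\<And>u U w. (\<And>n::nat. R (U n)) \<Longrightarrow> (\<And>n. U n \<in> borel_measurable borel) \<Longrightarrow> u \<in> borel_measurable borel \<Longrightarrow>
    fin w \<Longrightarrow> (\<And>n x. \<bar>U n x\<bar> \<le> \<bar>w x\<bar>) \<Longrightarrow> AE x in lborel. (\<lambda>n. U n x) \<longlonglongrightarrow> u x \<Longrightarrow> R u"
 shows "R h"
 using assms(2-4) assms(1) by (rule fin_induct)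

lemma integrable_kappa_mono:
 assumes "fin w" "u \<in> borel_measurable borel" "v \<in> borel_measurable borel"
  "\<And>x. \<bar>u x\<bar> \<le> \<bar>a * w x\<bar>" "\<And>x. \<bar>v x\<bar> \<le> \<bar>b * w x\<bar>"
 shows "integrable \<kappa> (\<lambda>z. u (fst z) * v (snd z))"
proof (rule integrable_cross)
 have [measurable]: "w \<in> borel_measurable borel" using assms(1) by (rule fin_borel)
 have "cross u v \<le> cross (\<lambda>x. a * w x) (\<lambda>x. b * w x)" using assms(4,5) by (rule cross_mono)
 also have "\<dots> = ennreal \<bar>a * b\<bar> * cross w w" by (rule cross_scale) measurable
 also have "\<dots> < \<infinity>" using assms(1) by (simp add: fin_def cross_self ennreal_mult_less_top)
 finally show "cross u v < \<infinity>" .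
qed fact+

text \<open>Dominated convergence for the form; the product of the two majorants has to be integrable for the
  kernel measure.\<close>

lemma q_limit:
 assumes "\<And>n. U n \<in> borel_measurable borel" "\<And>n. V n \<in> borel_measurable borel"
  "u \<in> borel_measurable borel" "v \<in> borel_measurable borel"
  "w \<in> borel_measurable borel" "w' \<in> borel_measurable borel" "cross w w' < \<infinity>"
  "\<And>n x. \<bar>U n x\<bar> \<le> \<bar>w x\<bar>" "\<And>n x. \<bar>V n x\<bar> \<le> \<bar>w' x\<bar>"
  "AE x in lborel. (\<lambda>n. U n x) \<longlonglongrightarrow> u x" "AE x in lborel. (\<lambda>n. V n x) \<longlonglongrightarrow> v x"
 shows "(\<lambda>n. q (U n) (V n)) \<longlonglongrightarrow> q u v"
 unfolding q_def
proof (rule integral_dominated_convergence)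
 note [measurable] = assms(1-6)
 show "(\<lambda>z. u (fst z) * v (snd z)) \<in> borel_measurable \<kappa>" by measurable
 show "(\<lambda>z. U n (fst z) * V n (snd z)) \<in> borel_measurable \<kappa>" for n by measurable
 show "integrable \<kappa> (\<lambda>z. \<bar>w (fst z) * w' (snd z)\<bar>)"
  using integrable_cross[OF assms(5,6,7)] by simp
 show "AE z in \<kappa>. norm (U n (fst z) * V n (snd z)) \<le> \<bar>w (fst z) * w' (snd z)\<bar>" for n
  using assms(8,9) by (auto simp: abs_mult intro!: mult_mono)
 show "AE z in \<kappa>. (\<lambda>n. U n (fst z) * V n (snd z)) \<longlonglongrightarrow> u (fst z) * v (snd z)"
  using AE_kappa[OF assms(10)] AE_kappa[OF assms(11)] by eventually_elim (auto intro: tendsto_mult)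
qed

lemma gaussian_dominated:
 fixes v :: "real^'n"
 assumes "0 < c"
 shows "\<bar>exp (- (c * (norm (x - v))^2))\<bar> \<le> \<bar>exp (c * (norm v)^2) * exp (- (c / 2 * (norm x)^2))\<bar>"
 using gaussian_recenter[of c x v] assms by simp

lemma integrable_gaussians:
 fixes v v' :: "real^'n"
 assumes "0 < c"
 shows "integrable \<kappa> (\<lambda>z. exp (- (c * (norm (fst z - v))^2)) * exp (- (c * (norm (snd z - v'))^2)))"
 by (rule integrable_kappa_mono[OF fin_gaussian[of "c / 2"] _ _ gaussian_dominated[OF assms] gaussian_dominated[OF assms]])
   (use assms in auto)

lemma q_gaussians:
 fixes v v' :: "real^'n"
 assumes "0 < c"
 shows "q (\<lambda>x. exp (- (c * (norm (x - v))^2))) (\<lambda>x. exp (- (c * (norm (x - v'))^2)))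
  = kform f (\<lambda>x. exp (- (c * (norm (x - v))^2))) (\<lambda>x. exp (- (c * (norm (x - v'))^2)))"
 unfolding q_def by (rule kform_kappa[symmetric]) (auto intro: integrable_gaussians assms)

text \<open>Sums of Gaussians are Schwartz functions, where positivity is given; it survives dominated
  limits.\<close>

lemma q_psd: "fin h \<Longrightarrow> 0 \<le> q h h"
proof (induction rule: fin_dense_induct)
 case (gaussian c V a)
 let ?G = "\<lambda>v x::real^'n. exp (- (c * (norm (x - v))^2))"
 have inj: "inj_on ?G V"
 proof (rule inj_onI)
  fix v v' assume "?G v = ?G v'"
  then have "?G v v = ?G v' v" by metis
  then show "v = v'" using \<open>0 < c\<close> by simp
 qed
 let ?b = "\<lambda>\<gamma>. a (the_inv_into V ?G \<gamma>)"
 have "0 \<le> (\<Sum>\<gamma>\<in>?G ` V. \<Sum>\<psi>\<in>?G ` V. ?b \<gamma> * ?b \<psi> * kform f \<gamma> \<psi>)"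
  using gaussian by (intro psd_schwartz) (auto intro: gaussian_schwartz)
 also have "\<dots> = (\<Sum>v\<in>V. \<Sum>v'\<in>V. a v * a v' * q (?G v) (?G v'))"
 proof -
  have inv: "the_inv_into V ?G (?G v) = v" if "v \<in> V" for v
   by (rule the_inv_into_f_f[OF inj that])
  show ?thesis
   by (subst sum.reindex[OF inj], rule sum.cong[OF refl], unfold o_def, subst sum.reindex[OF inj], rule sum.cong[OF refl])
     (simp add: inv q_gaussians[OF \<open>0 < c\<close>])
 qed
 also have "\<dots> = q (\<lambda>x. \<Sum>v\<in>V. a v * ?G v x) (\<lambda>x. \<Sum>v\<in>V. a v * ?G v x)"
 proof -
  have "q (\<lambda>x. \<Sum>v\<in>V. a v * ?G v x) (\<lambda>x. \<Sum>v\<in>V. a v * ?G v x) =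
    (\<integral>z. (\<Sum>v\<in>V. \<Sum>v'\<in>V. a v * a v' * (?G v (fst z) * ?G v' (snd z))) \<partial>\<kappa>)"
   unfolding q_def by (simp add: sum_product mult_ac)
  also have "\<dots> = (\<Sum>v\<in>V. \<Sum>v'\<in>V. a v * a v' * q (?G v) (?G v'))"
   unfolding q_def
   by (subst Bochner_Integration.integral_sum | intro sum.cong refl Bochner_Integration.integrable_sum integrable_mult_right integrable_gaussians \<open>0 < c\<close> | simp)+
  finally show ?thesis by simp
 qed
 finally show ?case .
next
 case (scale r u)
 have "q (\<lambda>x. r * u x) (\<lambda>x. r * u x) = (\<integral>z. (r * r) * (u (fst z) * u (snd z)) \<partial>\<kappa>)"
  unfolding q_def by (simp add: mult_ac)
 also have "\<dots> = (r * r) * q u u" unfolding q_def by simp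
 finally show ?case using scale by simp
next
 case (limit u U w)
 have "(\<lambda>n. q (U n) (U n)) \<longlonglongrightarrow> q u u"
  by (rule q_limit[where w=w and w'=w]) (use limit in \<open>auto simp: cross_self fin_def\<close>)
 then show ?case using limit(1) by (intro LIMSEQ_le_const) auto
qed

lemma q_bilinear:
 assumes "integrable \<kappa> (\<lambda>z. u (fst z) * u (snd z))" "integrable \<kappa> (\<lambda>z. u (fst z) * v (snd z))"
  "integrable \<kappa> (\<lambda>z. v (fst z) * u (snd z))" "integrable \<kappa> (\<lambda>z. v (fst z) * v (snd z))"
 shows "q (\<lambda>x. a * u x + b * v x) (\<lambda>x. a * u x + b * v x)
   = a^2 * q u u + a * b * (q u v + q v u) + b^2 * q v v"
proof -
 have "q (\<lambda>x. a * u x + b * v x) (\<lambda>x. a * u x + b * v x) =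
  (\<integral>z. a^2 * (u (fst z) * u (snd z)) + a * b * (u (fst z) * v (snd z))
    + a * b * (v (fst z) * u (snd z)) + b^2 * (v (fst z) * v (snd z)) \<partial>\<kappa>)"
  unfolding q_def by (intro integral_eqI) (simp add: power2_eq_square algebra_simps)
 also have "\<dots> = a^2 * q u u + a * b * q u v + a * b * q v u + b^2 * q v v"
  using assms unfolding q_def by simp
 finally show ?thesis by (simp add: algebra_simps)
qed

text \<open>Positivity of the form at \<open>|u| - |v|\<close>. It bounds the mixed form by the diagonal ones,
  so that the form is defined for any two functions with finite absolute form.\<close>

lemma cross_le:
 assumes u: "fin u" and v: "fin v"
 shows "cross u v + cross v u \<le> cross u u + cross v v"
proof -
 have [measurable]: "u \<in> borel_measurable borel" "v \<in> borel_measurable borel" using u v by auto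
 define tr where "tr n h x = (if norm x \<le> real n \<and> \<bar>h x\<bar> \<le> real n then \<bar>h x\<bar> else 0)" for n and h :: "real^'n \<Rightarrow> real" and x
 have [measurable]: "tr n h \<in> borel_measurable borel" if [measurable]: "h \<in> borel_measurable borel" for n h
  unfolding tr_def by measurable
 have tr: "0 \<le> tr n h x" "tr n h x \<le> \<bar>h x\<bar>" for n h x by (auto simp: tr_def)
 have SUP: "(SUP n. ennreal (tr n h x * tr n k y)) = ennreal (\<bar>h x\<bar> * \<bar>k y\<bar>)" for h k x y
 proof (rule antisym)
  show "(SUP n. ennreal (tr n h x * tr n k y)) \<le> ennreal (\<bar>h x\<bar> * \<bar>k y\<bar>)"
   using tr by (intro SUP_least ennreal_leI mult_mono) auto
  obtain n where "max (max (norm x) (norm y)) (max \<bar>h x\<bar> \<bar>k y\<bar>) \<le> real n" using real_arch_simple by blast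
  then have "ennreal (\<bar>h x\<bar> * \<bar>k y\<bar>) = ennreal (tr n h x * tr n k y)" by (simp add: tr_def)
  also have "\<dots> \<le> (SUP n. ennreal (tr n h x * tr n k y))" by (rule SUP_upper) simp
  finally show "ennreal (\<bar>h x\<bar> * \<bar>k y\<bar>) \<le> (SUP n. ennreal (tr n h x * tr n k y))" .
 qed
 have inc: "incseq (\<lambda>n z. ennreal (tr n h (fst z) * tr n k (snd z)))" for h k
  unfolding incseq_def le_fun_def
  by (intro allI impI ennreal_leI mult_mono) (auto simp: tr_def)
 have lim: "(SUP n. cross (tr n h) (tr n k)) = cross h k"
  if [measurable]: "h \<in> borel_measurable borel" "k \<in> borel_measurable borel" for h k
 proof -
  have "(SUP n. cross (tr n h) (tr n k)) = (\<integral>\<^sup>+z. (SUP n. ennreal (tr n h (fst z) * tr n k (snd z))) \<partial>\<kappa>)"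
   unfolding cross_def using inc[of h k] tr
   by (subst nn_integral_monotone_convergence_SUP) auto
  then show ?thesis by (simp add: SUP cross_def)
 qed
 have fintr: "fin (tr n h)" if "h \<in> borel_measurable borel" for n h
  by (rule fin_bounded[where C="real n" and R="real n"]) (use that in \<open>auto simp: tr_def\<close>)
 have step: "cross (tr n u) (tr n v) + cross (tr n v) (tr n u) \<le> cross u u + cross v v" for n
 proof -
  let ?u = "tr n u" and ?v = "tr n v"
  let ?w = "indicator (cball 0 (real n)) :: real^'n \<Rightarrow> real"
  have w: "fin ?w"
   by (rule fin_bounded[where C=1 and R="real n"]) (auto split: split_indicator intro!: borel_measurable_indicator)
  have dom: "\<bar>tr n h x\<bar> \<le> \<bar>real n * ?w x\<bar>" for h x by (auto simp: tr_def split: split_indicator)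
  have int: "integrable \<kappa> (\<lambda>z. tr n h (fst z) * tr n k (snd z))"
   if "h \<in> borel_measurable borel" "k \<in> borel_measurable borel" for h k
   by (rule integrable_kappa_mono[OF w _ _ dom dom]) (use that in auto)
  have cq: "cross (tr n h) (tr n k) = ennreal (q (tr n h) (tr n k))"
   if "h \<in> borel_measurable borel" "k \<in> borel_measurable borel" for h k
   unfolding cross_def q_def using int[OF that] tr
   by (subst nn_integral_eq_integral[symmetric]) auto
  have q0: "0 \<le> q (tr n h) (tr n k)" for h k
   unfolding q_def using tr by (intro integral_nonneg_AE) auto
  have "fin (\<lambda>x. 1 * ?u x + (- 1) * ?v x)"
   by (rule fin_bounded[where C="real n" and R="real n"]) (auto simp: tr_def)
  from q_psd[OF this] have "q ?u ?v + q ?v ?u \<le> q ?u ?u + q ?v ?v"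
   by (subst (asm) q_bilinear) (auto intro: int)
  then have "ennreal (q ?u ?v + q ?v ?u) \<le> ennreal (q ?u ?u + q ?v ?v)" by (rule ennreal_leI)
  then have "cross ?u ?v + cross ?v ?u \<le> cross ?u ?u + cross ?v ?v"
   by (simp add: cq q0)
  also have "\<dots> \<le> cross u u + cross v v"
   using tr by (intro add_mono cross_mono) auto
  finally show ?thesis .
 qed
 have "cross u v + cross v u = (SUP n. cross (tr n u) (tr n v) + cross (tr n v) (tr n u))"
 proof (subst ennreal_SUP_add)
  show "incseq (\<lambda>n. cross (tr n u) (tr n v))" "incseq (\<lambda>n. cross (tr n v) (tr n u))"
   by (auto intro!: incseq_SucI cross_mono simp: tr_def)
 qed (simp add: lim)
 also have "\<dots> \<le> cross u u + cross v v" by (rule SUP_least) (rule step)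
 finally show ?thesis .
qed

lemma cross_finite: "fin u \<Longrightarrow> fin v \<Longrightarrow> cross u v < \<infinity>"
proof -
 assume uv: "fin u" "fin v"
 have "cross u v \<le> cross u v + cross v u" by simp
 also have "\<dots> \<le> cross u u + cross v v" using uv by (rule cross_le)
 also have "\<dots> < \<infinity>" using uv by (simp add: fin_def cross_self less_top[symmetric] ennreal_add_eq_top)
 finally show ?thesis .
qed

lemma integrable_q: "fin u \<Longrightarrow> fin v \<Longrightarrow> integrable \<kappa> (\<lambda>z. u (fst z) * v (snd z))"
 by (rule integrable_cross) (auto intro: cross_finite[unfolded infinity_ennreal_def])

lemma abs_form_add:
 assumes u: "fin u" and v: "fin v"
 shows "abs_form f (\<lambda>x. u x + v x) \<le> 2 * abs_form f u + 2 * abs_form f v"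
proof -
 have [measurable]: "u \<in> borel_measurable borel" "v \<in> borel_measurable borel" using u v by auto
 have "abs_form f (\<lambda>x. u x + v x) \<le> (\<integral>\<^sup>+z. (ennreal (\<bar>u (fst z)\<bar> * \<bar>u (snd z)\<bar>) + ennreal (\<bar>v (fst z)\<bar> * \<bar>v (snd z)\<bar>))
   + (ennreal (\<bar>u (fst z)\<bar> * \<bar>v (snd z)\<bar>) + ennreal (\<bar>v (fst z)\<bar> * \<bar>u (snd z)\<bar>)) \<partial>\<kappa>)"
 proof (subst abs_form_kappa, measurable, intro nn_integral_mono)
  fix z
  have "\<bar>u (fst z) + v (fst z)\<bar> * \<bar>u (snd z) + v (snd z)\<bar> \<le> (\<bar>u (fst z)\<bar> + \<bar>v (fst z)\<bar>) * (\<bar>u (snd z)\<bar> + \<bar>v (snd z)\<bar>)"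
   by (intro mult_mono) auto
  then have "ennreal (\<bar>u (fst z) + v (fst z)\<bar> * \<bar>u (snd z) + v (snd z)\<bar>) \<le>
    ennreal ((\<bar>u (fst z)\<bar> * \<bar>u (snd z)\<bar> + \<bar>v (fst z)\<bar> * \<bar>v (snd z)\<bar>) + (\<bar>u (fst z)\<bar> * \<bar>v (snd z)\<bar> + \<bar>v (fst z)\<bar> * \<bar>u (snd z)\<bar>))"
   by (intro ennreal_leI) (simp add: algebra_simps)
  then show "ennreal (\<bar>u (fst z) + v (fst z)\<bar> * \<bar>u (snd z) + v (snd z)\<bar>) \<le>
    (ennreal (\<bar>u (fst z)\<bar> * \<bar>u (snd z)\<bar>) + ennreal (\<bar>v (fst z)\<bar> * \<bar>v (snd z)\<bar>))
   + (ennreal (\<bar>u (fst z)\<bar> * \<bar>v (snd z)\<bar>) + ennreal (\<bar>v (fst z)\<bar> * \<bar>u (snd z)\<bar>))"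
   by simp
 qed
 also have "\<dots> = (cross u u + cross v v) + (cross u v + cross v u)"
  unfolding cross_def by (simp add: nn_integral_add)
 also have "\<dots> \<le> (cross u u + cross v v) + (cross u u + cross v v)"
  using cross_le[OF u v] by (rule add_left_mono)
 also have "\<dots> = 2 * abs_form f u + 2 * abs_form f v"
  by (simp add: cross_self mult_2 add_ac)
 finally show ?thesis .
qed

lemma abs_form_scale: "h \<in> borel_measurable borel \<Longrightarrow> abs_form f (\<lambda>x. a * h x) = ennreal (a^2) * abs_form f h"
 using cross_scale[of h h a a] by (simp add: cross_self power2_eq_square)

lemma fin_add: "fin u \<Longrightarrow> fin v \<Longrightarrow> fin (\<lambda>x. u x + v x)"
 using abs_form_add[of u v] unfolding fin_def
 by (auto simp: ennreal_mult_less_top intro!: borel_measurable_add elim!: order_le_less_trans)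

lemma fin_zero: "fin (\<lambda>x. 0)" by (simp add: fin_def abs_form_def)

lemma fin_sum: "(\<And>i. i \<in> S \<Longrightarrow> fin (h i)) \<Longrightarrow> fin (\<lambda>x. \<Sum>i\<in>S. h i x)"
 by (induction S rule: infinite_finite_induct) (auto intro: fin_add fin_zero)

lemma q_add_left: "fin u \<Longrightarrow> fin v \<Longrightarrow> fin w \<Longrightarrow> q (\<lambda>x. u x + v x) w = q u w + q v w"
 unfolding q_def by (simp add: distrib_right integrable_q)

lemma q_add_right: "fin u \<Longrightarrow> fin v \<Longrightarrow> fin w \<Longrightarrow> q w (\<lambda>x. u x + v x) = q w u + q w v"
 unfolding q_def by (simp add: distrib_left integrable_q)

lemma q_scale_left: "q (\<lambda>x. a * u x) w = a * q u w"
 unfolding q_def by (simp add: mult.assoc)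

lemma q_scale_right: "q w (\<lambda>x. a * u x) = a * q w u"
 unfolding q_def by (simp add: mult.left_commute)

lemma q_zero: "q (\<lambda>x. 0) w = 0" "q w (\<lambda>x. 0) = 0"
 by (simp_all add: q_def)

lemma q_sum_left: "finite S \<Longrightarrow> (\<And>i. i \<in> S \<Longrightarrow> fin (h i)) \<Longrightarrow> fin w \<Longrightarrow> q (\<lambda>x. \<Sum>i\<in>S. h i x) w = (\<Sum>i\<in>S. q (h i) w)"
 by (induction S rule: finite_induct) (auto simp: q_add_left fin_sum q_zero)

lemma q_sum_right: "finite S \<Longrightarrow> (\<And>i. i \<in> S \<Longrightarrow> fin (h i)) \<Longrightarrow> fin w \<Longrightarrow> q w (\<lambda>x. \<Sum>i\<in>S. h i x) = (\<Sum>i\<in>S. q w (h i))"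
 by (induction S rule: finite_induct) (auto simp: q_add_right fin_sum q_zero)

lemma fin_gaussian_at:
 assumes "0 < c" shows "fin (\<lambda>x. exp (- (c * (norm (x - v))^2)))"
 by (rule fin_mono[OF _ fin_scale[OF fin_gaussian] gaussian_dominated]) (use assms in auto)

lemma q_sym_gaussians:
 assumes "0 < c" "0 < c'"
 shows "q (\<lambda>x. exp (- (c * (norm (x - v))^2))) (\<lambda>x. exp (- (c' * (norm (x - v'))^2)))
  = q (\<lambda>x. exp (- (c' * (norm (x - v'))^2))) (\<lambda>x. exp (- (c * (norm (x - v))^2)))"
proof -
 let ?G = "\<lambda>c v x::real^'n. exp (- (c * (norm (x - v))^2))"
 have "q (?G c v) (?G c' v') = kform f (?G c v) (?G c' v')" if "0 < c" "0 < c'" for c c' v v'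
  unfolding q_def by (rule kform_kappa[symmetric]) (auto intro!: integrable_q fin_gaussian_at that)
 then show ?thesis using sym_schwartz[OF gaussian_schwartz gaussian_schwartz, of c c' v v'] assms by simp
qed

text \<open>Symmetry is known for Gaussians, which are Schwartz functions, and passes to limits in one
  argument at a time.\<close>

lemma q_sym:
 assumes u: "fin u" and v: "fin v"
 shows "q u v = q v u"
proof -
 let ?G = "\<lambda>c v x::real^'n. exp (- (c * (norm (x - v))^2))"
 have lim: "q u v = q v u"
  if "fin v" and U: "\<And>n. q (U n) v = q v (U n)" "\<And>n. U n \<in> borel_measurable borel" "u \<in> borel_measurable borel"
   "fin w" "\<And>n x. \<bar>U n x\<bar> \<le> \<bar>w x\<bar>" "AE x in lborel. (\<lambda>n. U n x) \<longlonglongrightarrow> u x"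
  for v u and U :: "nat \<Rightarrow> real^'n \<Rightarrow> real" and w
 proof -
  have "(\<lambda>n. q (U n) v) \<longlonglongrightarrow> q u v"
   by (rule q_limit[where w=w and w'=v]) (use that in \<open>auto simp: cross_finite[unfolded infinity_ennreal_def] intro: fin_borel\<close>)
  moreover have "(\<lambda>n. q v (U n)) \<longlonglongrightarrow> q v u"
   by (rule q_limit[where w=v and w'=w]) (use that in \<open>auto simp: cross_finite[unfolded infinity_ennreal_def] intro: fin_borel\<close>)
  ultimately show ?thesis using LIMSEQ_unique by (simp add: U(1))
 qed
 have 1: "q u (?G c v) = q (?G c v) u" if "fin u" "0 < c" for u c v
  using that(1)
 proof (induction rule: fin_dense_induct)
  case (gaussian c' V a)
  then show ?case using \<open>0 < c\<close>
   by (simp add: q_sum_left q_sum_right fin_scale fin_gaussian_at q_scale_left q_scale_right q_sym_gaussians cong: sum.cong)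
 next
  case (scale r u)
  then show ?case by (simp add: q_scale_left q_scale_right)
 next
  case (limit u U w)
  then show ?case by (rule lim[OF fin_gaussian_at[OF \<open>0 < c\<close>]])
 qed
 show ?thesis using v
 proof (induction rule: fin_dense_induct)
  case (gaussian c' V a)
  have "q u (\<lambda>x. \<Sum>v\<in>V. a v * ?G c' v x) = (\<Sum>v\<in>V. a v * q u (?G c' v))"
   using gaussian u by (simp add: q_sum_right fin_scale fin_gaussian_at q_scale_right)
  moreover have "q (\<lambda>x. \<Sum>v\<in>V. a v * ?G c' v x) u = (\<Sum>v\<in>V. a v * q (?G c' v) u)"
   using gaussian u by (simp add: q_sum_left fin_scale fin_gaussian_at q_scale_left)
  ultimately show ?case using 1[OF u \<open>0 < c'\<close>] by (simp only:)
 next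
  case (scale r u)
  then show ?case by (simp add: q_scale_left q_scale_right)
 next
  case (limit v V w)
  show ?case by (rule lim[OF u limit(1)[symmetric] limit(2-6), symmetric])
 qed
qed

lemma q_Cauchy_Schwarz:
 assumes u: "fin u" and v: "fin v"
 shows "(q u v)^2 \<le> q u u * q v v"
proof -
 have quad: "0 \<le> a^2 * q u u + 2 * a * b * q u v + b^2 * q v v" for a b
 proof -
  have "0 \<le> q (\<lambda>x. a * u x + b * v x) (\<lambda>x. a * u x + b * v x)"
   by (intro q_psd fin_add fin_scale u v)
  then show ?thesis using q_sym[OF u v]
   by (subst (asm) q_bilinear) (auto intro: integrable_q u v)
 qed
 show ?thesis
 proof (cases "q v v = 0")
  case False
  then have pos: "0 < q v v" using q_psd[OF v] by linarith
  have "0 \<le> (q v v)^2 * q u u + 2 * q v v * (- q u v) * q u v + (- q u v)^2 * q v v" by (rule quad)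
  also have "\<dots> = q v v * (q v v * q u u - (q u v)^2)" by (simp add: power2_eq_square algebra_simps)
  finally show ?thesis using pos by (simp add: zero_le_mult_iff mult.commute)
 next
  case True
  have "q u v = 0"
  proof (rule ccontr)
   assume ne: "q u v \<noteq> 0"
   have "0 \<le> 1^2 * q u u + 2 * 1 * (- (q u u + 1) / (2 * q u v)) * q u v + (- (q u u + 1) / (2 * q u v))^2 * q v v" by (rule quad)
   then show False using ne True by (simp add: field_simps)
  qed
  then show ?thesis using True by simp
 qed
qed

lemma q_le_abs_form: "fin u \<Longrightarrow> ennreal (q u u) \<le> abs_form f u"
proof -
 assume u: "fin u"
 have "ennreal (q u u) \<le> ennreal (\<integral>z. \<bar>u (fst z) * u (snd z)\<bar> \<partial>\<kappa>)"
  unfolding q_def by (intro ennreal_leI order_trans[OF abs_ge_self integral_abs_bound])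
 also have "\<dots> = (\<integral>\<^sup>+z. ennreal \<bar>u (fst z) * u (snd z)\<bar> \<partial>\<kappa>)"
  using integrable_q[OF u u] by (intro nn_integral_eq_integral[symmetric]) auto
 also have "\<dots> = abs_form f u" using fin_borel[OF u] by (simp add: abs_form_kappa abs_mult)
 finally show ?thesis .
qed

end

section \<open>Orthonormal bases\<close>

lemma orthonormal_norm_sum:
 fixes e :: "'i \<Rightarrow> 'k::real_inner"
 assumes "finite S" "\<And>i j. i \<in> S \<Longrightarrow> j \<in> S \<Longrightarrow> e i \<bullet> e j = (if i = j then 1 else 0)"
 shows "(norm (\<Sum>j\<in>S. c j *\<^sub>R e j))^2 = (\<Sum>j\<in>S. (c j)^2)"
proof -
 have "(norm (\<Sum>j\<in>S. c j *\<^sub>R e j))^2 = (\<Sum>i\<in>S. \<Sum>j\<in>S. c i * (c j * (e i \<bullet> e j)))"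
  unfolding power2_norm_eq_inner by (simp add: inner_sum_left inner_sum_right sum_distrib_left) (subst sum.swap, simp add: mult_ac)
 also have "\<dots> = (\<Sum>i\<in>S. \<Sum>j\<in>S. if i = j then (c i)^2 else 0)"
  using assms(2) by (intro sum.cong refl) (auto simp: power2_eq_square)
 also have "\<dots> = (\<Sum>j\<in>S. (c j)^2)" using assms(1) by simp
 finally show ?thesis .
qed

text \<open>Finite partial sums are Cauchy by the theorem of Pythagoras.\<close>

lemma orthonormal_summable:
 fixes e :: "nat \<Rightarrow> 'k::{real_inner, complete_space}"
 assumes orth: "\<And>i j. i \<in> I \<Longrightarrow> j \<in> I \<Longrightarrow> e i \<bullet> e j = (if i = j then 1 else 0)"
  and sq: "(\<lambda>j. (c j)^2) summable_on I"
 shows "(\<lambda>j. c j *\<^sub>R e j) summable_on I"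
proof -
 let ?f = "\<lambda>j. c j *\<^sub>R e j"
 obtain L where L: "((\<lambda>j. (c j)^2) has_sum L) I" using sq unfolding summable_on_def by blast
 have "\<exists>P. eventually P (finite_subsets_at_top I) \<and> (\<forall>F F'. P F \<and> P F' \<longrightarrow> dist (sum ?f F) (sum ?f F') < \<epsilon>)" if "0 < \<epsilon>" for \<epsilon>
 proof -
  have "\<forall>\<^sub>F F in finite_subsets_at_top I. dist (\<Sum>j\<in>F. (c j)^2) L < (\<epsilon> / 2)^2 / 2"
   using L that unfolding has_sum_def by (intro tendstoD) auto
  from this[unfolded eventually_finite_subsets_at_top] obtain F0 where F0: "finite F0" "F0 \<subseteq> I"
   and F0': "\<forall>F. finite F \<and> F0 \<subseteq> F \<and> F \<subseteq> I \<longrightarrow> dist (\<Sum>j\<in>F. (c j)^2) L < (\<epsilon> / 2)^2 / 2"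
   by (elim exE conjE)
  have F0'': "dist (\<Sum>j\<in>F. (c j)^2) L < (\<epsilon> / 2)^2 / 2" if "finite F" "F0 \<subseteq> F" "F \<subseteq> I" for F
   using F0' that by simp
  define P where "P F \<longleftrightarrow> finite F \<and> F0 \<subseteq> F \<and> F \<subseteq> I" for F
  have close: "dist (sum ?f F) (sum ?f F0) < \<epsilon> / 2" if "P F" for F
  proof -
   have F: "finite F" "F0 \<subseteq> F" "F \<subseteq> I" using that by (auto simp: P_def)
   have "(dist (sum ?f F) (sum ?f F0))^2 = (norm (sum ?f (F - F0)))^2"
    using F by (simp add: dist_norm sum_diff)
   also have "\<dots> = (\<Sum>j\<in>F - F0. (c j)^2)"
    using F by (intro orthonormal_norm_sum orth) auto
   also have "\<dots> = (\<Sum>j\<in>F. (c j)^2) - (\<Sum>j\<in>F0. (c j)^2)" using F by (simp add: sum_diff)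
   also have "\<dots> < (\<epsilon> / 2)^2"
    using F0''[OF F] F0''[OF F0(1) order_refl F0(2)] unfolding dist_real_def by linarith
   finally show ?thesis using \<open>0 < \<epsilon>\<close> by (intro power2_less_imp_less[of _ "\<epsilon> / 2"]) auto
  qed
  have "eventually P (finite_subsets_at_top I)"
   unfolding eventually_finite_subsets_at_top P_def using F0 by blast
  moreover have "dist (sum ?f F) (sum ?f F') < \<epsilon>" if "P F" "P F'" for F F'
   using close[OF that(1)] close[OF that(2)] by (rule dist_triangle_half_r[of "sum ?f F0", unfolded dist_commute[of "sum ?f F0"]])
  ultimately show ?thesis by blast
 qed
 then have "cauchy_filter (filtermap (sum ?f) (finite_subsets_at_top I))"
  by (simp add: cauchy_filter_metric_filtermap)
 moreover have "Topological_Spaces.complete (UNIV :: 'k set)"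
  by (meson Cauchy_convergent UNIV_I complete_def convergent_def)
 ultimately obtain L' where "(sum ?f \<longlongrightarrow> L') (finite_subsets_at_top I)"
  using complete_uniform[where S=UNIV] by (force simp add: filterlim_def)
 then show ?thesis using summable_on_def has_sum_def by blast
qed

locale orthonormal_basis =
 fixes I :: "nat set" and e :: "nat \<Rightarrow> 'k::{real_inner, complete_space}"
 assumes basis: "complete_orthonormal_basis I e"
begin

lemma orth: "i \<in> I \<Longrightarrow> j \<in> I \<Longrightarrow> e i \<bullet> e j = (if i = j then 1 else 0)"
 using basis by (auto simp: complete_orthonormal_basis_def)

lemma norm_e [simp]: "i \<in> I \<Longrightarrow> norm (e i) = 1"
 using orth[of i i] by (simp add: norm_eq_sqrt_inner)

lemma coordinate_of_sum:
 assumes "((\<lambda>j. c j *\<^sub>R e j) has_sum k) I" "i \<in> I"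
 shows "k \<bullet> e i = c i"
proof -
 have "((\<lambda>j. (c j *\<^sub>R e j) \<bullet> e i) has_sum (k \<bullet> e i)) I"
  using has_sum_bounded_linear[OF bounded_linear_inner_left assms(1)] .
 moreover have "((\<lambda>j. (c j *\<^sub>R e j) \<bullet> e i) has_sum (c i)) I"
 proof -
  have "((\<lambda>j. (c j *\<^sub>R e j) \<bullet> e i) has_sum (c i)) {i}"
   using has_sum_finite[of "{i}" "\<lambda>j. (c j *\<^sub>R e j) \<bullet> e i"] orth[OF assms(2,2)] by simp
  then show ?thesis
   by (rule has_sum_cong_neutral[THEN iffD1, rotated -1]) (use assms(2) orth in auto)
 qed
 ultimately show ?thesis by (rule has_sum_unique)
qed

definition proj :: "nat \<Rightarrow> 'k \<Rightarrow> 'k" where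
 "proj N k = (\<Sum>j\<in>I \<inter> {..<N}. (k \<bullet> e j) *\<^sub>R e j)"

lemma proj_inner: "i \<in> I \<Longrightarrow> proj N k \<bullet> e i = (if i < N then k \<bullet> e i else 0)"
 unfolding proj_def inner_sum_left using orth
 by (subst sum.cong[OF refl, where h="\<lambda>j. if j = i then k \<bullet> e i else 0"]) auto

lemma proj_orth: "(k - proj N k) \<bullet> proj N l = 0"
proof -
 have "(k - proj N k) \<bullet> e j = 0" if "j \<in> I \<inter> {..<N}" for j
  using that by (simp add: inner_diff_left proj_inner)
 then show ?thesis unfolding proj_def[of N l] inner_sum_right by simp
qed

lemma norm_proj: "(norm k)^2 = (norm (proj N k))^2 + (norm (k - proj N k))^2"
proof -
 have "(norm (d + p))^2 = (norm d)^2 + (norm p)^2" if "d \<bullet> p = 0" for d p :: 'k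
  using that by (simp add: power2_norm_eq_inner inner_add_left inner_add_right inner_commute)
 from this[OF proj_orth[of k N k]] show ?thesis by simp
qed

lemma norm_proj_sum: "(norm (proj N k))^2 = (\<Sum>j\<in>I \<inter> {..<N}. (k \<bullet> e j)^2)"
 unfolding proj_def by (rule orthonormal_norm_sum) (auto simp: orth)

lemma norm_minus_proj_le: "norm (k - proj N k) \<le> norm k"
 by (rule power2_le_imp_le) (use norm_proj[of k N] in auto)

lemma Bessel: "finite S \<Longrightarrow> S \<subseteq> I \<Longrightarrow> (\<Sum>j\<in>S. (k \<bullet> e j)^2) \<le> (norm k)^2"
proof -
 assume S: "finite S" "S \<subseteq> I"
 obtain N where "S \<subseteq> {..<N}" using finite_nat_iff_bounded[THEN iffD1, OF S(1)] by (elim exE)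
 then have N: "S \<subseteq> I \<inter> {..<N}" using S(2) by simp
 have "(\<Sum>j\<in>S. (k \<bullet> e j)^2) \<le> (\<Sum>j\<in>I \<inter> {..<N}. (k \<bullet> e j)^2)"
  using N by (intro sum_mono2) auto
 also have "\<dots> = (norm (proj N k))^2" by (rule norm_proj_sum[symmetric])
 also have "\<dots> \<le> (norm k)^2" using norm_proj[of k N] by simp
 finally show ?thesis .
qed

lemma coordinates_square_summable: "(\<lambda>j. (k \<bullet> e j)^2) summable_on I"
 by (rule nonneg_bdd_above_summable_on) (auto simp: bdd_above_def intro!: exI[of _ "(norm k)^2"] Bessel)

lemma proj_tendsto: "(\<lambda>N. proj N k) \<longlonglongrightarrow> k"
proof (rule LIMSEQ_I)
 fix r :: real assume r: "0 < r"
 have "k \<in> closure (span (e ` I))" using basis by (auto simp: complete_orthonormal_basis_def)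
 then obtain l where l: "l \<in> span (e ` I)" "dist l k < r" using r unfolding closure_approachable by blast
 obtain t c where t: "finite t" "t \<subseteq> e ` I" "l = (\<Sum>a\<in>t. c a *\<^sub>R a)"
  using l(1) unfolding span_explicit by blast
 obtain S where S: "S \<subseteq> I" "finite S" "t = e ` S" using finite_subset_image[OF t(1,2)] by blast
 obtain N0 where N0: "S \<subseteq> {..<N0}" using finite_nat_iff_bounded[THEN iffD1, OF S(2)] by (elim exE)
 have "norm (proj N k - k) < r" if N: "N \<ge> N0" for N
 proof -
  have pe: "proj N (e j) = e j" if "j \<in> S" for j
  proof -
   have j: "j \<in> I" "j < N" using that S N0 N by auto
   have "proj N (e j) = (\<Sum>i\<in>I \<inter> {..<N}. if i = j then e j else 0)"
    unfolding proj_def using orth j by (intro sum.cong refl) auto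
   then show ?thesis using j by simp
  qed
  have lin: "linear (proj N)" unfolding proj_def
   by (intro linear_compose_sum ballI linearI) (auto simp: inner_add_left scaleR_add_left)
  have "proj N l = l" unfolding t(3) S(3)
   by (subst linear_sum[OF lin]) (auto simp: linear_scale[OF lin] pe intro!: sum.cong)
  then have "proj N k - k = - ((k - l) - proj N (k - l))" by (simp add: linear_diff[OF lin])
  then have "norm (proj N k - k) = norm ((k - l) - proj N (k - l))" by (metis norm_minus_cancel)
  also have "\<dots> \<le> norm (k - l)" by (rule norm_minus_proj_le)
  also have "\<dots> < r" using l(2) by (simp add: dist_norm norm_minus_commute)
  finally show ?thesis .
 qed
 then show "\<exists>no. \<forall>n\<ge>no. norm (proj n k - k) < r" by blast
qed

lemma coordinates_eq_imp_eq:
 assumes "\<And>i. i \<in> I \<Longrightarrow> k \<bullet> e i = l \<bullet> e i"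
 shows "k = l"
proof -
 have "proj N k = proj N l" for N using assms by (simp add: proj_def)
 then show ?thesis using proj_tendsto[of k] proj_tendsto[of l] LIMSEQ_unique by simp
qed

lemma Riesz_Fischer:
 assumes "\<And>S. finite S \<Longrightarrow> S \<subseteq> I \<Longrightarrow> (\<Sum>j\<in>S. (c j)^2) \<le> C"
 obtains k where "\<And>i. i \<in> I \<Longrightarrow> k \<bullet> e i = c i" "(norm k)^2 \<le> C"
proof -
 have "(\<lambda>j. (c j)^2) summable_on I"
  by (rule nonneg_bdd_above_summable_on) (use assms in \<open>auto simp: bdd_above_def\<close>)
 from orthonormal_summable[OF orth this] obtain k where k: "((\<lambda>j. c j *\<^sub>R e j) has_sum k) I"
  unfolding summable_on_def by blast
 have ki: "k \<bullet> e i = c i" if "i \<in> I" for i using coordinate_of_sum[OF k that] .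
 have "(\<lambda>N. (norm (proj N k))^2) \<longlonglongrightarrow> (norm k)^2" by (intro tendsto_intros proj_tendsto)
 moreover have "(norm (proj N k))^2 \<le> C" for N
  using assms[of "I \<inter> {..<N}"] ki by (simp add: norm_proj_sum)
 ultimately have "(norm k)^2 \<le> C" by (intro LIMSEQ_le_const2) auto
 with ki show ?thesis using that by blast
qed

end

context pd_kernel
begin

lemma sigma_finite_kappa: "sigma_finite_measure \<kappa>"
proof -
 have "sigma_finite_measure (lborel \<Otimes>\<^sub>M lborel :: ((real^'n) \<times> (real^'n)) measure)"
  unfolding lborel_prod by (rule sigma_finite_lborel)
 from sigma_finite_measure.sigma_finite_iff_density_finite[OF this, of "\<lambda>z. ennreal (f (fst z - snd z))"]
 show ?thesis unfolding \<kappa>_def by simp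
qed

section \<open>Schwartz functions have finite absolute form\<close>

text \<open>The kernel depends on the difference only.\<close>

lemma cross_translate:
 assumes [measurable]: "u \<in> borel_measurable borel"
 shows "cross (\<lambda>x. u (x - a)) (\<lambda>x. u (x - a)) = cross u u"
proof -
 have "cross (\<lambda>x. u (x - a)) (\<lambda>x. u (x - a)) = (\<integral>\<^sup>+x. (\<integral>\<^sup>+y. ennreal (f ((x - a) - (y - a))) * ennreal (\<bar>u (x - a)\<bar> * \<bar>u (y - a)\<bar>) \<partial>lborel) \<partial>lborel)"
  unfolding cross_def by (subst nn_integral_kappa) auto
 also have "\<dots> = (\<integral>\<^sup>+x. (\<integral>\<^sup>+y. ennreal (f ((x - a) - y)) * ennreal (\<bar>u (x - a)\<bar> * \<bar>u y\<bar>) \<partial>lborel) \<partial>lborel)"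
  by (intro nn_integral_cong nn_integral_lborel_shift[where g="\<lambda>y. ennreal (f ((_ - a) - y)) * ennreal (\<bar>u (_ - a)\<bar> * \<bar>u y\<bar>)"]) measurable
 also have "\<dots> = (\<integral>\<^sup>+x. (\<integral>\<^sup>+y. ennreal (f (x - y)) * ennreal (\<bar>u x\<bar> * \<bar>u y\<bar>) \<partial>lborel) \<partial>lborel)"
  by (rule nn_integral_lborel_shift[where g="\<lambda>x. (\<integral>\<^sup>+y. ennreal (f (x - y)) * ennreal (\<bar>u x\<bar> * \<bar>u y\<bar>) \<partial>lborel)"]) measurable
 also have "\<dots> = cross u u"
  unfolding cross_def by (subst nn_integral_kappa) auto
 finally show ?thesis .
qed

text \<open>A polynomially decaying function is a superposition of translates of the indicator of a ball; the
  mixed form of any two translates is bounded by the form of one ball.\<close>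

lemma fin_polynomial_decay: "fin (\<lambda>x. 1 / (1 + norm x) ^ (2 * CARD('n)))"
proof -
 let ?m = "2 * CARD('n)"
 define w where "w x = 1 / (1 + norm x) ^ ?m" for x :: "real^'n"
 have w0: "0 \<le> w x" for x by (simp add: w_def)
 have [measurable]: "w \<in> borel_measurable borel" unfolding w_def by measurable
 define b where "b a x = (indicator (cball 0 1) (x - a) :: real)" for a x :: "real^'n"
 have bdef: "b a x = (if norm (x - a) \<le> 1 then 1 else 0)" for a x by (simp add: b_def indicator_def)
 have [measurable]: "(\<lambda>z. b (h z) (g z)) \<in> borel_measurable M"
  if [measurable]: "h \<in> borel_measurable M" "g \<in> borel_measurable M" for h g and M :: "'z measure"
  unfolding bdef by measurable
 define v where "v = emeasure lborel (cball (0::real^'n) 1)"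
 have v: "0 < v" "v < \<infinity>"
 proof -
  show "v < \<infinity>" unfolding v_def by (rule emeasure_bounded_finite) simp
  have "\<not> negligible (cball (0::real^'n) 1)" by (simp add: negligible_convex_interior)
  then show "0 < v" unfolding v_def
   by (auto simp: negligible_iff_emeasure0 less_le emeasure_completion)
 qed
 have int_b: "(\<integral>\<^sup>+a. ennreal (b a x) \<partial>lborel) = v" for x
 proof -
  have "(\<integral>\<^sup>+a. ennreal (b a x) \<partial>lborel) = (\<integral>\<^sup>+a. indicator (cball 0 1) (a - x) \<partial>lborel)"
   by (intro nn_integral_cong) (simp add: bdef indicator_def norm_minus_commute)
  also have "\<dots> = (\<integral>\<^sup>+(a::real^'n). indicator (cball 0 1) a \<partial>lborel)"
   by (rule nn_integral_lborel_shift[of "indicator (cball 0 1)" x])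
     (intro borel_measurable_indicator borel_closed closed_cball)
  finally show ?thesis by (simp add: v_def)
 qed
 define K :: real where "K = 2 ^ ?m"
 have smear: "w x * b a x \<le> K * (w a * b a x)" for x a
 proof (cases "norm (x - a) \<le> 1")
  case True
  have "norm (a - x) \<le> 1" using True by (simp add: norm_minus_commute)
  then have "norm a \<le> 1 + norm x"
   using norm_triangle_ineq2[of a x] by simp
  also have "\<dots> \<le> 1 + 2 * norm x" by (rule add_left_mono) simp
  finally have "1 + norm a \<le> 2 * (1 + norm x)" by simp
  then have "(1 + norm a) ^ ?m \<le> (2 * (1 + norm x)) ^ ?m" by (intro power_mono) auto
  also have "\<dots> = K * (1 + norm x) ^ ?m" by (simp only: K_def power_mult_distrib)
  finally have "(1 + norm a) ^ ?m \<le> K * (1 + norm x) ^ ?m" .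
  moreover have "0 < (1 + norm x) ^ ?m" "0 < (1 + norm a) ^ ?m" by (auto intro!: zero_less_power add_pos_nonneg)
  ultimately show ?thesis using True by (simp add: bdef w_def field_simps)
 qed (simp add: bdef)
 have K0: "0 \<le> K" by (simp add: K_def)
 have w_le: "ennreal (w x) * v \<le> ennreal K * (\<integral>\<^sup>+a. ennreal (w a * b a x) \<partial>lborel)" for x
 proof -
  have "ennreal (w x) * v = (\<integral>\<^sup>+a. ennreal (w x) * ennreal (b a x) \<partial>lborel)"
   by (subst nn_integral_cmult) (auto simp: int_b)
  also have "\<dots> \<le> (\<integral>\<^sup>+a. ennreal K * ennreal (w a * b a x) \<partial>lborel)"
   using smear w0 K0 by (intro nn_integral_mono) (auto simp: ennreal_mult'[symmetric] bdef intro!: ennreal_leI)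
  finally show ?thesis by (subst (asm) nn_integral_cmult) auto
 qed
 interpret kap: sigma_finite_measure \<kappa> by (rule sigma_finite_kappa)
 interpret pk: pair_sigma_finite \<kappa> "lborel :: (real^'n) measure" by standard
 have b_fin: "fin (b a)" for a
  by (rule fin_bounded[where C=1 and R="1 + norm a"])
    (auto simp: bdef, metis add.commute add_le_cancel_right diff_add_cancel dual_order.trans norm_triangle_ineq not_le)
 define M where "M = cross (b 0) (b 0)"
 have M: "M < \<infinity>" using b_fin[of 0] by (simp add: M_def fin_def cross_self)
 have cross_b: "cross (b a) (b c) \<le> 2 * M" for a c
 proof -
  have self: "cross (b a) (b a) = M" for a
  proof -
   have "b a = (\<lambda>x. b 0 (x - a))" by (simp add: b_def fun_eq_iff)
   then show ?thesis using cross_translate[OF fin_borel[OF b_fin[of 0]], of a] by (simp only: M_def)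
  qed
  have "cross (b a) (b c) \<le> cross (b a) (b c) + cross (b c) (b a)" by simp
  also have "\<dots> \<le> cross (b a) (b a) + cross (b c) (b c)" by (rule cross_le[OF b_fin b_fin])
  also have "\<dots> = 2 * M" by (simp add: self mult_2)
  finally show ?thesis .
 qed
 define W where "W = (\<integral>\<^sup>+a. ennreal (w a) \<partial>lborel)"
 have W: "W < \<infinity>" unfolding W_def w_def using nn_integral_polynomial_decay_finite[where ?'v="real^'n"] by simp
 have "v * v * cross w w = (\<integral>\<^sup>+z. (ennreal (w (fst z)) * v) * (ennreal (w (snd z)) * v) \<partial>\<kappa>)"
  unfolding cross_def using w0
  by (subst nn_integral_cmult[symmetric]) (auto simp: ennreal_mult mult_ac intro!: nn_integral_cong)
 also have "\<dots> \<le> (\<integral>\<^sup>+z. (ennreal K * (\<integral>\<^sup>+a. ennreal (w a * b a (fst z)) \<partial>lborel)) * (ennreal K * (\<integral>\<^sup>+c. ennreal (w c * b c (snd z)) \<partial>lborel)) \<partial>\<kappa>)"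
  by (intro nn_integral_mono mult_mono w_le) auto
 also have "\<dots> = (\<integral>\<^sup>+z. (\<integral>\<^sup>+a. (\<integral>\<^sup>+c. ennreal (K * K) * (ennreal (w a * b a (fst z)) * ennreal (w c * b c (snd z))) \<partial>lborel) \<partial>lborel) \<partial>\<kappa>)"
  by (intro nn_integral_cong) (simp add: nn_integral_cmult nn_integral_multc ennreal_mult K0 mult_ac)
 also have "\<dots> = (\<integral>\<^sup>+a. (\<integral>\<^sup>+z. (\<integral>\<^sup>+c. ennreal (K * K) * (ennreal (w a * b a (fst z)) * ennreal (w c * b c (snd z))) \<partial>lborel) \<partial>\<kappa>) \<partial>lborel)"
  by (rule pk.Fubini'[symmetric]) measurable
 also have "\<dots> = (\<integral>\<^sup>+a. (\<integral>\<^sup>+c. (\<integral>\<^sup>+z. ennreal (K * K) * (ennreal (w a * b a (fst z)) * ennreal (w c * b c (snd z))) \<partial>\<kappa>) \<partial>lborel) \<partial>lborel)"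
  by (intro nn_integral_cong pk.Fubini'[symmetric]) measurable
 also have "\<dots> = (\<integral>\<^sup>+a. (\<integral>\<^sup>+c. (ennreal (K * K) * ennreal (w a) * ennreal (w c)) * cross (b a) (b c) \<partial>lborel) \<partial>lborel)"
 proof (intro nn_integral_cong)
  fix a c
  have "(\<integral>\<^sup>+z. ennreal (K * K) * (ennreal (w a * b a (fst z)) * ennreal (w c * b c (snd z))) \<partial>\<kappa>) =
    (\<integral>\<^sup>+z. (ennreal (K * K) * ennreal (w a) * ennreal (w c)) * ennreal (\<bar>b a (fst z)\<bar> * \<bar>b c (snd z)\<bar>) \<partial>\<kappa>)"
   using w0 by (intro nn_integral_cong) (simp add: ennreal_mult bdef mult_ac)
  then show "(\<integral>\<^sup>+z. ennreal (K * K) * (ennreal (w a * b a (fst z)) * ennreal (w c * b c (snd z))) \<partial>\<kappa>) =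
    (ennreal (K * K) * ennreal (w a) * ennreal (w c)) * cross (b a) (b c)"
   unfolding cross_def by (simp add: nn_integral_cmult)
 qed
 also have "\<dots> \<le> (\<integral>\<^sup>+a. (\<integral>\<^sup>+c. (ennreal (K * K) * ennreal (w a) * ennreal (w c)) * (2 * M) \<partial>lborel) \<partial>lborel)"
  by (intro nn_integral_mono mult_left_mono cross_b) auto
 also have "\<dots> = ennreal (K * K) * W * W * (2 * M)"
  unfolding W_def by (simp add: nn_integral_cmult nn_integral_multc mult_ac)
 also have "\<dots> < \<infinity>" using W M by (simp add: ennreal_mult_less_top)
 finally have "cross w w < \<infinity>" using v by (auto simp: ennreal_mult_less_top)
 then show ?thesis by (simp add: fin_def cross_self[symmetric] w_def[abs_def])
qed

lemma fin_schwartz: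
 assumes "\<psi> \<in> schwartz"
 shows "fin \<psi>"
proof -
 obtain C where C: "0 \<le> C" "\<And>x. \<bar>\<psi> x\<bar> \<le> C / (1 + norm x) ^ (2 * CARD('n))"
  using schwartz_decay[OF assms] by blast
 show ?thesis
 proof (rule fin_mono[OF schwartz_borel[OF assms] fin_scale[OF fin_polynomial_decay, of C]])
  show "\<bar>\<psi> x\<bar> \<le> \<bar>C * (1 / (1 + norm x) ^ (2 * CARD('n)))\<bar>" for x
   using C(2)[of x] C(1) by simp
 qed
qed

lemma kform_q: "fin u \<Longrightarrow> fin v \<Longrightarrow> kform f u v = q u v"
 unfolding q_def by (rule kform_kappa) (auto intro: integrable_q)

end

section \<open>Functions as elements of K\<close>

text \<open>The function \<open>fj j\<close> represents the basis vector \<open>e j\<close>; coordinates of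
  elements of \<open>K\<close> are values of the form at these functions.\<close>

locale K_space = orthonormal_basis I e
 for I :: "nat set" and e :: "nat \<Rightarrow> 'k::{real_inner, complete_space}" +
 fixes f :: "real ^ 'n \<Rightarrow> real" and \<iota> :: "(real ^ 'n \<Rightarrow> real) \<Rightarrow> 'k" and fj :: "nat \<Rightarrow> real ^ 'n \<Rightarrow> real"
 assumes kernel: "covariance_kernel f"
  and completion: "schwartz_completion f \<iota>"
  and fj_schwartz: "\<And>j. j \<in> I \<Longrightarrow> fj j \<in> schwartz"
  and e_eq: "\<And>j. j \<in> I \<Longrightarrow> e j = \<iota> (fj j)"
begin

text \<open>The value of \<open>f\<close> at the origin is arbitrary and may be negative; changing it to 0
  alters no integral.\<close>

definition f0 :: "real ^ 'n \<Rightarrow> real" where "f0 z = (if z = 0 then 0 else f z)"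

lemma borel_f0 [measurable]: "f0 \<in> borel_measurable borel"
proof -
 have "continuous_on (- {0}) f" using kernel by (simp add: covariance_kernel_def)
 then have "(\<lambda>x. indicator (- {0}) x *\<^sub>R f x) \<in> borel_measurable borel"
  by (intro borel_measurable_continuous_on_indicator) auto
 moreover have "(\<lambda>x. indicator (- {0}) x *\<^sub>R f x) = f0"
  by (auto simp: f0_def fun_eq_iff)
 ultimately show ?thesis by simp
qed

lemma borel_f [measurable]: "f \<in> borel_measurable borel"
proof -
 have "(\<lambda>x. f0 x + f 0 * indicator {0} x) \<in> borel_measurable borel" by measurable
 moreover have "(\<lambda>x. f0 x + f 0 * indicator {0} x) = f"
  by (auto simp: f0_def fun_eq_iff)
 ultimately show ?thesis by simp
qed

lemma AE_f0: "AE y in lborel. f (x - y) = f0 (x - y)"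
 using AE_lborel_singleton[of x] by eventually_elim (auto simp: f0_def)

lemma abs_form_f0: "abs_form f h = abs_form f0 h"
 unfolding abs_form_def
proof (rule nn_integral_cong, rule nn_integral_cong_AE)
 show "AE y in lborel. ennreal (\<bar>h x\<bar> * f (x - y) * \<bar>h y\<bar>) = ennreal (\<bar>h x\<bar> * f0 (x - y) * \<bar>h y\<bar>)" for x
  using AE_f0[of x] by eventually_elim simp
qed

lemma kform_f0:
 assumes [measurable]: "u \<in> borel_measurable borel" "v \<in> borel_measurable borel"
 shows "kform f u v = kform f0 u v"
 unfolding kform_def
proof (rule integral_eqI, rule integral_cong_AE)
 show "AE y in lborel. u x * f (x - y) * v y = u x * f0 (x - y) * v y" for x
  using AE_f0[of x] by eventually_elim simp
qed measurable

lemma inner_iota: "\<gamma> \<in> schwartz \<Longrightarrow> \<psi> \<in> schwartz \<Longrightarrow> \<iota> \<gamma> \<bullet> \<iota> \<psi> = kform f \<gamma> \<psi>"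
 using completion by (auto simp: schwartz_completion_def)

sublocale ker: pd_kernel f0
proof
 show "f0 \<in> borel_measurable borel" by measurable
 show "0 \<le> f0 x" for x using kernel by (auto simp: covariance_kernel_def f0_def)
 show "integrable lborel (\<lambda>x. f0 x * \<gamma> x)" if g: "\<gamma> \<in> schwartz" for \<gamma>
 proof -
  have [measurable]: "\<gamma> \<in> borel_measurable borel" by (rule schwartz_borel[OF g])
  have "integrable lborel (\<lambda>x. f x * \<gamma> x)" using kernel g by (auto simp: covariance_kernel_def)
  then show ?thesis
  proof (rule integrable_cong_AE_imp)
   show "AE x in lborel. f x * \<gamma> x = f0 x * \<gamma> x"
    using AE_lborel_singleton[of 0] by eventually_elim (auto simp: f0_def)
  qed measurable
 qed
 have k: "kform f0 \<gamma> \<psi> = \<iota> \<gamma> \<bullet> \<iota> \<psi>" if "\<gamma> \<in> schwartz" "\<psi> \<in> schwartz" for \<gamma> \<psi>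
  using inner_iota[OF that] kform_f0[OF schwartz_borel schwartz_borel, OF that] by simp
 show "kform f0 \<gamma> \<psi> = kform f0 \<psi> \<gamma>" if "\<gamma> \<in> schwartz" "\<psi> \<in> schwartz" for \<gamma> \<psi>
  using k that by (simp add: inner_commute)
 show "0 \<le> (\<Sum>\<gamma>\<in>S. \<Sum>\<psi>\<in>S. a \<gamma> * a \<psi> * kform f0 \<gamma> \<psi>)"
  if "finite S" "S \<subseteq> schwartz" for S and a :: "(real ^ 'n \<Rightarrow> real) \<Rightarrow> real"
 proof -
  have "(\<Sum>\<gamma>\<in>S. \<Sum>\<psi>\<in>S. a \<gamma> * a \<psi> * kform f0 \<gamma> \<psi>) = (\<Sum>\<gamma>\<in>S. a \<gamma> *\<^sub>R \<iota> \<gamma>) \<bullet> (\<Sum>\<psi>\<in>S. a \<psi> *\<^sub>R \<iota> \<psi>)"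
   unfolding inner_sum_left inner_sum_right using that k
   by (intro sum.cong refl) (auto simp: subset_iff inner_commute)
  then show ?thesis by simp
 qed
qed

lemma fin_iff: "ker.fin h \<longleftrightarrow> h \<in> borel_measurable borel \<and> abs_form f h < \<infinity>"
 by (simp add: ker.fin_def abs_form_f0)

lemma kform_q: "ker.fin u \<Longrightarrow> ker.fin v \<Longrightarrow> kform f u v = ker.q u v"
 by (simp add: kform_f0 ker.fin_borel ker.kform_q)

lemma q_schwartz: "\<gamma> \<in> schwartz \<Longrightarrow> \<psi> \<in> schwartz \<Longrightarrow> ker.q \<gamma> \<psi> = \<iota> \<gamma> \<bullet> \<iota> \<psi>"
 by (simp add: inner_iota kform_q ker.fin_schwartz)

lemma fin_fj: "j \<in> I \<Longrightarrow> ker.fin (fj j)"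
 by (intro ker.fin_schwartz fj_schwartz)

lemma q_fj: "i \<in> I \<Longrightarrow> j \<in> I \<Longrightarrow> ker.q (fj i) (fj j) = (if i = j then 1 else 0)"
 using orth[of i j] by (simp add: q_schwartz fj_schwartz e_eq)

lemma q_fj_sum:
 assumes "finite S" "S \<subseteq> I"
 shows "ker.q (\<lambda>x. \<Sum>j\<in>S. c j * fj j x) (\<lambda>x. \<Sum>j\<in>S. c j * fj j x) = (\<Sum>j\<in>S. (c j)^2)"
proof -
 have fin: "ker.fin (\<lambda>x. c j * fj j x)" if "j \<in> S" for j
  using that assms by (intro ker.fin_scale fin_fj) auto
 have "ker.q (\<lambda>x. \<Sum>j\<in>S. c j * fj j x) (\<lambda>x. \<Sum>j\<in>S. c j * fj j x)
   = (\<Sum>i\<in>S. \<Sum>j\<in>S. ker.q (\<lambda>x. c i * fj i x) (\<lambda>x. c j * fj j x))"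
  using assms(1) fin by (simp add: ker.q_sum_left ker.q_sum_right ker.fin_sum)
 also have "\<dots> = (\<Sum>i\<in>S. \<Sum>j\<in>S. if i = j then (c i)^2 else 0)"
  using assms(2) by (intro sum.cong refl) (auto simp: ker.q_scale_left ker.q_scale_right q_fj power2_eq_square subset_iff)
 also have "\<dots> = (\<Sum>j\<in>S. (c j)^2)" using assms(1) by simp
 finally show ?thesis .
qed

text \<open>The candidate has the coordinates \<open>q h (fj j)\<close>. The inequality of Cauchy and Schwarz
  for the form bounds their squares by \<open>q h h\<close>, and approximates \<open>q h \<psi>\<close> by
  finite expansions of \<open>\<psi>\<close>.\<close>

lemma K_representation:
 assumes h: "ker.fin h"
 obtains k where "\<And>\<psi>. \<psi> \<in> schwartz \<Longrightarrow> k \<bullet> \<iota> \<psi> = kform f h \<psi>" "ennreal ((norm k)^2) \<le> abs_form f h"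
proof -
 define c where "c j = ker.q h (fj j)" for j
 have fin: "ker.fin (\<lambda>x. a j * fj j x)" if "j \<in> I" for a j
  using that by (intro ker.fin_scale fin_fj)
 have qh: "ker.q h (\<lambda>x. \<Sum>j\<in>S. a j * fj j x) = (\<Sum>j\<in>S. a j * c j)" if "finite S" "S \<subseteq> I" for S a
  using that h fin by (subst ker.q_sum_right) (auto simp: ker.q_scale_right c_def subset_iff)
 have "(\<Sum>j\<in>S. (c j)^2) \<le> ker.q h h" if S: "finite S" "S \<subseteq> I" for S
 proof -
  let ?u = "\<lambda>x. \<Sum>j\<in>S. c j * fj j x" and ?s = "\<Sum>j\<in>S. (c j)^2"
  have "ker.fin ?u" using S fin by (intro ker.fin_sum) auto
  from ker.q_Cauchy_Schwarz[OF h this] have "?s^2 \<le> ker.q h h * ?s"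
   using qh[OF S, of c] q_fj_sum[OF S, of c] by (simp add: power2_eq_square)
  then have "?s * (ker.q h h - ?s) \<ge> 0" by (simp add: power2_eq_square algebra_simps)
  moreover have "0 \<le> ?s" by (intro sum_nonneg) auto
  ultimately show ?thesis using ker.q_psd[OF h] by (cases "?s = 0") (auto simp: zero_le_mult_iff)
 qed
 from Riesz_Fischer[OF this] obtain k where k: "\<And>i. i \<in> I \<Longrightarrow> k \<bullet> e i = c i" "(norm k)^2 \<le> ker.q h h" by blast
 have "ennreal ((norm k)^2) \<le> abs_form f h"
  using ennreal_leI[OF k(2)] ker.q_le_abs_form[OF h] unfolding abs_form_f0 by (rule order_trans)
 moreover have "k \<bullet> \<iota> \<psi> = kform f h \<psi>" if psi: "\<psi> \<in> schwartz" for \<psi>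
 proof -
  define d where "d j = \<iota> \<psi> \<bullet> e j" for j
  define u where "u N x = (\<Sum>j\<in>I \<inter> {..<N}. d j * fj j x)" for N :: nat and x
  have fin_psi: "ker.fin \<psi>" by (rule ker.fin_schwartz[OF psi])
  have fin_u: "ker.fin (u N)" for N unfolding u_def using fin by (intro ker.fin_sum) auto
  have q_hu: "ker.q h (u N) = k \<bullet> proj N (\<iota> \<psi>)" for N
   using qh[of "I \<inter> {..<N}" d] k(1) unfolding u_def proj_def inner_sum_right d_def by simp
  have q_pu: "ker.q \<psi> (u N) = (\<Sum>j\<in>I \<inter> {..<N}. (d j)^2)" for N
   unfolding u_def using fin fin_psi
   by (subst ker.q_sum_right) (auto simp: ker.q_scale_right q_schwartz psi fj_schwartz e_eq d_def power2_eq_square intro!: sum.cong)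
  have q_uu: "ker.q (u N) (u N) = (\<Sum>j\<in>I \<inter> {..<N}. (d j)^2)" for N
   unfolding u_def by (rule q_fj_sum) auto
  define r where "r N x = 1 * \<psi> x + (-1) * u N x" for N x
  have fin_r: "ker.fin (r N)" for N
   unfolding r_def using fin_psi fin_u by (intro ker.fin_add ker.fin_scale)
  have "ker.q (r N) (r N) = (norm (\<iota> \<psi>))^2 - (\<Sum>j\<in>I \<inter> {..<N}. (d j)^2)" for N
   unfolding r_def
   by (subst ker.q_bilinear)
     (auto intro: ker.integrable_q fin_psi fin_u simp: q_pu q_uu ker.q_sym[OF fin_u fin_psi] q_schwartz psi power2_norm_eq_inner)
  then have q_rr: "ker.q (r N) (r N) = (norm (\<iota> \<psi> - proj N (\<iota> \<psi>)))^2" for N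
   using norm_proj[of "\<iota> \<psi>" N] by (simp add: norm_proj_sum d_def)
  have "ker.q h (r N) = ker.q h \<psi> - k \<bullet> proj N (\<iota> \<psi>)" for N
  proof -
   have "ker.q h (r N) = ker.q h (\<lambda>x. 1 * \<psi> x) + ker.q h (\<lambda>x. (-1) * u N x)"
    unfolding r_def by (intro ker.q_add_right ker.fin_scale h fin_psi fin_u)
   also have "\<dots> = 1 * ker.q h \<psi> + (-1) * (k \<bullet> proj N (\<iota> \<psi>))"
    by (simp only: ker.q_scale_right q_hu)
   finally show ?thesis by simp
  qed
  then have bound: "(ker.q h \<psi> - k \<bullet> proj N (\<iota> \<psi>))^2 \<le> ker.q h h * (norm (\<iota> \<psi> - proj N (\<iota> \<psi>)))^2" for N
   using ker.q_Cauchy_Schwarz[OF h fin_r[of N]] q_rr by simp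
  have "(\<lambda>N. (ker.q h \<psi> - k \<bullet> proj N (\<iota> \<psi>))^2) \<longlonglongrightarrow> (ker.q h \<psi> - k \<bullet> \<iota> \<psi>)^2"
   by (intro tendsto_intros proj_tendsto)
  moreover have "(\<lambda>N. ker.q h h * (norm (\<iota> \<psi> - proj N (\<iota> \<psi>)))^2) \<longlonglongrightarrow> ker.q h h * (norm (\<iota> \<psi> - \<iota> \<psi>))^2"
   by (intro tendsto_intros proj_tendsto)
  ultimately have "(ker.q h \<psi> - k \<bullet> \<iota> \<psi>)^2 \<le> ker.q h h * (norm (\<iota> \<psi> - \<iota> \<psi>))^2"
   using bound by (intro LIMSEQ_le) auto
  then show ?thesis by (simp add: kform_q h fin_psi)
 qed
 ultimately show ?thesis using that by blast
qed

lemma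
 assumes h: "h \<in> borel_measurable borel" "abs_form f h < \<infinity>"
 shows K_elem_inner: "\<psi> \<in> schwartz \<Longrightarrow> K_elem f \<iota> h \<bullet> \<iota> \<psi> = kform f h \<psi>"
  and K_elem_norm: "ennreal ((norm (K_elem f \<iota> h))^2) \<le> abs_form f h"
proof -
 have "ker.fin h" using h by (simp add: fin_iff)
 then obtain k where k: "\<And>\<psi>. \<psi> \<in> schwartz \<Longrightarrow> k \<bullet> \<iota> \<psi> = kform f h \<psi>" "ennreal ((norm k)^2) \<le> abs_form f h"
  by (rule K_representation) blast
 have "(THE k. \<forall>\<psi>\<in>schwartz. k \<bullet> \<iota> \<psi> = kform f h \<psi>) = k"
 proof (rule the_equality)
  fix l assume "\<forall>\<psi>\<in>schwartz. l \<bullet> \<iota> \<psi> = kform f h \<psi>"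
  then show "l = k" by (intro coordinates_eq_imp_eq) (simp add: e_eq k fj_schwartz)
 qed (use k in auto)
 then have "K_elem f \<iota> h = k" using h by (simp add: K_elem_def)
 with k show "\<psi> \<in> schwartz \<Longrightarrow> K_elem f \<iota> h \<bullet> \<iota> \<psi> = kform f h \<psi>"
  and "ennreal ((norm (K_elem f \<iota> h))^2) \<le> abs_form f h" by auto
qed

lemma K_elem_norm_le: "ennreal ((norm (K_elem f \<iota> h))^2) \<le> abs_form f h"
proof (cases "h \<in> borel_measurable borel \<and> abs_form f h < \<infinity>")
 case True then show ?thesis using K_elem_norm by blast
next
 case False then show ?thesis by (simp only: K_elem_def if_False) simp
qed

lemma K_elem_coordinate: "ker.fin h \<Longrightarrow> i \<in> I \<Longrightarrow> K_elem f \<iota> h \<bullet> e i = ker.q h (fj i)"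
 using kform_q[of h "fj i"] fin_fj[of i] by (simp add: e_eq K_elem_inner fin_iff fj_schwartz)

lemma K_elem_scale: "ker.fin h \<Longrightarrow> K_elem f \<iota> (\<lambda>x. a * h x) = a *\<^sub>R K_elem f \<iota> h"
 by (rule coordinates_eq_imp_eq) (simp add: K_elem_coordinate ker.fin_scale ker.q_scale_left)

lemma K_elem_add: "ker.fin u \<Longrightarrow> ker.fin v \<Longrightarrow> K_elem f \<iota> (\<lambda>x. u x + v x) = K_elem f \<iota> u + K_elem f \<iota> v"
 by (rule coordinates_eq_imp_eq) (simp add: K_elem_coordinate ker.fin_add ker.q_add_left fin_fj inner_add_left)

lemma fin_diff: "ker.fin u \<Longrightarrow> ker.fin v \<Longrightarrow> ker.fin (\<lambda>x. u x - v x)"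
 using ker.fin_add[OF _ ker.fin_scale, of u v "-1"] by simp

lemma K_elem_diff: "ker.fin u \<Longrightarrow> ker.fin v \<Longrightarrow> K_elem f \<iota> (\<lambda>x. u x - v x) = K_elem f \<iota> u - K_elem f \<iota> v"
 using K_elem_add[OF _ ker.fin_scale, of u v "-1"] K_elem_scale[of v "-1"] by simp

lemma K_elem_diff_norm_le:
 assumes u: "ker.fin u" and [measurable]: "v \<in> borel_measurable borel"
 shows "ennreal ((norm (K_elem f \<iota> u - K_elem f \<iota> v))^2) \<le> abs_form f (\<lambda>x. u x - v x)"
proof (cases "abs_form f (\<lambda>x. u x - v x) < \<infinity>")
 case True
 have [measurable]: "u \<in> borel_measurable borel" using u by (rule ker.fin_borel)
 have d: "ker.fin (\<lambda>x. u x - v x)" using True by (simp add: fin_iff)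
 have "ker.fin v" using fin_diff[OF u d] by simp
 from K_elem_diff[OF u this] show ?thesis using K_elem_norm_le[of "\<lambda>x. u x - v x"] by simp
qed (simp add: not_less top_unique)

lemma fin_bounded_set: "bounded A \<Longrightarrow> A \<in> sets borel \<Longrightarrow> ker.fin (indicator A)"
proof -
 assume A: "bounded A" "A \<in> sets borel"
 then obtain R where R: "\<And>x. x \<in> A \<Longrightarrow> norm x \<le> R" unfolding bounded_iff by blast
 show ?thesis
  by (rule ker.fin_bounded[where C=1 and R=R]) (use A R in \<open>auto split: split_indicator simp: not_le[symmetric]\<close>)
qed

lemma abs_form_triangle:
 assumes [measurable]: "u \<in> borel_measurable borel" "v \<in> borel_measurable borel"
 shows "abs_form f (\<lambda>x. u x + v x) \<le> 2 * abs_form f u + 2 * abs_form f v"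
proof (cases "abs_form f u < \<infinity> \<and> abs_form f v < \<infinity>")
 case True
 then show ?thesis using ker.abs_form_add[of u v] by (simp add: fin_iff abs_form_f0)
next
 case False
 then show ?thesis by (auto simp: not_less top_unique ennreal_mult_eq_top_iff)
qed

lemma abs_form_mono: "(\<And>x. \<bar>u x\<bar> \<le> \<bar>v x\<bar>) \<Longrightarrow> abs_form f u \<le> abs_form f v"
 unfolding abs_form_f0 unfolding abs_form_def
 by (intro nn_integral_mono ennreal_leI mult_mono) (auto simp: ker.nonneg)

lemma abs_form_measurable [measurable (raw)]:
 fixes g :: "'z \<Rightarrow> real^'n \<Rightarrow> real"
 assumes [measurable]: "case_prod g \<in> borel_measurable (M \<Otimes>\<^sub>M borel)"
 shows "(\<lambda>z. abs_form f (g z)) \<in> borel_measurable M"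
proof -
 have [measurable]: "(\<lambda>w. g (fst (fst w)) (snd (fst w))) \<in> borel_measurable ((M \<Otimes>\<^sub>M borel) \<Otimes>\<^sub>M borel)"
  "(\<lambda>w. g (fst (fst w)) (snd w)) \<in> borel_measurable ((M \<Otimes>\<^sub>M borel) \<Otimes>\<^sub>M borel)"
  using assms by (auto simp: case_prod_beta' intro!: measurable_compose[OF _ assms, of "\<lambda>w. (fst (fst w), snd (fst w))", simplified]
    measurable_compose[OF _ assms, of "\<lambda>w. (fst (fst w), snd w)", simplified])
 show ?thesis unfolding abs_form_def by measurable
qed

lemma kform_measurable [measurable (raw)]:
 fixes g :: "'z \<Rightarrow> real^'n \<Rightarrow> real"
 assumes [measurable]: "case_prod g \<in> borel_measurable (M \<Otimes>\<^sub>M borel)" "\<psi> \<in> borel_measurable borel"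
 shows "(\<lambda>z. kform f (g z) \<psi>) \<in> borel_measurable M"
proof -
 show ?thesis unfolding kform_def by measurable
qed

text \<open>Measurability of a \<open>K\<close>-valued map is expressed through its coordinates, each of which
  is a double integral.\<close>

lemma K_elem_coordinate_measurable:
 fixes g :: "'z \<Rightarrow> real^'n \<Rightarrow> real"
 assumes [measurable]: "case_prod g \<in> borel_measurable (M \<Otimes>\<^sub>M borel)" and i: "i \<in> I"
 shows "(\<lambda>z. K_elem f \<iota> (g z) \<bullet> e i) \<in> borel_measurable M"
proof -
 have [measurable]: "fj i \<in> borel_measurable borel" by (rule schwartz_borel[OF fj_schwartz[OF i]])
 have eq: "K_elem f \<iota> (g z) \<bullet> e i = (if abs_form f (g z) < \<infinity> then kform f (g z) (fj i) else 0)" if "z \<in> space M" for z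
 proof -
  have "g z \<in> borel_measurable borel" using measurable_Pair2[OF assms(1) that] by simp
  then show ?thesis using i by (auto simp: K_elem_inner e_eq fj_schwartz) (simp add: K_elem_def)
 qed
 show ?thesis by (subst measurable_cong[OF eq]) measurable
qed

end

section \<open>Square integrable random variables\<close>

lemma discriminant_le:
 fixes a b c :: real
 assumes "\<And>s t. 0 \<le> s^2 * a + 2 * s * t * c + t^2 * b"
 shows "c^2 \<le> a * b"
proof (cases "b = 0")
 case False
 have "0 \<le> b" using assms[of 0 1] by simp
 with False have "0 < b" by simp
 have "0 \<le> b^2 * a + 2 * b * (- c) * c + (- c)^2 * b" by (rule assms)
 also have "\<dots> = b * (a * b - c^2)" by (simp add: power2_eq_square algebra_simps)
 finally show ?thesis using \<open>0 < b\<close> by (simp add: zero_le_mult_iff)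
next
 case True
 have "c = 0"
 proof (rule ccontr)
  assume "c \<noteq> 0"
  then show False using assms[of 1 "- (a + 1) / (2 * c)"] True by (simp add: field_simps)
 qed
 then show ?thesis using True by simp
qed

lemma ennreal_squeeze_0:
 fixes a b :: "nat \<Rightarrow> ennreal"
 assumes "\<And>n. a n \<le> b n" "b \<longlonglongrightarrow> 0"
 shows "a \<longlonglongrightarrow> 0"
 by (rule tendsto_sandwich[where f="\<lambda>_. 0" and h=b]) (use assms in auto)

lemma ennreal_power2_le:
 fixes x :: ennreal
 assumes "x^2 \<le> (ennreal s)^2" "0 \<le> s"
 shows "x \<le> ennreal s"
proof (cases x)
 case (real r)
 then have "ennreal (r^2) \<le> ennreal (s^2)" using assms by (simp add: ennreal_power)
 then have "r^2 \<le> s^2" using assms by (simp add: ennreal_le_iff)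
 then have "r \<le> s" using assms(2) by (rule power2_le_imp_le)
 then show ?thesis using real by (simp add: ennreal_leI)
next
 case top
 then have "\<top> \<le> ennreal (s^2)" using assms by (simp add: ennreal_power power2_eq_square[of "\<top>::ennreal"] ennreal_top_mult)
 then show ?thesis by (simp add: top_unique)
qed

abbreviation nn2 :: "'a measure \<Rightarrow> ('a \<Rightarrow> real) \<Rightarrow> ennreal" where
 "nn2 M X \<equiv> \<integral>\<^sup>+w. ennreal ((X w)^2) \<partial>M"

definition square_integrable :: "'a measure \<Rightarrow> ('a \<Rightarrow> real) \<Rightarrow> bool" where
 "square_integrable M X \<longleftrightarrow> X \<in> borel_measurable M \<and> integrable M (\<lambda>w. (X w)^2)"

lemma square_integrable_borel [measurable_dest]: "square_integrable M X \<Longrightarrow> X \<in> borel_measurable M"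
 by (simp add: square_integrable_def)

lemma square_integrable_iff_nn:
 "square_integrable M X \<longleftrightarrow> X \<in> borel_measurable M \<and> (nn2 M (\<lambda>w. X w)) < \<infinity>"
 by (auto simp: square_integrable_def integrable_iff_bounded)

lemma square_integrable_nn_eq:
 "square_integrable M X \<Longrightarrow> (nn2 M (\<lambda>w. X w)) = ennreal (\<integral>w. (X w)^2 \<partial>M)"
 unfolding square_integrable_def by (intro nn_integral_eq_integral) auto

lemma square_integrable_mult:
 assumes "square_integrable M X" "square_integrable M Y"
 shows "integrable M (\<lambda>w. X w * Y w)"
proof (rule integrable_dominated)
 show "integrable M (\<lambda>w. (X w)^2 + (Y w)^2)" using assms by (simp add: square_integrable_def)
 show "(\<lambda>w. X w * Y w) \<in> borel_measurable M" using assms by (auto simp: square_integrable_def)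
 have "\<bar>x * y\<bar> \<le> x^2 + y^2" for x y :: real
 proof -
  have "2 * (\<bar>x\<bar> * \<bar>y\<bar>) \<le> x^2 + y^2" using sum_squares_bound[of "\<bar>x\<bar>" "\<bar>y\<bar>"] by (simp add: mult.assoc)
  moreover have "0 \<le> \<bar>x\<bar> * \<bar>y\<bar>" by simp
  ultimately show ?thesis unfolding abs_mult by linarith
 qed
 then show "AE w in M. norm (X w * Y w) \<le> norm ((X w)^2 + (Y w)^2)" by simp
qed

lemma square_integrable_add:
 assumes "square_integrable M X" "square_integrable M Y"
 shows "square_integrable M (\<lambda>w. X w + Y w)"
 using assms square_integrable_mult[OF assms] unfolding square_integrable_def power2_sum
 by (auto simp: mult.assoc)

lemma square_integrable_scale: "square_integrable M X \<Longrightarrow> square_integrable M (\<lambda>w. a * X w)"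
 by (auto simp: square_integrable_def power_mult_distrib)

lemma square_integrable_diff:
 "square_integrable M X \<Longrightarrow> square_integrable M Y \<Longrightarrow> square_integrable M (\<lambda>w. X w - Y w)"
 using square_integrable_add[OF _ square_integrable_scale, of M X Y "-1"] by simp

lemma square_integrable_sum:
 "(\<And>i. i \<in> S \<Longrightarrow> square_integrable M (X i)) \<Longrightarrow> square_integrable M (\<lambda>w. \<Sum>i\<in>S. X i w)"
 by (induction S rule: infinite_finite_induct) (auto intro: square_integrable_add simp: square_integrable_def[of M "\<lambda>_. 0"])

lemma square_integrable_bounded_mult:
 assumes "square_integrable M X" "Y \<in> borel_measurable M" "\<And>w. w \<in> space M \<Longrightarrow> \<bar>Y w\<bar> \<le> C"
 shows "square_integrable M (\<lambda>w. Y w * X w)"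
 unfolding square_integrable_def
proof
 show m: "(\<lambda>w. Y w * X w) \<in> borel_measurable M" using assms by (auto simp: square_integrable_def)
 show "integrable M (\<lambda>w. (Y w * X w)^2)"
 proof (rule integrable_dominated)
  show "integrable M (\<lambda>w. C^2 * (X w)^2)" using assms by (simp add: square_integrable_def)
  show "AE w in M. norm ((Y w * X w)^2) \<le> norm (C^2 * (X w)^2)"
  proof (rule AE_I2)
   fix w assume "w \<in> space M"
   then have "(Y w)^2 \<le> C^2" using assms(3)[of w] by (metis abs_ge_zero power2_abs power_mono)
   then show "norm ((Y w * X w)^2) \<le> norm (C^2 * (X w)^2)"
    by (simp add: power_mult_distrib mult_right_mono)
  qed
 qed (use m in measurable)
qed

text \<open>The seminorm of \<open>L\<^sup>2\<close>.\<close>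

definition norm2 :: "'a measure \<Rightarrow> ('a \<Rightarrow> real) \<Rightarrow> real" where
 "norm2 M X = sqrt (\<integral>w. (X w)^2 \<partial>M)"

lemma norm2_nonneg [simp]: "0 \<le> norm2 M X"
 by (simp add: norm2_def)

lemma norm2_sq: "(norm2 M X)^2 = (\<integral>w. (X w)^2 \<partial>M)"
 by (simp add: norm2_def)

lemma L2_Cauchy_Schwarz:
 assumes X: "square_integrable M X" and Y: "square_integrable M Y"
 shows "\<bar>\<integral>w. X w * Y w \<partial>M\<bar> \<le> norm2 M X * norm2 M Y"
proof -
 let ?a = "\<integral>w. (X w)^2 \<partial>M" and ?b = "\<integral>w. (Y w)^2 \<partial>M" and ?c = "\<integral>w. X w * Y w \<partial>M"
 have "?c^2 \<le> ?a * ?b"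
 proof (rule discriminant_le)
  fix s t :: real
  have "0 \<le> (\<integral>w. (s * X w + t * Y w)^2 \<partial>M)" by simp
  also have "\<dots> = (\<integral>w. s^2 * (X w)^2 + 2 * s * t * (X w * Y w) + t^2 * (Y w)^2 \<partial>M)"
   by (intro integral_eqI) (simp add: power2_eq_square algebra_simps)
  also have "\<dots> = s^2 * ?a + 2 * s * t * ?c + t^2 * ?b"
   using X Y square_integrable_mult[OF X Y] by (simp add: square_integrable_def)
  finally show "0 \<le> s^2 * ?a + 2 * s * t * ?c + t^2 * ?b" .
 qed
 then have "sqrt (?c^2) \<le> sqrt (?a * ?b)" by (rule real_sqrt_le_mono)
 then show ?thesis by (simp add: norm2_def real_sqrt_mult)
qed

lemma norm2_triangle:
 assumes X: "square_integrable M X" and Y: "square_integrable M Y"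
 shows "norm2 M (\<lambda>w. X w + Y w) \<le> norm2 M X + norm2 M Y"
proof (rule power2_le_imp_le)
 have "(norm2 M (\<lambda>w. X w + Y w))^2 = (\<integral>w. (X w)^2 + 2 * (X w * Y w) + (Y w)^2 \<partial>M)"
  unfolding norm2_sq by (intro integral_eqI) (simp add: power2_eq_square algebra_simps)
 also have "\<dots> = (norm2 M X)^2 + 2 * (\<integral>w. X w * Y w \<partial>M) + (norm2 M Y)^2"
  unfolding norm2_sq using X Y square_integrable_mult[OF X Y] by (simp add: square_integrable_def)
 also have "\<dots> \<le> (norm2 M X + norm2 M Y)^2"
  using L2_Cauchy_Schwarz[OF X Y] by (simp add: power2_sum)
 finally show "(norm2 M (\<lambda>w. X w + Y w))^2 \<le> (norm2 M X + norm2 M Y)^2" .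
qed simp

lemma L2_limitD:
 assumes "L2_limit M X Z"
 shows "Z \<in> borel_measurable M" "X n \<in> borel_measurable M" "(\<lambda>n. nn2 M (\<lambda>w. X n w - Z w)) \<longlonglongrightarrow> 0"
 using assms by (auto simp: L2_limit_def)

lemma nn2_triangle:
 assumes [measurable]: "X \<in> borel_measurable M" "Y \<in> borel_measurable M"
 shows "(nn2 M (\<lambda>w. X w + Y w)) \<le> 2 * (nn2 M (\<lambda>w. X w)) + 2 * (nn2 M (\<lambda>w. Y w))"
proof -
 have "(x + y)^2 \<le> 2 * x^2 + 2 * y^2" for x y :: real
  using sum_squares_bound[of x y] by (simp add: power2_sum)
 then have "(nn2 M (\<lambda>w. X w + Y w)) \<le> (\<integral>\<^sup>+w. 2 * ennreal ((X w)^2) + 2 * ennreal ((Y w)^2) \<partial>M)"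
  by (intro nn_integral_mono) (simp add: ennreal_mult''[symmetric] ennreal_plus[symmetric] ennreal_leI del: ennreal_plus flip: ennreal_numeral)
 then show ?thesis by (simp add: nn_integral_add nn_integral_cmult)
qed

lemma L2_limit_square_integrable:
 assumes "L2_limit M X Z" "\<And>n. square_integrable M (X n)"
 shows "square_integrable M Z" "(\<lambda>n. norm2 M (\<lambda>w. X n w - Z w)) \<longlonglongrightarrow> 0"
proof -
 note [measurable] = L2_limitD(1,2)[OF assms(1)]
 have "\<forall>\<^sub>F n in sequentially. (nn2 M (\<lambda>w. X n w - Z w)) < 1"
  using L2_limitD(3)[OF assms(1)] by (rule order_tendstoD) simp
 then obtain n where "(nn2 M (\<lambda>w. X n w - Z w)) < 1"
  unfolding eventually_sequentially by blast
 then have "(nn2 M (\<lambda>w. X n w - Z w)) < \<infinity>" by (rule order_less_trans) simp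
 then have "square_integrable M (\<lambda>w. X n w - Z w)" by (simp add: square_integrable_iff_nn)
 from square_integrable_diff[OF assms(2)[of n] this] show Z: "square_integrable M Z" by simp
 have "(\<lambda>n. ennreal ((norm2 M (\<lambda>w. X n w - Z w))^2)) \<longlonglongrightarrow> 0"
  using L2_limitD(3)[OF assms(1)] square_integrable_diff[OF assms(2) Z]
  by (simp add: square_integrable_nn_eq norm2_sq)
 then have "(\<lambda>n. (norm2 M (\<lambda>w. X n w - Z w))^2) \<longlonglongrightarrow> 0"
  by (subst (asm) ennreal_0[symmetric], subst (asm) tendsto_ennreal_iff) auto
 from tendsto_real_sqrt[OF this] show "(\<lambda>n. norm2 M (\<lambda>w. X n w - Z w)) \<longlonglongrightarrow> 0" by simp
qed

lemma L2_limit_product: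
 assumes "L2_limit M X Z" "\<And>n. square_integrable M (X n)" "L2_limit M Y W" "\<And>n. square_integrable M (Y n)"
 shows "(\<lambda>n. \<integral>w. X n w * Y n w \<partial>M) \<longlonglongrightarrow> (\<integral>w. Z w * W w \<partial>M)"
proof -
 note Z = L2_limit_square_integrable[OF assms(1,2)] and W = L2_limit_square_integrable[OF assms(3,4)]
 let ?d = "\<lambda>n. norm2 M (\<lambda>w. X n w - Z w) * (norm2 M W + norm2 M (\<lambda>w. Y n w - W w)) + norm2 M Z * norm2 M (\<lambda>w. Y n w - W w)"
 have "\<bar>(\<integral>w. X n w * Y n w \<partial>M) - (\<integral>w. Z w * W w \<partial>M)\<bar> \<le> ?d n" for n
 proof -
  have "(\<integral>w. X n w * Y n w \<partial>M) - (\<integral>w. Z w * W w \<partial>M)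
   = (\<integral>w. (X n w - Z w) * Y n w \<partial>M) + (\<integral>w. Z w * (Y n w - W w) \<partial>M)"
   using square_integrable_mult[OF assms(2) assms(4), of n n] square_integrable_mult[OF Z(1) assms(4), of n]
    square_integrable_mult[OF Z(1) W(1)]
   by (simp add: left_diff_distrib right_diff_distrib)
  also have "\<bar>\<dots>\<bar> \<le> norm2 M (\<lambda>w. X n w - Z w) * norm2 M (Y n) + norm2 M Z * norm2 M (\<lambda>w. Y n w - W w)"
   using L2_Cauchy_Schwarz[OF square_integrable_diff[OF assms(2) Z(1)] assms(4), of n n]
    L2_Cauchy_Schwarz[OF Z(1) square_integrable_diff[OF assms(4) W(1)], of n] by linarith
  also have "norm2 M (Y n) \<le> norm2 M W + norm2 M (\<lambda>w. Y n w - W w)"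
   using norm2_triangle[OF W(1) square_integrable_diff[OF assms(4) W(1)], of n] by simp
  finally show ?thesis by (simp add: mult_left_mono)
 qed
 then have le: "norm ((\<integral>w. X n w * Y n w \<partial>M) - (\<integral>w. Z w * W w \<partial>M)) \<le> ?d n" for n by simp
 have "?d \<longlonglongrightarrow> 0 * (norm2 M W + 0) + norm2 M Z * 0"
  by (intro tendsto_intros Z W)
 then have "?d \<longlonglongrightarrow> 0" by simp
 from Lim_null_comparison[OF always_eventually[OF allI[OF le]] this]
 have "(\<lambda>n. (\<integral>w. X n w * Y n w \<partial>M) - (\<integral>w. Z w * W w \<partial>M)) \<longlonglongrightarrow> 0" .
 then show ?thesis by (simp add: LIM_zero_iff)
qed

lemma L2_limit_norm2:
 assumes "L2_limit M X Z" "\<And>n. square_integrable M (X n)"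
 shows "(\<lambda>n. norm2 M (X n)) \<longlonglongrightarrow> norm2 M Z"
 using L2_limit_product[OF assms assms]
 unfolding norm2_def power2_eq_square by (intro tendsto_real_sqrt)

lemma L2_limit_add:
 assumes "L2_limit M X Z" "L2_limit M Y W"
 shows "L2_limit M (\<lambda>n w. X n w + Y n w) (\<lambda>w. Z w + W w)"
proof -
 note m [measurable] = L2_limitD(1,2)[OF assms(1)] L2_limitD(1,2)[OF assms(2)]
 have "(nn2 M (\<lambda>w. X n w + Y n w - (Z w + W w))) \<le>
   2 * (nn2 M (\<lambda>w. X n w - Z w)) + 2 * (nn2 M (\<lambda>w. Y n w - W w))" for n
  using nn2_triangle[of "\<lambda>w. X n w - Z w" M "\<lambda>w. Y n w - W w"] by (simp add: algebra_simps)
 moreover have "(\<lambda>n. 2 * (nn2 M (\<lambda>w. X n w - Z w)) + 2 * (nn2 M (\<lambda>w. Y n w - W w))) \<longlonglongrightarrow> 2 * 0 + 2 * 0"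
  by (intro tendsto_add ennreal_tendsto_cmult L2_limitD(3)[OF assms(1)] L2_limitD(3)[OF assms(2)]) auto
 then have "(\<lambda>n. 2 * (nn2 M (\<lambda>w. X n w - Z w)) + 2 * (nn2 M (\<lambda>w. Y n w - W w))) \<longlonglongrightarrow> 0" by simp
 ultimately have "(\<lambda>n. nn2 M (\<lambda>w. X n w + Y n w - (Z w + W w))) \<longlonglongrightarrow> 0"
  by (rule ennreal_squeeze_0)
 then show ?thesis by (simp add: L2_limit_def)
qed

lemma L2_limit_scale:
 assumes "L2_limit M X Z"
 shows "L2_limit M (\<lambda>n w. a * X n w) (\<lambda>w. a * Z w)"
proof -
 note m [measurable] = L2_limitD(1,2)[OF assms(1)]
 have "(nn2 M (\<lambda>w. a * X n w - a * Z w)) = ennreal (a^2) * (nn2 M (\<lambda>w. X n w - Z w))" for n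
  by (simp add: nn_integral_cmult[symmetric] ennreal_mult[symmetric] power_mult_distrib[symmetric] right_diff_distrib)
 moreover have "(\<lambda>n. ennreal (a^2) * (nn2 M (\<lambda>w. X n w - Z w))) \<longlonglongrightarrow> ennreal (a^2) * 0"
  by (intro ennreal_tendsto_cmult L2_limitD(3)[OF assms(1)]) auto
 ultimately show ?thesis by (simp add: L2_limit_def)
qed

lemma L2_limit_sum:
 assumes "finite S" "\<And>i. i \<in> S \<Longrightarrow> L2_limit M (X i) (Z i)"
 shows "L2_limit M (\<lambda>n w. \<Sum>i\<in>S. X i n w) (\<lambda>w. \<Sum>i\<in>S. Z i w)"
 using assms by (induction S rule: finite_induct) (auto intro: L2_limit_add simp: L2_limit_def[of M "\<lambda>_ _. 0"])

lemma L2_limit_unique: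
 assumes "L2_limit M X Z" "L2_limit M X W"
 shows "AE w in M. Z w = W w"
proof -
 note m [measurable] = L2_limitD(1,2)[OF assms(1)] L2_limitD(1)[OF assms(2)]
 have "L2_limit M (\<lambda>n w. X n w + (- 1) * X n w) (\<lambda>w. Z w + (- 1) * W w)"
  by (intro L2_limit_add L2_limit_scale assms)
 then have "(\<lambda>n::nat. \<integral>\<^sup>+w. ennreal ((Z w - W w)^2) \<partial>M) \<longlonglongrightarrow> 0"
  by (simp add: L2_limit_def power2_commute)
 then have "(nn2 M (\<lambda>w. Z w - W w)) = 0" by (simp add: LIMSEQ_const_iff)
 then have "AE w in M. ennreal ((Z w - W w)^2) = 0" by (subst (asm) nn_integral_0_iff_AE) auto
 then show ?thesis by eventually_elim simp
qed

text \<open>A subsequence with summable increments converges almost surely; its limit is identified by the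
  lemma of Fatou.\<close>

lemma (in prob_space) L2_complete:
 assumes X: "\<And>n. X n \<in> borel_measurable M"
  and Cauchy: "\<And>\<epsilon>. 0 < \<epsilon> \<Longrightarrow> \<exists>N. \<forall>m\<ge>N. \<forall>n\<ge>N. (nn2 M (\<lambda>w. X m w - X n w)) \<le> ennreal \<epsilon>"
 shows "\<exists>Z. L2_limit M X Z"
proof -
 note [measurable] = X
 define N where "N k = (SOME N. \<forall>m\<ge>N. \<forall>n\<ge>N. (nn2 M (\<lambda>w. X m w - X n w)) \<le> ennreal ((1/4) ^ k))" for k :: nat
 have N: "\<forall>m\<ge>N k. \<forall>n\<ge>N k. (nn2 M (\<lambda>w. X m w - X n w)) \<le> ennreal ((1/4) ^ k)" for k
  unfolding N_def by (rule someI_ex[OF Cauchy]) simp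
 define r where "r k = k + (\<Sum>i\<le>k. N i)" for k
 have r: "N k \<le> r k" "r k \<le> r (Suc k)" "k \<le> r k" for k
  using member_le_sum[of k "{..k}" N] unfolding r_def by auto
 define D where "D k w = X (r (Suc k)) w - X (r k) w" for k w
 have [measurable]: "D k \<in> borel_measurable M" for k unfolding D_def by measurable
 have D2: "(nn2 M (\<lambda>w. D k w)) \<le> ennreal ((1/4) ^ k)" for k
  unfolding D_def using N[of k] r[of k] by (meson order_trans)
 have D1: "(\<integral>\<^sup>+w. ennreal \<bar>D k w\<bar> \<partial>M) \<le> ennreal ((1/2) ^ k)" for k
 proof -
  have "(\<integral>\<^sup>+w. ennreal \<bar>D k w\<bar> * 1 \<partial>M)^2 \<le> (\<integral>\<^sup>+w. (ennreal \<bar>D k w\<bar>)^2 \<partial>M) * (\<integral>\<^sup>+w. 1^2 \<partial>M)"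
   by (rule Cauchy_Schwarz_nn_integral) auto
  then have "(\<integral>\<^sup>+w. ennreal \<bar>D k w\<bar> \<partial>M)^2 \<le> (nn2 M (\<lambda>w. D k w))"
   by (simp add: ennreal_power emeasure_space_1)
  also have "\<dots> \<le> ennreal ((1/4) ^ k)" by (rule D2)
  also have "(1/4::real) ^ k = ((1/2) ^ k)^2" by (simp add: power2_eq_square power_mult_distrib[symmetric])
  also have "ennreal (((1/2) ^ k)^2) = (ennreal ((1/2) ^ k))^2" by (simp add: ennreal_power)
  finally show ?thesis by (rule ennreal_power2_le) simp
 qed
 have "(\<integral>\<^sup>+w. (\<Sum>k. ennreal \<bar>D k w\<bar>) \<partial>M) = (\<Sum>k. \<integral>\<^sup>+w. ennreal \<bar>D k w\<bar> \<partial>M)"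
  by (rule nn_integral_suminf) auto
 also have "\<dots> \<le> (\<Sum>k. ennreal ((1/2) ^ k))" by (intro suminf_le D1) auto
 also have "\<dots> < \<infinity>" by (simp add: suminf_ennreal2 summable_geometric)
 finally have "AE w in M. (\<Sum>k. ennreal \<bar>D k w\<bar>) \<noteq> \<infinity>" by (intro nn_integral_PInf_AE) auto
 then have conv: "AE w in M. convergent (\<lambda>k. X (r k) w)"
 proof eventually_elim
  fix w assume "(\<Sum>k. ennreal \<bar>D k w\<bar>) \<noteq> \<infinity>"
  then have "summable (\<lambda>k. \<bar>D k w\<bar>)" by (intro summable_suminf_not_top) auto
  then have "summable (\<lambda>k. D k w)" by (rule summable_rabs_cancel)
  then have "convergent (\<lambda>n. \<Sum>k<n. D k w)" by (simp add: summable_iff_convergent)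
  then have "convergent (\<lambda>n. (\<Sum>k<n. D k w) + X (r 0) w)" by (intro convergent_add convergent_const)
  moreover have "(\<Sum>k<n. D k w) + X (r 0) w = X (r n) w" for n
   unfolding D_def using sum_lessThan_telescope[of "\<lambda>k. X (r k) w" n] by simp
  ultimately show "convergent (\<lambda>k. X (r k) w)" by simp
 qed
 define Z where "Z w = lim (\<lambda>k. X (r k) w)" for w
 have [measurable]: "Z \<in> borel_measurable M" unfolding Z_def by measurable
 have "(\<lambda>n. nn2 M (\<lambda>w. X n w - Z w)) \<longlonglongrightarrow> 0"
 proof -
  show ?thesis
  proof (rule order_tendstoI)
   fix a :: ennreal assume "0 < a"
   then obtain \<epsilon> :: real where eps: "0 < \<epsilon>" "ennreal \<epsilon> < a"
    by (metis dense ennreal_cases ennreal_less_zero_iff less_irrefl order_less_trans ennreal_top_neq_zero not_less top_greatest)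
   obtain N0 where N0: "\<forall>m\<ge>N0. \<forall>n\<ge>N0. (nn2 M (\<lambda>w. X m w - X n w)) \<le> ennreal \<epsilon>"
    using Cauchy[OF eps(1)] by blast
   have "(nn2 M (\<lambda>w. X n w - Z w)) < a" if "N0 \<le> n" for n
   proof -
    have "(nn2 M (\<lambda>w. X n w - Z w)) = (\<integral>\<^sup>+w. liminf (\<lambda>k. ennreal ((X n w - X (r k) w)^2)) \<partial>M)"
    proof (rule nn_integral_cong_AE, use conv in eventually_elim)
     fix w assume "convergent (\<lambda>k. X (r k) w)"
     then have "(\<lambda>k. X (r k) w) \<longlonglongrightarrow> Z w" unfolding Z_def by (simp add: convergent_LIMSEQ_iff)
     then have "(\<lambda>k. ennreal ((X n w - X (r k) w)^2)) \<longlonglongrightarrow> ennreal ((X n w - Z w)^2)"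
      by (intro tendsto_ennrealI tendsto_intros)
     from lim_imp_Liminf[OF _ this] show "ennreal ((X n w - Z w)^2) = liminf (\<lambda>k. ennreal ((X n w - X (r k) w)^2))"
      by simp
    qed
    also have "\<dots> \<le> liminf (\<lambda>k. \<integral>\<^sup>+w. ennreal ((X n w - X (r k) w)^2) \<partial>M)"
     by (rule nn_integral_liminf) auto
    also have "\<dots> \<le> liminf (\<lambda>k. ennreal \<epsilon>)"
    proof (rule Liminf_mono)
     show "\<forall>\<^sub>F k in sequentially. (nn2 M (\<lambda>w. X n w - X (r k) w)) \<le> ennreal \<epsilon>"
      unfolding eventually_sequentially using N0 that r(3) by (meson order_trans)
    qed
    also have "\<dots> = ennreal \<epsilon>" by (simp add: Liminf_const)
    finally show ?thesis using eps(2) by simp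
   qed
   then show "\<forall>\<^sub>F n in sequentially. (nn2 M (\<lambda>w. X n w - Z w)) < a"
    unfolding eventually_sequentially by blast
  qed auto
 qed
 then show ?thesis unfolding L2_limit_def by (intro exI[of _ Z]) auto
qed

section \<open>Fourier uniqueness, independence and Gaussian variables\<close>

lemma Int_stable_vimages:
 "Int_stable {Y -` S \<inter> \<Omega> |S. S \<in> sets N}"
proof (rule Int_stableI)
 fix a b assume "a \<in> {Y -` S \<inter> \<Omega> |S. S \<in> sets N}" "b \<in> {Y -` S \<inter> \<Omega> |S. S \<in> sets N}"
 then obtain S T where "a = Y -` S \<inter> \<Omega>" "b = Y -` T \<inter> \<Omega>" "S \<in> sets N" "T \<in> sets N" by auto
 then have "a \<inter> b = Y -` (S \<inter> T) \<inter> \<Omega>" "S \<inter> T \<in> sets N" by auto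
 then show "a \<inter> b \<in> {Y -` S \<inter> \<Omega> |S. S \<in> sets N}" by blast
qed

context prob_space
begin

lemma integrable_bounded_mult:
 fixes V h :: "'a \<Rightarrow> real"
 assumes "integrable M V" "h \<in> borel_measurable M" "\<And>w. \<bar>h w\<bar> \<le> C"
 shows "integrable M (\<lambda>w. V w * h w)"
proof (rule integrable_dominated)
 show "integrable M (\<lambda>w. C * V w)" using assms(1) by simp
 show "(\<lambda>w. V w * h w) \<in> borel_measurable M" using assms by auto
 have "\<bar>V w * h w\<bar> \<le> \<bar>C * V w\<bar>" for w
 proof -
  have "\<bar>h w\<bar> \<le> \<bar>C\<bar>" using assms(3)[of w] by linarith
  from mult_right_mono[OF this, of "\<bar>V w\<bar>"] show ?thesis by (simp add: abs_mult mult.commute)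
 qed
 then show "AE w in M. norm (V w * h w) \<le> norm (C * V w)" by simp
qed

text \<open>The positive and negative parts of \<open>V\<close>, as densities, push forward under
  \<open>X\<close> to measures with equal characteristic functions.\<close>

lemma integral_eq_0_if_fourier_eq_0:
 fixes V X :: "'a \<Rightarrow> real"
 assumes V: "integrable M V" and X [measurable]: "X \<in> borel_measurable M"
  and cos0: "\<And>a. (\<integral>w. V w * cos (a * X w) \<partial>M) = 0"
  and sin0: "\<And>a. (\<integral>w. V w * sin (a * X w) \<partial>M) = 0"
  and S [measurable]: "S \<in> sets borel"
 shows "(\<integral>w. V w * indicator S (X w) \<partial>M) = 0"
proof -
 have [measurable]: "V \<in> borel_measurable M" using V by simp
 define Vp where "Vp w = max 0 (V w)" for w
 define Vm where "Vm w = max 0 (- V w)" for w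
 have [measurable]: "Vp \<in> borel_measurable M" "Vm \<in> borel_measurable M" unfolding Vp_def Vm_def by measurable
 have pm: "0 \<le> Vp w" "0 \<le> Vm w" "V w = Vp w - Vm w" for w by (auto simp: Vp_def Vm_def)
 have int: "integrable M Vp" "integrable M Vm"
  unfolding Vp_def Vm_def using V by auto
 define c where "c = (\<integral>w. Vp w \<partial>M)"
 have c_eq: "(\<integral>w. Vm w \<partial>M) = c"
  using cos0[of 0] int by (simp add: pm(3) c_def)
 have c0: "0 \<le> c" unfolding c_def using pm by (intro integral_nonneg_AE) auto
 have split: "(\<integral>w. V w * h w \<partial>M) = (\<integral>w. Vp w * h w \<partial>M) - (\<integral>w. Vm w * h w \<partial>M)"
  if "h \<in> borel_measurable M" "\<And>w. \<bar>h w\<bar> \<le> 1" for h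
  using integrable_bounded_mult[OF int(1) that] integrable_bounded_mult[OF int(2) that]
  by (simp add: pm(3) left_diff_distrib)
 show ?thesis
 proof (cases "c = 0")
  case True
  have "AE w in M. Vp w = 0" "AE w in M. Vm w = 0"
   using integral_nonneg_eq_0_iff_AE[OF int(1)] integral_nonneg_eq_0_iff_AE[OF int(2)] True c_eq pm
   by (auto simp: c_def)
  then have "AE w in M. V w = 0" by eventually_elim (simp add: pm(3))
  then have "(\<integral>w. V w * indicator S (X w) \<partial>M) = (\<integral>w. 0 \<partial>M)"
   by (intro integral_cong_AE) auto
  then show ?thesis by simp
 next
  case False
  with c0 have c: "0 < c" by simp
  define N where "N W = distr (density M (\<lambda>w. ennreal (W w / c))) borel X" for W
  have rd: "real_distribution (N W)"
   and int_N: "\<And>g. g \<in> borel_measurable borel \<Longrightarrow> (\<integral>x. g x \<partial>N W) = (\<integral>w. W w * g (X w) \<partial>M) / (c::real)"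
   if W: "integrable M W" "\<And>w. 0 \<le> W w" "(\<integral>w. W w \<partial>M) = c" for W
  proof -
   have [measurable]: "W \<in> borel_measurable M" using W(1) by simp
   have "emeasure (density M (\<lambda>w. ennreal (W w / c))) (space M) = (\<integral>\<^sup>+w. ennreal (W w / c) \<partial>M)"
    by (subst emeasure_density) (auto intro!: nn_integral_cong)
   also have "\<dots> = ennreal (\<integral>w. W w / c \<partial>M)"
    using W c by (intro nn_integral_eq_integral) auto
   also have "\<dots> = 1" using W c by simp
   finally have "prob_space (density M (\<lambda>w. ennreal (W w / c)))" by (intro prob_spaceI) simp
   then interpret D: prob_space "density M (\<lambda>w. ennreal (W w / c))" .
   show "real_distribution (N W)" unfolding N_def by (rule D.real_distribution_distr) simp
   fix g :: "real \<Rightarrow> real" assume [measurable]: "g \<in> borel_measurable borel"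
   have "(\<integral>x. g x \<partial>N W) = (\<integral>w. g (X w) \<partial>density M (\<lambda>w. ennreal (W w / c)))"
    unfolding N_def by (rule integral_distr) auto
   also have "\<dots> = (\<integral>w. (W w / c) *\<^sub>R g (X w) \<partial>M)"
    by (rule integral_density) (use W c in auto)
   finally show "(\<integral>x. g x \<partial>N W) = (\<integral>w. W w * g (X w) \<partial>M) / (c::real)" by simp
  qed
  note P = rd[OF int(1) pm(1) c_def[symmetric]] int_N[OF int(1) pm(1) c_def[symmetric]]
  note N = rd[OF int(2) pm(2) c_eq] int_N[OF int(2) pm(2) c_eq]
  have char: "char L t = Complex (\<integral>x. cos (t * x) \<partial>L) (\<integral>x. sin (t * x) \<partial>L)" if "real_distribution L" for L t
  proof -
   interpret L: real_distribution L by fact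
   have "integrable L (\<lambda>x. iexp (t * x))"
    by (rule L.integrable_iexp) auto
   then show ?thesis unfolding char_def
    by (simp add: complex_eq_iff integral_Re[symmetric] integral_Im[symmetric] Re_exp Im_exp)
  qed
  have "(\<integral>x. cos (t * x) \<partial>N Vp) = (\<integral>x. cos (t * x) \<partial>N Vm)" "(\<integral>x. sin (t * x) \<partial>N Vp) = (\<integral>x. sin (t * x) \<partial>N Vm)" for t
   using cos0[of t] sin0[of t] split[of "\<lambda>w. cos (t * X w)"] split[of "\<lambda>w. sin (t * X w)"]
   by (simp_all add: P(2) N(2))
  then have "char (N Vp) = char (N Vm)" using char[OF P(1)] char[OF N(1)] by (intro ext) simp
  then have "N Vp = N Vm" by (intro Levy_uniqueness P(1) N(1))
  then have "(\<integral>x. indicator S x \<partial>N Vp) = (\<integral>x. indicator S x \<partial>N Vm :: real)" by simp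
  then have "(\<integral>w. Vp w * indicator S (X w) \<partial>M) = (\<integral>w. Vm w * indicator S (X w) \<partial>M)"
   using c by (simp add: P(2) N(2) del: integral_indicator Bochner_Integration.integral_indicator)
  then show ?thesis using split[of "\<lambda>w. indicator S (X w)"] by (simp add: indicator_def)
 qed
qed

text \<open>The one-dimensional uniqueness theorem is applied to one coordinate after the other; at each stage
  the phase \<open>c\<close> supplies both the cosine and the sine.\<close>

lemma integral_cylinder_eq_0:
 fixes X :: "'i \<Rightarrow> 'a \<Rightarrow> real"
 assumes "finite J" "integrable M Z" "\<And>j. j \<in> J \<Longrightarrow> X j \<in> borel_measurable M" "\<And>j. j \<in> J \<Longrightarrow> S j \<in> sets borel"
  and "\<And>\<theta> c. (\<integral>w. Z w * cos ((\<Sum>j\<in>J. \<theta> j * X j w) + c) \<partial>M) = 0"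
 shows "(\<integral>w. Z w * (\<Prod>j\<in>J. indicator (S j) (X j w)) \<partial>M) = 0"
 using assms
proof (induction J arbitrary: Z rule: finite_induct)
 case empty
 from empty(4)[of "\<lambda>_. 0" 0] show ?case by simp
next
 case (insert i J)
 note [measurable] = insert.prems(2,3)
 have Z: "integrable M Z" by fact
 have [measurable]: "Z \<in> borel_measurable M" using Z by simp
 have [measurable]: "X i \<in> borel_measurable M" "S i \<in> sets borel" using insert.prems by auto
 let ?Z = "\<lambda>w. Z w * indicator (S i) (X i w)"
 have "(\<integral>w. ?Z w * (\<Prod>j\<in>J. indicator (S j) (X j w)) \<partial>M) = 0"
 proof (rule insert.IH)
  show "integrable M ?Z" by (rule integrable_bounded_mult[OF Z, where C=1]) (auto simp: indicator_def)
  fix \<theta> c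
  define A where "A w = (\<Sum>j\<in>J. \<theta> j * X j w)" for w
  have [measurable]: "A \<in> borel_measurable M" unfolding A_def using insert.prems by (intro borel_measurable_sum) auto
  define V where "V w = Z w * cos (A w + c)" for w
  have all: "(\<integral>w. Z w * cos (A w + a * X i w + c) \<partial>M) = 0" for a c
  proof -
   have "(\<Sum>j\<in>insert i J. (\<theta>(i := a)) j * X j w) = A w + a * X i w" for w
    unfolding A_def using insert.hyps by (subst sum.insert) (auto intro!: sum.cong)
   then show ?thesis using insert.prems(4)[of "\<theta>(i := a)" c] by simp
  qed
  have int: "integrable M (\<lambda>w. Z w * cos (h w))" if "h \<in> borel_measurable M" for h
   by (rule integrable_bounded_mult[OF Z, where C=1]) (use that in auto)
  have V: "integrable M V" unfolding V_def by (rule int) measurable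
  have "(\<integral>w. V w * indicator (S i) (X i w) \<partial>M) = 0"
  proof (rule integral_eq_0_if_fourier_eq_0[OF V])
   fix a
   have "(\<integral>w. V w * cos (a * X i w) \<partial>M) =
    (\<integral>w. Z w * cos (A w + a * X i w + c) / 2 + Z w * cos (A w + (- a) * X i w + c) / 2 \<partial>M)"
    by (intro integral_eqI)
      (simp add: V_def cos_add cos_diff sin_add sin_diff field_simps)
   also have "\<dots> = 0"
    by (subst Bochner_Integration.integral_add) (use all[of a c] all[of "-a" c] in \<open>auto intro!: int integrable_divide_zero\<close>)
   finally show "(\<integral>w. V w * cos (a * X i w) \<partial>M) = 0" .
   \<comment> \<open>A shift of the phase turns the cosine into the sine.\<close>
  have shift: "cos (y + (c - pi / 2)) = sin (y + c)" for y
    by (simp add: cos_diff sin_add cos_add sin_diff algebra_simps)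
   have "(\<integral>w. V w * sin (a * X i w) \<partial>M) =
    (\<integral>w. Z w * cos (A w + a * X i w + (c - pi / 2)) / 2 - Z w * cos (A w + (- a) * X i w + (c - pi / 2)) / 2 \<partial>M)"
    unfolding shift by (intro integral_eqI)
      (simp add: V_def cos_add cos_diff sin_add sin_diff field_simps)
   also have "\<dots> = 0"
    by (subst Bochner_Integration.integral_diff) (use all[of a "c - pi/2"] all[of "-a" "c - pi/2"] in \<open>auto intro!: int integrable_divide_zero\<close>)
   finally show "(\<integral>w. V w * sin (a * X i w) \<partial>M) = 0" .
  qed auto
  then show "(\<integral>w. ?Z w * cos ((\<Sum>j\<in>J. \<theta> j * X j w) + c) \<partial>M) = 0"
   by (simp add: V_def A_def mult_ac)
 qed (use insert.prems in auto)
 then show ?case using insert.hyps by (simp add: mult.assoc)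
qed

text \<open>Independence of a single variable \<open>g\<close> from the \<open>\<sigma>\<close>-field of
  \<open>A\<close>, in the form in which it is used for increments of the noise.\<close>

lemma
 fixes Y g h
 assumes A: "space A = space M" "sets A \<subseteq> sets M" and [measurable]: "g \<in> borel_measurable M" "h \<in> borel_measurable borel"
  and ind: "\<And>H S. H \<in> sets A \<Longrightarrow> S \<in> sets borel \<Longrightarrow> prob (H \<inter> (g -` S \<inter> space M)) = prob H * prob (g -` S \<inter> space M)"
  and Y: "Y \<in> borel_measurable A" "integrable M (Y :: 'a \<Rightarrow> real)" and hg: "integrable M (\<lambda>w. h (g w :: real) :: real)"
 shows integrable_indep_mult: "integrable M (\<lambda>w. Y w * h (g w))"
  and integral_indep_mult: "(\<integral>w. Y w * h (g w) \<partial>M) = (\<integral>w. Y w \<partial>M) * (\<integral>w. h (g w) \<partial>M)"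
proof -
 have gh: "{(\<lambda>w. h (g w)) -` S \<inter> space M |S. S \<in> sets borel} \<subseteq> {g -` S \<inter> space M |S. S \<in> sets borel}"
 proof safe
  fix S :: "real set" assume "S \<in> sets borel"
  then have "h -` S \<in> sets borel" using measurable_sets[of h borel borel S] by simp
  then show "\<exists>T. (\<lambda>w. h (g w)) -` S \<inter> space M = g -` T \<inter> space M \<and> T \<in> sets borel"
   by (intro exI[of _ "h -` S"]) auto
 qed
 have YA: "{Y -` S \<inter> space M |S. S \<in> sets borel} \<subseteq> sets A"
 proof safe
  fix S :: "real set" assume "S \<in> sets borel"
  from measurable_sets[OF Y(1) this] show "Y -` S \<inter> space M \<in> sets A" by (simp add: A(1))
 qed
 have "indep_set (sigma_sets (space M) {Y -` S \<inter> space M |S. S \<in> sets borel})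
   (sigma_sets (space M) {(\<lambda>w. h (g w)) -` S \<inter> space M |S. S \<in> sets borel})"
 proof (rule indep_set_sigma_sets)
  show "indep_set {Y -` S \<inter> space M |S. S \<in> sets borel} {(\<lambda>w. h (g w)) -` S \<inter> space M |S. S \<in> sets borel}"
   unfolding indep_sets2_eq
  proof (intro conjI ballI)
   show "{Y -` S \<inter> space M |S. S \<in> sets borel} \<subseteq> events" using YA A(2) by (rule order_trans)
   show "{(\<lambda>w. h (g w)) -` S \<inter> space M |S. S \<in> sets borel} \<subseteq> events" by auto
   fix a b assume "a \<in> {Y -` S \<inter> space M |S. S \<in> sets borel}" "b \<in> {(\<lambda>w. h (g w)) -` S \<inter> space M |S. S \<in> sets borel}"
   then have b: "b \<in> {(\<lambda>w. h (g w)) -` S \<inter> space M |S. S \<in> sets borel}" and "a \<in> {Y -` S \<inter> space M |S. S \<in> sets borel}" by auto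
   from this(2) have "a \<in> sets A" using YA by (rule subsetD[rotated])
   moreover from b have "b \<in> {g -` S \<inter> space M |S. S \<in> sets borel}" using gh by (elim subsetD[rotated])
   ultimately show "prob (a \<inter> b) = prob a * prob b" using ind[of a] by auto
  qed
 qed (rule Int_stable_vimages)+
 moreover have "random_variable borel Y" using Y(2) by simp
 ultimately have "indep_var borel Y borel (\<lambda>w. h (g w))"
  unfolding indep_var_eq by simp
 from indep_var_lebesgue_integral[OF this Y(2) hg] indep_var_integrable[OF this Y(2) hg]
 show "integrable M (\<lambda>w. Y w * h (g w))"
  "(\<integral>w. Y w * h (g w) \<partial>M) = (\<integral>w. Y w \<partial>M) * (\<integral>w. h (g w) \<partial>M)" by auto
qed

text \<open>The degenerate case is included: a constant with mean zero vanishes.\<close>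

lemma centered_gaussian:
 assumes "gaussian_rv M X" "(\<integral>w. X w \<partial>M) = 0"
 shows "square_integrable M X"
  and "(\<integral>w. cos (X w + c) \<partial>M) = cos c * exp (- (\<integral>w. (X w)^2 \<partial>M) / 2)"
proof -
 have X [measurable]: "X \<in> borel_measurable M" using assms(1) by (simp add: gaussian_rv_def)
 from assms(1) consider (const) m where "AE w in M. X w = m"
  | (normal) m \<sigma> where "0 < \<sigma>" "distributed M lborel X (normal_density m \<sigma>)"
  unfolding gaussian_rv_def by blast
 then have "square_integrable M X \<and> (\<integral>w. cos (X w + c) \<partial>M) = cos c * exp (- (\<integral>w. (X w)^2 \<partial>M) / 2)"
 proof cases
  case const
  then have "(\<integral>w. X w \<partial>M) = (\<integral>w. m \<partial>M)" by (intro integral_cong_AE) auto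
  then have "m = 0" using assms(2) by (simp add: prob_space)
  with const have AE0: "AE w in M. X w = 0" by simp
  have "(nn2 M (\<lambda>w. X w)) = (\<integral>\<^sup>+w. 0 \<partial>M)"
   using AE0 by (intro nn_integral_cong_AE) (auto elim: eventually_mono)
  moreover have "(\<integral>w. (X w)^2 \<partial>M) = (\<integral>w. 0 \<partial>M)"
   using AE0 by (intro integral_cong_AE) (auto elim: eventually_mono)
  moreover have "(\<integral>w. cos (X w + c) \<partial>M) = (\<integral>w. cos c \<partial>M)"
   using AE0 by (intro integral_cong_AE) (auto elim: eventually_mono)
  ultimately show ?thesis by (simp add: square_integrable_iff_nn prob_space)
 next
  case normal
  have m: "m = 0" using normal_distributed_expectation[OF normal(1,2)] assms(2) by simp
  have var: "(\<integral>w. (X w)^2 \<partial>M) = \<sigma>^2"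
   using normal_distributed_variance[OF normal(1,2)] assms(2) by simp
  have sq: "square_integrable M X"
  proof -
   have "integrable M (\<lambda>w. (X w)^2)"
   proof (rule ccontr)
    assume "\<not> integrable M (\<lambda>w. (X w)^2)"
    then have "(\<integral>w. (X w)^2 \<partial>M) = 0" by (rule not_integrable_integral_eq)
    then show False using var normal(1) by simp
   qed
   then show ?thesis by (simp add: square_integrable_def)
  qed
  have N: "distributed M lborel (\<lambda>w. (X w - m) / \<sigma>) std_normal_density"
   using normal normal_standard_normal_convert[of \<sigma> X m] by simp
  have law: "distr M borel (\<lambda>w. X w / \<sigma>) = std_normal_distribution"
   using distributed_distr_eq_density[OF N] m by (simp cong: distr_cong)
  have "complex_of_real (exp (- \<sigma>\<^sup>2 / 2)) = (CLINT x|distr M borel (\<lambda>w. X w / \<sigma>). iexp (\<sigma> * x))"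
   unfolding law using char_std_normal_distribution by (simp add: char_def fun_eq_iff)
  also have "\<dots> = (CLINT w|M. iexp (\<sigma> * (X w / \<sigma>)))" by (rule integral_distr) auto
  also have "\<dots> = (CLINT w|M. iexp (X w))" using normal(1) by simp
  finally have char: "(CLINT w|M. iexp (X w)) = complex_of_real (exp (- \<sigma>\<^sup>2 / 2))" by simp
  have "integrable M (\<lambda>w. iexp (X w))" by (rule integrable_iexp) auto
  from integral_Re[OF this] integral_Im[OF this]
  have cs: "(\<integral>w. cos (X w) \<partial>M) = exp (- \<sigma>\<^sup>2 / 2)" "(\<integral>w. sin (X w) \<partial>M) = 0"
   unfolding char by (simp_all add: Re_exp Im_exp)
  have int: "integrable M (\<lambda>w. cos (X w))" "integrable M (\<lambda>w. sin (X w))"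
   by (auto intro!: integrable_const_bound[where B=1])
  have "(\<integral>w. cos (X w + c) \<partial>M) = (\<integral>w. cos (X w) * cos c - sin (X w) * sin c \<partial>M)"
   by (simp add: cos_add)
  also have "\<dots> = exp (- \<sigma>\<^sup>2 / 2) * cos c" using int cs by simp
  finally show ?thesis using sq var by simp
 qed
 then show "square_integrable M X"
  and "(\<integral>w. cos (X w + c) \<partial>M) = cos c * exp (- (\<integral>w. (X w)^2 \<partial>M) / 2)" by auto
qed

end

section \<open>Covariances of the noise\<close>

lemma (in prob_space) L1_le_norm2:
 assumes "square_integrable M X"
 shows "(\<integral>w. \<bar>X w\<bar> \<partial>M) \<le> norm2 M X" "integrable M X"
proof -
 have 1: "square_integrable M (\<lambda>w. \<bar>X w\<bar>)" "square_integrable M (\<lambda>w. 1)"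
  using assms by (auto simp: square_integrable_def)
 from L2_Cauchy_Schwarz[OF this] show "(\<integral>w. \<bar>X w\<bar> \<partial>M) \<le> norm2 M X"
  by (simp add: norm2_def prob_space)
 show "integrable M X" using assms unfolding square_integrable_def by (blast intro: square_integrable_imp_integrable)
qed

lemma vimage_generator_measurable:
 assumes "\<G> \<subseteq> Pow \<Omega>" "\<And>S. S \<in> sets N \<Longrightarrow> X -` S \<inter> \<Omega> \<in> \<G>" "X \<in> \<Omega> \<rightarrow> space N"
 shows "X \<in> measurable (sigma \<Omega> \<G>) N"
 using assms by (intro measurableI) (auto simp: space_measure_of)

locale noise = K_space I e f \<iota> fj + prob_space P
 for I :: "nat set" and e :: "nat \<Rightarrow> 'k::{real_inner, complete_space}"
  and f :: "real ^ 'n \<Rightarrow> real" and \<iota> :: "(real ^ 'n \<Rightarrow> real) \<Rightarrow> 'k" and fj :: "nat \<Rightarrow> real ^ 'n \<Rightarrow> real"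
  and P :: "'a measure" +
 fixes F :: "(real \<times> (real ^ 'n) \<Rightarrow> real) \<Rightarrow> 'a \<Rightarrow> real"
  and B :: "'k \<Rightarrow> real \<Rightarrow> 'a \<Rightarrow> real"
  and E :: "real \<Rightarrow> 'a \<Rightarrow> real"
 assumes complete: "complete_measure P"
  and gauss: "gaussian_noise P f F"
  and process: "noise_process P \<iota> F B"
  and indep: "independent_families P {0..} E test_functions F"
begin

abbreviation mean :: "('a \<Rightarrow> real) \<Rightarrow> real" (binder "\<E> " 10) where "mean X \<equiv> integral\<^sup>L P X"

lemma F_gaussian_sum:
 assumes "finite J" "\<And>j. j \<in> J \<Longrightarrow> \<phi> j \<in> test_functions"
 shows "gaussian_rv P (\<lambda>w. \<Sum>j\<in>J. \<theta> j * F (\<phi> j) w)"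
proof -
 have "(\<Sum>j\<in>J. \<theta> j * F (\<phi> j) w) = (\<Sum>\<psi>\<in>\<phi> ` J. (\<Sum>j\<in>{j \<in> J. \<phi> j = \<psi>}. \<theta> j) * F \<psi> w)" for w
  by (subst sum.image_gen[OF assms(1), of _ \<phi>]) (auto simp: sum_distrib_right intro!: sum.cong)
 moreover have "gaussian_rv P (\<lambda>w. \<Sum>\<psi>\<in>\<phi> ` J. (\<Sum>j\<in>{j \<in> J. \<phi> j = \<psi>}. \<theta> j) * F \<psi> w)"
 proof -
  have *: "\<And>S a. finite S \<and> S \<subseteq> test_functions \<Longrightarrow> gaussian_rv P (\<lambda>w. \<Sum>\<phi>\<in>S. a \<phi> * F \<phi> w)"
   using gauss unfolding gaussian_noise_def by blast
  show ?thesis by (rule *) (use assms in auto)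
 qed
 ultimately show ?thesis by simp
qed

lemma F_mean: "\<phi> \<in> test_functions \<Longrightarrow> (\<E> w. F \<phi> w) = 0"
 using gauss by (simp add: gaussian_noise_def)

lemma F_square_integrable: "\<phi> \<in> test_functions \<Longrightarrow> square_integrable P (F \<phi>)"
 using F_gaussian_sum[of "{()}" "\<lambda>_. \<phi>" "\<lambda>_. 1"] F_mean[of \<phi>] centered_gaussian(1)[of "F \<phi>"] by simp

text \<open>The phase \<open>c\<close> makes one real formula carry the full complex characteristic
  function.\<close>

lemma F_sum_cos:
 assumes "finite J" "\<And>j. j \<in> J \<Longrightarrow> \<phi> j \<in> test_functions"
 shows "(\<E> w. cos ((\<Sum>j\<in>J. \<theta> j * F (\<phi> j) w) + c)) = cos c * exp (- (\<E> w. (\<Sum>j\<in>J. \<theta> j * F (\<phi> j) w)^2) / 2)"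
proof (rule centered_gaussian(2)[OF F_gaussian_sum[OF assms]])
 have "integrable P (F (\<phi> j))" if "j \<in> J" for j
  using L1_le_norm2(2)[OF F_square_integrable[OF assms(2)[OF that]]] .
 then show "(\<E> w. (\<Sum>j\<in>J. \<theta> j * F (\<phi> j) w)) = 0"
  using F_mean assms(2) by (subst Bochner_Integration.integral_sum) auto
qed

abbreviation slice :: "(real \<times> (real ^ 'n) \<Rightarrow> real) \<Rightarrow> real \<Rightarrow> 'k" where
 "slice \<phi> s \<equiv> \<iota> (\<lambda>x. \<phi> (s, x))"

lemma test_function_measurable [measurable]: "\<phi> \<in> test_functions \<Longrightarrow> \<phi> \<in> borel_measurable (borel \<Otimes>\<^sub>M borel)"
 using smooth_imp_borel[of \<phi>] by (simp add: test_functions_def borel_prod)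

lemma slice_inner: "\<phi> \<in> test_functions \<Longrightarrow> \<psi> \<in> test_functions \<Longrightarrow>
  slice \<phi> s \<bullet> slice \<psi> s = kform f (\<lambda>x. \<phi> (s, x)) (\<lambda>x. \<psi> (s, x))"
 by (intro inner_iota test_function_slice_schwartz)

lemma slice_inner_measurable:
 assumes [measurable]: "\<phi> \<in> test_functions" "\<psi> \<in> test_functions"
 shows "(\<lambda>s. slice \<phi> s \<bullet> slice \<psi> s) \<in> borel_measurable borel"
 unfolding slice_inner[OF assms] kform_def by measurable

lemma slice_coordinate_measurable:
 assumes [measurable]: "\<phi> \<in> test_functions" shows "(\<lambda>s. slice \<phi> s \<bullet> k) \<in> borel_measurable borel"
proof (rule borel_measurable_LIMSEQ_real)
 show "(\<lambda>N. slice \<phi> s \<bullet> proj N k) \<longlonglongrightarrow> slice \<phi> s \<bullet> k" for s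
  by (intro tendsto_intros proj_tendsto)
 have [measurable]: "(\<lambda>s. slice \<phi> s \<bullet> e j) \<in> borel_measurable borel" if "j \<in> I" for j
 proof -
  have [measurable]: "fj j \<in> borel_measurable borel" by (rule schwartz_borel[OF fj_schwartz[OF that]])
  have "slice \<phi> s \<bullet> e j = kform f (\<lambda>x. \<phi> (s, x)) (fj j)" for s
   using that by (simp add: e_eq inner_iota test_function_slice_schwartz assms fj_schwartz)
  then have "(\<lambda>s. slice \<phi> s \<bullet> e j) = (\<lambda>s. kform f (\<lambda>x. \<phi> (s, x)) (fj j))" by (rule ext)
  moreover have "(\<lambda>s. kform f (\<lambda>x. \<phi> (s, x)) (fj j)) \<in> borel_measurable borel" by measurable
  ultimately show ?thesis by (simp only:)
 qed
 show "(\<lambda>s. slice \<phi> s \<bullet> proj N k) \<in> borel_measurable borel" for N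
  unfolding proj_def inner_sum_right inner_scaleR_right by (intro borel_measurable_sum borel_measurable_times borel_measurable_const) auto
qed

text \<open>The integrand whose noise integral is \<open>B k t\<close>.\<close>

definition H :: "'k \<Rightarrow> real \<Rightarrow> real \<Rightarrow> 'k" where "H k t s = indicator {0..t} s *\<^sub>R k"

lemma slice_H_norm_measurable:
 assumes [measurable]: "\<phi> \<in> test_functions"
 shows "(\<lambda>s. norm (slice \<phi> s - H k t s)) \<in> borel_measurable borel"
proof -
 have "norm (slice \<phi> s - H k t s) = sqrt (slice \<phi> s \<bullet> slice \<phi> s - 2 * indicator {0..t} s * (slice \<phi> s \<bullet> k) + indicator {0..t} s * (k \<bullet> k))" for s
  unfolding norm_eq_sqrt_inner H_def
  by (intro arg_cong[where f=sqrt]) (auto simp: inner_diff_left inner_diff_right inner_commute indicator_def)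
 then show ?thesis
  using slice_inner_measurable[OF assms assms] slice_coordinate_measurable[OF assms, of k] by simp
qed

abbreviation half :: "real measure" where "half \<equiv> restrict_space lborel {0..}"

lemma F_covariance:
 assumes "\<phi> \<in> test_functions" "\<psi> \<in> test_functions"
 shows "(\<E> w. F \<phi> w * F \<psi> w) = (\<integral>s. slice \<phi> s \<bullet> slice \<psi> s \<partial>half)"
 using gauss assms unfolding gaussian_noise_def
 by (simp add: slice_inner set_lebesgue_integral_def integral_restrict_space)

text \<open>The extension is an isometry, so the covariance is the inner product of the integrands in
  \<open>L\<^sup>2\<close> of the half line.\<close>

lemma noise_extension_covariance:
 assumes t: "0 \<le> t" "0 \<le> t'"
  and X: "noise_extension P \<iota> F (\<lambda>s. indicator {0..t} s *\<^sub>R k) X" and Y: "noise_extension P \<iota> F (\<lambda>s. indicator {0..t'} s *\<^sub>R l) Y"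
 shows "(\<E> w. X w * Y w) = min t t' * (k \<bullet> l)"
proof -
 obtain \<phi> where phi: "\<And>n. \<phi> n \<in> test_functions"
  "(\<lambda>n. \<integral>\<^sup>+s\<in>{0..}. ennreal ((norm (slice (\<phi> n) s - H k t s))^2) \<partial>lborel) \<longlonglongrightarrow> 0" "L2_limit P (\<lambda>n. F (\<phi> n)) X"
  using X unfolding noise_extension_def H_def by blast
 obtain \<psi> where psi: "\<And>n. \<psi> n \<in> test_functions"
  "(\<lambda>n. \<integral>\<^sup>+s\<in>{0..}. ennreal ((norm (slice (\<psi> n) s - H l t' s))^2) \<partial>lborel) \<longlonglongrightarrow> 0" "L2_limit P (\<lambda>n. F (\<psi> n)) Y"
  using Y unfolding noise_extension_def H_def by blast
 define \<alpha> where "\<alpha> n s = norm (slice (\<phi> n) s - H k t s)" for n s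
 define \<gamma> where "\<gamma> n s = norm (slice (\<psi> n) s - H l t' s)" for n s
 have [measurable]: "\<alpha> n \<in> borel_measurable borel" "\<gamma> n \<in> borel_measurable borel" for n
  unfolding \<alpha>_def \<gamma>_def using slice_H_norm_measurable phi(1) psi(1) by auto
 have mh: "h \<in> borel_measurable borel \<Longrightarrow> h \<in> borel_measurable half" for h :: "real \<Rightarrow> real"
  by (intro measurable_restrict_space1) simp
 have [measurable]: "\<alpha> n \<in> borel_measurable half" "\<gamma> n \<in> borel_measurable half" for n by (rule mh; measurable)+
 have nn: "(\<integral>\<^sup>+s\<in>{0..}. ennreal ((h s)^2) \<partial>lborel) = (\<integral>\<^sup>+s. ennreal ((h s)^2) \<partial>half)" for h :: "real \<Rightarrow> real"
  by (subst nn_integral_restrict_space) auto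
 have a0: "(\<lambda>n. \<integral>\<^sup>+s. ennreal ((\<alpha> n s)^2) \<partial>half) \<longlonglongrightarrow> 0" and g0: "(\<lambda>n. \<integral>\<^sup>+s. ennreal ((\<gamma> n s)^2) \<partial>half) \<longlonglongrightarrow> 0"
  using phi(2) psi(2) unfolding \<alpha>_def[symmetric] \<gamma>_def[symmetric] nn by auto
 have "\<forall>\<^sub>F n in sequentially. (\<integral>\<^sup>+s. ennreal ((\<alpha> n s)^2) \<partial>half) < 1" "\<forall>\<^sub>F n in sequentially. (\<integral>\<^sup>+s. ennreal ((\<gamma> n s)^2) \<partial>half) < 1"
  using order_tendstoD(2)[OF a0] order_tendstoD(2)[OF g0] by auto
 then have "\<forall>\<^sub>F n in sequentially. (\<integral>\<^sup>+s. ennreal ((\<alpha> n s)^2) \<partial>half) < 1 \<and> (\<integral>\<^sup>+s. ennreal ((\<gamma> n s)^2) \<partial>half) < 1"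
  by (rule eventually_conj)
 then obtain N where N: "\<And>n. N \<le> n \<Longrightarrow> (\<integral>\<^sup>+s. ennreal ((\<alpha> n s)^2) \<partial>half) < 1 \<and> (\<integral>\<^sup>+s. ennreal ((\<gamma> n s)^2) \<partial>half) < 1"
  unfolding eventually_sequentially by blast
 define A where "A n = \<alpha> (n + N)" for n
 define G where "G n = \<gamma> (n + N)" for n
 have sqA: "square_integrable half (A n)" and sqG: "square_integrable half (G n)" for n
  using N[of "n + N"] by (auto simp: square_integrable_iff_nn A_def G_def intro: order_less_trans)
 have sq0: "square_integrable half (\<lambda>_. 0)" by (simp add: square_integrable_def)
 have "(\<lambda>n. norm2 half (\<lambda>s. A n s - 0)) \<longlonglongrightarrow> 0"
  by (rule L2_limit_square_integrable(2)[of half A "\<lambda>_. 0"])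
    (use sqA LIMSEQ_ignore_initial_segment[OF a0, of N] in \<open>auto simp: L2_limit_def A_def\<close>)
 then have A0: "(\<lambda>n. norm2 half (A n)) \<longlonglongrightarrow> 0" by simp
 have "(\<lambda>n. norm2 half (\<lambda>s. G n s - 0)) \<longlonglongrightarrow> 0"
  by (rule L2_limit_square_integrable(2)[of half G "\<lambda>_. 0"])
    (use sqG LIMSEQ_ignore_initial_segment[OF g0, of N] in \<open>auto simp: L2_limit_def G_def\<close>)
 then have G0: "(\<lambda>n. norm2 half (G n)) \<longlonglongrightarrow> 0" by simp
 define h1 where "h1 s = norm k * indicator {0..t} s" for s :: real
 define h2 where "h2 s = norm l * indicator {0..t'} s" for s :: real
 have sq_ind: "square_integrable half (\<lambda>s. a * indicator {0..t} s)" for a t :: real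
 proof (rule square_integrable_scale)
  have "(\<integral>\<^sup>+s. ennreal ((indicator {0..t} s)^2) \<partial>half) = (\<integral>\<^sup>+s\<in>{0..}. ennreal ((indicator {0..t} s)^2) \<partial>lborel)"
   by (subst nn_integral_restrict_space) simp_all
  also have "\<dots> \<le> (\<integral>\<^sup>+s. indicator {0..t} s \<partial>lborel)"
   by (intro nn_integral_mono) (auto split: split_indicator)
  also have "\<dots> < \<infinity>" by (cases "0 \<le> t") auto
  finally show "square_integrable half (indicator {0..t})"
   unfolding square_integrable_iff_nn by (auto intro!: mh)
 qed
 have sqh1: "square_integrable half h1" and sqh2: "square_integrable half h2"
  unfolding h1_def h2_def by (rule sq_ind)+
 define p where "p n s = slice (\<phi> (n + N)) s \<bullet> slice (\<psi> (n + N)) s" for n s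
 define r where "r s = H k t s \<bullet> H l t' s" for s
 have [measurable]: "p n \<in> borel_measurable half" for n
  unfolding p_def by (rule mh, rule slice_inner_measurable) (use phi psi in auto)
 have r_eq: "r s = indicator {0..min t t'} s * (k \<bullet> l)" for s
  by (auto simp: r_def H_def split: split_indicator)
 have int_r: "integrable half r" "(\<integral>s. r s \<partial>half) = min t t' * (k \<bullet> l)"
 proof -
  have *: "has_bochner_integral lborel (indicator {0..min t t'} :: real \<Rightarrow> real) (min t t')"
  proof -
   have "has_bochner_integral lborel (indicator {0..m} :: real \<Rightarrow> real) m" if "0 \<le> m" for m :: real
    using has_bochner_integral_real_indicator[of "{0..m}" lborel] that by simp
   then show ?thesis using t by simp
  qed
  have "has_bochner_integral lborel (\<lambda>s. indicator {0..} s *\<^sub>R r s) (min t t' * (k \<bullet> l))"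
   using has_bochner_integral_mult_left[OF *, of "k \<bullet> l"]
   by (rule has_bochner_integral_cong[THEN iffD1, rotated -1]) (auto simp: r_eq split: split_indicator)
  then show "integrable half r" "(\<integral>s. r s \<partial>half) = min t t' * (k \<bullet> l)"
   by (auto simp: integrable_restrict_space integral_restrict_space has_bochner_integral_iff)
 qed
 have pr: "\<bar>p n s - r s\<bar> \<le> A n s * h2 s + A n s * G n s + h1 s * G n s" for n s
 proof -
  have "p n s - r s = (slice (\<phi> (n + N)) s - H k t s) \<bullet> H l t' s
    + (slice (\<phi> (n + N)) s - H k t s) \<bullet> (slice (\<psi> (n + N)) s - H l t' s) + H k t s \<bullet> (slice (\<psi> (n + N)) s - H l t' s)"
   by (simp add: p_def r_def algebra_simps)
  also have "\<bar>\<dots>\<bar> \<le> A n s * norm (H l t' s) + A n s * G n s + norm (H k t s) * G n s"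
   unfolding A_def G_def \<alpha>_def \<gamma>_def
   by (intro order_trans[OF abs_triangle_ineq] add_mono Cauchy_Schwarz_ineq2)
  finally show ?thesis by (simp add: h1_def h2_def H_def mult_ac)
 qed
 let ?D = "\<lambda>n s. A n s * h2 s + A n s * G n s + h1 s * G n s"
 have intD: "integrable half (?D n)" for n
  using square_integrable_mult sqA sqG sqh1 sqh2 by (intro Bochner_Integration.integrable_add) auto
 have int_pr: "integrable half (\<lambda>s. p n s - r s)" for n
 proof (rule integrable_dominated[OF intD[of n]])
  have "norm (p n s - r s) \<le> norm (?D n s)" for s
   unfolding real_norm_def by (rule order_trans[OF pr[of n s] abs_ge_self])
  then show "AE s in half. norm (p n s - r s) \<le> norm (?D n s)" by (rule AE_I2)
  show "(\<lambda>s. p n s - r s) \<in> borel_measurable half" using int_r(1) by simp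
 qed
 have "\<bar>(\<integral>s. p n s \<partial>half) - (\<integral>s. r s \<partial>half)\<bar> \<le> norm2 half (A n) * norm2 half h2 + norm2 half (A n) * norm2 half (G n) + norm2 half h1 * norm2 half (G n)" for n
 proof -
  have "integrable half (p n)" using Bochner_Integration.integrable_add[OF int_pr[of n] int_r(1)] by simp
  then have "\<bar>(\<integral>s. p n s \<partial>half) - (\<integral>s. r s \<partial>half)\<bar> = \<bar>\<integral>s. p n s - r s \<partial>half\<bar>" using int_r(1) by simp
  also have "\<dots> \<le> (\<integral>s. \<bar>p n s - r s\<bar> \<partial>half)" by (rule integral_abs_bound)
  also have "\<dots> \<le> (\<integral>s. ?D n s \<partial>half)" using int_pr intD pr by (intro integral_mono) auto
  also have "\<dots> = (\<integral>s. A n s * h2 s \<partial>half) + (\<integral>s. A n s * G n s \<partial>half) + (\<integral>s. h1 s * G n s \<partial>half)"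
   using square_integrable_mult[OF sqA sqh2] square_integrable_mult[OF sqA sqG] square_integrable_mult[OF sqh1 sqG] by simp
  also have "\<dots> \<le> norm2 half (A n) * norm2 half h2 + norm2 half (A n) * norm2 half (G n) + norm2 half h1 * norm2 half (G n)"
   using L2_Cauchy_Schwarz[OF sqA sqh2, of n] L2_Cauchy_Schwarz[OF sqA sqG, of n n] L2_Cauchy_Schwarz[OF sqh1 sqG, of n]
   by linarith
  finally show ?thesis .
 qed
 then have le: "norm ((\<integral>s. p n s \<partial>half) - (\<integral>s. r s \<partial>half)) \<le> norm2 half (A n) * norm2 half h2 + norm2 half (A n) * norm2 half (G n) + norm2 half h1 * norm2 half (G n)" for n
  by simp
 have "(\<lambda>n. norm2 half (A n) * norm2 half h2 + norm2 half (A n) * norm2 half (G n) + norm2 half h1 * norm2 half (G n)) \<longlonglongrightarrow> 0 * norm2 half h2 + 0 * 0 + norm2 half h1 * 0"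
  by (intro tendsto_intros A0 G0)
 then have "(\<lambda>n. norm2 half (A n) * norm2 half h2 + norm2 half (A n) * norm2 half (G n) + norm2 half h1 * norm2 half (G n)) \<longlonglongrightarrow> 0" by simp
 from Lim_null_comparison[OF always_eventually[OF allI[OF le]] this]
 have "(\<lambda>n. (\<integral>s. p n s \<partial>half)) \<longlonglongrightarrow> (\<integral>s. r s \<partial>half)" by (simp add: LIM_zero_iff)
 moreover have "(\<lambda>n. \<integral>w. F (\<phi> (n + N)) w * F (\<psi> (n + N)) w \<partial>P) \<longlonglongrightarrow> (\<E> w. X w * Y w)"
  by (rule LIMSEQ_ignore_initial_segment[OF L2_limit_product[OF phi(3) _ psi(3)]])
    (auto intro: F_square_integrable phi psi)
 ultimately show ?thesis
  using int_r(2) LIMSEQ_unique by (simp add: F_covariance phi psi p_def)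
qed

lemma B_extension: "0 \<le> t \<Longrightarrow> noise_extension P \<iota> F (\<lambda>s. indicator {0..t} s *\<^sub>R k) (B k t)"
 using process by (simp add: noise_process_def)

lemma B_approx:
 "0 \<le> t \<Longrightarrow> \<exists>\<phi>. (\<forall>n. \<phi> n \<in> test_functions) \<and> L2_limit P (\<lambda>n. F (\<phi> n)) (B k t)"
 using B_extension[of t k] unfolding noise_extension_def by blast

lemma B_square_integrable: "0 \<le> t \<Longrightarrow> square_integrable P (B k t)"
proof -
 assume "0 \<le> t"
 then obtain \<phi> where phi: "\<And>n. \<phi> n \<in> test_functions" "L2_limit P (\<lambda>n. F (\<phi> n)) (B k t)" using B_approx[of t k] by blast
 from L2_limit_square_integrable(1)[OF phi(2) F_square_integrable[OF phi(1)]] show ?thesis .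
qed

lemma B_covariance: "0 \<le> s \<Longrightarrow> 0 \<le> t \<Longrightarrow> (\<E> w. B k s w * B l t w) = min s t * (k \<bullet> l)"
 by (intro noise_extension_covariance B_extension)

lemma B_mean: "0 \<le> t \<Longrightarrow> (\<E> w. B k t w) = 0"
proof -
 assume "0 \<le> t"
 then obtain \<phi> where phi: "\<And>n. \<phi> n \<in> test_functions" "L2_limit P (\<lambda>n. F (\<phi> n)) (B k t)" using B_approx[of t k] by blast
 have "L2_limit P (\<lambda>n w. 1) (\<lambda>w. 1)" by (simp add: L2_limit_def)
 from L2_limit_product[OF phi(2) _ this] have "(\<lambda>n. \<integral>w. F (\<phi> n) w \<partial>P) \<longlonglongrightarrow> (\<E> w. B k t w)"
  using F_square_integrable[OF phi(1)] by (simp add: square_integrable_def)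
 then show ?thesis using F_mean[OF phi(1)] by (simp add: LIMSEQ_const_iff)
qed

lemma B_measurable [measurable]: "0 \<le> t \<Longrightarrow> B k t \<in> borel_measurable P"
 using B_square_integrable by (simp add: square_integrable_def)

definition \<sigma>E :: "'a measure" where
 "\<sigma>E = sigma (space P) {E s -` S \<inter> space P |s S. 0 \<le> s \<and> S \<in> sets borel}"

definition \<sigma>F :: "'a measure" where
 "\<sigma>F = sigma (space P) {F \<phi> -` S \<inter> space P |\<phi> S. \<phi> \<in> test_functions \<and> S \<in> sets borel}"

lemma space_\<sigma> [simp]: "space \<sigma>E = space P" "space \<sigma>F = space P"
 by (auto simp: \<sigma>E_def \<sigma>F_def space_measure_of_conv)

lemma indep_E_F: "indep_set (sets \<sigma>E) (sets \<sigma>F)"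
proof -
 have "sets \<sigma>E = sigma_sets (space P) {E s -` S \<inter> space P |s S. 0 \<le> s \<and> S \<in> sets borel}"
  "sets \<sigma>F = sigma_sets (space P) {F \<phi> -` S \<inter> space P |\<phi> S. \<phi> \<in> test_functions \<and> S \<in> sets borel}"
  unfolding \<sigma>E_def \<sigma>F_def by (auto intro!: sets_measure_of)
 then show ?thesis using indep unfolding independent_families_def by simp
qed

lemma sets_\<sigma>E: "sets \<sigma>E \<subseteq> sets P"
 using indep_setD_ev1[OF indep_E_F] .

lemma E_\<sigma>E_measurable: "0 \<le> s \<Longrightarrow> E s \<in> borel_measurable \<sigma>E"
 unfolding \<sigma>E_def by (rule vimage_generator_measurable) auto

lemma E_measurable [measurable]: "0 \<le> s \<Longrightarrow> E s \<in> borel_measurable P"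
 using measurable_sets[OF E_\<sigma>E_measurable] sets_\<sigma>E by (intro measurableI) auto

text \<open>Gaussianity of the noise process together with its independence of the time change, in one
  formula: the cosine of a sum is a limit of functions of \<open>F\<close>, and the event \<open>D\<close>
  depends on \<open>E\<close> only.\<close>

lemma B_sum_cos:
 assumes J: "finite J" and t: "\<And>j. j \<in> J \<Longrightarrow> 0 \<le> t j" and D: "D \<in> sets \<sigma>E"
 shows "(\<E> w. indicator D w * cos ((\<Sum>j\<in>J. \<theta> j * B (k j) (t j) w) + c))
  = prob D * (cos c * exp (- (\<E> w. (\<Sum>j\<in>J. \<theta> j * B (k j) (t j) w)^2) / 2))"
proof -
 have [measurable]: "D \<in> sets P" using D sets_\<sigma>E by blast
 have "\<forall>j\<in>J. \<exists>\<phi>. (\<forall>n. \<phi> n \<in> test_functions) \<and> L2_limit P (\<lambda>n. F (\<phi> n)) (B (k j) (t j))"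
  using t B_approx by blast
 then obtain \<phi> where phi: "\<And>j n. j \<in> J \<Longrightarrow> \<phi> j n \<in> test_functions"
  "\<And>j. j \<in> J \<Longrightarrow> L2_limit P (\<lambda>n. F (\<phi> j n)) (B (k j) (t j))" by metis
 define Y where "Y n w = (\<Sum>j\<in>J. \<theta> j * F (\<phi> j n) w)" for n w
 define Z where "Z w = (\<Sum>j\<in>J. \<theta> j * B (k j) (t j) w)" for w
 have lim: "L2_limit P Y Z" unfolding Y_def Z_def
  by (intro L2_limit_sum L2_limit_scale J phi)
 have sqY: "square_integrable P (Y n)" for n unfolding Y_def
  by (intro square_integrable_sum square_integrable_scale F_square_integrable phi)
 note Z = L2_limit_square_integrable[OF lim sqY]
 have [measurable]: "Y n \<in> borel_measurable P" "Z \<in> borel_measurable P" for n using sqY Z by auto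
 have YF: "Y n \<in> borel_measurable \<sigma>F" for n
  unfolding Y_def
 proof (intro borel_measurable_sum borel_measurable_times borel_measurable_const)
  show "F (\<phi> j n) \<in> borel_measurable \<sigma>F" if "j \<in> J" for j
   unfolding \<sigma>F_def using phi(1)[OF that] by (intro vimage_generator_measurable) auto
 qed
 have eq1: "(\<E> w. indicator D w * cos (Y n w + c)) = (\<E> w. indicator D w) * (\<E> w. cos (Y n w + c))" for n
 proof (rule integral_indep_mult[where A=\<sigma>E and g="Y n" and h="\<lambda>y. cos (y + c)"])
  fix H' S assume H': "H' \<in> sets \<sigma>E" and S: "S \<in> sets (borel :: real measure)"
  have "Y n -` S \<inter> space P \<in> sets \<sigma>F" using measurable_sets[OF YF S] by simp
  from indep_setD[OF indep_E_F H' this] show "prob (H' \<inter> (Y n -` S \<inter> space P)) = prob H' * prob (Y n -` S \<inter> space P)" .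
 qed (use D sets_\<sigma>E in \<open>auto intro!: integrable_const_bound[where B=1] borel_measurable_indicator\<close>)
 have eq2: "(\<E> w. cos (Y n w + c)) = cos c * exp (- (\<E> w. (Y n w)^2) / 2)" for n
  unfolding Y_def by (rule F_sum_cos[OF J phi(1)])
 have eq: "(\<E> w. indicator D w * cos (Y n w + c)) = prob D * (cos c * exp (- (norm2 P (Y n))\<^sup>2 / 2))" for n
  using eq1[of n] eq2[of n] by (simp add: norm2_sq)
 have "(\<lambda>n. prob D * (cos c * exp (- (norm2 P (Y n))\<^sup>2 / 2))) \<longlonglongrightarrow> prob D * (cos c * exp (- (norm2 P Z)\<^sup>2 / 2))"
  by (intro tendsto_intros L2_limit_norm2[OF lim sqY]) simp
 moreover have "(\<lambda>n. \<integral>w. indicator D w * cos (Y n w + c) \<partial>P) \<longlonglongrightarrow> (\<E> w. indicator D w * cos (Z w + c))"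
 proof -
  have int: "integrable P (\<lambda>w. indicator D w * cos (h w + c))" if [measurable]: "h \<in> borel_measurable P" for h
   by (rule integrable_const_bound[where B=1]) (auto split: split_indicator)
  have "norm ((\<E> w. indicator D w * cos (Y n w + c)) - (\<E> w. indicator D w * cos (Z w + c))) \<le> norm2 P (\<lambda>w. Y n w - Z w)" for n
  proof -
   have sqd: "square_integrable P (\<lambda>w. Y n w - Z w)" by (intro square_integrable_diff sqY Z)
   have "norm ((\<E> w. indicator D w * cos (Y n w + c)) - (\<E> w. indicator D w * cos (Z w + c)))
    = \<bar>\<integral>w. indicator D w * cos (Y n w + c) - indicator D w * cos (Z w + c) \<partial>P\<bar>"
    using int by simp
   also have "\<dots> \<le> (\<E> w. \<bar>indicator D w * cos (Y n w + c) - indicator D w * cos (Z w + c)\<bar>)"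
    by (rule integral_abs_bound)
   also have "\<dots> \<le> (\<E> w. \<bar>Y n w - Z w\<bar>)"
   proof (rule integral_mono)
    fix w
    have "\<bar>cos (Y n w + c) - cos (Z w + c)\<bar> \<le> \<bar>(Y n w + c) - (Z w + c)\<bar>"
    proof -
     have "\<bar>cos (Y n w + c) - cos (Z w + c)\<bar> = 2 * (\<bar>sin ((Y n w + c + (Z w + c)) / 2)\<bar> * \<bar>sin ((Z w + c - (Y n w + c)) / 2)\<bar>)"
      unfolding cos_diff_cos by (simp add: abs_mult)
     also have "\<dots> \<le> 2 * (1 * \<bar>(Z w + c - (Y n w + c)) / 2\<bar>)"
      by (intro mult_left_mono mult_mono abs_sin_le_one abs_sin_x_le_abs_x) auto
     finally show ?thesis by (simp add: abs_minus_commute)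
    qed
    then show "\<bar>indicator D w * cos (Y n w + c) - indicator D w * cos (Z w + c)\<bar> \<le> \<bar>Y n w - Z w\<bar>"
     by (auto split: split_indicator)
   qed (use int L1_le_norm2(2)[OF sqd] in auto)
   also have "\<dots> \<le> norm2 P (\<lambda>w. Y n w - Z w)" by (rule L1_le_norm2(1)[OF sqd])
   finally show ?thesis .
  qed
  from Lim_null_comparison[OF always_eventually[OF allI[OF this]] Z(2)] show ?thesis by (simp add: LIM_zero_iff)
 qed
 ultimately show ?thesis unfolding eq by (simp add: LIMSEQ_unique norm2_sq Z_def)
qed

section \<open>Independence of increments from the past\<close>

definition inc :: "'k \<Rightarrow> real \<Rightarrow> real \<Rightarrow> 'a \<Rightarrow> real" where
 "inc k u v w = B k v w - B k u w"

lemma inc_square_integrable: "0 \<le> u \<Longrightarrow> 0 \<le> v \<Longrightarrow> square_integrable P (inc k u v)"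
 unfolding inc_def[abs_def] by (intro square_integrable_diff B_square_integrable)

lemma inc_measurable [measurable]: "0 \<le> u \<Longrightarrow> 0 \<le> v \<Longrightarrow> inc k u v \<in> borel_measurable P"
 using inc_square_integrable by (simp add: square_integrable_def)

lemma B_mult_integrable: "0 \<le> s \<Longrightarrow> 0 \<le> t \<Longrightarrow> integrable P (\<lambda>w. B k s w * B l t w)"
 by (intro square_integrable_mult B_square_integrable)

lemma inc_variance: "0 \<le> u \<Longrightarrow> u \<le> v \<Longrightarrow> (\<E> w. inc k u v w * inc l u v w) = (v - u) * (k \<bullet> l)"
 unfolding inc_def by (simp add: left_diff_distrib right_diff_distrib B_mult_integrable B_covariance algebra_simps)

lemma inc_orthogonal: "0 \<le> s \<Longrightarrow> s \<le> u \<Longrightarrow> u \<le> v \<Longrightarrow> (\<E> w. B l s w * inc k u v w) = 0"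
 unfolding inc_def by (simp add: right_diff_distrib B_mult_integrable B_covariance)

text \<open>The noise in all directions \<open>k\<close> and not only along the basis, and the whole path of
  \<open>E\<close>: the time change may then be treated as known when increments of the noise are
  averaged.\<close>

definition past :: "real \<Rightarrow> 'a measure" where
 "past u = sigma (space P) ({B k s -` S \<inter> space P |k s S. 0 \<le> s \<and> s \<le> u \<and> S \<in> sets borel} \<union>
   {E s -` S \<inter> space P |s S. 0 \<le> s \<and> S \<in> sets borel} \<union> null_sets P)"

definition cylinders :: "real \<Rightarrow> 'a set set" where
 "cylinders u = {D \<inter> {w \<in> space P. \<forall>i\<in>J. B (fst i) (snd i) w \<in> S i} | D J S.
   D \<in> sets \<sigma>E \<and> finite J \<and> (\<forall>i\<in>J. 0 \<le> snd i \<and> snd i \<le> u \<and> S i \<in> sets borel)}"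

lemma space_past [simp]: "space (past u) = space P"
 by (simp add: past_def space_measure_of_conv)

lemma past_generator: "{B k s -` S \<inter> space P |k s S. 0 \<le> s \<and> s \<le> u \<and> S \<in> sets borel} \<union>
   {E s -` S \<inter> space P |s S. 0 \<le> s \<and> S \<in> sets borel} \<union> null_sets P \<subseteq> sets P"
 by (auto intro!: measurable_sets[of _ P borel])

lemma sets_past: "sets (past u) = sigma_sets (space P) ({B k s -` S \<inter> space P |k s S. 0 \<le> s \<and> s \<le> u \<and> S \<in> sets borel} \<union>
   {E s -` S \<inter> space P |s S. 0 \<le> s \<and> S \<in> sets borel} \<union> null_sets P)"
 unfolding past_def using past_generator[of u] sets.space_closed[of P] by (intro sets_measure_of) auto

lemma sets_past_le: "sets (past u) \<subseteq> sets P"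
 unfolding sets_past by (rule sets.sigma_sets_subset[OF past_generator])

lemma B_past:
 assumes "0 \<le> s" "s \<le> u"
 shows "B k s \<in> borel_measurable (past u)"
 unfolding past_def
proof (rule vimage_generator_measurable[OF order_trans[OF past_generator sets.space_closed]])
 fix S :: "real set" assume "S \<in> sets borel"
 then have "B k s -` S \<inter> space P \<in> {B k s -` S \<inter> space P |k s S. 0 \<le> s \<and> s \<le> u \<and> S \<in> sets borel}"
  using assms by (intro CollectI exI conjI) (rule refl | assumption)+
 then show "B k s -` S \<inter> space P \<in> {B k s -` S \<inter> space P |k s S. 0 \<le> s \<and> s \<le> u \<and> S \<in> sets borel} \<union>
   {E s -` S \<inter> space P |s S. 0 \<le> s \<and> S \<in> sets borel} \<union> null_sets P" by (intro UnI1)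
qed simp

text \<open>The increment is uncorrelated with the earlier noise, so the variance of the sum splits and the
  characteristic function factorises.\<close>

lemma cylinder_sum_cos:
 assumes uv: "0 \<le> u" "u \<le> v" and J: "finite J" "\<And>i. i \<in> J \<Longrightarrow> 0 \<le> snd i \<and> snd i \<le> u" and D: "D \<in> sets \<sigma>E"
 shows "(\<E> w. indicator D w * cos ((\<Sum>i\<in>J. \<theta> i * B (fst i) (snd i) w) + a * inc k u v w + c))
  = prob D * (cos c * exp (- (\<E> w. (\<Sum>i\<in>J. \<theta> i * B (fst i) (snd i) w)^2) / 2) * exp (- (a^2 * ((v - u) * (k \<bullet> k))) / 2))"
proof -
 define X where "X w = (\<Sum>i\<in>J. \<theta> i * B (fst i) (snd i) w)" for w
 let ?\<theta> = "case_sum \<theta> (\<lambda>b. if b then a else - a)"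
 let ?k = "case_sum fst (\<lambda>b. k)" and ?t = "case_sum snd (\<lambda>b. if b then v else u)"
 have sum: "(\<Sum>j\<in>J <+> (UNIV :: bool set). ?\<theta> j * B (?k j) (?t j) w) = X w + a * inc k u v w" for w
  using J(1) by (simp add: sum.Plus UNIV_bool X_def inc_def algebra_simps)
 have sqX: "square_integrable P X" unfolding X_def
  using J by (intro square_integrable_sum square_integrable_scale B_square_integrable) auto
 have sqZ: "square_integrable P (\<lambda>w. a * inc k u v w)"
  using uv by (intro square_integrable_scale inc_square_integrable) auto
 have sqB: "square_integrable P (\<lambda>w. \<theta> i * B (fst i) (snd i) w)" if "i \<in> J" for i
  using that J by (intro square_integrable_scale B_square_integrable) auto
 have "(\<E> w. X w * (a * inc k u v w)) = (\<E> w. (\<Sum>i\<in>J. (\<theta> i * B (fst i) (snd i) w) * (a * inc k u v w)))"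
  by (simp add: X_def sum_distrib_right)
 also have "\<dots> = (\<Sum>i\<in>J. \<integral>w. (\<theta> i * B (fst i) (snd i) w) * (a * inc k u v w) \<partial>P)"
  by (intro Bochner_Integration.integral_sum square_integrable_mult sqB sqZ)
 also have "\<dots> = (\<Sum>i\<in>J. (\<theta> i * a) * (\<E> w. B (fst i) (snd i) w * inc k u v w))"
  by (intro sum.cong refl) (simp add: mult_ac flip: integral_mult_right_zero)
 also have "\<dots> = 0" using J uv by (intro sum.neutral) (auto simp: inc_orthogonal)
 finally have XZ: "(\<E> w. X w * (a * inc k u v w)) = 0" .
 have "(\<E> w. (X w + a * inc k u v w)^2) = (\<E> w. (X w)^2 + 2 * (X w * (a * inc k u v w)) + (a * inc k u v w)^2)"
  by (intro integral_eqI) (simp add: power2_sum)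
 also have "\<dots> = (\<E> w. (X w)^2) + (\<E> w. (a * inc k u v w)^2)"
  using sqX sqZ square_integrable_mult[OF sqX sqZ] XZ unfolding square_integrable_def by simp
 also have "(\<E> w. (a * inc k u v w)^2) = a^2 * ((v - u) * (k \<bullet> k))"
  using inc_variance[OF uv, of k k] by (simp add: power_mult_distrib) (simp add: power2_eq_square)
 finally have var: "(\<E> w. (X w + a * inc k u v w)^2) = (\<E> w. (X w)^2) + a^2 * ((v - u) * (k \<bullet> k))" .
 have "(\<E> w. indicator D w * cos ((\<Sum>j\<in>J <+> (UNIV :: bool set). ?\<theta> j * B (?k j) (?t j) w) + c))
  = prob D * (cos c * exp (- (\<E> w. (\<Sum>j\<in>J <+> (UNIV :: bool set). ?\<theta> j * B (?k j) (?t j) w)^2) / 2))"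
  by (rule B_sum_cos) (use J D uv in auto)
 then show ?thesis unfolding sum var X_def[symmetric]
  by (simp add: mult_exp_exp add_divide_distrib[symmetric] mult.assoc)
qed

text \<open>The uniqueness theorem is used twice: for the earlier values of the noise, which turns the
  factorisation of characteristic functions into one for the event, and then for the increment.\<close>

lemma cylinder_indep:
 assumes H: "H' \<in> cylinders u" and uv: "0 \<le> u" "u \<le> v" and S' [measurable]: "S' \<in> sets borel"
 shows "prob (H' \<inter> (inc k u v -` S' \<inter> space P)) = prob H' * prob (inc k u v -` S' \<inter> space P)"
proof -
 obtain D J S where DJS: "D \<in> sets \<sigma>E" "finite J" "\<And>i. i \<in> J \<Longrightarrow> 0 \<le> snd i \<and> snd i \<le> u \<and> S i \<in> sets borel"
  "H' = D \<inter> {w \<in> space P. \<forall>i\<in>J. B (fst i) (snd i) w \<in> S i}"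
  using H unfolding cylinders_def by blast
 have [measurable]: "D \<in> sets P" using DJS(1) sets_\<sigma>E by blast
 define X where "X i = B (fst i) (snd i)" for i :: "'k \<times> real"
 define Z where "Z = inc k u v"
 have [measurable]: "Z \<in> borel_measurable P" unfolding Z_def using uv by (intro inc_measurable) auto
 have mX: "X i \<in> borel_measurable P" if "i \<in> J" for i unfolding X_def using DJS(3)[OF that] by auto
 define V where "V = (v - u) * (k \<bullet> k)"
 define Pr where "Pr w = (\<Prod>i\<in>J. indicator (S i) (X i w) :: real)" for w
 have mPi [measurable]: "Pr \<in> borel_measurable P"
  unfolding Pr_def using mX DJS(3) by (intro borel_measurable_prod) (auto intro!: measurable_compose[OF mX borel_measurable_indicator])
 have Pi01: "Pr w = (if \<forall>i\<in>J. X i w \<in> S i then 1 else 0)" for w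
 proof (cases "\<forall>i\<in>J. X i w \<in> S i")
  case False
  then obtain i where "i \<in> J" "X i w \<notin> S i" by blast
  then have "\<exists>i\<in>J. indicator (S i) (X i w) = (0 :: real)" by (intro bexI[of _ i]) auto
  from prod_zero[OF DJS(2) this] show ?thesis using False by (simp add: Pr_def)
 qed (simp add: Pr_def)
 have ind_H: "indicator H' w = indicator D w * Pr w" if "w \<in> space P" for w
  using that by (auto simp: DJS(4) Pi01 X_def split: split_indicator)
 have "{w \<in> space P. Pr w = 1} \<in> sets P" by measurable
 moreover have "H' = D \<inter> {w \<in> space P. Pr w = 1}" by (auto simp: DJS(4) Pi01 X_def)
 ultimately have [measurable]: "H' \<in> sets P" by auto
 have cs: "(\<E> w. indicator D w * cos ((\<Sum>i\<in>J. \<theta> i * X i w) + a * Z w + c))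
  = prob D * (cos c * exp (- (\<E> w. (\<Sum>i\<in>J. \<theta> i * X i w)^2) / 2) * exp (- (a^2 * V) / 2))" for \<theta> a c
  unfolding X_def Z_def V_def by (rule cylinder_sum_cos) (use uv DJS in auto)
 have int: "integrable P (\<lambda>w. indicator D w * cos (h w))" if [measurable]: "h \<in> borel_measurable P" for h :: "'a \<Rightarrow> real"
  by (rule integrable_const_bound[where B=1]) (auto split: split_indicator)
 have mA: "(\<lambda>w. \<Sum>i\<in>J. \<theta> i * X i w) \<in> borel_measurable P" for \<theta>
  using mX by (intro borel_measurable_sum) auto
 have cos_part: "(\<E> w. (indicator D w * (cos (a * Z w) - exp (- (a^2 * V) / 2))) * Pr w) = 0" for a
  unfolding Pr_def
 proof (rule integral_cylinder_eq_0[OF DJS(2)])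
  show "integrable P (\<lambda>w. indicator D w * (cos (a * Z w) - exp (- (a^2 * V) / 2)))"
   unfolding right_diff_distrib by (intro Bochner_Integration.integrable_diff int integrable_mult_left) (auto simp: less_top[symmetric])
  fix \<theta> c
  define A where "A w = (\<Sum>i\<in>J. \<theta> i * X i w)" for w
  have [measurable]: "A \<in> borel_measurable P" unfolding A_def by (rule mA)
  have "(\<E> w. indicator D w * (cos (a * Z w) - exp (- (a^2 * V) / 2)) * cos (A w + c))
   = (\<integral>w. (indicator D w * cos (A w + a * Z w + c) + indicator D w * cos (A w + (- a) * Z w + c)) / 2
     - exp (- (a^2 * V) / 2) * (indicator D w * cos (A w + 0 * Z w + c)) \<partial>P)"
   by (intro integral_eqI) (simp add: cos_add cos_diff sin_add sin_diff field_simps)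
  also have "\<dots> = ((\<E> w. indicator D w * cos (A w + a * Z w + c)) + (\<E> w. indicator D w * cos (A w + (- a) * Z w + c))) / 2
    - exp (- (a^2 * V) / 2) * (\<E> w. indicator D w * cos (A w + 0 * Z w + c))"
   using int[of "\<lambda>w. A w + a * Z w + c"] int[of "\<lambda>w. A w + (- a) * Z w + c"] int[of "\<lambda>w. A w + 0 * Z w + c"]
   by simp
  also have "\<dots> = 0" unfolding A_def cs by simp
  finally show "(\<E> w. indicator D w * (cos (a * Z w) - exp (- (a^2 * V) / 2)) * cos ((\<Sum>i\<in>J. \<theta> i * X i w) + c)) = 0"
   by (simp add: A_def)
 qed (use mX DJS in auto)
 have sin_part: "(\<E> w. (indicator D w * sin (a * Z w)) * Pr w) = 0" for a
  unfolding Pr_def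
 proof (rule integral_cylinder_eq_0[OF DJS(2)])
  show "integrable P (\<lambda>w. indicator D w * sin (a * Z w))"
   by (rule integrable_const_bound[where B=1]) (auto split: split_indicator)
  fix \<theta> c
  define A where "A w = (\<Sum>i\<in>J. \<theta> i * X i w)" for w
  have [measurable]: "A \<in> borel_measurable P" unfolding A_def by (rule mA)
  have shift: "cos (y + (c - pi / 2)) = sin (y + c)" for y
   by (simp add: cos_diff sin_add cos_add sin_diff algebra_simps)
  have "(\<E> w. indicator D w * sin (a * Z w) * cos (A w + c))
   = (\<E> w. (indicator D w * cos (A w + a * Z w + (c - pi / 2)) - indicator D w * cos (A w + (- a) * Z w + (c - pi / 2))) / 2)"
   unfolding shift by (intro integral_eqI) (simp add: cos_add cos_diff sin_add sin_diff field_simps)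
  also have "\<dots> = ((\<E> w. indicator D w * cos (A w + a * Z w + (c - pi / 2))) - (\<E> w. indicator D w * cos (A w + (- a) * Z w + (c - pi / 2)))) / 2"
   using int[of "\<lambda>w. A w + a * Z w + (c - pi / 2)"] int[of "\<lambda>w. A w + (- a) * Z w + (c - pi / 2)"] by simp
  also have "\<dots> = 0" unfolding A_def cs by simp
  finally show "(\<E> w. indicator D w * sin (a * Z w) * cos ((\<Sum>i\<in>J. \<theta> i * X i w) + c)) = 0"
   by (simp add: A_def)
 qed (use mX DJS in auto)
 have top: "space P \<in> sets \<sigma>E" using sets.top[of \<sigma>E] by simp
 have cosZ: "(\<E> w. cos (a * Z w)) = exp (- (a^2 * V) / 2)" for a
 proof -
  have "(\<E> w. cos (a * Z w)) = (\<E> w. indicator (space P) w * cos ((\<Sum>i\<in>{}. 0 * B (fst i) (snd i) w) + a * inc k u v w + 0))"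
   by (intro integral_eqI) (simp add: Z_def)
  also have "\<dots> = exp (- (a^2 * V) / 2)"
   by (subst cylinder_sum_cos[OF uv _ _ top]) (auto simp: V_def prob_space)
  finally show ?thesis .
 qed
 have sinZ: "(\<E> w. sin (a * Z w)) = 0" for a
 proof -
  have "(\<E> w. sin (a * Z w)) = (\<E> w. indicator (space P) w * cos ((\<Sum>i\<in>{}. 0 * B (fst i) (snd i) w) + a * inc k u v w + (- pi / 2)))"
   by (intro integral_eqI) (simp add: Z_def cos_diff)
  also have "\<dots> = 0"
   by (subst cylinder_sum_cos[OF uv _ _ top]) auto
  finally show ?thesis .
 qed
 define W where "W w = indicator H' w - prob H'" for w
 have intH: "integrable P (\<lambda>w. indicator H' w * g (a * Z w))" if [measurable]: "g \<in> borel_measurable borel" and "\<And>x. \<bar>g x\<bar> \<le> 1" for g :: "real \<Rightarrow> real" and a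
  by (rule integrable_const_bound[where B=1]) (use that(2) in \<open>auto split: split_indicator\<close>)
 have intg: "integrable P (\<lambda>w. g (a * Z w))" if [measurable]: "g \<in> borel_measurable borel" and "\<And>x. \<bar>g x\<bar> \<le> 1" for g :: "real \<Rightarrow> real" and a
  by (rule integrable_const_bound[where B=1]) (use that(2) in auto)
 have W_int: "(\<E> w. W w * g (a * Z w)) = (\<E> w. indicator H' w * g (a * Z w)) - prob H' * (\<E> w. g (a * Z w))"
  if "g \<in> borel_measurable borel" "\<And>x. \<bar>g x\<bar> \<le> 1" for g :: "real \<Rightarrow> real" and a
  using intH[OF that, of a] intg[OF that, of a] unfolding W_def by (simp add: left_diff_distrib)
 have "(\<E> w. W w * indicator S' (Z w)) = 0"
 proof (rule integral_eq_0_if_fourier_eq_0)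
  show "integrable P W" unfolding W_def by (auto simp: less_top[symmetric])
  fix a
  have "(\<E> w. indicator H' w * cos (a * Z w)) - exp (- (a^2 * V) / 2) * prob H'
    = (\<E> w. indicator H' w * cos (a * Z w) - exp (- (a^2 * V) / 2) * indicator H' w)"
   using intH[of cos a] by (simp add: less_top[symmetric])
  also have "\<dots> = (\<E> w. (indicator D w * (cos (a * Z w) - exp (- (a^2 * V) / 2))) * Pr w)"
   by (intro integral_eqI) (simp add: ind_H algebra_simps)
  finally show "(\<E> w. W w * cos (a * Z w)) = 0"
   using W_int[of cos a] cos_part[of a] by (simp add: cosZ)
  have "(\<E> w. indicator H' w * sin (a * Z w)) = (\<E> w. (indicator D w * sin (a * Z w)) * Pr w)"
   by (intro integral_eqI) (simp add: ind_H algebra_simps)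
  then show "(\<E> w. W w * sin (a * Z w)) = 0"
   using W_int[of sin a] sin_part[of a] by (simp add: sinZ)
 qed auto
 moreover have "(\<E> w. W w * indicator S' (1 * Z w)) = (\<E> w. indicator H' w * indicator S' (1 * Z w)) - prob H' * (\<E> w. indicator S' (1 * Z w))"
  by (rule W_int) (auto simp: indicator_def)
 moreover have "(\<E> w. indicator H' w * indicator S' (1 * Z w)) = prob (H' \<inter> (Z -` S' \<inter> space P))"
 proof -
  have "(\<E> w. indicator H' w * indicator S' (1 * Z w)) = (\<integral>w. indicator (H' \<inter> (Z -` S' \<inter> space P)) w \<partial>P :: real)"
   by (intro integral_eqI) (auto split: split_indicator)
  then show ?thesis by simp
 qed
 moreover have "(\<E> w. indicator S' (1 * Z w)) = prob (Z -` S' \<inter> space P)"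
 proof -
  have "(\<E> w. indicator S' (1 * Z w)) = (\<integral>w. indicator (Z -` S' \<inter> space P) w \<partial>P :: real)"
   by (intro integral_eqI) (auto split: split_indicator)
  then show ?thesis by simp
 qed
 ultimately show ?thesis by (simp add: Z_def)
qed

lemma cylinders_Int: "A \<in> cylinders u \<Longrightarrow> C \<in> cylinders u \<Longrightarrow> A \<inter> C \<in> cylinders u"
proof -
 assume "A \<in> cylinders u" "C \<in> cylinders u"
 then obtain D J S D' J' S' where A: "D \<in> sets \<sigma>E" "finite J" "\<forall>i\<in>J. 0 \<le> snd i \<and> snd i \<le> u \<and> S i \<in> sets borel"
   "A = D \<inter> {w \<in> space P. \<forall>i\<in>J. B (fst i) (snd i) w \<in> S i}"
  and C: "D' \<in> sets \<sigma>E" "finite J'" "\<forall>i\<in>J'. 0 \<le> snd i \<and> snd i \<le> u \<and> S' i \<in> sets borel"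
   "C = D' \<inter> {w \<in> space P. \<forall>i\<in>J'. B (fst i) (snd i) w \<in> S' i}"
  unfolding cylinders_def by blast
 let ?S = "\<lambda>i. (if i \<in> J then S i else UNIV) \<inter> (if i \<in> J' then S' i else UNIV)"
 have "A \<inter> C = (D \<inter> D') \<inter> {w \<in> space P. \<forall>i\<in>J \<union> J'. B (fst i) (snd i) w \<in> ?S i}"
  unfolding A(4) C(4) by auto
 moreover have "D \<inter> D' \<in> sets \<sigma>E" using A C by auto
 moreover have "\<forall>i\<in>J \<union> J'. 0 \<le> snd i \<and> snd i \<le> u \<and> ?S i \<in> sets borel" using A(3) C(3) by auto
 moreover have "finite (J \<union> J')" using A(2) C(2) by simp
 ultimately show ?thesis unfolding cylinders_def by (intro CollectI exI conjI)
qed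

lemma cylinder_sets: "A \<in> cylinders u \<Longrightarrow> A \<in> sets P"
proof -
 assume "A \<in> cylinders u"
 then obtain D J S where A: "D \<in> sets \<sigma>E" "finite J" "\<forall>i\<in>J. 0 \<le> snd i \<and> snd i \<le> u \<and> S i \<in> sets borel"
   "A = D \<inter> {w \<in> space P. \<forall>i\<in>J. B (fst i) (snd i) w \<in> S i}"
  unfolding cylinders_def by blast
 have "{w \<in> space P. \<forall>i\<in>J. B (fst i) (snd i) w \<in> S i} \<in> sets P"
 proof (rule sets.sets_Collect_finite_All[OF _ A(2)])
  fix i assume "i \<in> J"
  with A(3) have i: "0 \<le> snd i" "S i \<in> sets borel" by auto
  have "{w \<in> space P. B (fst i) (snd i) w \<in> S i} = B (fst i) (snd i) -` S i \<inter> space P" by auto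
  then show "{w \<in> space P. B (fst i) (snd i) w \<in> S i} \<in> sets P"
   using measurable_sets[OF B_measurable[OF i(1)] i(2)] by simp
 qed
 then show ?thesis using A(1,4) sets_\<sigma>E by auto
qed

text \<open>Cylinder events and null sets form an intersection-stable generator of the past.\<close>

lemma past_indep:
 assumes uv: "0 \<le> u" "u \<le> v" and H: "H' \<in> sets (past u)" and S: "S' \<in> sets borel"
 shows "prob (H' \<inter> (inc k u v -` S' \<inter> space P)) = prob H' * prob (inc k u v -` S' \<inter> space P)"
proof -
 let ?Z = "inc k u v" and ?C = "cylinders u \<union> null_sets P"
 have [measurable]: "?Z \<in> borel_measurable P" using uv by auto
 have "indep_set (sigma_sets (space P) ?C) (sigma_sets (space P) {?Z -` S \<inter> space P |S. S \<in> sets borel})"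
 proof (rule indep_set_sigma_sets)
  show "indep_set ?C {?Z -` S \<inter> space P |S. S \<in> sets borel}"
   unfolding indep_sets2_eq
  proof (intro conjI ballI)
   show "?C \<subseteq> events" using cylinder_sets by auto
   show "{?Z -` S \<inter> space P |S. S \<in> sets borel} \<subseteq> events" by auto
   fix a b assume a: "a \<in> ?C" and "b \<in> {?Z -` S \<inter> space P |S. S \<in> sets borel}"
   then obtain S where S: "S \<in> sets borel" "b = ?Z -` S \<inter> space P" by auto
   then have b: "b \<in> sets P" by auto
   from a show "prob (a \<inter> b) = prob a * prob b"
   proof
    assume "a \<in> cylinders u"
    then show ?thesis using cylinder_indep[OF _ uv S(1)] S(2) by simp
   next
    assume a: "a \<in> null_sets P"
    then have "a \<inter> b \<in> null_sets P" using b by (rule null_set_Int2)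
    then show ?thesis using a by (simp add: measure_eq_0_null_sets)
   qed
  qed
  show "Int_stable ?C"
  proof (rule Int_stableI)
   fix a b assume ab: "a \<in> ?C" "b \<in> ?C"
   then have m: "a \<in> sets P" "b \<in> sets P" using cylinder_sets by auto
   show "a \<inter> b \<in> ?C"
   proof (cases "a \<in> null_sets P \<or> b \<in> null_sets P")
    case True
    then show ?thesis using m null_set_Int1[of b P a] null_set_Int2[of a P b] by auto
   next
    case False
    then show ?thesis using ab cylinders_Int by auto
   qed
  qed
  show "Int_stable {?Z -` S \<inter> space P |S. S \<in> sets borel}" by (rule Int_stable_vimages)
 qed
 moreover have "sets (past u) \<subseteq> sigma_sets (space P) ?C"
  unfolding sets_past
 proof (rule sigma_sets_mono, intro Un_least)
  show "{B k s -` S \<inter> space P |k s S. 0 \<le> s \<and> s \<le> u \<and> S \<in> sets borel} \<subseteq> sigma_sets (space P) ?C"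
  proof safe
   fix k and s :: real and S :: "real set" assume s: "0 \<le> s" "s \<le> u" "S \<in> sets borel"
   have "B k s -` S \<inter> space P = space P \<inter> {w \<in> space P. \<forall>i\<in>{(k, s)}. B (fst i) (snd i) w \<in> S}" by auto
   moreover have "space P \<in> sets \<sigma>E" using sets.top[of \<sigma>E] by simp
   ultimately have "B k s -` S \<inter> space P \<in> cylinders u"
    unfolding cylinders_def using s by (intro CollectI exI[of _ "space P"] exI[of _ "{(k, s)}"] exI[of _ "\<lambda>_. S"]) auto
   then show "B k s -` S \<inter> space P \<in> sigma_sets (space P) ?C" by (intro sigma_sets.Basic) auto
  qed
  show "{E s -` S \<inter> space P |s S. 0 \<le> s \<and> S \<in> sets borel} \<subseteq> sigma_sets (space P) ?C"
  proof safe
   fix s :: real and S :: "real set" assume s: "0 \<le> s" "S \<in> sets borel"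
   have "E s -` S \<inter> space P \<in> sets \<sigma>E" using measurable_sets[OF E_\<sigma>E_measurable[OF s(1)] s(2)] by simp
   then have "E s -` S \<inter> space P \<in> cylinders u"
    unfolding cylinders_def by (intro CollectI exI[of _ "E s -` S \<inter> space P"] exI[of _ "{}"]) auto
   then show "E s -` S \<inter> space P \<in> sigma_sets (space P) ?C" by (intro sigma_sets.Basic) auto
  qed
  show "null_sets P \<subseteq> sigma_sets (space P) ?C" by auto
 qed
 moreover have "inc k u v -` S' \<inter> space P \<in> sigma_sets (space P) {?Z -` S \<inter> space P |S. S \<in> sets borel}"
  using S by (intro sigma_sets.Basic) blast
 ultimately show ?thesis using H by (intro indep_setD[where A="sigma_sets (space P) ?C"]) auto
qed

lemma
 assumes uv: "0 \<le> u" "u \<le> v" and Y: "Y \<in> borel_measurable (past u)" "integrable P Y"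
 shows past_inc_integrable: "integrable P (\<lambda>w. Y w * inc k u v w)"
  and past_inc: "(\<E> w. Y w * inc k u v w) = 0"
  and past_inc_sq_integrable: "integrable P (\<lambda>w. Y w * (inc k u v w)^2)"
  and past_inc_sq: "(\<E> w. Y w * (inc k u v w)^2) = (\<E> w. Y w) * ((v - u) * (k \<bullet> k))"
proof -
 have sq: "square_integrable P (inc k u v)" using uv by (intro inc_square_integrable) auto
 have m: "inc k u v \<in> borel_measurable P" using sq by (simp add: square_integrable_def)
 have i2: "integrable P (\<lambda>w. (inc k u v w)^2)" using sq by (simp add: square_integrable_def)
 have i1: "integrable P (inc k u v)" using L1_le_norm2(2)[OF sq] .
 have mean: "(\<E> w. inc k u v w) = 0"
  using uv L1_le_norm2(2)[OF B_square_integrable] by (simp add: inc_def B_mean)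
 have var: "(\<E> w. (inc k u v w)^2) = (v - u) * (k \<bullet> k)"
  using inc_variance[OF uv, of k k] by (simp add: power2_eq_square)
 have R1: "integrable P (\<lambda>w. Y w * h (inc k u v w))"
  and R2: "(\<E> w. Y w * h (inc k u v w)) = (\<E> w. Y w) * (\<E> w. h (inc k u v w))"
  if h: "h \<in> borel_measurable borel" "integrable P (\<lambda>w. h (inc k u v w))" for h :: "real \<Rightarrow> real"
  by (rule integrable_indep_mult[OF space_past sets_past_le m h(1) _ Y h(2)], rule past_indep[OF uv], assumption+)
    (rule integral_indep_mult[OF space_past sets_past_le m h(1) _ Y h(2)], rule past_indep[OF uv], assumption+)
 show "integrable P (\<lambda>w. Y w * inc k u v w)" using R1[of "\<lambda>x. x"] i1 by simp
 show "(\<E> w. Y w * inc k u v w) = 0" using R2[of "\<lambda>x. x"] i1 mean by simp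
 show "integrable P (\<lambda>w. Y w * (inc k u v w)^2)" using R1[of "\<lambda>x. x^2"] i2 by simp
 show "(\<E> w. Y w * (inc k u v w)^2) = (\<E> w. Y w) * ((v - u) * (k \<bullet> k))"
  using R2[of "\<lambda>x. x^2"] i2 var by simp
qed

text \<open>The difference has second moment zero by the covariance formula.\<close>

lemma B_linear:
 assumes "0 \<le> t"
 shows "AE w in P. B (a *\<^sub>R k + b *\<^sub>R l) t w = a * B k t w + b * B l t w"
proof -
 let ?m = "a *\<^sub>R k + b *\<^sub>R l"
 have sq: "square_integrable P (\<lambda>w. B ?m t w - (a * B k t w + b * B l t w))"
  by (intro square_integrable_diff square_integrable_add square_integrable_scale B_square_integrable assms)
 have [simp]: "integrable P (\<lambda>w. B k t w * B l t w)" for k l by (rule B_mult_integrable[OF assms assms])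
 have "(\<E> w. (B ?m t w - (a * B k t w + b * B l t w))^2)
  = (\<integral>w. B ?m t w * B ?m t w - 2 * a * (B ?m t w * B k t w) - 2 * b * (B ?m t w * B l t w)
    + a * a * (B k t w * B k t w) + 2 * a * b * (B k t w * B l t w) + b * b * (B l t w * B l t w) \<partial>P)"
  by (intro integral_eqI) (simp add: power2_eq_square algebra_simps)
 also have "\<dots> = 0"
  using assms by (simp add: B_covariance inner_add_left inner_add_right inner_commute algebra_simps)
 finally have "AE w in P. (B ?m t w - (a * B k t w + b * B l t w))^2 = 0"
  using sq by (subst (asm) integral_nonneg_eq_0_iff_AE) (auto simp: square_integrable_def)
 then show ?thesis by eventually_elim simp
qed

text \<open>Polarisation of the formula for squares.\<close>

lemma
 assumes uv: "0 \<le> u" "u \<le> v" and Y: "Y \<in> borel_measurable (past u)" "integrable P Y"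
 shows past_inc_inc_integrable: "integrable P (\<lambda>w. Y w * (inc k u v w * inc l u v w))"
  and past_inc_inc: "(\<E> w. Y w * (inc k u v w * inc l u v w)) = (\<E> w. Y w) * ((v - u) * (k \<bullet> l))"
proof -
 have uv': "0 \<le> u" "0 \<le> v" using uv by auto
 have [measurable]: "Y \<in> borel_measurable P" using Y by simp
 let ?p = "1 *\<^sub>R k + 1 *\<^sub>R l"
 have AE: "AE w in P. inc ?p u v w = inc k u v w + inc l u v w"
  using B_linear[OF uv'(1), of 1 k 1 l] B_linear[OF uv'(2), of 1 k 1 l] unfolding inc_def by eventually_elim simp
 let ?g = "\<lambda>w. (Y w * (inc ?p u v w)^2 - Y w * (inc k u v w)^2 - Y w * (inc l u v w)^2) / 2"
 have eq: "AE w in P. ?g w = Y w * (inc k u v w * inc l u v w)"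
  using AE by eventually_elim (simp add: power2_eq_square algebra_simps)
 have int: "integrable P ?g" using past_inc_sq_integrable[OF uv Y] by simp
 have m: "(\<lambda>w. Y w * (inc k u v w * inc l u v w)) \<in> borel_measurable P" using uv' by measurable
 show "integrable P (\<lambda>w. Y w * (inc k u v w * inc l u v w))" by (rule integrable_cong_AE_imp[OF int m eq])
 have "(\<E> w. Y w * (inc k u v w * inc l u v w)) = (\<E> w. ?g w)"
  using eq by (intro integral_cong_AE m) (use int in \<open>auto elim: eventually_mono\<close>)
 also have "\<dots> = ((\<E> w. Y w) * ((v - u) * (?p \<bullet> ?p)) - (\<E> w. Y w) * ((v - u) * (k \<bullet> k)) - (\<E> w. Y w) * ((v - u) * (l \<bullet> l))) / 2"
  using past_inc_sq_integrable[OF uv Y] by (simp add: past_inc_sq[OF uv Y])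
 also have "\<dots> = (\<E> w. Y w) * ((v - u) * (k \<bullet> l))"
  by (simp add: inner_add_left inner_add_right inner_commute field_simps)
 finally show "(\<E> w. Y w * (inc k u v w * inc l u v w)) = (\<E> w. Y w) * ((v - u) * (k \<bullet> l))" .
qed

end

section \<open>The time change and its filtration\<close>

lemma ennreal_le_suminf_indicator:
 "ennreal x \<le> (\<Sum>m::nat. if real m < x then 1 else 0)"
proof -
 let ?n = "nat \<lceil>x\<rceil>"
 have "real m < x" if "m < ?n" for m using that by linarith
 then have "(\<Sum>m<?n. if real m < x then 1 else 0) = (\<Sum>m<?n. 1 :: ennreal)" by (intro sum.cong) auto
 also have "\<dots> = ennreal (real ?n)" by (simp add: ennreal_of_nat_eq_real_of_nat)
 finally have "ennreal (real ?n) = (\<Sum>m<?n. if real m < x then 1 else 0)" ..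
 also have "\<dots> \<le> (\<Sum>m::nat. if real m < x then 1 else 0)" by (rule sum_le_suminf) auto
 finally show ?thesis using ennreal_leI[of x "real ?n"] by (meson order_trans real_nat_ceiling_ge)
qed

locale time_changed = noise I e f \<iota> fj P F B E
 for I :: "nat set" and e :: "nat \<Rightarrow> 'k::{real_inner, complete_space}"
  and f :: "real ^ 'n \<Rightarrow> real" and \<iota> :: "(real ^ 'n \<Rightarrow> real) \<Rightarrow> 'k" and fj :: "nat \<Rightarrow> real ^ 'n \<Rightarrow> real"
  and P :: "'a measure" and F B E +
 fixes \<beta> :: real and U :: "real \<Rightarrow> 'a \<Rightarrow> real" and G :: "real \<Rightarrow> 'a measure"
 assumes U: "stable_subordinator P \<beta> U"
  and E_eq: "E = inverse_process U"
  and G_eq: "G = time_changed_filtration P I (\<lambda>j. B (e j)) E"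
begin

lemma U_measurable [measurable]: "0 \<le> t \<Longrightarrow> U t \<in> borel_measurable P"
 using U by (simp add: stable_subordinator_def subordinator_def)

lemma AE_U: "AE w in P. U 0 w = 0 \<and> mono_on {0..} (\<lambda>t. U t w)"
 using U by (auto simp: stable_subordinator_def subordinator_def)

lemma U_nonneg: "U 0 w = 0 \<Longrightarrow> mono_on {0..} (\<lambda>t. U t w) \<Longrightarrow> 0 \<le> \<tau> \<Longrightarrow> 0 \<le> U \<tau> w"
 using mono_onD[of "{0..}" "\<lambda>t. U t w" 0 \<tau>] by simp

text \<open>The Chernoff bound with the Laplace transform at 1.\<close>

lemma U_small_probability: "0 \<le> \<tau> \<Longrightarrow> prob {w \<in> space P. U \<tau> w \<le> t} \<le> exp (t - \<tau>)"
proof -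
 assume \<tau>: "0 \<le> \<tau>"
 then have [measurable]: "U \<tau> \<in> borel_measurable P" by simp
 have laplace: "(\<E> w. exp (- 1 * U \<tau> w)) = exp (- \<tau> * 1 powr \<beta>)"
  using U \<tau> unfolding stable_subordinator_def by (metis zero_le_one)
 have int: "integrable P (\<lambda>w. exp (- U \<tau> w))"
 proof (rule integrable_const_bound[where B=1])
  show "AE w in P. norm (exp (- U \<tau> w)) \<le> 1" using AE_U by eventually_elim (use \<tau> U_nonneg in auto)
 qed measurable
 have "prob {w \<in> space P. U \<tau> w \<le> t} = (\<E> w. indicator {w \<in> space P. U \<tau> w \<le> t} w)" by simp
 also have "\<dots> \<le> (\<E> w. exp t * exp (- U \<tau> w))"
 proof (rule integral_mono)
  fix w
  show "indicator {w \<in> space P. U \<tau> w \<le> t} w \<le> exp t * exp (- U \<tau> w)"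
   unfolding mult_exp_exp by (auto split: split_indicator)
 qed (use int in \<open>auto simp: less_top[symmetric]\<close>)
 also have "\<dots> = exp (t - \<tau>)" using laplace by (simp add: exp_diff exp_minus divide_inverse)
 finally show ?thesis .
qed

text \<open>The paths on which the inverse is finite, monotone and right continuous at every time.\<close>

definition good :: "'a \<Rightarrow> bool" where
 "good w \<longleftrightarrow> U 0 w = 0 \<and> mono_on {0..} (\<lambda>t. U t w) \<and> (\<forall>t. \<exists>\<tau>>0. t < U \<tau> w)"

text \<open>The subordinator is unbounded: its probability of staying below \<open>t\<close> up to time
  \<open>m\<close> is at most \<open>exp (t - m)\<close>.\<close>

lemma AE_good: "AE w in P. good w"
proof -
 have "AE w in P. \<exists>m::nat. real n < U (real m) w" for n :: nat
 proof -
  let ?A = "{w \<in> space P. \<forall>m::nat. U (real m) w \<le> real n}"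
  have [measurable]: "?A \<in> sets P" by measurable
  have "prob ?A \<le> exp (real n - real m)" for m :: nat
   by (rule order_trans[OF finite_measure_mono U_small_probability[of "real m" "real n"]]) auto
  moreover have "(\<lambda>m. exp (real n - real m)) \<longlonglongrightarrow> 0"
  proof -
   have "(\<lambda>m. exp (real n) * (exp (- 1)) ^ m) \<longlonglongrightarrow> exp (real n) * 0"
    by (intro tendsto_intros LIMSEQ_power_zero) simp
   moreover have "exp (real n) * (exp (- 1)) ^ m = exp (real n - real m)" for m
    by (simp add: exp_of_nat_mult[symmetric] mult_exp_exp)
   ultimately show ?thesis by simp
  qed
  ultimately have "prob ?A \<le> 0" by (intro LIMSEQ_le_const) auto
  then have "prob ?A = 0" using measure_nonneg[of P ?A] by linarith
  then have "AE w in P. w \<notin> ?A" by (intro AE_not_in) (simp add: null_sets_def emeasure_eq_measure)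
  then show ?thesis using AE_space by eventually_elim (auto simp: not_le)
 qed
 then have "AE w in P. \<forall>n::nat. \<exists>m::nat. real n < U (real m) w" by (simp add: AE_all_countable)
 then show ?thesis using AE_U
 proof eventually_elim
  case (elim w)
  have "\<exists>\<tau>>0. t < U \<tau> w" for t
  proof -
   obtain n :: nat where n: "t \<le> real n" using real_arch_simple by blast
   obtain m :: nat where m: "real n < U (real m) w" using elim by blast
   have "m \<noteq> 0" using m elim by (intro notI) simp
   then show ?thesis using n m by (intro exI[of _ "real m"]) auto
  qed
  then show ?case using elim unfolding good_def by blast
 qed
qed

lemma
 assumes "good w"
 shows E_nonneg: "0 \<le> E t w" and E_mono: "s \<le> t \<Longrightarrow> E s w \<le> E t w"
  and E_right_continuous: "continuous (at_right t) (\<lambda>t. E t w)"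
  and E_gt_imp_U_le: "0 < m \<Longrightarrow> m < E t w \<Longrightarrow> U m w \<le> t"
proof -
 let ?S = "\<lambda>t. {\<tau>. 0 < \<tau> \<and> t < U \<tau> w}"
 have E: "E t w = Inf (?S t)" for t by (simp add: E_eq inverse_process_def)
 have ne: "?S t \<noteq> {}" for t using assms unfolding good_def by auto
 have bdd: "bdd_below (?S t)" for t by (intro bdd_belowI[of _ 0]) auto
 show "0 \<le> E t w" unfolding E using ne by (intro cInf_greatest) auto
 show mono: "E s w \<le> E t w" if "s \<le> t" for s t
  unfolding E using that by (intro cInf_superset_mono ne bdd) auto
 show "U m w \<le> t" if "0 < m" "m < E t w"
 proof (rule ccontr)
  assume "\<not> U m w \<le> t"
  then have "m \<in> ?S t" using that by auto
  then have "E t w \<le> m" unfolding E by (rule cInf_lower[OF _ bdd])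
  then show False using that by simp
 qed
 show "continuous (at_right t) (\<lambda>t. E t w)"
  unfolding continuous_within
 proof (rule order_tendstoI)
  fix a assume "a < E t w"
  then have "a < E s w" if "s > t" for s using mono[of t s] that by simp
  then show "\<forall>\<^sub>F s in at_right t. a < E s w" by (simp add: eventually_at_filter)
 next
  fix a assume "E t w < a"
  then obtain \<tau> where \<tau>: "0 < \<tau>" "t < U \<tau> w" "\<tau> < a"
   unfolding E using cInf_less_iff[OF ne bdd] by auto
  have "E s w < a" if "s < U \<tau> w" for s
   using cInf_lower[OF _ bdd, of \<tau> s] \<tau> that unfolding E by auto
  then show "\<forall>\<^sub>F s in at_right t. E s w < a"
   using \<tau>(2) unfolding eventually_at_right[OF \<tau>(2)] by blast
 qed
qed

lemma AE_E_nonneg: "AE w in P. 0 \<le> E t w"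
 using AE_good by eventually_elim (rule E_nonneg)

lemma AE_E_mono: "s \<le> t \<Longrightarrow> AE w in P. E s w \<le> E t w"
 using AE_good by eventually_elim (rule E_mono)

text \<open>The tail of \<open>E t\<close> at \<open>m\<close> is the probability that the subordinator is
  still below \<open>t\<close> at time \<open>m\<close>, which decays exponentially.\<close>

lemma E_integrable: "0 \<le> t \<Longrightarrow> integrable P (E t)"
proof -
 assume t: "0 \<le> t"
 then have [measurable]: "E t \<in> borel_measurable P" by simp
 have "(\<integral>\<^sup>+w. ennreal (E t w) \<partial>P) \<le> (\<integral>\<^sup>+w. (\<Sum>m::nat. if real m < E t w then 1 else 0) \<partial>P)"
  by (intro nn_integral_mono ennreal_le_suminf_indicator)
 also have "\<dots> = (\<Sum>m::nat. \<integral>\<^sup>+w. (if real m < E t w then 1 else 0) \<partial>P)"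
  by (rule nn_integral_suminf) auto
 also have "\<dots> \<le> (\<Sum>m::nat. ennreal (exp t * (exp (- 1)) ^ m))"
 proof (rule suminf_le)
  fix m :: nat
  have eq: "exp t * (exp (- 1)) ^ m = exp (t - real m)"
   by (simp add: exp_of_nat_mult[symmetric] mult_exp_exp)
  have "(\<integral>\<^sup>+w. (if real m < E t w then 1 else 0) \<partial>P) = (\<integral>\<^sup>+w. indicator {w \<in> space P. real m < E t w} w \<partial>P)"
   by (intro nn_integral_cong) (auto split: split_indicator)
  also have "\<dots> = ennreal (prob {w \<in> space P. real m < E t w})" by (simp add: emeasure_eq_measure)
  also have "\<dots> \<le> ennreal (exp (t - real m))"
  proof (rule ennreal_leI, cases "m = 0")
   case True
   then show "prob {w \<in> space P. real m < E t w} \<le> exp (t - real m)"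
    using t by (intro order_trans[OF prob_le_1]) simp
  next
   case False
   have "prob {w \<in> space P. real m < E t w} \<le> prob {w \<in> space P. U (real m) w \<le> t}"
   proof (rule finite_measure_mono_AE)
    show "AE w in P. w \<in> {w \<in> space P. real m < E t w} \<longrightarrow> w \<in> {w \<in> space P. U (real m) w \<le> t}"
     using AE_good by eventually_elim (use False E_gt_imp_U_le in auto)
   qed measurable
   also have "\<dots> \<le> exp (t - real m)" by (rule U_small_probability) simp
   finally show "prob {w \<in> space P. real m < E t w} \<le> exp (t - real m)" .
  qed
  finally show "(\<integral>\<^sup>+w. (if real m < E t w then 1 else 0) \<partial>P) \<le> ennreal (exp t * (exp (- 1)) ^ m)" unfolding eq .
 qed auto
 also have "\<dots> < \<infinity>" by (simp add: suminf_ennreal2 summable_geometric)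
 finally have "(\<integral>\<^sup>+w. ennreal (E t w) \<partial>P) < \<infinity>" .
 moreover have "(\<integral>\<^sup>+w. ennreal (norm (E t w)) \<partial>P) = (\<integral>\<^sup>+w. ennreal (E t w) \<partial>P)"
  using AE_E_nonneg[of t] by (intro nn_integral_cong_AE) (auto elim: eventually_mono)
 ultimately show ?thesis by (simp add: integrable_iff_bounded)
qed

abbreviation NF :: "real \<Rightarrow> 'a measure" where "NF \<equiv> noise_filtration P I (\<lambda>j. B (e j)) E"

definition gen :: "real \<Rightarrow> 'a set set" where
 "gen u = {B (e j) s -` S \<inter> space P |j s S. j \<in> I \<and> 0 \<le> s \<and> s \<le> u \<and> S \<in> sets borel} \<union>
     {E s -` S \<inter> space P |s S. 0 \<le> s \<and> S \<in> sets borel} \<union> null_sets P"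

lemma gen_past: "gen u \<subseteq> sets (past u)"
proof -
 have "{B (e j) s -` S \<inter> space P |j s S. j \<in> I \<and> 0 \<le> s \<and> s \<le> u \<and> S \<in> sets borel}
   \<subseteq> {B k s -` S \<inter> space P |k s S. 0 \<le> s \<and> s \<le> u \<and> S \<in> sets borel}" by blast
 then have "gen u \<subseteq> {B k s -` S \<inter> space P |k s S. 0 \<le> s \<and> s \<le> u \<and> S \<in> sets borel} \<union>
   {E s -` S \<inter> space P |s S. 0 \<le> s \<and> S \<in> sets borel} \<union> null_sets P"
  unfolding gen_def by (intro Un_mono subset_refl)
 then show ?thesis unfolding sets_past by (rule order_trans) (rule sigma_sets_superset_generator)
qed

lemma gen_space: "gen u \<subseteq> Pow (space P)"
 using gen_past[of u] sets.space_closed[of "past u"] by auto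

lemma NF_def': "NF t = sigma (space P) (\<Inter>u\<in>{t<..}. sigma_sets (space P) (gen u))"
 by (simp add: noise_filtration_def gen_def)

lemma space_NF [simp]: "space (NF t) = space P"
 by (simp add: NF_def' space_measure_of_conv)

lemma sets_NF: "sets (NF t) = sigma_sets (space P) (\<Inter>u\<in>{t<..}. sigma_sets (space P) (gen u))"
proof -
 have "(\<Inter>u\<in>{t<..}. sigma_sets (space P) (gen u)) \<subseteq> sigma_sets (space P) (gen (t + 1))" by (rule INF_lower) simp
 also have "\<dots> \<subseteq> Pow (space P)" using sigma_sets_into_sp[OF gen_space] by auto
 finally show ?thesis unfolding NF_def' by (rule sets_measure_of)
qed

lemma NF_past: "t < u \<Longrightarrow> sets (NF t) \<subseteq> sets (past u)"
proof -
 assume "t < u"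
 then have "(\<Inter>u\<in>{t<..}. sigma_sets (space P) (gen u)) \<subseteq> sigma_sets (space P) (gen u)" by (intro INF_lower) simp
 also have "\<dots> \<subseteq> sets (past u)" using sets.sigma_sets_subset[OF gen_past] by simp
 finally show ?thesis unfolding sets_NF using sets.sigma_sets_subset[of _ "past u"] by simp
qed

lemma NF_filtration: "filtration (space P) NF"
proof
 show "space (NF t) = space P" for t by simp
 show "sets (NF s) \<subseteq> sets (NF t)" if "s \<le> t" for s t
  unfolding sets_NF using that by (intro sigma_sets_mono' INF_superset_mono) auto
qed

lemma null_sets_NF: "N \<in> null_sets P \<Longrightarrow> N \<in> sets (NF t)"
 unfolding sets_NF gen_def by (intro sigma_sets.Basic) auto

lemma \<sigma>E_NF: "sets \<sigma>E \<subseteq> sets (NF t)"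
proof -
 have "{E s -` S \<inter> space P |s S. 0 \<le> s \<and> S \<in> sets borel} \<subseteq> sets (NF t)"
  unfolding sets_NF gen_def by (intro subsetI sigma_sets.Basic INT_I) auto
 from sets.sigma_sets_subset[OF this] show ?thesis
  unfolding \<sigma>E_def by (subst sets_measure_of) auto
qed

lemma E_le_\<sigma>E: "0 \<le> a \<Longrightarrow> {w \<in> space P. E a w \<le> t} \<in> sets \<sigma>E"
 using measurable_sets[OF E_\<sigma>E_measurable, of a "{..t}"] by (simp add: vimage_def Int_def conj_commute)

lemma E_stopping_time: "0 \<le> a \<Longrightarrow> stopping_time NF (E a)"
 unfolding stopping_time_def pred_def using E_le_\<sigma>E \<sigma>E_NF by auto

lemma sets_G: "0 \<le> a \<Longrightarrow> sets (G a) = {A. \<forall>t. {w \<in> A. E a w \<le> t} \<in> sets (NF t)}"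
 unfolding G_eq time_changed_filtration_def
 by (rule filtration.sets_pre_sigma[OF NF_filtration E_stopping_time])

lemma space_G [simp]: "space (G a) = space P"
 unfolding G_eq time_changed_filtration_def by (rule filtration.space_pre_sigma[OF NF_filtration])

lemma G_E_less_past:
 assumes a: "0 \<le> a" and A: "A \<in> sets (G a)"
 shows "{w \<in> A. E a w < t} \<in> sets (past t)"
proof -
 have "{w \<in> A. E a w < t} = (\<Union>m::nat. {w \<in> A. E a w \<le> t - 1 / real (Suc m)})"
 proof safe
  fix w assume "E a w < t" "w \<in> A"
  then obtain m where "inverse (real (Suc m)) < t - E a w" using reals_Archimedean[of "t - E a w"] by auto
  then show "w \<in> (\<Union>m::nat. {w \<in> A. E a w \<le> t - 1 / real (Suc m)})"
   using \<open>w \<in> A\<close> by (auto simp: inverse_eq_divide intro!: exI[of _ m])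
 next
  fix w m assume "E a w \<le> t - 1 / real (Suc m)"
  moreover have "0 < 1 / real (Suc m)" by simp
  ultimately show "E a w < t" by linarith
 qed
 moreover have "{w \<in> A. E a w \<le> t - 1 / real (Suc m)} \<in> sets (past t)" for m
  using A NF_past[of "t - 1 / real (Suc m)" t] unfolding sets_G[OF a] by auto
 ultimately show ?thesis by auto
qed

lemma sets_G_le: "0 \<le> a \<Longrightarrow> sets (G a) \<subseteq> sets P"
proof
 fix A assume a: "0 \<le> a" and A: "A \<in> sets (G a)"
 have eq: "A = (\<Union>n::nat. {w \<in> A. E a w < real n})" using reals_Archimedean2 by auto
 have "{w \<in> A. E a w < real n} \<in> sets P" for n
  using G_E_less_past[OF a A, of "real n"] sets_past_le by blast
 then have "(\<Union>n::nat. {w \<in> A. E a w < real n}) \<in> sets P" by auto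
 then show "A \<in> sets P" by (rule back_subst[of "\<lambda>A. A \<in> sets P"]) (rule eq[symmetric])
qed

lemma G_measurable: "0 \<le> a \<Longrightarrow> Y \<in> borel_measurable (G a) \<Longrightarrow> Y \<in> borel_measurable P"
 using measurable_sets[of Y "G a" borel] sets_G_le by (intro measurableI) auto

lemma G_mono:
 assumes "0 \<le> a" "a \<le> b"
 shows "sets (G a) \<subseteq> sets (G b)"
proof
 fix A assume A: "A \<in> sets (G a)"
 have b: "0 \<le> b" using assms by simp
 have sub: "A \<subseteq> space P" using sets.sets_into_space[OF A] by simp
 have "{w \<in> A. E b w \<le> t} \<in> sets (NF t)" for t
 proof -
  let ?N = "{w \<in> space P. \<not> E a w \<le> E b w}"
  have [measurable]: "E a \<in> borel_measurable P" "E b \<in> borel_measurable P" using assms b by auto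
  have mA: "A \<in> sets P" using A sets_G_le[OF assms(1)] by auto
  have [measurable]: "?N \<in> sets P" by measurable
  have "?N \<in> null_sets P" using AE_E_mono[OF assms(2)] by (subst (asm) AE_iff_null) auto
  have N1: "?N \<inter> {w \<in> A. E b w \<le> t} \<in> null_sets P"
  proof (rule null_set_Int2[OF \<open>?N \<in> null_sets P\<close>])
   have "{w \<in> A. E b w \<le> t} = A \<inter> {w \<in> space P. E b w \<le> t}" using sub by auto
   then show "{w \<in> A. E b w \<le> t} \<in> sets P" using mA by simp
  qed
  have eq: "{w \<in> A. E b w \<le> t} = (({w \<in> A. E a w \<le> t} \<inter> {w \<in> space P. E b w \<le> t}) - ?N) \<union> (?N \<inter> {w \<in> A. E b w \<le> t})"
   using sub by auto
  have h1: "{w \<in> A. E a w \<le> t} \<in> sets (NF t)" using A unfolding sets_G[OF assms(1)] by auto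
  have h2: "{w \<in> space P. E b w \<le> t} \<in> sets (NF t)" using E_le_\<sigma>E[OF b] \<sigma>E_NF by auto
  have "(({w \<in> A. E a w \<le> t} \<inter> {w \<in> space P. E b w \<le> t}) - ?N) \<union> (?N \<inter> {w \<in> A. E b w \<le> t}) \<in> sets (NF t)"
   by (rule sets.Un[OF sets.Diff[OF sets.Int[OF h1 h2] null_sets_NF[OF \<open>?N \<in> null_sets P\<close>]] null_sets_NF[OF N1]])
  then show ?thesis by (rule back_subst[of "\<lambda>A. A \<in> sets (NF t)"]) (rule eq[symmetric])
 qed
 then show "A \<in> sets (G b)" unfolding sets_G[OF b] by auto
qed

lemma G_measurable_mono: "0 \<le> a \<Longrightarrow> a \<le> b \<Longrightarrow> Y \<in> borel_measurable (G a) \<Longrightarrow> Y \<in> borel_measurable (G b)"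
 using measurable_sets[of Y "G a" borel] G_mono[of a b] by (intro measurableI) auto

text \<open>An event known at the random time \<open>E a\<close>, intersected with \<open>E a < t\<close>, is
  known at time \<open>t\<close>.\<close>

lemma G_restrict_past:
 assumes a: "0 \<le> a" and Y: "Y \<in> borel_measurable (G a)"
 shows "(\<lambda>w. Y w * (if E a w < t then 1 else 0 :: real)) \<in> borel_measurable (past t)"
proof (rule measurableI)
 fix S :: "real set" assume S: "S \<in> sets borel"
 have "Y -` S \<inter> space P \<in> sets (G a)" using measurable_sets[OF Y S] by simp
 from G_E_less_past[OF a this, of t]
 have 1: "{w \<in> space P. Y w \<in> S \<and> E a w < t} \<in> sets (past t)"
  by (rule back_subst[of "\<lambda>A. A \<in> sets (past t)"]) auto
 have "space P \<in> sets (G a)" using sets.top[of "G a"] by simp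
 from sets.compl_sets[OF G_E_less_past[OF a this, of t]]
 have 2: "{w \<in> space P. \<not> E a w < t} \<in> sets (past t)"
  by (rule back_subst[of "\<lambda>A. A \<in> sets (past t)"]) auto
 have "(\<lambda>w. Y w * (if E a w < t then 1 else 0)) -` S \<inter> space (past t)
  = {w \<in> space P. Y w \<in> S \<and> E a w < t} \<union> (if 0 \<in> S then {w \<in> space P. \<not> E a w < t} else {})"
  by (auto split: if_splits)
 then show "(\<lambda>w. Y w * (if E a w < t then 1 else 0)) -` S \<inter> space (past t) \<in> sets (past t)"
  using 1 2 by auto
qed simp

end

section \<open>The noise at random times\<close>

text \<open>Sample paths are continuous only almost surely, so measurability of the noise at a random time
  rests on completeness.\<close>

lemma (in complete_measure) borel_measurable_cong_AE:
 fixes X Y :: "'a \<Rightarrow> 'b::topological_space"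
 assumes X: "X \<in> borel_measurable M" and eq: "AE w in M. X w = Y w"
 shows "Y \<in> borel_measurable M"
proof -
 obtain N where N: "N \<in> null_sets M" "{w \<in> space M. X w \<noteq> Y w} \<subseteq> N"
  using eq by (auto simp: eventually_ae_filter)
 show ?thesis
 proof (rule measurableI)
  fix S :: "'b set" assume "S \<in> sets borel"
  then have XS: "X -` S \<inter> space M \<in> sets M" using X by (rule measurable_sets[rotated])
  have "Y -` S \<inter> N \<in> sets M" using N(1) by (intro complete[of _ N]) auto
  moreover have "Y -` S \<inter> space M = (X -` S \<inter> space M - N) \<union> (Y -` S \<inter> N)"
   using N sets.sets_into_space[of N M] by auto
  ultimately show "Y -` S \<inter> space M \<in> sets M" using XS N(1) by auto
 qed simp
qed

lemma L2_limit_bounded_mult: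
 assumes lim: "L2_limit M X Z" and Y: "Y \<in> borel_measurable M" "\<And>w. w \<in> space M \<Longrightarrow> \<bar>Y w\<bar> \<le> C"
 shows "L2_limit M (\<lambda>n w. Y w * X n w) (\<lambda>w. Y w * Z w)"
proof -
 note m [measurable] = L2_limitD(1,2)[OF lim] Y(1)
 have "(nn2 M (\<lambda>w. Y w * X n w - Y w * Z w)) \<le> ennreal (C^2) * (nn2 M (\<lambda>w. X n w - Z w))" for n
 proof -
  have "(nn2 M (\<lambda>w. Y w * X n w - Y w * Z w)) \<le> (\<integral>\<^sup>+w. ennreal (C^2) * ennreal ((X n w - Z w)^2) \<partial>M)"
  proof (intro nn_integral_mono)
   fix w assume "w \<in> space M"
   then have "\<bar>Y w\<bar>^2 \<le> C^2" using Y(2) by (intro power_mono) auto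
   then have "(Y w)^2 * (X n w - Z w)^2 \<le> C^2 * (X n w - Z w)^2" by (intro mult_right_mono) auto
   then show "ennreal ((Y w * X n w - Y w * Z w)^2) \<le> ennreal (C^2) * ennreal ((X n w - Z w)^2)"
    by (simp add: right_diff_distrib[symmetric] power_mult_distrib ennreal_mult[symmetric] ennreal_leI)
  qed
  then show ?thesis by (simp add: nn_integral_cmult)
 qed
 moreover have "(\<lambda>n. ennreal (C^2) * (nn2 M (\<lambda>w. X n w - Z w))) \<longlonglongrightarrow> ennreal (C^2) * 0"
  by (intro ennreal_tendsto_cmult L2_limitD(3)[OF lim]) auto
 then have "(\<lambda>n. ennreal (C^2) * (nn2 M (\<lambda>w. X n w - Z w))) \<longlonglongrightarrow> 0" by simp
 ultimately have "(\<lambda>n. nn2 M (\<lambda>w. Y w * X n w - Y w * Z w)) \<longlonglongrightarrow> 0"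
  by (rule ennreal_squeeze_0)
 then show ?thesis by (simp add: L2_limit_def)
qed

lemma
 fixes f g :: "'a \<Rightarrow> nat"
 assumes [measurable]: "f \<in> measurable M (count_space UNIV)" "g \<in> measurable M (count_space UNIV)"
 shows pred_nat_less [measurable]: "Measurable.pred M (\<lambda>w. f w < g w)"
  and pred_nat_le [measurable]: "Measurable.pred M (\<lambda>w. f w \<le> g w)"
proof -
 have [measurable]: "(\<lambda>w. real (f w)) \<in> borel_measurable M" "(\<lambda>w. real (g w)) \<in> borel_measurable M"
  by (auto intro: measurable_compose[OF assms(1)] measurable_compose[OF assms(2)])
 have "Measurable.pred M (\<lambda>w. real (f w) < real (g w))" "Measurable.pred M (\<lambda>w. real (f w) \<le> real (g w))"
  by measurable
 then show "Measurable.pred M (\<lambda>w. f w < g w)" "Measurable.pred M (\<lambda>w. f w \<le> g w)" by simp_all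
qed

context time_changed
begin

text \<open>The index of the dyadic interval that contains \<open>E a\<close>, with \<open>E a\<close> cut off
  at \<open>n\<close>; only finitely many indices occur.\<close>

definition idx :: "nat \<Rightarrow> real \<Rightarrow> 'a \<Rightarrow> nat" where
 "idx n a w = nat \<lfloor>2 ^ n * min (max 0 (E a w)) (real n)\<rfloor>"

text \<open>The right end point of the dyadic interval with index \<open>i\<close>. Approximation from above
  keeps the discretised times stopping times.\<close>

definition gt :: "nat \<Rightarrow> nat \<Rightarrow> real" where "gt n i = (real i + 1) / 2 ^ n"

definition \<tau> :: "nat \<Rightarrow> real \<Rightarrow> 'a \<Rightarrow> real" where "\<tau> n a w = gt n (idx n a w)"

definition L :: "nat \<Rightarrow> nat" where "L n = n * 2 ^ n"

lemma gt_pos: "0 \<le> gt n i" by (simp add: gt_def)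

lemma gt_mono: "i \<le> j \<Longrightarrow> gt n i \<le> gt n j" by (simp add: gt_def divide_right_mono)

lemma idx_le: "idx n a w \<le> L n"
proof -
 have "2 ^ n * min (max 0 (E a w)) (real n) \<le> 2 ^ n * real n" by (intro mult_left_mono) auto
 then have "\<lfloor>2 ^ n * min (max 0 (E a w)) (real n)\<rfloor> \<le> \<lfloor>2 ^ n * real n\<rfloor>" by (rule floor_mono)
 also have "2 ^ n * real n = real (L n)" by (simp add: L_def)
 also have "\<lfloor>real (L n)\<rfloor> = int (L n)" by (rule floor_of_nat)
 finally show ?thesis unfolding idx_def by simp
qed

lemma idx_mono: "good w \<Longrightarrow> a \<le> b \<Longrightarrow> idx n a w \<le> idx n b w"
 unfolding idx_def using E_mono[of w a b] by (intro nat_mono floor_mono mult_left_mono min.mono max.mono) auto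

lemma AE_idx_mono: "a \<le> b \<Longrightarrow> AE w in P. idx n a w \<le> idx n b w"
 using AE_good by eventually_elim (rule idx_mono)

lemma idx_bounds: "2 ^ n * min (max 0 (E a w)) (real n) < real (idx n a w) + 1"
  "real (idx n a w) \<le> 2 ^ n * min (max 0 (E a w)) (real n)"
proof -
 have "0 \<le> 2 ^ n * min (max 0 (E a w)) (real n)" by simp
 then show "2 ^ n * min (max 0 (E a w)) (real n) < real (idx n a w) + 1"
  "real (idx n a w) \<le> 2 ^ n * min (max 0 (E a w)) (real n)"
  unfolding idx_def by linarith+
qed

lemma E_less_gt: "idx n a w < L n \<Longrightarrow> E a w < gt n (idx n a w)"
proof -
 assume "idx n a w < L n"
 then have "real (Suc (idx n a w)) \<le> real (L n)" by (simp only: of_nat_le_iff Suc_le_eq)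
 then have "real (idx n a w) + 1 \<le> real n * 2 ^ n" by (simp add: L_def)
 moreover have "real n * 2 ^ n = 2 ^ n * real n" by simp
 ultimately have "2 ^ n * min (max 0 (E a w)) (real n) < 2 ^ n * real n"
  using idx_bounds(1)[of n a w] by linarith
 then have "min (max 0 (E a w)) (real n) < real n"
  by (rule mult_left_less_imp_less) simp
 then have "min (max 0 (E a w)) (real n) = max 0 (E a w)" by (simp add: min_def split: if_splits)
 then have le: "2 ^ n * max 0 (E a w) < real (idx n a w) + 1" using idx_bounds(1)[of n a w] by simp
 have "2 ^ n * E a w \<le> 2 ^ n * max 0 (E a w)" by (rule mult_left_mono) auto
 from order_le_less_trans[OF this le] show ?thesis by (simp add: gt_def pos_less_divide_eq mult.commute)
qed

lemma idx_eq_\<sigma>E: "0 \<le> a \<Longrightarrow> {w \<in> space P. idx n a w = i} \<in> sets \<sigma>E"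
proof -
 assume "0 \<le> a"
 then have [measurable]: "E a \<in> borel_measurable \<sigma>E" by (rule E_\<sigma>E_measurable)
 have "{w \<in> space \<sigma>E. nat \<lfloor>2 ^ n * min (max 0 (E a w)) (real n)\<rfloor> = i} \<in> sets \<sigma>E" by measurable
 then show ?thesis by (simp add: idx_def)
qed

lemma \<sigma>E_past: "sets \<sigma>E \<subseteq> sets (past u)"
 using \<sigma>E_NF[of "u - 1"] NF_past[of "u - 1" u] by auto

lemma idx_eq_past: "0 \<le> a \<Longrightarrow> {w \<in> space P. idx n a w = i} \<in> sets (past u)"
 using idx_eq_\<sigma>E \<sigma>E_past by blast

lemma idx_measurable_past: "0 \<le> a \<Longrightarrow> idx n a \<in> measurable (past u) (count_space UNIV)"
 using idx_eq_past by (subst measurable_count_space_eq2_countable) (auto simp: vimage_def Int_def conj_commute)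

lemma idx_measurable [measurable]: "0 \<le> a \<Longrightarrow> idx n a \<in> measurable P (count_space UNIV)"
 using measurable_sets[OF idx_measurable_past[of a n 0]] sets_past_le[of 0] by (intro measurableI) auto

lemma \<tau>_measurable [measurable]: "0 \<le> a \<Longrightarrow> \<tau> n a \<in> borel_measurable P"
 unfolding \<tau>_def[abs_def] by (rule measurable_compose[OF idx_measurable]) auto

lemma \<tau>_close: "good w \<Longrightarrow> E a w \<le> real n \<Longrightarrow> \<bar>\<tau> n a w - E a w\<bar> \<le> 1 / 2 ^ n"
proof -
 assume g: "good w" "E a w \<le> real n"
 have m: "min (max 0 (E a w)) (real n) = E a w" using E_nonneg[OF g(1), of a] g(2) by simp
 have "E a w \<le> \<tau> n a w" using idx_bounds(1)[of n a w] unfolding m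
  by (simp add: \<tau>_def gt_def pos_le_divide_eq mult.commute)
 moreover have "\<tau> n a w \<le> E a w + 1 / 2 ^ n" using idx_bounds(2)[of n a w] unfolding m
  by (simp add: \<tau>_def gt_def add_divide_distrib pos_divide_le_eq mult.commute)
 ultimately show ?thesis by simp
qed

lemma \<tau>_bound: "good w \<Longrightarrow> \<bar>\<tau> n a w - E a w\<bar> \<le> E a w + 1"
proof -
 assume g: "good w"
 have E0: "0 \<le> E a w" by (rule E_nonneg[OF g])
 have "real (idx n a w) \<le> 2 ^ n * E a w"
  using idx_bounds(2)[of n a w] E0 by (rule_tac order_trans) auto
 then have "real (idx n a w) / 2 ^ n \<le> E a w" by (simp add: pos_divide_le_eq mult.commute)
 moreover have "1 / 2 ^ n \<le> (1::real)" by simp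
 moreover have "\<tau> n a w = real (idx n a w) / 2 ^ n + 1 / 2 ^ n" by (simp add: \<tau>_def gt_def add_divide_distrib)
 ultimately have "\<tau> n a w \<le> E a w + 1" by linarith
 moreover have "0 \<le> \<tau> n a w" by (simp add: \<tau>_def gt_pos)
 ultimately show ?thesis using E0 by (simp add: abs_le_iff)
qed

lemma \<tau>_tendsto: "good w \<Longrightarrow> (\<lambda>n. \<tau> n a w) \<longlonglongrightarrow> E a w"
proof -
 assume g: "good w"
 obtain n0 :: nat where n0: "E a w \<le> real n0" using real_arch_simple by blast
 have "\<forall>\<^sub>F n in sequentially. norm (\<tau> n a w - E a w) \<le> (1 / 2) ^ n"
  unfolding eventually_sequentially
 proof (intro exI[of _ n0] allI impI)
  fix n assume "n0 \<le> n"
  then have "E a w \<le> real n" using n0 by linarith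
  from \<tau>_close[OF g this] show "norm (\<tau> n a w - E a w) \<le> (1 / 2) ^ n" by (simp add: power_divide)
 qed
 then have "(\<lambda>n. \<tau> n a w - E a w) \<longlonglongrightarrow> 0"
  by (rule Lim_null_comparison) (rule LIMSEQ_power_zero, simp)
 then show ?thesis by (simp add: LIM_zero_iff)
qed

definition Pairs :: "nat \<Rightarrow> (nat \<times> nat) set" where "Pairs n = {(i, j). i < j \<and> j \<le> L n}"

lemma finite_Pairs [simp]: "finite (Pairs n)"
 by (rule finite_subset[of _ "{..L n} \<times> {..L n}"]) (auto simp: Pairs_def)

definition at_pair :: "nat \<Rightarrow> real \<Rightarrow> real \<Rightarrow> nat \<times> nat \<Rightarrow> 'a \<Rightarrow> real" where
 "at_pair n a b p w = (if idx n a w = fst p then 1 else 0) * (if idx n b w = snd p then 1 else 0)"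

lemma at_pair_past: "0 \<le> a \<Longrightarrow> 0 \<le> b \<Longrightarrow> at_pair n a b p \<in> borel_measurable (past u)"
proof -
 assume "0 \<le> a" "0 \<le> b"
 then have [measurable]: "idx n a \<in> measurable (past u) (count_space UNIV)" "idx n b \<in> measurable (past u) (count_space UNIV)"
  by (auto intro: idx_measurable_past)
 show ?thesis unfolding at_pair_def[abs_def] by measurable
qed

lemma measurable_past_P: "X \<in> borel_measurable (past u) \<Longrightarrow> X \<in> borel_measurable P"
 using measurable_sets[of X "past u" borel] sets_past_le by (intro measurableI) auto

lemma sum_at_pair:
 "(\<Sum>p\<in>Pairs n. at_pair n a b p w * h p) = (if idx n a w < idx n b w then h (idx n a w, idx n b w) else 0)"
proof -
 have "(\<Sum>p\<in>Pairs n. at_pair n a b p w * h p) = (\<Sum>p\<in>Pairs n. if p = (idx n a w, idx n b w) then h p else 0)"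
  by (intro sum.cong refl) (auto simp: at_pair_def prod_eq_iff)
 also have "\<dots> = (if (idx n a w, idx n b w) \<in> Pairs n then h (idx n a w, idx n b w) else 0)" by simp
 finally show ?thesis using idx_le by (simp add: Pairs_def)
qed

abbreviation inc_at :: "nat \<Rightarrow> 'k \<Rightarrow> nat \<times> nat \<Rightarrow> 'a \<Rightarrow> real" where
 "inc_at n k p \<equiv> inc k (gt n (fst p)) (gt n (snd p))"

text \<open>The increment of the noise between the discretised times, decomposed according to the values of
  these times. On every piece the two times are deterministic.\<close>

definition dS :: "nat \<Rightarrow> 'k \<Rightarrow> real \<Rightarrow> real \<Rightarrow> 'a \<Rightarrow> real" where
 "dS n k a b w = (\<Sum>p\<in>Pairs n. at_pair n a b p w * inc_at n k p w)"

lemma dS_square_integrable: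
 assumes "0 \<le> a" "0 \<le> b"
 shows "square_integrable P (dS n k a b)"
 unfolding dS_def[abs_def]
proof (intro square_integrable_sum square_integrable_bounded_mult[where C=1])
 show "square_integrable P (inc_at n k p)" for p by (intro inc_square_integrable gt_pos)
 show "at_pair n a b p \<in> borel_measurable P" for p using at_pair_past[OF assms] by (rule measurable_past_P)
qed (simp add: at_pair_def)

text \<open>On the event that the two discretised times have given values, the weight belongs to the past at
  the earlier one and the increment is independent of it.\<close>

lemma
 assumes ab: "0 \<le> a" "0 \<le> b" and V: "integrable P V"
  and pV: "\<And>i. i < L n \<Longrightarrow> (\<lambda>w. V w * (if idx n a w = i then 1 else 0)) \<in> borel_measurable (past (gt n i))"
 shows step_integrable: "integrable P (\<lambda>w. V w * dS n k a b w)"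
  and step_zero: "(\<E> w. V w * dS n k a b w) = 0"
  and step_square: "(\<E> w. V w * (dS n k a b w * dS n l a b w))
    = (k \<bullet> l) * (\<E> w. V w * (if idx n a w < idx n b w then \<tau> n b w - \<tau> n a w else 0))"
proof -
 have [measurable]: "V \<in> borel_measurable P" using V by simp
 let ?V = "\<lambda>p w. V w * at_pair n a b p w"
 have Vp: "?V p \<in> borel_measurable (past (gt n (fst p)))" if "p \<in> Pairs n" for p
 proof -
  have "fst p < L n" using that by (auto simp: Pairs_def)
  have "(\<lambda>w. (V w * (if idx n a w = fst p then 1 else 0)) * at_pair n a b p w) \<in> borel_measurable (past (gt n (fst p)))"
   by (intro borel_measurable_times pV at_pair_past ab) fact
  moreover have "(V w * (if idx n a w = fst p then 1 else 0)) * at_pair n a b p w = ?V p w" for w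
   by (simp add: at_pair_def)
  ultimately show ?thesis by simp
 qed
 have Vi: "integrable P (?V p)" for p
 proof (rule integrable_bounded_mult[OF V, where C=1])
  show "at_pair n a b p \<in> borel_measurable P" by (rule measurable_past_P[OF at_pair_past[OF ab]])
 qed (simp add: at_pair_def)
 have le: "gt n (fst p) \<le> gt n (snd p)" if "p \<in> Pairs n" for p
  using that by (intro gt_mono) (auto simp: Pairs_def)
 have eq: "V w * dS n k a b w = (\<Sum>p\<in>Pairs n. ?V p w * inc_at n k p w)" for w
  unfolding dS_def by (simp add: sum_distrib_left mult.assoc)
 show "integrable P (\<lambda>w. V w * dS n k a b w)"
  unfolding eq by (intro Bochner_Integration.integrable_sum past_inc_integrable gt_pos le Vp Vi)
 have "(\<E> w. V w * dS n k a b w) = (\<Sum>p\<in>Pairs n. \<integral>w. ?V p w * inc_at n k p w \<partial>P)"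
  unfolding eq by (intro Bochner_Integration.integral_sum past_inc_integrable gt_pos le Vp Vi)
 also have "\<dots> = 0" by (intro sum.neutral ballI past_inc gt_pos le Vp Vi)
 finally show "(\<E> w. V w * dS n k a b w) = 0" .
 have eq2: "V w * (dS n k a b w * dS n l a b w) = (\<Sum>p\<in>Pairs n. ?V p w * (inc_at n k p w * inc_at n l p w))" for w
 proof -
  have "dS n k a b w * dS n l a b w = (\<Sum>p\<in>Pairs n. at_pair n a b p w * (inc_at n k p w * inc_at n l p w))"
   unfolding dS_def sum_at_pair by simp
  then show ?thesis by (simp add: sum_distrib_left mult.assoc)
 qed
 have "(\<E> w. V w * (dS n k a b w * dS n l a b w))
  = (\<Sum>p\<in>Pairs n. \<integral>w. ?V p w * (inc_at n k p w * inc_at n l p w) \<partial>P)"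
  unfolding eq2 by (intro Bochner_Integration.integral_sum past_inc_inc_integrable gt_pos le Vp Vi)
 also have "\<dots> = (\<Sum>p\<in>Pairs n. (\<E> w. ?V p w) * ((gt n (snd p) - gt n (fst p)) * (k \<bullet> l)))"
  by (intro sum.cong refl past_inc_inc gt_pos le Vp Vi)
 also have "\<dots> = (k \<bullet> l) * (\<Sum>p\<in>Pairs n. \<integral>w. ?V p w * (gt n (snd p) - gt n (fst p)) \<partial>P)"
  by (subst sum_distrib_left, intro sum.cong refl, subst integral_mult_left_zero) (simp add: mult_ac)
 also have "(\<Sum>p\<in>Pairs n. \<integral>w. ?V p w * (gt n (snd p) - gt n (fst p)) \<partial>P) = (\<E> w. (\<Sum>p\<in>Pairs n. ?V p w * (gt n (snd p) - gt n (fst p))))"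
  using Vi by (intro Bochner_Integration.integral_sum[symmetric]) auto
 also have "\<dots> = (\<E> w. V w * (if idx n a w < idx n b w then \<tau> n b w - \<tau> n a w else 0))"
  using sum_at_pair[of n a b _ "\<lambda>p. gt n (snd p) - gt n (fst p)"]
  by (intro integral_eqI) (simp add: mult.assoc sum_distrib_left[symmetric] \<tau>_def)
 finally show "(\<E> w. V w * (dS n k a b w * dS n l a b w))
    = (k \<bullet> l) * (\<E> w. V w * (if idx n a w < idx n b w then \<tau> n b w - \<tau> n a w else 0))" .
qed

definition Mn :: "nat \<Rightarrow> 'k \<Rightarrow> real \<Rightarrow> 'a \<Rightarrow> real" where "Mn n k a w = B k (\<tau> n a w) w"

definition M :: "'k \<Rightarrow> real \<Rightarrow> 'a \<Rightarrow> real" where "M k a w = B k (E a w) w"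

lemma AE_Mn_diff:
 assumes "a \<le> b"
 shows "AE w in P. Mn n k b w - Mn n k a w = dS n k a b w"
 using AE_idx_mono[OF assms, of n]
proof (eventually_elim)
 fix w assume "idx n a w \<le> idx n b w"
 then show "Mn n k b w - Mn n k a w = dS n k a b w"
  unfolding dS_def sum_at_pair by (auto simp: Mn_def \<tau>_def inc_def)
qed

lemma Mn_sum: "Mn n k a w = (\<Sum>i\<le>L n. (if idx n a w = i then 1 else 0) * B k (gt n i) w)"
proof -
 have "(\<Sum>i\<le>L n. (if idx n a w = i then 1 else 0) * B k (gt n i) w) = (\<Sum>i\<in>{..L n}. if i = idx n a w then B k (gt n i) w else 0)"
  by (intro sum.cong refl) auto
 then show ?thesis using idx_le[of n a w] by (simp add: Mn_def \<tau>_def)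
qed

lemma Mn_square_integrable: "0 \<le> a \<Longrightarrow> square_integrable P (Mn n k a)"
proof -
 assume a: "0 \<le> a"
 have [measurable]: "idx n a \<in> measurable P (count_space UNIV)" using a by measurable
 have "Mn n k a = (\<lambda>w. \<Sum>i\<le>L n. (if idx n a w = i then 1 else 0) * B k (gt n i) w)" using Mn_sum by auto
 moreover have "square_integrable P (\<lambda>w. \<Sum>i\<le>L n. (if idx n a w = i then 1 else 0) * B k (gt n i) w)"
  by (intro square_integrable_sum square_integrable_bounded_mult[where C=1] B_square_integrable gt_pos) auto
 ultimately show ?thesis by simp
qed

lemma inc_square_event:
 assumes "D \<in> sets \<sigma>E" "0 \<le> u" "0 \<le> v"
 shows "(\<E> w. indicator D w * (B k u w - B k v w)^2) = (k \<bullet> k) * (\<E> w. indicator D w * \<bar>u - v\<bar>)"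
  and "integrable P (\<lambda>w. indicator D w * (B k u w - B k v w)^2)"
proof -
 have D: "D \<in> sets P" using assms(1) sets_\<sigma>E by auto
 have main: "(\<E> w. indicator D w * (inc k u v w)^2) = prob D * ((v - u) * (k \<bullet> k)) \<and> integrable P (\<lambda>w. indicator D w * (inc k u v w)^2)"
  if "0 \<le> u" "u \<le> v" for u v
 proof -
  have "(indicator D :: 'a \<Rightarrow> real) \<in> borel_measurable (past u)"
   using assms(1) \<sigma>E_past by (intro borel_measurable_indicator) auto
  moreover have "integrable P (indicator D :: 'a \<Rightarrow> real)" using D by (simp add: less_top[symmetric])
  ultimately show ?thesis using past_inc_sq[OF that] past_inc_sq_integrable[OF that] D by simp
 qed
 have "(\<E> w. indicator D w * (B k u w - B k v w)^2) = prob D * (\<bar>u - v\<bar> * (k \<bullet> k)) \<and> integrable P (\<lambda>w. indicator D w * (B k u w - B k v w)^2)"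
 proof (cases "u \<le> v")
  case True
  have c: "(B k u w - B k v w)^2 = (inc k u v w)^2" for w by (simp add: inc_def power2_commute)
  show ?thesis unfolding c using main[OF assms(2) True] True by simp
 next
  case False
  then show ?thesis using main[OF assms(3), of u] by (simp add: inc_def)
 qed
 then show "(\<E> w. indicator D w * (B k u w - B k v w)^2) = (k \<bullet> k) * (\<E> w. indicator D w * \<bar>u - v\<bar>)"
  and "integrable P (\<lambda>w. indicator D w * (B k u w - B k v w)^2)" using D by (simp_all add: mult_ac)
qed

text \<open>Both discretised times are functions of \<open>E\<close>, which is independent of the noise; on
  each piece the second moment of the increment is its length.\<close>

lemma Mn_distance:
 assumes a: "0 \<le> a"
 shows "(\<E> w. (Mn n k a w - Mn m k a w)^2) = (k \<bullet> k) * (\<E> w. \<bar>\<tau> n a w - \<tau> m a w\<bar>)"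
proof -
 \<comment> \<open>A finite partition on which both discretised times are constant.\<close>
 define D where "D i j = {w \<in> space P. idx n a w = i} \<inter> {w \<in> space P. idx m a w = j}" for i j
 have D: "D i j \<in> sets \<sigma>E" for i j unfolding D_def using idx_eq_\<sigma>E[OF a] by auto
 have [measurable]: "D i j \<in> sets P" for i j using D sets_\<sigma>E by blast
 have decomp: "h (idx n a w) (idx m a w) = (\<Sum>i\<le>L n. \<Sum>j\<le>L m. indicator (D i j) w * h i j)" if "w \<in> space P" for h :: "nat \<Rightarrow> nat \<Rightarrow> real" and w
 proof -
  have "(\<Sum>i\<le>L n. \<Sum>j\<le>L m. indicator (D i j) w * h i j) = (\<Sum>i\<in>{..L n}. \<Sum>j\<in>{..L m}. if j = idx m a w then (if i = idx n a w then h i j else 0) else 0)"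
   using that by (intro sum.cong refl) (auto simp: D_def)
  also have "\<dots> = (\<Sum>i\<in>{..L n}. if i = idx n a w then h i (idx m a w) else 0)"
   using idx_le[of m a w] by (intro sum.cong refl) (auto simp: sum.delta)
  also have "\<dots> = h (idx n a w) (idx m a w)" using idx_le[of n a w] by simp
  finally show ?thesis ..
 qed
 have "(\<E> w. (Mn n k a w - Mn m k a w)^2) = (\<E> w. (\<Sum>i\<le>L n. \<Sum>j\<le>L m. indicator (D i j) w * (B k (gt n i) w - B k (gt m j) w)^2))"
 proof (rule integral_eqI)
  fix w assume "w \<in> space P"
  from decomp[OF this, of "\<lambda>i j. (B k (gt n i) w - B k (gt m j) w)^2"]
  show "(Mn n k a w - Mn m k a w)^2 = (\<Sum>i\<le>L n. \<Sum>j\<le>L m. indicator (D i j) w * (B k (gt n i) w - B k (gt m j) w)^2)"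
   by (simp add: Mn_def \<tau>_def)
 qed
 also have "\<dots> = (\<Sum>i\<le>L n. \<Sum>j\<le>L m. \<integral>w. indicator (D i j) w * (B k (gt n i) w - B k (gt m j) w)^2 \<partial>P)"
 proof -
  have int: "integrable P (\<lambda>w. indicator (D i j) w * (B k (gt n i) w - B k (gt m j) w)^2)" for i j
   by (rule inc_square_event(2)[OF D gt_pos gt_pos])
  show ?thesis
   by (subst Bochner_Integration.integral_sum, intro Bochner_Integration.integrable_sum int)
     (intro sum.cong refl Bochner_Integration.integral_sum int)
 qed
 also have "\<dots> = (\<Sum>i\<le>L n. \<Sum>j\<le>L m. (k \<bullet> k) * (\<E> w. indicator (D i j) w * \<bar>gt n i - gt m j\<bar>))"
  using inc_square_event(1)[OF D gt_pos gt_pos] by (intro sum.cong refl) auto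
 also have "\<dots> = (k \<bullet> k) * (\<Sum>i\<le>L n. \<Sum>j\<le>L m. (\<E> w. indicator (D i j) w * \<bar>gt n i - gt m j\<bar>))"
  by (simp only: sum_distrib_left)
 also have "(\<Sum>i\<le>L n. \<Sum>j\<le>L m. (\<E> w. indicator (D i j) w * \<bar>gt n i - gt m j\<bar>)) = (\<E> w. (\<Sum>i\<le>L n. \<Sum>j\<le>L m. indicator (D i j) w * \<bar>gt n i - gt m j\<bar>))"
 proof -
  have int: "integrable P (\<lambda>w. indicator (D i j) w * \<bar>gt n i - gt m j\<bar>)" for i j
   by (intro integrable_mult_left) (simp add: less_top[symmetric])
  show ?thesis
   by (subst Bochner_Integration.integral_sum, intro Bochner_Integration.integrable_sum int)
     (intro sum.cong refl Bochner_Integration.integral_sum[symmetric] int)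
 qed
 also have "\<dots> = (\<E> w. \<bar>\<tau> n a w - \<tau> m a w\<bar>)"
 proof (rule integral_eqI)
  fix w assume "w \<in> space P"
  from decomp[OF this, of "\<lambda>i j. \<bar>gt n i - gt m j\<bar>"]
  show "(\<Sum>i\<le>L n. \<Sum>j\<le>L m. indicator (D i j) w * \<bar>gt n i - gt m j\<bar>) = \<bar>\<tau> n a w - \<tau> m a w\<bar>"
   by (simp add: \<tau>_def)
 qed
 finally show ?thesis .
qed

lemma \<tau>_L1: "0 \<le> a \<Longrightarrow> (\<lambda>n. \<integral>w. \<bar>\<tau> n a w - E a w\<bar> \<partial>P) \<longlonglongrightarrow> 0" "0 \<le> a \<Longrightarrow> integrable P (\<tau> n a)"
proof -
 assume a: "0 \<le> a"
 then have [measurable]: "E a \<in> borel_measurable P" "\<tau> n a \<in> borel_measurable P" for n by simp_all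
 have "(\<lambda>n. \<integral>w. \<bar>\<tau> n a w - E a w\<bar> \<partial>P) \<longlonglongrightarrow> (\<E> w. 0)"
 proof (rule integral_dominated_convergence[where w="\<lambda>w. E a w + 1"])
  show "integrable P (\<lambda>w. E a w + 1)" using E_integrable[OF a] by simp
  show "AE w in P. (\<lambda>n. \<bar>\<tau> n a w - E a w\<bar>) \<longlonglongrightarrow> 0"
   using AE_good by eventually_elim (use \<tau>_tendsto in \<open>simp add: tendsto_rabs_zero LIM_zero\<close>)
  show "AE w in P. norm \<bar>\<tau> n a w - E a w\<bar> \<le> E a w + 1" for n
   using AE_good by eventually_elim (use \<tau>_bound in simp)
 qed auto
 then show "(\<lambda>n. \<integral>w. \<bar>\<tau> n a w - E a w\<bar> \<partial>P) \<longlonglongrightarrow> 0" by simp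
 have "integrable P (\<lambda>w. \<tau> n a w - E a w)"
 proof (rule integrable_dominated)
  show "integrable P (\<lambda>w. E a w + 1)" using E_integrable[OF a] by simp
  show "AE w in P. norm (\<tau> n a w - E a w) \<le> norm (E a w + 1)"
   using AE_good
  proof eventually_elim
   fix w assume "good w"
   from \<tau>_bound[OF this, of n a] show "norm (\<tau> n a w - E a w) \<le> norm (E a w + 1)" by simp
  qed
 qed measurable
 from Bochner_Integration.integrable_add[OF this E_integrable[OF a]] show "integrable P (\<tau> n a)" by simp
qed

text \<open>Path continuity gives almost sure convergence; the limit exists in mean square because, by the
  lemma of Fatou, the distance is bounded by the mean distance of the discretised times to \<open>E
  a\<close>.\<close>

lemma M_limit:
 assumes a: "0 \<le> a"
 shows "L2_limit P (\<lambda>n. Mn n k a) (M k a)"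
proof -
 have [measurable]: "E a \<in> borel_measurable P" "Mn n k a \<in> borel_measurable P" for n
  using a Mn_square_integrable[OF a] by (auto simp: square_integrable_def)
 have cont: "AE w in P. continuous_on {0..} (\<lambda>t. B k t w)"
  using process by (simp add: noise_process_def)
 have conv: "AE w in P. (\<lambda>n. Mn n k a w) \<longlonglongrightarrow> M k a w"
  using cont AE_good
 proof eventually_elim
  fix w assume c: "continuous_on {0..} (\<lambda>t. B k t w)" and g: "good w"
  show "(\<lambda>n. Mn n k a w) \<longlonglongrightarrow> M k a w"
   unfolding Mn_def M_def
   by (rule continuous_on_tendsto_compose[OF c \<tau>_tendsto[OF g]]) (auto simp: E_nonneg[OF g] \<tau>_def gt_pos)
 qed
 have [measurable]: "M k a \<in> borel_measurable P"
 proof (rule complete_measure.borel_measurable_cong_AE[OF complete])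
  show "(\<lambda>w. lim (\<lambda>n. Mn n k a w)) \<in> borel_measurable P" by measurable
  show "AE w in P. lim (\<lambda>n. Mn n k a w) = M k a w"
   using conv by eventually_elim (rule limI)
 qed
 have bound: "(nn2 P (\<lambda>w. Mn n k a w - M k a w)) \<le> ennreal ((k \<bullet> k) * (\<E> w. \<bar>\<tau> n a w - E a w\<bar>))" for n
 proof -
  have "(nn2 P (\<lambda>w. Mn n k a w - M k a w)) = (\<integral>\<^sup>+w. liminf (\<lambda>m. ennreal ((Mn n k a w - Mn m k a w)^2)) \<partial>P)"
  proof (rule nn_integral_cong_AE, use conv in eventually_elim)
   fix w assume "(\<lambda>n. Mn n k a w) \<longlonglongrightarrow> M k a w"
   then have "(\<lambda>m. ennreal ((Mn n k a w - Mn m k a w)^2)) \<longlonglongrightarrow> ennreal ((Mn n k a w - M k a w)^2)"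
    by (intro tendsto_ennrealI tendsto_intros)
   from lim_imp_Liminf[OF _ this] show "ennreal ((Mn n k a w - M k a w)^2) = liminf (\<lambda>m. ennreal ((Mn n k a w - Mn m k a w)^2))"
    by simp
  qed
  also have "\<dots> \<le> liminf (\<lambda>m. \<integral>\<^sup>+w. ennreal ((Mn n k a w - Mn m k a w)^2) \<partial>P)"
   by (rule nn_integral_liminf) auto
  also have "\<dots> = liminf (\<lambda>m. ennreal ((k \<bullet> k) * (\<E> w. \<bar>\<tau> n a w - \<tau> m a w\<bar>)))"
   using square_integrable_nn_eq[OF square_integrable_diff[OF Mn_square_integrable[OF a] Mn_square_integrable[OF a]]] Mn_distance[OF a]
   by simp
  also have "\<dots> = ennreal ((k \<bullet> k) * (\<E> w. \<bar>\<tau> n a w - E a w\<bar>))"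
  proof (rule lim_imp_Liminf)
   have "(\<lambda>m. \<integral>w. \<bar>\<tau> n a w - \<tau> m a w\<bar> \<partial>P) \<longlonglongrightarrow> (\<E> w. \<bar>\<tau> n a w - E a w\<bar>)"
   proof (rule integral_dominated_convergence[where w="\<lambda>w. \<bar>\<tau> n a w\<bar> + (2 * E a w + 1)"])
    show "integrable P (\<lambda>w. \<bar>\<tau> n a w\<bar> + (2 * E a w + 1))" using E_integrable[OF a] \<tau>_L1(2)[OF a] by simp
    show "AE w in P. (\<lambda>m. \<bar>\<tau> n a w - \<tau> m a w\<bar>) \<longlonglongrightarrow> \<bar>\<tau> n a w - E a w\<bar>"
     using AE_good by eventually_elim (intro tendsto_intros \<tau>_tendsto)
    show "AE w in P. norm \<bar>\<tau> n a w - \<tau> m a w\<bar> \<le> \<bar>\<tau> n a w\<bar> + (2 * E a w + 1)" for m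
     using AE_good
    proof eventually_elim
     fix w assume g: "good w"
     show "norm \<bar>\<tau> n a w - \<tau> m a w\<bar> \<le> \<bar>\<tau> n a w\<bar> + (2 * E a w + 1)"
      using \<tau>_bound[OF g, of m a] E_nonneg[OF g, of a] by (simp add: abs_if split: if_splits)
    qed
   qed (use a in auto)
   then show "(\<lambda>m. ennreal ((k \<bullet> k) * (\<E> w. \<bar>\<tau> n a w - \<tau> m a w\<bar>))) \<longlonglongrightarrow> ennreal ((k \<bullet> k) * (\<E> w. \<bar>\<tau> n a w - E a w\<bar>))"
    by (intro tendsto_ennrealI tendsto_intros)
  qed simp
  finally show ?thesis .
 qed
 have "(\<lambda>n. ennreal ((k \<bullet> k) * (\<E> w. \<bar>\<tau> n a w - E a w\<bar>))) \<longlonglongrightarrow> ennreal ((k \<bullet> k) * 0)"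
  by (intro tendsto_ennrealI tendsto_intros \<tau>_L1 a)
 then have "(\<lambda>n. ennreal ((k \<bullet> k) * (\<E> w. \<bar>\<tau> n a w - E a w\<bar>))) \<longlonglongrightarrow> 0" by simp
 from ennreal_squeeze_0[OF bound this] show ?thesis by (simp add: L2_limit_def)
qed

lemma M_square_integrable: "0 \<le> a \<Longrightarrow> square_integrable P (M k a)"
 using L2_limit_square_integrable(1)[OF M_limit Mn_square_integrable] .

lemma dS_limit:
 assumes ab: "0 \<le> a" "a \<le> b"
 shows "L2_limit P (\<lambda>n. dS n k a b) (\<lambda>w. M k b w - M k a w)"
proof -
 have b: "0 \<le> b" using ab by simp
 have "L2_limit P (\<lambda>n w. Mn n k b w + (-1) * Mn n k a w) (\<lambda>w. M k b w + (-1) * M k a w)"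
  by (intro L2_limit_add L2_limit_scale M_limit ab b)
 then have L: "L2_limit P (\<lambda>n w. Mn n k b w - Mn n k a w) (\<lambda>w. M k b w - M k a w)" by simp
 have "(nn2 P (\<lambda>w. dS n k a b w - (M k b w - M k a w))) =
   (nn2 P (\<lambda>w. (Mn n k b w - Mn n k a w) - (M k b w - M k a w)))" for n
  using AE_Mn_diff[OF ab(2), of n k] by (intro nn_integral_cong_AE) (auto elim: eventually_mono)
 then show ?thesis using L dS_square_integrable[OF ab(1) b] by (simp add: L2_limit_def square_integrable_def)
qed

text \<open>For \<open>i < L n\<close> no cut-off takes place, and then the index \<open>i\<close> forces
  \<open>E c < gt n i\<close>.\<close>

lemma G_idx_past:
 assumes c: "0 \<le> c" and Y: "Y \<in> borel_measurable (G c)" and i: "i < L n"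
 shows "(\<lambda>w. Y w * (if idx n c w = i then 1 else 0 :: real)) \<in> borel_measurable (past (gt n i))"
proof -
 have [measurable]: "idx n c \<in> measurable (past (gt n i)) (count_space UNIV)" by (rule idx_measurable_past[OF c])
 note [measurable] = G_restrict_past[OF c Y, of "gt n i"]
 have "(\<lambda>w. (Y w * (if E c w < gt n i then 1 else 0)) * (if idx n c w = i then 1 else 0)) \<in> borel_measurable (past (gt n i))"
  by measurable
 moreover have "(Y w * (if E c w < gt n i then 1 else 0)) * (if idx n c w = i then 1 else 0) = Y w * (if idx n c w = i then 1 else 0)" for w
  using E_less_gt[of n c w] i by auto
 ultimately show ?thesis by simp
qed

lemma bounded_integrable:
 fixes Y :: "'a \<Rightarrow> real"
 assumes "Y \<in> borel_measurable P" "\<And>w. w \<in> space P \<Longrightarrow> \<bar>Y w\<bar> \<le> C"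
 shows "integrable P Y"
 using assms by (intro integrable_const_bound[where B=C]) auto

text \<open>The formula holds for the discretised times, with their difference in place of that of
  \<open>E\<close>, and passes to the limit.\<close>

lemma M_increment_square:
 assumes ab: "0 \<le> a" "a \<le> b" and Y: "Y \<in> borel_measurable (G a)" "\<And>w. w \<in> space P \<Longrightarrow> \<bar>Y w\<bar> \<le> C"
 shows "(\<E> w. Y w * ((M k b w - M k a w) * (M l b w - M l a w))) = (k \<bullet> l) * (\<E> w. Y w * (E b w - E a w))"
proof -
 have b: "0 \<le> b" using ab by simp
 have [measurable]: "Y \<in> borel_measurable P" by (rule G_measurable[OF ab(1) Y(1)])
 have [measurable]: "E a \<in> borel_measurable P" "E b \<in> borel_measurable P" "\<tau> n a \<in> borel_measurable P" "\<tau> n b \<in> borel_measurable P" for n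
  using ab b by simp_all
 have intY: "integrable P Y" by (rule bounded_integrable[OF _ Y(2)]) measurable
 have eq: "(\<E> w. (Y w * dS n k a b w) * dS n l a b w) = (k \<bullet> l) * (\<E> w. Y w * (\<tau> n b w - \<tau> n a w))" for n
 proof -
  have "(\<E> w. Y w * (if idx n a w < idx n b w then \<tau> n b w - \<tau> n a w else 0)) = (\<E> w. Y w * (\<tau> n b w - \<tau> n a w))"
  proof (rule integral_cong_AE)
   have [measurable]: "idx n a \<in> measurable P (count_space UNIV)" "idx n b \<in> measurable P (count_space UNIV)" using ab b by simp_all
   show "(\<lambda>w. Y w * (if idx n a w < idx n b w then \<tau> n b w - \<tau> n a w else 0)) \<in> borel_measurable P" by measurable
   show "AE w in P. Y w * (if idx n a w < idx n b w then \<tau> n b w - \<tau> n a w else 0) = Y w * (\<tau> n b w - \<tau> n a w)"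
    using AE_idx_mono[OF ab(2), of n] by eventually_elim (auto simp: \<tau>_def)
  qed measurable
  then show ?thesis using step_square[OF ab(1) b intY G_idx_past[OF ab(1) Y(1)], of n k l] by (simp add: mult.assoc)
 qed
 have lim1: "(\<lambda>n. \<integral>w. (Y w * dS n k a b w) * dS n l a b w \<partial>P) \<longlonglongrightarrow> (\<E> w. (Y w * (M k b w - M k a w)) * (M l b w - M l a w))"
  by (rule L2_limit_product[OF L2_limit_bounded_mult[OF dS_limit[OF ab] _ Y(2)] square_integrable_bounded_mult[OF dS_square_integrable _ Y(2)] dS_limit[OF ab] dS_square_integrable])
    (use ab b in auto)
 have lim2: "(\<lambda>n. \<integral>w. Y w * (\<tau> n b w - \<tau> n a w) \<partial>P) \<longlonglongrightarrow> (\<E> w. Y w * (E b w - E a w))"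
 proof (rule integral_dominated_convergence[where w="\<lambda>w. \<bar>C\<bar> * ((2 * E b w + 1) + (2 * E a w + 1))"])
  show "integrable P (\<lambda>w. \<bar>C\<bar> * ((2 * E b w + 1) + (2 * E a w + 1)))"
   using E_integrable[OF ab(1)] E_integrable[OF b] by simp
  show "AE w in P. (\<lambda>n. Y w * (\<tau> n b w - \<tau> n a w)) \<longlonglongrightarrow> Y w * (E b w - E a w)"
   using AE_good by eventually_elim (intro tendsto_intros \<tau>_tendsto)
  show "AE w in P. norm (Y w * (\<tau> n b w - \<tau> n a w)) \<le> \<bar>C\<bar> * ((2 * E b w + 1) + (2 * E a w + 1))" for n
   using AE_good AE_space
  proof eventually_elim
   fix w assume g: "good w" and "w \<in> space P"
   then have "\<bar>Y w\<bar> \<le> \<bar>C\<bar>" using Y(2)[of w] by linarith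
   moreover have "\<bar>\<tau> n b w - \<tau> n a w\<bar> \<le> (2 * E b w + 1) + (2 * E a w + 1)"
    using \<tau>_bound[OF g, of n a] \<tau>_bound[OF g, of n b] E_nonneg[OF g, of a] E_nonneg[OF g, of b] by (simp add: abs_if split: if_splits)
   ultimately show "norm (Y w * (\<tau> n b w - \<tau> n a w)) \<le> \<bar>C\<bar> * ((2 * E b w + 1) + (2 * E a w + 1))"
    unfolding real_norm_def abs_mult by (intro mult_mono) auto
  qed
 qed measurable
 have "(\<lambda>n. (k \<bullet> l) * (\<E> w. Y w * (\<tau> n b w - \<tau> n a w))) \<longlonglongrightarrow> (k \<bullet> l) * (\<E> w. Y w * (E b w - E a w))"
  by (intro tendsto_intros lim2)
 from LIMSEQ_unique[OF lim1[unfolded eq] this] show ?thesis by (simp add: mult.assoc)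
qed

text \<open>The earlier increment joins \<open>Y\<close> in the weight: once the start of the later increment
  has a fixed value, the earlier increment only involves noise up to that value.\<close>

lemma M_increment_orthogonal:
 assumes abcd: "0 \<le> a" "a \<le> b" "b \<le> c" "c \<le> d" and Y: "Y \<in> borel_measurable (G c)" "\<And>w. w \<in> space P \<Longrightarrow> \<bar>Y w\<bar> \<le> C"
 shows "(\<E> w. Y w * ((M k b w - M k a w) * (M l d w - M l c w))) = 0"
proof -
 have pos: "0 \<le> b" "0 \<le> c" "0 \<le> d" using abcd by auto
 have [measurable]: "Y \<in> borel_measurable P" by (rule G_measurable[OF pos(2) Y(1)])
 have zero: "(\<E> w. (Y w * dS n k a b w) * dS n l c d w) = 0" for n
 proof -
  \<comment> \<open>The last factor is 1 almost surely; it makes the measurability in the past hold everywhere.\<close>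
  define V where "V w = Y w * dS n k a b w * (if idx n b w \<le> idx n c w then 1 else 0)" for w
  have [measurable]: "idx n b \<in> measurable P (count_space UNIV)" "idx n c \<in> measurable P (count_space UNIV)" using pos by simp_all
  have [measurable]: "dS n k a b \<in> borel_measurable P" "dS n l c d \<in> borel_measurable P"
   using dS_square_integrable abcd(1) pos by (auto simp: square_integrable_def)
  have sq: "square_integrable P (\<lambda>w. Y w * dS n k a b w)"
   by (rule square_integrable_bounded_mult[OF dS_square_integrable _ Y(2)]) (use abcd(1) pos in auto)
  have "integrable P V" unfolding V_def
   by (rule integrable_bounded_mult[OF L1_le_norm2(2)[OF sq], where C=1]) auto
  moreover have "(\<lambda>w. V w * (if idx n c w = i then 1 else 0)) \<in> borel_measurable (past (gt n i))" if i: "i < L n" for i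
  proof -
   have [measurable]: "idx n c \<in> measurable (past (gt n i)) (count_space UNIV)" "idx n b \<in> measurable (past (gt n i)) (count_space UNIV)"
    using pos by (auto intro: idx_measurable_past)
   have "(\<lambda>w. (Y w * (if idx n c w = i then 1 else 0)) *
     ((if idx n b w \<le> i then 1 else 0) * (\<Sum>p\<in>{p \<in> Pairs n. snd p \<le> i}. at_pair n a b p w * inc_at n k p w))) \<in> borel_measurable (past (gt n i))"
   proof (rule borel_measurable_times[OF G_idx_past[OF pos(2) Y(1) i]], intro borel_measurable_times borel_measurable_sum)
    show "(\<lambda>w. if idx n b w \<le> i then 1 else 0 :: real) \<in> borel_measurable (past (gt n i))" by measurable
    fix p assume p: "p \<in> {p \<in> Pairs n. snd p \<le> i}"
    show "at_pair n a b p \<in> borel_measurable (past (gt n i))" by (rule at_pair_past[OF abcd(1) pos(1)])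
    show "inc_at n k p \<in> borel_measurable (past (gt n i))"
     unfolding inc_def[abs_def] using p
     by (intro borel_measurable_diff B_past gt_pos gt_mono) (auto simp: Pairs_def)
   qed
   moreover have "(Y w * (if idx n c w = i then 1 else 0)) *
     ((if idx n b w \<le> i then 1 else 0) * (\<Sum>p\<in>{p \<in> Pairs n. snd p \<le> i}. at_pair n a b p w * inc_at n k p w))
     = V w * (if idx n c w = i then 1 else 0)" for w
   proof (cases "idx n c w = i \<and> idx n b w \<le> i")
    case True
    have "dS n k a b w = (\<Sum>p\<in>{p \<in> Pairs n. snd p \<le> i}. at_pair n a b p w * inc_at n k p w)"
     unfolding dS_def using True by (intro sum.mono_neutral_right) (auto simp: at_pair_def)
    then show ?thesis using True by (simp add: V_def)
   qed (auto simp: V_def)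
   ultimately show ?thesis by simp
  qed
  ultimately have "(\<E> w. V w * dS n l c d w) = 0" by (intro step_zero pos)
  moreover have "(\<E> w. V w * dS n l c d w) = (\<E> w. (Y w * dS n k a b w) * dS n l c d w)"
  proof (rule integral_cong_AE)
   show "AE w in P. V w * dS n l c d w = (Y w * dS n k a b w) * dS n l c d w"
    using AE_idx_mono[OF abcd(3), of n] by eventually_elim (simp add: V_def)
  qed (unfold V_def, measurable)
  ultimately show ?thesis by simp
 qed
 have "(\<lambda>n. \<integral>w. (Y w * dS n k a b w) * dS n l c d w \<partial>P) \<longlonglongrightarrow> (\<E> w. (Y w * (M k b w - M k a w)) * (M l d w - M l c w))"
  by (rule L2_limit_product[OF L2_limit_bounded_mult[OF dS_limit[OF abcd(1,2)] _ Y(2)] square_integrable_bounded_mult[OF dS_square_integrable _ Y(2)] dS_limit[OF pos(2) abcd(4)] dS_square_integrable])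
    (use abcd(1) pos in auto)
 then have "(\<E> w. (Y w * (M k b w - M k a w)) * (M l d w - M l c w)) = 0"
  unfolding zero by (simp add: LIMSEQ_const_iff)
 then show ?thesis by (simp add: mult.assoc)
qed

end

section \<open>The predictable sigma-field and the measure of the time change\<close>

locale integration = time_changed I e f \<iota> fj P F B E \<beta> U G
 for I :: "nat set" and e :: "nat \<Rightarrow> 'k::{real_inner, complete_space}"
  and f :: "real ^ 'n \<Rightarrow> real" and \<iota> :: "(real ^ 'n \<Rightarrow> real) \<Rightarrow> 'k" and fj :: "nat \<Rightarrow> real ^ 'n \<Rightarrow> real"
  and P :: "'a measure" and F B E \<beta> U G +
 fixes T :: real
 assumes T_pos: "0 < T"
begin

abbreviation PS :: "('a \<times> real) measure" where "PS \<equiv> predictable_sigma P G T"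

text \<open>The generator of the predictable \<open>\<sigma>\<close>-field.\<close>

definition rects :: "('a \<times> real) set set" where
 "rects = {A \<times> {a<..b} |a b A. 0 \<le> a \<and> a < b \<and> b \<le> T \<and> A \<in> sets (G a)}"

lemma rectI: "0 \<le> a \<Longrightarrow> a < b \<Longrightarrow> b \<le> T \<Longrightarrow> A \<in> sets (G a) \<Longrightarrow> A \<times> {a<..b} \<in> rects"
 unfolding rects_def by blast

lemma rects_Pow: "rects \<subseteq> Pow (space P \<times> {0<..T})"
proof
 fix R assume "R \<in> rects"
 then obtain a b A where R: "R = A \<times> {a<..b}" "0 \<le> a" "b \<le> T" "A \<in> sets (G a)" unfolding rects_def by blast
 have "A \<subseteq> space P" using sets.sets_into_space[OF R(4)] by simp
 then show "R \<in> Pow (space P \<times> {0<..T})" using R by auto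
qed

lemma space_PS [simp]: "space PS = space P \<times> {0<..T}"
 unfolding predictable_sigma_def by (simp add: space_measure_of_conv)

lemma sets_PS: "sets PS = sigma_sets (space P \<times> {0<..T}) rects"
 unfolding predictable_sigma_def rects_def[symmetric] by (rule sets_measure_of[OF rects_Pow])

lemma rects_PS: "R \<in> rects \<Longrightarrow> R \<in> sets PS"
 unfolding sets_PS by (rule sigma_sets.Basic)

lemma Int_stable_rects: "Int_stable rects"
proof (rule Int_stableI)
 fix R R' assume "R \<in> rects" "R' \<in> rects"
 then obtain a b A a' b' A' where R: "R = A \<times> {a<..b}" "0 \<le> a" "a < b" "b \<le> T" "A \<in> sets (G a)"
  and R': "R' = A' \<times> {a'<..b'}" "0 \<le> a'" "a' < b'" "b' \<le> T" "A' \<in> sets (G a')"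
  unfolding rects_def by blast
 show "R \<inter> R' \<in> rects"
 proof (cases "max a a' < min b b'")
  case True
  have "A \<in> sets (G (max a a'))" "A' \<in> sets (G (max a a'))"
   using R R' G_mono[of a "max a a'"] G_mono[of a' "max a a'"] by auto
  moreover have "R \<inter> R' = (A \<inter> A') \<times> {max a a'<..min b b'}" using R(1) R'(1) by auto
  ultimately show ?thesis using R R' True by (auto intro!: rectI)
 next
  case False
  then have "R \<inter> R' = {} \<times> {0<..T}" using R(1) R'(1) by auto
  then show ?thesis using T_pos rectI[of 0 T "{}"] by simp
 qed
qed

lemma PS_le: "sets PS \<subseteq> sets (P \<Otimes>\<^sub>M borel)"
proof -
 have "rects \<subseteq> sets (P \<Otimes>\<^sub>M borel)"
  using sets_G_le unfolding rects_def by (auto intro!: pair_measureI)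
 moreover have "space P \<times> {0<..T} \<in> sets (P \<Otimes>\<^sub>M borel)" by (intro pair_measureI) auto
 ultimately show ?thesis
  unfolding sets_PS by (intro sets.sigma_sets_subset') auto
qed

abbreviation IM :: "'a \<Rightarrow> real measure" where "IM w \<equiv> interval_measure (\<lambda>t. E t w)"

text \<open>Predictable sets are product measurable, hence their sections are Borel sets.\<close>

lemma section_measurable:
 fixes u :: "'a \<times> real \<Rightarrow> ennreal"
 assumes u: "u \<in> borel_measurable PS" and w: "w \<in> space P"
 shows "(\<lambda>t. u (w, t) * indicator {0<..T} t) \<in> borel_measurable (IM w)"
proof (rule measurableI)
 fix S :: "ennreal set" assume "S \<in> sets borel"
 then have "u -` S \<inter> space PS \<in> sets (P \<Otimes>\<^sub>M borel)" using measurable_sets[OF u] PS_le by blast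
 then have 1: "Pair w -` (u -` S \<inter> space PS) \<in> sets borel" by (rule sets_Pair1)
 have "(\<lambda>t. u (w, t) * indicator {0<..T} t) -` S \<inter> space (IM w) = Pair w -` (u -` S \<inter> space PS) \<union> (if 0 \<in> S then - {0<..T} else {})"
  using w by (auto split: split_indicator_asm split_indicator)
 then show "(\<lambda>t. u (w, t) * indicator {0<..T} t) -` S \<inter> space (IM w) \<in> sets (IM w)" using 1 by auto
qed simp

text \<open>Integration against the Stieltjes measure of one path of the time change. On the exceptional paths
  that measure has no relation to \<open>E\<close>, so every evaluation is restricted to good paths.\<close>

definition kern :: "('a \<times> real \<Rightarrow> ennreal) \<Rightarrow> 'a \<Rightarrow> ennreal" where
 "kern u w = (\<integral>\<^sup>+t\<in>{0<..T}. u (w, t) \<partial>IM w)"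

lemma IM_Ioc: "good w \<Longrightarrow> a \<le> b \<Longrightarrow> emeasure (IM w) {a<..b} = ennreal (E b w - E a w)"
 by (rule emeasure_interval_measure_Ioc) (auto intro: E_mono E_right_continuous)

lemma kern_rect:
 assumes "good w" "0 \<le> a" "a < b" "b \<le> T"
 shows "kern (\<lambda>z. h (fst z) * indicator {a<..b} (snd z)) w = h w * ennreal (E b w - E a w)"
proof -
 have "kern (\<lambda>z. h (fst z) * indicator {a<..b} (snd z)) w = (\<integral>\<^sup>+t. h w * indicator {a<..b} t \<partial>IM w)"
  unfolding kern_def using assms by (intro nn_integral_cong) (auto split: split_indicator)
 also have "\<dots> = h w * emeasure (IM w) {a<..b}" by (rule nn_integral_cmult_indicator) simp
 finally show ?thesis using IM_Ioc[OF assms(1), of a b] assms(3) by simp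
qed

lemma kern_finite: "good w \<Longrightarrow> kern (\<lambda>_. 1) w = ennreal (E T w - E 0 w)"
proof -
 assume "good w"
 from kern_rect[OF this, of 0 T "\<lambda>_. 1"] T_pos
 have "kern (\<lambda>z. 1 * indicator {0<..T} (snd z)) w = ennreal (E T w - E 0 w)" by simp
 moreover have "kern (\<lambda>z. 1 * indicator {0<..T} (snd z)) w = kern (\<lambda>_. 1) w"
  unfolding kern_def by (intro nn_integral_cong) (auto split: split_indicator)
 ultimately show ?thesis by simp
qed

lemma kern_mono: "(\<And>t. t \<in> {0<..T} \<Longrightarrow> u (w, t) \<le> v (w, t)) \<Longrightarrow> kern u w \<le> kern v w"
 unfolding kern_def by (intro nn_integral_mono) (auto split: split_indicator)

lemma kern_cong: "(\<And>t. t \<in> {0<..T} \<Longrightarrow> u (w, t) = v (w, t)) \<Longrightarrow> kern u w = kern v w"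
 unfolding kern_def by (intro nn_integral_cong) (auto split: split_indicator)

lemma kern_cmult: "u \<in> borel_measurable PS \<Longrightarrow> w \<in> space P \<Longrightarrow> kern (\<lambda>z. c * u z) w = c * kern u w"
 unfolding kern_def using section_measurable by (simp add: mult.assoc nn_integral_cmult)

lemma kern_add: "u \<in> borel_measurable PS \<Longrightarrow> v \<in> borel_measurable PS \<Longrightarrow> w \<in> space P \<Longrightarrow> kern (\<lambda>z. u z + v z) w = kern u w + kern v w"
 unfolding kern_def using section_measurable by (simp add: distrib_right nn_integral_add)

lemma kern_suminf:
 assumes "\<And>i. u i \<in> borel_measurable PS" "w \<in> space P"
 shows "kern (\<lambda>z. \<Sum>i. u i z) w = (\<Sum>i. kern (u i) w)"
 unfolding kern_def
 by (simp add: nn_integral_suminf[OF section_measurable[OF assms(1) assms(2)], symmetric])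

lemma kern_SUP:
 assumes "\<And>i. u i \<in> borel_measurable PS" "incseq u" "w \<in> space P"
 shows "kern (\<lambda>z. SUP i. u i z) w = (SUP i. kern (u i) w)"
proof -
 have "(\<integral>\<^sup>+t. (SUP i. u i (w, t) * indicator {0<..T} t) \<partial>IM w) = (SUP i. \<integral>\<^sup>+t. u i (w, t) * indicator {0<..T} t \<partial>IM w)"
  using section_measurable[OF assms(1) assms(3)] assms(2)
  by (intro nn_integral_monotone_convergence_SUP) (auto simp: incseq_def le_fun_def intro!: mult_right_mono)
 then show ?thesis unfolding kern_def by (simp add: SUP_mult_right_ennreal)
qed

lemma E0T_measurable [measurable]: "E 0 \<in> borel_measurable P" "E T \<in> borel_measurable P"
 using T_pos by simp_all

text \<open>The class of sets with this property is a Dynkin system containing the rectangles, on which the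
  value is an increment of \<open>E\<close>. Completeness absorbs the exceptional paths.\<close>

lemma kern_indicator_measurable: "S \<in> sets PS \<Longrightarrow> kern (indicator S) \<in> borel_measurable P"
 unfolding sets_PS
proof (induction rule: sigma_sets_induct_disjoint[OF Int_stable_rects rects_Pow, consumes 1, case_names basic empty compl union])
 case (basic R)
 then obtain a b A where R: "R = A \<times> {a<..b}" "0 \<le> a" "a < b" "b \<le> T" "A \<in> sets (G a)" unfolding rects_def by blast
 have [measurable]: "A \<in> sets P" using R sets_G_le by auto
 have [measurable]: "E a \<in> borel_measurable P" "E b \<in> borel_measurable P" using R by simp_all
 have "(\<lambda>w. indicator A w * ennreal (E b w - E a w)) \<in> borel_measurable P" by measurable
 moreover have "AE w in P. indicator A w * ennreal (E b w - E a w) = kern (indicator R) w"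
  using AE_good
 proof eventually_elim
  fix w assume "good w"
  from kern_rect[OF this R(2,3,4), of "indicator A"]
  have "kern (\<lambda>z. indicator A (fst z) * indicator {a<..b} (snd z)) w = indicator A w * ennreal (E b w - E a w)" .
  moreover have "kern (indicator R) w = kern (\<lambda>z. indicator A (fst z) * indicator {a<..b} (snd z)) w"
   by (rule kern_cong) (auto simp: R(1) split: split_indicator)
  ultimately show "indicator A w * ennreal (E b w - E a w) = kern (indicator R) w" by simp
 qed
 ultimately show ?case by (rule complete_measure.borel_measurable_cong_AE[OF complete])
next
 case empty
 show ?case by (simp add: kern_def)
next
 case (compl H)
 then have H: "H \<in> sets PS" by (simp add: sets_PS)
 note [measurable] = compl(2)
 have "(\<lambda>w. ennreal (E T w - E 0 w) - kern (indicator H) w) \<in> borel_measurable P" by measurable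
 moreover have "AE w in P. ennreal (E T w - E 0 w) - kern (indicator H) w = kern (indicator (space P \<times> {0<..T} - H)) w"
  using AE_good AE_space
 proof eventually_elim
  fix w assume g: "good w" and w: "w \<in> space P"
  let ?C = "space P \<times> {0<..T} - H"
  have "?C \<in> sets PS" using sets.compl_sets[OF H] by simp
  then have "kern (\<lambda>z. indicator H z + indicator ?C z) w = kern (indicator H) w + kern (indicator ?C) w"
   using H w by (intro kern_add) auto
  moreover have "kern (\<lambda>z. indicator H z + indicator ?C z) w = kern (\<lambda>_. 1) w"
   using w by (intro kern_cong) (auto split: split_indicator)
  ultimately have sum: "ennreal (E T w - E 0 w) = kern (indicator H) w + kern (indicator ?C) w"
   using kern_finite[OF g] by simp
  then have "kern (indicator H) w \<noteq> \<infinity>" by (metis ennreal_neq_top infinity_ennreal_def ennreal_add_eq_top)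
  then show "ennreal (E T w - E 0 w) - kern (indicator H) w = kern (indicator ?C) w"
   unfolding sum by (simp add: ennreal_add_diff_cancel_left)
 qed
 ultimately show ?case by (rule complete_measure.borel_measurable_cong_AE[OF complete])
next
 case (union H)
 then have H: "H i \<in> sets PS" for i by (auto simp: sets_PS)
 have "kern (indicator (\<Union>i. H i)) w = (\<Sum>i. kern (indicator (H i)) w)" if "w \<in> space P" for w
 proof -
  have "kern (indicator (\<Union>i. H i)) w = kern (\<lambda>z. \<Sum>i. indicator (H i) z) w"
   using suminf_indicator[OF union(1)] by (intro kern_cong) (simp add: fun_eq_iff)
  then show ?thesis using kern_suminf[of "\<lambda>i. indicator (H i)", OF _ that] H by simp
 qed
 moreover have "(\<lambda>w. \<Sum>i. kern (indicator (H i)) w) \<in> borel_measurable P" using union(3) by (intro borel_measurable_suminf_order) auto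
 ultimately show ?case by (simp cong: measurable_cong)
qed

lemma kern_measurable: "u \<in> borel_measurable PS \<Longrightarrow> kern u \<in> borel_measurable P"
proof (induction rule: borel_measurable_induct)
 case (cong f g)
 have "kern f w = kern g w" if "w \<in> space P" for w using cong(3) that by (intro kern_cong) auto
 then show ?case using cong(4) by (simp cong: measurable_cong)
next
 case (set A)
 then show ?case by (rule kern_indicator_measurable)
next
 case (mult u c)
 have "(\<lambda>w. c * kern u w) \<in> borel_measurable P" using mult by measurable
 then show ?case using kern_cmult[OF mult(2)] by (simp cong: measurable_cong)
next
 case (add u v)
 have "(\<lambda>w. kern v w + kern u w) \<in> borel_measurable P" using add by measurable
 then show ?case using kern_add[OF add.hyps(3) add.hyps(1)] by (simp cong: measurable_cong)
next
 case (seq U)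
 have "(\<lambda>w. SUP i. kern (U i) w) \<in> borel_measurable P" using seq by measurable
 moreover have "kern (\<lambda>z. SUP i. U i z) w = (SUP i. kern (U i) w)" if "w \<in> space P" for w
  by (rule kern_SUP[OF seq.hyps(1) seq.hyps(3) that])
 ultimately have "kern (\<lambda>z. SUP i. U i z) \<in> borel_measurable P" by (simp cong: measurable_cong)
 then show ?case by (simp add: SUP_apply[abs_def] image_comp)
qed

text \<open>The measure \<open>P(d\<omega>) dE\<^sub>t\<close> on predictable sets.\<close>

definition \<nu> :: "('a \<times> real) measure" where
 "\<nu> = measure_of (space PS) (sets PS) (\<lambda>H. \<integral>\<^sup>+w. kern (indicator H) w \<partial>P)"

lemma sets_nu [simp, measurable_cong]: "sets \<nu> = sets PS"
 unfolding \<nu>_def by (rule sets.sets_measure_of_eq)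

lemma space_nu [simp]: "space \<nu> = space P \<times> {0<..T}"
 using sets_eq_imp_space_eq[OF sets_nu] by simp

lemma emeasure_nu: "S \<in> sets PS \<Longrightarrow> emeasure \<nu> S = (\<integral>\<^sup>+w. kern (indicator S) w \<partial>P)"
 unfolding \<nu>_def
proof (rule emeasure_measure_of_sigma)
 show "sigma_algebra (space PS) (sets PS)" ..
 show "positive (sets PS) (\<lambda>H. \<integral>\<^sup>+w. kern (indicator H) w \<partial>P)"
  by (simp add: positive_def kern_def)
 show "countably_additive (sets PS) (\<lambda>H. \<integral>\<^sup>+w. kern (indicator H) w \<partial>P)"
 proof (rule countably_additiveI)
  fix H :: "nat \<Rightarrow> ('a \<times> real) set" assume H: "range H \<subseteq> sets PS" "disjoint_family H"
  have "(\<Sum>i. \<integral>\<^sup>+w. kern (indicator (H i)) w \<partial>P) = (\<integral>\<^sup>+w. (\<Sum>i. kern (indicator (H i)) w) \<partial>P)"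
   using H(1) kern_indicator_measurable by (intro nn_integral_suminf[symmetric]) auto
  also have "\<dots> = (\<integral>\<^sup>+w. kern (indicator (\<Union>i. H i)) w \<partial>P)"
  proof (rule nn_integral_cong)
   fix w assume w: "w \<in> space P"
   have "kern (indicator (\<Union>i. H i)) w = kern (\<lambda>z. \<Sum>i. indicator (H i) z) w"
    using suminf_indicator[OF H(2)] by (intro kern_cong) (simp add: fun_eq_iff)
   then show "(\<Sum>i. kern (indicator (H i)) w) = kern (indicator (\<Union>i. H i)) w"
    using kern_suminf[of "\<lambda>i. indicator (H i)", OF _ w] H(1) by (simp add: subset_eq)
  qed
  finally show "(\<Sum>i. \<integral>\<^sup>+w. kern (indicator (H i)) w \<partial>P) = (\<integral>\<^sup>+w. kern (indicator (\<Union>i. H i)) w \<partial>P)" .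
 qed
qed

lemma nn_integral_nu: "u \<in> borel_measurable PS \<Longrightarrow> (\<integral>\<^sup>+z. u z \<partial>\<nu>) = (\<integral>\<^sup>+w. kern u w \<partial>P)"
proof (induction rule: borel_measurable_induct)
 case (cong f g)
 have "(\<integral>\<^sup>+w. kern f w \<partial>P) = (\<integral>\<^sup>+w. kern g w \<partial>P)" using cong(3) by (intro nn_integral_cong kern_cong) auto
 moreover have "(\<integral>\<^sup>+z. f z \<partial>\<nu>) = (\<integral>\<^sup>+z. g z \<partial>\<nu>)" using cong(3) by (intro nn_integral_cong) auto
 ultimately show ?case using cong(4) by simp
next
 case (set A)
 then show ?case by (simp add: emeasure_nu)
next
 case (mult u c)
 then have "(\<integral>\<^sup>+w. kern (\<lambda>z. c * u z) w \<partial>P) = (\<integral>\<^sup>+w. c * kern u w \<partial>P)" by (intro nn_integral_cong kern_cmult)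
 then show ?case using mult kern_measurable by (simp add: nn_integral_cmult)
next
 case (add u v)
 then have "(\<integral>\<^sup>+w. kern (\<lambda>z. v z + u z) w \<partial>P) = (\<integral>\<^sup>+w. kern v w + kern u w \<partial>P)" by (intro nn_integral_cong kern_add)
 then show ?case using add kern_measurable by (simp add: nn_integral_add)
next
 case (seq U)
 have U: "U i \<in> borel_measurable \<nu>" for i using seq(1) by simp
 have "(\<integral>\<^sup>+w. kern (\<lambda>z. SUP i. U i z) w \<partial>P) = (\<integral>\<^sup>+w. (SUP i. kern (U i) w) \<partial>P)"
  by (intro nn_integral_cong kern_SUP[OF seq.hyps(1) seq.hyps(3)])
 also have "\<dots> = (SUP i. \<integral>\<^sup>+w. kern (U i) w \<partial>P)"
  using seq kern_measurable by (intro nn_integral_monotone_convergence_SUP) (auto simp: incseq_def le_fun_def intro!: kern_mono)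
 also have "\<dots> = (SUP i. \<integral>\<^sup>+z. U i z \<partial>\<nu>)" using seq.IH by simp
 also have "\<dots> = (\<integral>\<^sup>+z. (SUP i. U i z) \<partial>\<nu>)" using seq.hyps(3) U by (intro nn_integral_monotone_convergence_SUP[symmetric])
 finally show ?case by (simp add: SUP_apply[abs_def] image_comp)
qed

lemma finite_measure_nu: "finite_measure \<nu>"
proof (rule finite_measureI)
 have "emeasure \<nu> (space \<nu>) = (\<integral>\<^sup>+z. 1 \<partial>\<nu>)" by simp
 also have "\<dots> = (\<integral>\<^sup>+w. kern (\<lambda>_. 1) w \<partial>P)" by (rule nn_integral_nu) simp
 also have "\<dots> = (\<integral>\<^sup>+w. ennreal (E T w - E 0 w) \<partial>P)"
  using AE_good kern_finite by (intro nn_integral_cong_AE) (auto elim: eventually_mono)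
 also have "\<dots> \<le> (\<integral>\<^sup>+w. ennreal (norm (E T w - E 0 w)) \<partial>P)" by (intro nn_integral_mono ennreal_leI) simp
 also have "\<dots> < \<infinity>"
  using Bochner_Integration.integrable_diff[OF E_integrable[of T] E_integrable[of 0]] T_pos
  by (simp add: integrable_iff_bounded)
 finally show "emeasure \<nu> (space \<nu>) \<noteq> \<infinity>" by simp
qed

lemma rect_function_measurable:
 fixes X :: "'a \<Rightarrow> real"
 assumes ab: "0 \<le> a" "a < b" "b \<le> T" and X: "X \<in> borel_measurable (G a)"
 shows "(\<lambda>z. indicator {a<..b} (snd z) * X (fst z)) \<in> borel_measurable PS"
proof (rule measurableI)
 fix S :: "real set" assume "S \<in> sets borel"
 then have XS: "X -` S \<inter> space P \<in> sets (G a)" using measurable_sets[OF X] by simp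
 have 1: "(X -` S \<inter> space P) \<times> {a<..b} \<in> sets PS" by (intro rects_PS rectI ab XS)
 have "space P \<in> sets (G a)" using sets.top[of "G a"] by simp
 then have 2: "space P \<times> {a<..b} \<in> sets PS" by (intro rects_PS rectI ab)
 have "(\<lambda>z. indicator {a<..b} (snd z) * X (fst z)) -` S \<inter> space PS =
   (X -` S \<inter> space P) \<times> {a<..b} \<union> (if 0 \<in> S then space PS - space P \<times> {a<..b} else {})"
  using ab by (auto split: split_indicator_asm split_indicator)
 then show "(\<lambda>z. indicator {a<..b} (snd z) * X (fst z)) -` S \<inter> space PS \<in> sets PS"
  using 1 sets.Diff[OF sets.top 2] by (auto intro: sets.Un)
qed simp

lemma
 fixes X :: "'a \<Rightarrow> real"
 assumes ab: "0 \<le> a" "a < b" "b \<le> T" and X: "X \<in> borel_measurable (G a)" and C: "\<And>w. w \<in> space P \<Longrightarrow> \<bar>X w\<bar> \<le> C"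
 shows rect_integrable: "integrable \<nu> (\<lambda>z. indicator {a<..b} (snd z) * X (fst z))"
  and rect_integral: "(\<integral>z. indicator {a<..b} (snd z) * X (fst z) \<partial>\<nu>) = (\<E> w. X w * (E b w - E a w))"
proof -
 interpret nu: finite_measure \<nu> by (rule finite_measure_nu)
 have b: "0 \<le> b" using ab by simp
 have [measurable]: "E a \<in> borel_measurable P" "E b \<in> borel_measurable P" using ab b by simp_all
 have nonneg: "integrable \<nu> (\<lambda>z. indicator {a<..b} (snd z) * Y (fst z)) \<and>
   (\<integral>z. indicator {a<..b} (snd z) * Y (fst z) \<partial>\<nu>) = (\<E> w. Y w * (E b w - E a w)) \<and> integrable P (\<lambda>w. Y w * (E b w - E a w))"
  if Y: "Y \<in> borel_measurable (G a)" "\<And>w. w \<in> space P \<Longrightarrow> 0 \<le> Y w \<and> Y w \<le> D" for Y :: "'a \<Rightarrow> real" and D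
 proof -
  have [measurable]: "Y \<in> borel_measurable P" by (rule G_measurable[OF ab(1) Y(1)])
  have m: "(\<lambda>z. indicator {a<..b} (snd z) * Y (fst z)) \<in> borel_measurable \<nu>"
   using rect_function_measurable[OF ab Y(1)] by simp
  have int: "integrable \<nu> (\<lambda>z. indicator {a<..b} (snd z) * Y (fst z))"
  proof (rule nu.integrable_const_bound[where B=D, OF AE_I2 m])
   fix z assume "z \<in> space \<nu>"
   then have "fst z \<in> space P" by auto
   from Y(2)[OF this] have "0 \<le> Y (fst z)" "Y (fst z) \<le> D" by auto
   then show "norm (indicator {a<..b} (snd z) * Y (fst z)) \<le> D" by (auto split: split_indicator)
  qed
  have intE: "integrable P (\<lambda>w. Y w * (E b w - E a w))"
  proof (rule integrable_dominated)
   show "integrable P (\<lambda>w. D * (E b w - E a w))" using E_integrable[OF b] E_integrable[OF ab(1)] by simp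
   show "AE w in P. norm (Y w * (E b w - E a w)) \<le> norm (D * (E b w - E a w))"
    using AE_space by eventually_elim (use Y(2) in \<open>force simp: abs_mult intro!: mult_right_mono\<close>)
  qed measurable
  have "ennreal (\<integral>z. indicator {a<..b} (snd z) * Y (fst z) \<partial>\<nu>) = (\<integral>\<^sup>+z. ennreal (indicator {a<..b} (snd z) * Y (fst z)) \<partial>\<nu>)"
   using Y(2) by (intro nn_integral_eq_integral[symmetric] int) (auto split: split_indicator)
  also have "\<dots> = (\<integral>\<^sup>+w. kern (\<lambda>z. ennreal (indicator {a<..b} (snd z) * Y (fst z))) w \<partial>P)"
   using rect_function_measurable[OF ab Y(1)] by (intro nn_integral_nu) simp
  also have "\<dots> = (\<integral>\<^sup>+w. ennreal (Y w * (E b w - E a w)) \<partial>P)"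
  proof (rule nn_integral_cong_AE, use AE_good AE_space in eventually_elim)
   fix w assume g: "good w" and w: "w \<in> space P"
   have "kern (\<lambda>z. ennreal (indicator {a<..b} (snd z) * Y (fst z))) w = kern (\<lambda>z. ennreal (Y (fst z)) * indicator {a<..b} (snd z)) w"
    by (intro kern_cong) (auto split: split_indicator)
   also have "\<dots> = ennreal (Y w) * ennreal (E b w - E a w)" by (rule kern_rect[OF g ab])
   also have "\<dots> = ennreal (Y w * (E b w - E a w))" using Y(2)[OF w] by (simp add: ennreal_mult')
   finally show "kern (\<lambda>z. ennreal (indicator {a<..b} (snd z) * Y (fst z))) w = ennreal (Y w * (E b w - E a w))" .
  qed
  also have "\<dots> = ennreal (\<E> w. Y w * (E b w - E a w))"
  proof (rule nn_integral_eq_integral[OF intE])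
   show "AE w in P. 0 \<le> Y w * (E b w - E a w)"
    using AE_good AE_space by eventually_elim (use Y(2) E_mono ab in auto)
  qed
  finally have "ennreal (\<integral>z. indicator {a<..b} (snd z) * Y (fst z) \<partial>\<nu>) = ennreal (\<E> w. Y w * (E b w - E a w))" .
  moreover have "0 \<le> (\<integral>z. indicator {a<..b} (snd z) * Y (fst z) \<partial>\<nu>)"
   using Y(2) by (intro integral_nonneg_AE AE_I2) (auto split: split_indicator)
  moreover have "0 \<le> (\<E> w. Y w * (E b w - E a w))"
  proof (rule integral_nonneg_AE)
   show "AE w in P. 0 \<le> Y w * (E b w - E a w)"
    using AE_good AE_space by eventually_elim (use Y(2) E_mono ab in auto)
  qed
  ultimately show ?thesis using int intE by (simp add: ennreal_inj)
 qed
 have 1: "(\<lambda>w. X w + \<bar>C\<bar>) \<in> borel_measurable (G a)" using X by simp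
 have 2: "0 \<le> X w + \<bar>C\<bar> \<and> X w + \<bar>C\<bar> \<le> 2 * \<bar>C\<bar>" if "w \<in> space P" for w using C[OF that] by (auto simp: abs_if split: if_splits)
 note A = nonneg[OF 1 2] and B = nonneg[of "\<lambda>_. \<bar>C\<bar>" "\<bar>C\<bar>"]
 have eq: "indicator {a<..b} (snd z) * X (fst z) = indicator {a<..b} (snd z) * (X (fst z) + \<bar>C\<bar>) - indicator {a<..b} (snd z) * \<bar>C\<bar>" for z :: "'a \<times> real"
  by (simp add: algebra_simps)
 show "integrable \<nu> (\<lambda>z. indicator {a<..b} (snd z) * X (fst z))"
  unfolding eq using A B by (intro Bochner_Integration.integrable_diff) auto
 have "(\<integral>z. indicator {a<..b} (snd z) * X (fst z) \<partial>\<nu>) = (\<E> w. (X w + \<bar>C\<bar>) * (E b w - E a w)) - (\<E> w. \<bar>C\<bar> * (E b w - E a w))"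
  unfolding eq using A B by (subst Bochner_Integration.integral_diff) auto
 also have "\<dots> = (\<E> w. (X w + \<bar>C\<bar>) * (E b w - E a w) - \<bar>C\<bar> * (E b w - E a w))"
  using A B by (intro Bochner_Integration.integral_diff[symmetric]) auto
 also have "\<dots> = (\<E> w. X w * (E b w - E a w))" by (simp add: algebra_simps)
 finally show "(\<integral>z. indicator {a<..b} (snd z) * X (fst z) \<partial>\<nu>) = (\<E> w. X w * (E b w - E a w))" .
qed

section \<open>The isometry for step functions with values in K\<close>

text \<open>One step of a \<open>K\<close>-valued step function, with the conditions under which it can be
  integrated.\<close>

fun ok :: "real \<times> real \<times> 'k \<times> ('a \<Rightarrow> real) \<Rightarrow> bool" where
 "ok (a, b, k, X) \<longleftrightarrow> 0 \<le> a \<and> a < b \<and> b \<le> T \<and> X \<in> borel_measurable (G a) \<and> (\<exists>C. \<forall>w\<in>space P. \<bar>X w\<bar> \<le> C)"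

fun step_fun :: "real \<times> real \<times> 'k \<times> ('a \<Rightarrow> real) \<Rightarrow> 'a \<times> real \<Rightarrow> real" where
 "step_fun (a, b, k, X) z = indicator {a<..b} (snd z) * X (fst z)"

fun step_vec :: "real \<times> real \<times> 'k \<times> ('a \<Rightarrow> real) \<Rightarrow> 'k" where
 "step_vec (a, b, k, X) = k"

fun step_int :: "real \<times> real \<times> 'k \<times> ('a \<Rightarrow> real) \<Rightarrow> 'a \<Rightarrow> real" where
 "step_int (a, b, k, X) w = X w * (M k b w - M k a w)"

definition Kfun :: "(real \<times> real \<times> 'k \<times> ('a \<Rightarrow> real)) list \<Rightarrow> 'a \<times> real \<Rightarrow> 'k" where
 "Kfun hs z = (\<Sum>h\<leftarrow>hs. step_fun h z *\<^sub>R step_vec h)"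

definition Kint :: "(real \<times> real \<times> 'k \<times> ('a \<Rightarrow> real)) list \<Rightarrow> 'a \<Rightarrow> real" where
 "Kint hs w = (\<Sum>h\<leftarrow>hs. step_int h w)"

lemma increment_square_integrable: "0 \<le> a \<Longrightarrow> 0 \<le> b \<Longrightarrow> square_integrable P (\<lambda>w. M k b w - M k a w)"
 by (intro square_integrable_diff M_square_integrable)

lemma bounded_increment_product_integrable:
 assumes "0 \<le> a" "0 \<le> b" "0 \<le> c" "0 \<le> d" "Y \<in> borel_measurable P" "\<And>w. w \<in> space P \<Longrightarrow> \<bar>Y w\<bar> \<le> C"
 shows "integrable P (\<lambda>w. Y w * ((M k b w - M k a w) * (M l d w - M l c w)))"
proof -
 have "square_integrable P (\<lambda>w. Y w * (M k b w - M k a w))"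
  by (rule square_integrable_bounded_mult[OF increment_square_integrable[OF assms(1,2)] assms(5,6)])
 then have "integrable P (\<lambda>w. (Y w * (M k b w - M k a w)) * (M l d w - M l c w))"
  by (rule square_integrable_mult) (rule increment_square_integrable[OF assms(3,4)])
 then show ?thesis by (simp add: mult.assoc)
qed

text \<open>Both intervals are cut at \<open>a'\<close> and at the earlier of the two end points; all products
  but one involve disjoint intervals.\<close>

lemma M_increments_aligned:
 assumes a: "0 \<le> a" "a \<le> a'" "a' < b" "a' < b'" and Y: "Y \<in> borel_measurable (G a')" "\<And>w. w \<in> space P \<Longrightarrow> \<bar>Y w\<bar> \<le> C"
 defines "c \<equiv> min b b'"
 shows "(\<E> w. Y w * ((M k b w - M k a w) * (M l b' w - M l a' w))) = (k \<bullet> l) * (\<E> w. Y w * (E c w - E a' w))"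
proof -
 have c: "a' \<le> c" "c \<le> b" "c \<le> b'" "0 \<le> a'" "0 \<le> c" "0 \<le> b" "0 \<le> b'" using a unfolding c_def by auto
 have Yc: "Y \<in> borel_measurable (G c)" by (rule G_measurable_mono[OF c(4,1) Y(1)])
 have YP: "Y \<in> borel_measurable P" by (rule G_measurable[OF c(4) Y(1)])
 note int = bounded_increment_product_integrable[where Y=Y, OF _ _ _ _ YP Y(2)]
 let ?p = "\<lambda>u v x y w. Y w * ((M k v w - M k u w) * (M l y w - M l x w))"
 have "(\<E> w. ?p a b a' b' w) = (\<E> w. ?p a a' a' c w + ?p a a' c b' w + ?p a' c a' c w + ?p a' c c b' w + ?p c b a' c w + ?p c b c b' w)"
  by (rule Bochner_Integration.integral_cong) (simp_all add: algebra_simps)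
 also have "\<dots> = (\<E> w. ?p a a' a' c w) + (\<E> w. ?p a a' c b' w) + (\<E> w. ?p a' c a' c w)
   + (\<E> w. ?p a' c c b' w) + (\<E> w. ?p c b a' c w) + (\<E> w. ?p c b c b' w)"
  using a(1) c int by simp
 also have "(\<E> w. ?p a a' a' c w) = 0" by (rule M_increment_orthogonal[OF a(1,2) order_refl c(1) Y])
 also have "(\<E> w. ?p a a' c b' w) = 0" by (rule M_increment_orthogonal[OF a(1,2) c(1) c(3) Yc Y(2)])
 also have "(\<E> w. ?p a' c c b' w) = 0" by (rule M_increment_orthogonal[OF c(4,1) order_refl c(3) Yc Y(2)])
 also have "(\<E> w. ?p c b a' c w) = (\<E> w. Y w * ((M l c w - M l a' w) * (M k b w - M k c w)))"
  by (simp add: mult.commute)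
 also have "\<dots> = 0" by (rule M_increment_orthogonal[OF c(4,1) order_refl c(2) Yc Y(2)])
 also have "(\<E> w. ?p c b c b' w) = 0"
  by (cases "b \<le> b'") (simp_all add: c_def min_def)
 finally show ?thesis using M_increment_square[OF c(4,1) Y, of k l] by simp
qed

lemma step_pair_ordered:
 assumes ok: "ok (a, b, k, X)" "ok (a', b', l, X')" and le: "a \<le> a'"
 shows "integrable \<nu> (\<lambda>z. step_fun (a, b, k, X) z * step_fun (a', b', l, X') z)"
  and "(\<E> w. step_int (a, b, k, X) w * step_int (a', b', l, X') w)
   = (k \<bullet> l) * (\<integral>z. step_fun (a, b, k, X) z * step_fun (a', b', l, X') z \<partial>\<nu>)"
proof -
 obtain C C' where C: "\<And>w. w \<in> space P \<Longrightarrow> \<bar>X w\<bar> \<le> C" "\<And>w. w \<in> space P \<Longrightarrow> \<bar>X' w\<bar> \<le> C'" using ok by auto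
 define Y where "Y w = X w * X' w" for w
 have a: "0 \<le> a" "0 \<le> a'" "a < b" "a' < b'" "b \<le> T" "b' \<le> T" using ok by auto
 have Xm: "X \<in> borel_measurable (G a')" using ok le by (auto intro: G_measurable_mono)
 have X'm: "X' \<in> borel_measurable (G a')" using ok by auto
 have Ym: "Y \<in> borel_measurable (G a')" unfolding Y_def using Xm X'm by (rule borel_measurable_times)
 have YC: "\<bar>Y w\<bar> \<le> \<bar>C\<bar> * \<bar>C'\<bar>" if "w \<in> space P" for w
  unfolding Y_def abs_mult using C[OF that] by (intro mult_mono) auto
 have prod: "step_int (a, b, k, X) w * step_int (a', b', l, X') w = Y w * ((M k b w - M k a w) * (M l b' w - M l a' w))" for w
  by (simp add: Y_def)
 show "integrable \<nu> (\<lambda>z. step_fun (a, b, k, X) z * step_fun (a', b', l, X') z)"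
  and "(\<E> w. step_int (a, b, k, X) w * step_int (a', b', l, X') w)
   = (k \<bullet> l) * (\<integral>z. step_fun (a, b, k, X) z * step_fun (a', b', l, X') z \<partial>\<nu>)"
 proof (atomize (full), cases "b \<le> a'")
  case True
  then have "step_fun (a, b, k, X) z * step_fun (a', b', l, X') z = 0" for z
   by (auto split: split_indicator)
  moreover have "(\<E> w. Y w * ((M k b w - M k a w) * (M l b' w - M l a' w))) = 0"
   by (rule M_increment_orthogonal[OF a(1) less_imp_le[OF a(3)] True less_imp_le[OF a(4)] Ym YC])
  ultimately show "integrable \<nu> (\<lambda>z. step_fun (a, b, k, X) z * step_fun (a', b', l, X') z) \<and>
   (\<E> w. step_int (a, b, k, X) w * step_int (a', b', l, X') w)
    = (k \<bullet> l) * (\<integral>z. step_fun (a, b, k, X) z * step_fun (a', b', l, X') z \<partial>\<nu>)"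
   unfolding prod by (simp only: mult_zero_right Bochner_Integration.integrable_zero integral_zero simp_thms)
 next
  case False
  then have ba: "a' < b" by simp
  have c: "a' < min b b'" "min b b' \<le> T" using ba a by auto
  have eq: "step_fun (a, b, k, X) z * step_fun (a', b', l, X') z = indicator {a'<..min b b'} (snd z) * Y (fst z)" for z
   using le by (auto simp: Y_def split: split_indicator)
  have "(\<integral>z. indicator {a'<..min b b'} (snd z) * Y (fst z) \<partial>\<nu>) = (\<E> w. Y w * (E (min b b') w - E a' w))"
   by (rule rect_integral[OF a(2) c Ym YC])
  moreover have "integrable \<nu> (\<lambda>z. indicator {a'<..min b b'} (snd z) * Y (fst z))"
   by (rule rect_integrable[OF a(2) c Ym YC])
  ultimately show "integrable \<nu> (\<lambda>z. step_fun (a, b, k, X) z * step_fun (a', b', l, X') z) \<and>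
   (\<E> w. step_int (a, b, k, X) w * step_int (a', b', l, X') w)
    = (k \<bullet> l) * (\<integral>z. step_fun (a, b, k, X) z * step_fun (a', b', l, X') z \<partial>\<nu>)"
   unfolding prod eq using M_increments_aligned[OF a(1) le ba a(4) Ym YC] by simp
 qed
qed

lemma step_pair:
 assumes ok: "ok h" "ok h'"
 shows "integrable \<nu> (\<lambda>z. step_fun h z * step_fun h' z)"
  and "(\<E> w. step_int h w * step_int h' w) = (step_vec h \<bullet> step_vec h') * (\<integral>z. step_fun h z * step_fun h' z \<partial>\<nu>)"
proof -
 obtain a b k X a' b' l X' where h: "h = (a, b, k, X)" "h' = (a', b', l, X')" by (metis prod_cases4)
 note o = ok[unfolded h]
 show "integrable \<nu> (\<lambda>z. step_fun h z * step_fun h' z)"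
  and "(\<E> w. step_int h w * step_int h' w) = (step_vec h \<bullet> step_vec h') * (\<integral>z. step_fun h z * step_fun h' z \<partial>\<nu>)"
  unfolding h using step_pair_ordered[OF o] step_pair_ordered[OF o(2,1)]
  by (cases "a \<le> a'"; simp add: mult.commute inner_commute del: step_fun.simps step_int.simps)+
qed

lemma step_int_square_integrable: "ok h \<Longrightarrow> square_integrable P (step_int h)"
proof -
 assume ok: "ok h"
 obtain a b k X where h: "h = (a, b, k, X)" by (metis prod_cases4)
 obtain C where C: "\<And>w. w \<in> space P \<Longrightarrow> \<bar>X w\<bar> \<le> C" using ok h by auto
 have a: "0 \<le> a" "0 \<le> b" "X \<in> borel_measurable P" using ok h by (auto intro: G_measurable)
 have "square_integrable P (\<lambda>w. X w * (M k b w - M k a w))"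
  by (rule square_integrable_bounded_mult[OF increment_square_integrable[OF a(1,2)] a(3) C])
 then show ?thesis unfolding h by (simp add: step_int.simps[abs_def])
qed

lemma Kint_nth: "Kint hs w = (\<Sum>i<length hs. step_int (hs ! i) w)"
 unfolding Kint_def by (simp add: sum_list_sum_nth atLeast0LessThan)

lemma Kfun_nth: "Kfun hs z = (\<Sum>i<length hs. step_fun (hs ! i) z *\<^sub>R step_vec (hs ! i))"
 unfolding Kfun_def by (simp add: sum_list_sum_nth atLeast0LessThan)

lemma Kint_square_integrable: "list_all ok hs \<Longrightarrow> square_integrable P (Kint hs)"
 unfolding Kint_nth[abs_def] by (intro square_integrable_sum step_int_square_integrable) (auto simp: list_all_length)

lemma Kfun_norm_sq:
 "(norm (Kfun hs z))^2 = (\<Sum>i<length hs. \<Sum>j<length hs. (step_vec (hs ! i) \<bullet> step_vec (hs ! j)) * (step_fun (hs ! i) z * step_fun (hs ! j) z))"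
 unfolding dot_square_norm[symmetric] Kfun_nth inner_sum_left inner_sum_right
 by (intro sum.cong) (simp_all add: mult_ac inner_commute)

lemma Kfun_integrable: "list_all ok hs \<Longrightarrow> integrable \<nu> (\<lambda>z. (norm (Kfun hs z))^2)"
 unfolding Kfun_norm_sq using step_pair(1) by (intro Bochner_Integration.integrable_sum integrable_mult_right) (auto simp: list_all_length)

text \<open>Expansion into pairs of steps; for each pair both sides are the inner product of the vectors times
  an integral over the common interval.\<close>

lemma Kint_isometry:
 assumes ok: "list_all ok hs"
 shows "(nn2 P (\<lambda>w. Kint hs w)) = (\<integral>\<^sup>+z. ennreal ((norm (Kfun hs z))^2) \<partial>\<nu>)"
proof -
 let ?n = "length hs"
 have o: "i < ?n \<Longrightarrow> ok (hs ! i)" for i using ok by (simp add: list_all_length)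
 have "(\<E> w. (Kint hs w)^2) = (\<E> w. (\<Sum>i<?n. \<Sum>j<?n. step_int (hs ! i) w * step_int (hs ! j) w))"
  unfolding Kint_nth power2_eq_square sum_product ..
 also have "\<dots> = (\<Sum>i<?n. \<Sum>j<?n. \<integral>w. step_int (hs ! i) w * step_int (hs ! j) w \<partial>P)"
  using o by (subst Bochner_Integration.integral_sum; (intro Bochner_Integration.integrable_sum square_integrable_mult step_int_square_integrable sum.cong refl Bochner_Integration.integral_sum)?) auto
 also have "\<dots> = (\<Sum>i<?n. \<Sum>j<?n. (step_vec (hs ! i) \<bullet> step_vec (hs ! j)) * (\<integral>z. step_fun (hs ! i) z * step_fun (hs ! j) z \<partial>\<nu>))"
  using step_pair(2) o by (intro sum.cong refl) auto
 also have "\<dots> = (\<integral>z. (norm (Kfun hs z))^2 \<partial>\<nu>)"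
  unfolding Kfun_norm_sq using step_pair(1) o
  by (subst Bochner_Integration.integral_sum; (intro Bochner_Integration.integrable_sum integrable_mult_right sum.cong refl)?) (auto simp: Bochner_Integration.integral_sum)
 finally have "(\<E> w. (Kint hs w)^2) = (\<integral>z. (norm (Kfun hs z))^2 \<partial>\<nu>)" .
 then show ?thesis
  using square_integrable_nn_eq[OF Kint_square_integrable[OF ok]] nn_integral_eq_integral[OF Kfun_integrable[OF ok]] by simp
qed

text \<open>The sign is moved to the random coefficient and not to the vector: \<open>M\<close> is linear in
  the vector only almost surely.\<close>

definition negate :: "(real \<times> real \<times> 'k \<times> ('a \<Rightarrow> real)) list \<Rightarrow> (real \<times> real \<times> 'k \<times> ('a \<Rightarrow> real)) list" where
 "negate hs = map (\<lambda>(a, b, k, X). (a, b, k, \<lambda>w. - X w)) hs"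

lemma Kfun_append: "Kfun (hs @ hs') z = Kfun hs z + Kfun hs' z"
 by (simp add: Kfun_def)

lemma Kint_append: "Kint (hs @ hs') w = Kint hs w + Kint hs' w"
 by (simp add: Kint_def)

lemma Kfun_negate: "Kfun (negate hs) z = - Kfun hs z"
 unfolding Kfun_def negate_def by (induction hs) auto

lemma Kint_negate: "Kint (negate hs) w = - Kint hs w"
 unfolding Kint_def negate_def by (induction hs) auto

lemma ok_negate: "list_all ok hs \<Longrightarrow> list_all ok (negate hs)"
 unfolding negate_def by (induction hs) auto

lemma Kint_diff_isometry:
 assumes "list_all ok hs" "list_all ok hs'"
 shows "(nn2 P (\<lambda>w. Kint hs w - Kint hs' w)) = (\<integral>\<^sup>+z. ennreal ((norm (Kfun hs z - Kfun hs' z))^2) \<partial>\<nu>)"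
 using Kint_isometry[of "hs @ negate hs'"] assms ok_negate[OF assms(2)]
 by (simp add: Kint_append Kint_negate Kfun_append Kfun_negate)

end

section \<open>Density of elementary fields\<close>

context K_space
begin

lemma abs_form_dominated:
 assumes [measurable]: "\<And>n::nat. u n \<in> borel_measurable borel" "v \<in> borel_measurable borel"
  and le: "\<And>n x. \<bar>u n x\<bar> \<le> \<bar>v x\<bar>" and fin: "abs_form f v < \<infinity>" and lim: "\<And>x. (\<lambda>n. u n x) \<longlonglongrightarrow> 0"
 shows "(\<lambda>n. abs_form f (u n)) \<longlonglongrightarrow> 0"
proof -
 have "(\<lambda>n. \<integral>\<^sup>+z. ennreal (\<bar>u n (fst z)\<bar> * \<bar>u n (snd z)\<bar>) \<partial>ker.\<kappa>) \<longlonglongrightarrow> (\<integral>\<^sup>+z. 0 \<partial>ker.\<kappa>)"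
 proof (rule nn_integral_dominated_convergence)
  show "AE z in ker.\<kappa>. ennreal (\<bar>u n (fst z)\<bar> * \<bar>u n (snd z)\<bar>) \<le> ennreal (\<bar>v (fst z)\<bar> * \<bar>v (snd z)\<bar>)" for n
   using le by (intro AE_I2 ennreal_leI mult_mono) auto
  show "(\<integral>\<^sup>+z. ennreal (\<bar>v (fst z)\<bar> * \<bar>v (snd z)\<bar>) \<partial>ker.\<kappa>) < \<infinity>"
   using fin by (simp add: abs_form_f0 ker.abs_form_kappa)
  show "AE z in ker.\<kappa>. (\<lambda>n. ennreal (\<bar>u n (fst z)\<bar> * \<bar>u n (snd z)\<bar>)) \<longlonglongrightarrow> 0"
  proof (rule AE_I2)
   fix z
   have "(\<lambda>n. \<bar>u n (fst z)\<bar> * \<bar>u n (snd z)\<bar>) \<longlonglongrightarrow> 0"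
    using tendsto_mult[OF tendsto_rabs_zero[OF lim[of "fst z"]] tendsto_rabs_zero[OF lim[of "snd z"]]] by simp
   then show "(\<lambda>n. ennreal (\<bar>u n (fst z)\<bar> * \<bar>u n (snd z)\<bar>)) \<longlonglongrightarrow> 0"
    using tendsto_ennrealI by fastforce
  qed
 qed simp_all
 then show ?thesis by (simp add: abs_form_f0 ker.abs_form_kappa)
qed

end

context integration
begin

text \<open>The square of the norm of \<open>P_dagger\<close>, as an integral with respect to
  \<open>\<nu>\<close> over the fields as functions of \<open>((\<omega>, t), x)\<close>.\<close>

definition Dsq :: "(('a \<times> real) \<times> (real ^ 'n) \<Rightarrow> real) \<Rightarrow> ennreal" where
 "Dsq u = (\<integral>\<^sup>+z. abs_form f (\<lambda>x. u (z, x)) \<partial>\<nu>)"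

abbreviation PB :: "(('a \<times> real) \<times> (real ^ 'n)) measure" where "PB \<equiv> PS \<Otimes>\<^sub>M borel"

definition field :: "(real \<Rightarrow> real ^ 'n \<Rightarrow> 'a \<Rightarrow> real) \<Rightarrow> ('a \<times> real) \<times> (real ^ 'n) \<Rightarrow> real" where
 "field g = (\<lambda>((w, t), x). g t x w)"

lemma section_borel: "u \<in> borel_measurable PB \<Longrightarrow> z \<in> space \<nu> \<Longrightarrow> (\<lambda>x. u (z, x)) \<in> borel_measurable borel"
 by (rule measurable_Pair2[of _ PS]) auto

lemma abs_form_section_measurable [measurable]: "u \<in> borel_measurable PB \<Longrightarrow> (\<lambda>z. abs_form f (\<lambda>x. u (z, x))) \<in> borel_measurable PS"
 by (rule abs_form_measurable) simp

lemma abs_form_section_measurable' [measurable]: "u \<in> borel_measurable PB \<Longrightarrow> (\<lambda>z. abs_form f (\<lambda>x. u (z, x))) \<in> borel_measurable \<nu>"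
 using abs_form_section_measurable by simp

lemma dagger_sq_eq: "field g \<in> borel_measurable PB \<Longrightarrow> dagger_sq P E f T g = Dsq (field g)"
 using nn_integral_nu[OF abs_form_section_measurable, of "field g"]
 by (simp add: dagger_sq_def Dsq_def kern_def field_def)

lemma Dsq_mono: "(\<And>p. p \<in> space PB \<Longrightarrow> \<bar>u p\<bar> \<le> \<bar>v p\<bar>) \<Longrightarrow> Dsq u \<le> Dsq v"
 unfolding Dsq_def by (intro nn_integral_mono abs_form_mono) (auto simp: space_pair_measure)

lemma Dsq_cong: "(\<And>p. p \<in> space PB \<Longrightarrow> u p = v p) \<Longrightarrow> Dsq u = Dsq v"
 by (intro antisym Dsq_mono) auto

lemma Dsq_triangle:
 assumes [measurable]: "u \<in> borel_measurable PB" "v \<in> borel_measurable PB"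
 shows "Dsq (\<lambda>p. u p + v p) \<le> 2 * Dsq u + 2 * Dsq v"
proof -
 have "Dsq (\<lambda>p. u p + v p) \<le> (\<integral>\<^sup>+z. 2 * abs_form f (\<lambda>x. u (z, x)) + 2 * abs_form f (\<lambda>x. v (z, x)) \<partial>\<nu>)"
  unfolding Dsq_def using section_borel assms by (intro nn_integral_mono abs_form_triangle) auto
 also have "\<dots> = 2 * Dsq u + 2 * Dsq v"
  unfolding Dsq_def using abs_form_section_measurable'[OF assms(1)] abs_form_section_measurable'[OF assms(2)]
  by (simp add: nn_integral_add nn_integral_cmult)
 finally show ?thesis .
qed

lemma Dsq_scale: "u \<in> borel_measurable PB \<Longrightarrow> Dsq (\<lambda>p. c * u p) = ennreal (c^2) * Dsq u"
proof -
 assume u: "u \<in> borel_measurable PB"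
 have "Dsq (\<lambda>p. c * u p) = (\<integral>\<^sup>+z. ennreal (c^2) * abs_form f (\<lambda>x. u (z, x)) \<partial>\<nu>)"
  unfolding Dsq_def by (intro nn_integral_cong) (simp add: abs_form_f0 ker.abs_form_scale[OF section_borel[OF u]])
 then show ?thesis unfolding Dsq_def using abs_form_section_measurable'[OF u] by (simp add: nn_integral_cmult)
qed

text \<open>Dominated convergence, first for the kernel measure at a fixed \<open>(\<omega>, t)\<close> and
  then for \<open>\<nu>\<close>.\<close>

lemma Dsq_dominated:
 assumes u: "\<And>n::nat. u n \<in> borel_measurable PB" and v: "v \<in> borel_measurable PB"
  and le: "\<And>n p. p \<in> space PB \<Longrightarrow> \<bar>u n p\<bar> \<le> \<bar>v p\<bar>" and fin: "Dsq v < \<infinity>"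
  and lim: "\<And>p. p \<in> space PB \<Longrightarrow> (\<lambda>n. u n p) \<longlonglongrightarrow> 0"
 shows "(\<lambda>n. Dsq (u n)) \<longlonglongrightarrow> 0"
proof -
 have sp: "(z, x) \<in> space PB" if "z \<in> space \<nu>" for z and x :: "real ^ 'n" using that by (simp add: space_pair_measure)
 have "AE z in \<nu>. abs_form f (\<lambda>x. v (z, x)) \<noteq> \<infinity>"
  using fin unfolding Dsq_def by (intro nn_integral_noteq_infinite abs_form_section_measurable'[OF v]) auto
 then have "AE z in \<nu>. (\<lambda>n. abs_form f (\<lambda>x. u n (z, x))) \<longlonglongrightarrow> 0"
  using AE_space
 proof eventually_elim
  fix z assume "abs_form f (\<lambda>x. v (z, x)) \<noteq> \<infinity>" and z: "z \<in> space \<nu>"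
  then show "(\<lambda>n. abs_form f (\<lambda>x. u n (z, x))) \<longlonglongrightarrow> 0"
   by (intro abs_form_dominated[where v="\<lambda>x. v (z, x)"] section_borel[OF u] section_borel[OF v] le lim sp)
    (auto simp: less_top)
 qed
 then have "(\<lambda>n. \<integral>\<^sup>+z. abs_form f (\<lambda>x. u n (z, x)) \<partial>\<nu>) \<longlonglongrightarrow> (\<integral>\<^sup>+z. 0 \<partial>\<nu>)"
  using fin le sp
  by (intro nn_integral_dominated_convergence[where w="\<lambda>z. abs_form f (\<lambda>x. v (z, x))"] abs_form_section_measurable'[OF u]
   abs_form_section_measurable'[OF v]) (auto intro!: AE_I2 abs_form_mono simp: Dsq_def)
 then show ?thesis by (simp add: Dsq_def)
qed

lemma simple_step_measurable:
 assumes "simple_field P G T [(a, b, A, X)]"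
 shows "(\<lambda>p. indicator {a<..b} (snd (fst p)) * indicator A (snd p) * X (fst (fst p))) \<in> borel_measurable PB"
proof -
 have "(\<lambda>z. indicator {a<..b} (snd z) * X (fst z)) \<in> borel_measurable PS"
  using assms by (intro rect_function_measurable) (auto simp: simple_field_def)
 from measurable_compose[OF measurable_fst this]
 have 1: "(\<lambda>p. indicator {a<..b} (snd (fst p)) * X (fst (fst p))) \<in> borel_measurable PB" .
 have "A \<in> sets borel" using assms by (auto simp: simple_field_def)
 then have 2: "(\<lambda>p. indicator A (snd p) :: real) \<in> borel_measurable PB"
  by (intro measurable_compose[OF measurable_snd]) simp
 show ?thesis using borel_measurable_times[OF 1 2] by (simp add: mult_ac)
qed

abbreviation step_field :: "('n, 'a) simple_field \<Rightarrow> ('a \<times> real) \<times> (real ^ 'n) \<Rightarrow> real" where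
 "step_field gs \<equiv> field (simple_field_fun gs)"

lemma field_Cons: "step_field ((a, b, A, X) # gs) p =
  indicator {a<..b} (snd (fst p)) * indicator A (snd p) * X (fst (fst p)) + step_field gs p"
 by (cases p) (auto simp: field_def simple_field_fun_def)

lemma simple_field_Cons: "simple_field P G T (h # gs) \<longleftrightarrow> simple_field P G T [h] \<and> simple_field P G T gs"
 by (simp add: simple_field_def)

lemma simple_field_measurable: "simple_field P G T gs \<Longrightarrow> step_field gs \<in> borel_measurable PB"
proof (induction gs)
 case Nil
 then show ?case by (simp add: field_def simple_field_fun_def case_prod_beta')
next
 case (Cons h gs)
 obtain a b A X where h: "h = (a, b, A, X)" by (metis prod_cases4)
 from Cons(2) have "simple_field P G T [(a, b, A, X)]" "simple_field P G T gs"
  using simple_field_Cons[of h gs] h by auto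
 then show ?case
  unfolding h field_Cons[abs_def] using Cons(1) by (intro borel_measurable_add simple_step_measurable)
qed

lemma field_append: "step_field (gs @ gs') p = step_field gs p + step_field gs' p"
 by (cases p) (auto simp: field_def simple_field_fun_def)

lemma simple_field_append: "simple_field P G T (gs @ gs') \<longleftrightarrow> simple_field P G T gs \<and> simple_field P G T gs'"
 unfolding simple_field_def set_append ball_Un ..

definition approximable :: "(('a \<times> real) \<times> (real ^ 'n) \<Rightarrow> real) \<Rightarrow> bool" where
 "approximable u \<longleftrightarrow> (\<forall>\<epsilon>>0. \<exists>gs. simple_field P G T gs \<and> Dsq (\<lambda>p. step_field gs p - u p) \<le> ennreal \<epsilon>)"

lemma approximable_cong: "approximable u \<Longrightarrow> (\<And>p. p \<in> space PB \<Longrightarrow> u p = v p) \<Longrightarrow> approximable v"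
proof -
 assume u: "approximable u" and eq: "\<And>p. p \<in> space PB \<Longrightarrow> u p = v p"
 have "Dsq (\<lambda>p. step_field gs p - u p) = Dsq (\<lambda>p. step_field gs p - v p)" for gs
  by (rule Dsq_cong) (simp add: eq)
 then show ?thesis using u by (simp add: approximable_def)
qed

lemma Dsq_zero [simp]: "Dsq (\<lambda>p. 0) = 0"
 by (simp add: Dsq_def abs_form_def)

lemma approximable_simple: "simple_field P G T gs \<Longrightarrow> approximable (step_field gs)"
 unfolding approximable_def by (intro allI impI exI[of _ gs]) simp

text \<open>The constant 2 in the triangle inequality for squares is compensated by a quarter of the
  tolerance.\<close>

lemma two_quarters:
 assumes "0 < \<epsilon>"
 shows "2 * ennreal (\<epsilon> / 4) + 2 * ennreal (\<epsilon> / 4) = ennreal \<epsilon>"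
proof -
 have "2 * ennreal (\<epsilon> / 4) = ennreal (\<epsilon> / 2)" using ennreal_mult[of 2 "\<epsilon> / 4"] assms by simp
 then show ?thesis using ennreal_plus[of "\<epsilon> / 2" "\<epsilon> / 2"] assms by simp
qed

lemma approximable_near:
 assumes u: "u \<in> borel_measurable PB"
  and near: "\<And>\<epsilon>. 0 < \<epsilon> \<Longrightarrow> \<exists>v. v \<in> borel_measurable PB \<and> approximable v \<and> Dsq (\<lambda>p. v p - u p) \<le> ennreal \<epsilon>"
 shows "approximable u"
 unfolding approximable_def
proof (intro allI impI)
 fix \<epsilon> :: real assume \<epsilon>: "0 < \<epsilon>"
 then obtain v where v: "v \<in> borel_measurable PB" "approximable v" "Dsq (\<lambda>p. v p - u p) \<le> ennreal (\<epsilon> / 4)"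
  using near[of "\<epsilon> / 4"] by auto
 obtain gs where gs: "simple_field P G T gs" "Dsq (\<lambda>p. step_field gs p - v p) \<le> ennreal (\<epsilon> / 4)"
  using v(2) \<epsilon> unfolding approximable_def by (meson divide_pos_pos zero_less_numeral)
 have "Dsq (\<lambda>p. (step_field gs p - v p) + (v p - u p)) \<le> 2 * Dsq (\<lambda>p. step_field gs p - v p) + 2 * Dsq (\<lambda>p. v p - u p)"
  using simple_field_measurable[OF gs(1)] u v(1) by (intro Dsq_triangle) auto
 also have "\<dots> \<le> 2 * ennreal (\<epsilon> / 4) + 2 * ennreal (\<epsilon> / 4)" using gs v by (intro add_mono mult_left_mono) auto
 finally show "\<exists>gs. simple_field P G T gs \<and> Dsq (\<lambda>p. step_field gs p - u p) \<le> ennreal \<epsilon>"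
  using gs(1) two_quarters[OF \<epsilon>] by auto
qed

lemma approximable_limit:
 assumes u: "u \<in> borel_measurable PB" and v: "\<And>n::nat. v n \<in> borel_measurable PB" "\<And>n. approximable (v n)"
  and lim: "(\<lambda>n. Dsq (\<lambda>p. v n p - u p)) \<longlonglongrightarrow> 0"
 shows "approximable u"
proof (rule approximable_near[OF u])
 fix \<epsilon> :: real assume "0 < \<epsilon>"
 then have "eventually (\<lambda>n. Dsq (\<lambda>p. v n p - u p) < ennreal \<epsilon>) sequentially"
  using lim by (intro order_tendstoD(2)[OF lim]) simp
 then obtain n where "Dsq (\<lambda>p. v n p - u p) < ennreal \<epsilon>" using eventually_happens' sequentially_bot by blast
 then show "\<exists>v. v \<in> borel_measurable PB \<and> approximable v \<and> Dsq (\<lambda>p. v p - u p) \<le> ennreal \<epsilon>" using v by (meson less_imp_le)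
qed

lemma approximable_add:
 assumes m: "u \<in> borel_measurable PB" "v \<in> borel_measurable PB" and a: "approximable u" "approximable v"
 shows "approximable (\<lambda>p. u p + v p)"
 unfolding approximable_def
proof (intro allI impI)
 fix \<epsilon> :: real assume \<epsilon>: "0 < \<epsilon>"
 then have "0 < \<epsilon> / 4" by simp
 then obtain gs gs' where gs: "simple_field P G T gs" "Dsq (\<lambda>p. step_field gs p - u p) \<le> ennreal (\<epsilon> / 4)"
  and gs': "simple_field P G T gs'" "Dsq (\<lambda>p. step_field gs' p - v p) \<le> ennreal (\<epsilon> / 4)"
  using a unfolding approximable_def by meson
 have "Dsq (\<lambda>p. (step_field gs p - u p) + (step_field gs' p - v p))
   \<le> 2 * Dsq (\<lambda>p. step_field gs p - u p) + 2 * Dsq (\<lambda>p. step_field gs' p - v p)"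
  using simple_field_measurable[OF gs(1)] simple_field_measurable[OF gs'(1)] m by (intro Dsq_triangle) auto
 also have "\<dots> \<le> 2 * ennreal (\<epsilon> / 4) + 2 * ennreal (\<epsilon> / 4)" using gs gs' by (intro add_mono mult_left_mono) auto
 finally have "Dsq (\<lambda>p. step_field (gs @ gs') p - (u p + v p)) \<le> ennreal \<epsilon>"
  unfolding two_quarters[OF \<epsilon>] by (simp add: field_append algebra_simps)
 then show "\<exists>gs. simple_field P G T gs \<and> Dsq (\<lambda>p. step_field gs p - (u p + v p)) \<le> ennreal \<epsilon>"
  using gs(1) gs'(1) simple_field_append by blast
qed

definition scale_field :: "real \<Rightarrow> ('n, 'a) simple_field \<Rightarrow> ('n, 'a) simple_field" where
 "scale_field c gs = map (\<lambda>(a, b, A, X). (a, b, A, \<lambda>w. c * X w)) gs"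

lemma simple_field_scale: "simple_field P G T gs \<Longrightarrow> simple_field P G T (scale_field c gs)"
proof -
 have "\<exists>C'. \<forall>w\<in>space P. \<bar>c * X w\<bar> \<le> C'" if "\<forall>w\<in>space P. \<bar>X w\<bar> \<le> C" for X and C
  using that by (intro exI[of _ "\<bar>c\<bar> * C"]) (auto simp: abs_mult intro: mult_left_mono)
 then show "simple_field P G T gs \<Longrightarrow> simple_field P G T (scale_field c gs)"
  by (fastforce simp: simple_field_def scale_field_def)
qed

lemma field_scale: "step_field (scale_field c gs) p = c * step_field gs p"
proof (induction gs)
 case Nil
 then show ?case by (simp add: field_def simple_field_fun_def scale_field_def case_prod_beta')
next
 case (Cons h gs)
 obtain a b A X where h: "h = (a, b, A, X)" by (metis prod_cases4)
 have "scale_field c (h # gs) = (a, b, A, \<lambda>w. c * X w) # scale_field c gs" by (simp add: scale_field_def h)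
 then show ?case using Cons by (simp only: field_Cons h) (simp add: algebra_simps)
qed

lemma approximable_scale:
 assumes m: "u \<in> borel_measurable PB" and a: "c \<noteq> 0 \<Longrightarrow> approximable u"
 shows "approximable (\<lambda>p. c * u p)"
proof (cases "c = 0")
 case True
 have "approximable (field (simple_field_fun []))" by (intro approximable_simple) (simp add: simple_field_def)
 then show ?thesis by (rule approximable_cong) (auto simp: True field_def simple_field_fun_def)
next
 case False
 show ?thesis unfolding approximable_def
 proof (intro allI impI)
  fix \<epsilon> :: real assume \<epsilon>: "0 < \<epsilon>"
  then have "0 < \<epsilon> / c^2" using False by simp
  then obtain gs where gs: "simple_field P G T gs" "Dsq (\<lambda>p. step_field gs p - u p) \<le> ennreal (\<epsilon> / c^2)"
   using a[OF False] unfolding approximable_def by meson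
  have "Dsq (\<lambda>p. step_field (scale_field c gs) p - c * u p) = Dsq (\<lambda>p. c * (step_field gs p - u p))"
   by (simp add: field_scale algebra_simps)
  also have "\<dots> = ennreal (c^2) * Dsq (\<lambda>p. step_field gs p - u p)"
   using simple_field_measurable[OF gs(1)] m by (intro Dsq_scale) auto
  also have "\<dots> \<le> ennreal (c^2) * ennreal (\<epsilon> / c^2)" using gs by (intro mult_left_mono) auto
  also have "\<dots> = ennreal \<epsilon>" using False \<epsilon> by (simp add: ennreal_mult'[symmetric])
  finally show "\<exists>gs. simple_field P G T gs \<and> Dsq (\<lambda>p. step_field gs p - c * u p) \<le> ennreal \<epsilon>"
   using simple_field_scale[OF gs(1)] by blast
 qed
qed

lemma sets_PB: "sets PB = sigma_sets (space PB) {R \<times> S |R S. R \<in> rects \<and> S \<in> sets borel}"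
proof -
 have "sets PB = sets (sigma (space P \<times> {0<..T}) rects \<Otimes>\<^sub>M sigma (UNIV :: (real ^ 'n) set) (sets borel))"
  by (rule sets_pair_measure_cong) (simp_all add: sets_PS rects_Pow sets.sigma_sets_eq[of borel, simplified])
 also have "\<dots> = sets (sigma ((space P \<times> {0<..T}) \<times> UNIV) {R \<times> S |R S. R \<in> rects \<and> S \<in> sets borel})"
 proof (subst sigma_prod)
  have "space P \<times> {0<..T} \<in> rects" using T_pos sets.top[of "G 0"] by (intro rectI) auto
  then show "\<exists>E\<subseteq>rects. countable E \<and> space P \<times> {0<..T} = \<Union> E" by (intro exI[of _ "{space P \<times> {0<..T}}"]) auto
  show "\<exists>E\<subseteq>sets borel. countable E \<and> (UNIV :: (real ^ 'n) set) = \<Union> E" by (intro exI[of _ "{UNIV}"]) auto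
 qed (use rects_Pow in auto)
 also have "\<dots> = sigma_sets (space PB) {R \<times> S |R S. R \<in> rects \<and> S \<in> sets borel}"
  using rects_Pow by (subst sets_measure_of) (auto simp: space_pair_measure)
 finally show ?thesis .
qed

lemma Dsq_bounded_set: "bounded V \<Longrightarrow> V \<in> sets borel \<Longrightarrow> Dsq (\<lambda>p. indicator V (snd p)) < \<infinity>"
proof -
 assume V: "bounded V" "V \<in> sets borel"
 interpret nu: finite_measure \<nu> by (rule finite_measure_nu)
 have "abs_form f (indicator V) < \<infinity>" using fin_bounded_set[OF V] by (simp add: fin_iff)
 then show ?thesis using nu.emeasure_finite[of "space \<nu>"] by (simp add: Dsq_def ennreal_mult_eq_top_iff less_top[symmetric])
qed

lemma approximable_rect:
 assumes R: "R \<in> rects" and S: "S \<in> sets borel" and V: "bounded V" "V \<in> sets borel"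
 shows "approximable (\<lambda>p. indicator (R \<times> S) p * indicator V (snd p))"
proof -
 obtain a b A where ab: "R = A \<times> {a<..b}" "0 \<le> a" "a < b" "b \<le> T" "A \<in> sets (G a)" using R unfolding rects_def by blast
 let ?gs = "[(a, b, S \<inter> V, indicator A)]"
 have "simple_field P G T ?gs"
  using ab S V by (auto simp: simple_field_def split: split_indicator intro!: exI[of _ 1] intro: bounded_subset)
 then have "approximable (field (simple_field_fun ?gs))" by (rule approximable_simple)
 then show ?thesis
  by (rule approximable_cong) (auto simp: field_def simple_field_fun_def ab(1) indicator_def)
qed

lemma PB_generator_Pow: "{R \<times> S |R S. R \<in> rects \<and> S \<in> sets borel} \<subseteq> Pow (space PB)"
 using rects_Pow by (fastforce simp: space_pair_measure)

lemma Int_stable_PB_generator: "Int_stable {R \<times> S |R S. R \<in> rects \<and> S \<in> sets (borel :: (real ^ 'n) measure)}"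
proof (rule Int_stableI)
 fix A A' assume "A \<in> {R \<times> S |R S. R \<in> rects \<and> S \<in> sets (borel :: (real ^ 'n) measure)}" "A' \<in> {R \<times> S |R S. R \<in> rects \<and> S \<in> sets (borel :: (real ^ 'n) measure)}"
 then obtain R S R' S' where A: "A = R \<times> S" "R \<in> rects" "S \<in> sets borel" "A' = R' \<times> S'" "R' \<in> rects" "S' \<in> sets borel" by blast
 have "A \<inter> A' = (R \<inter> R') \<times> (S \<inter> S')" unfolding A by auto
 moreover have "R \<inter> R' \<in> rects" using A Int_stable_rects by (simp add: Int_stable_def)
 moreover have "S \<inter> S' \<in> sets borel" using A by auto
 ultimately show "A \<inter> A' \<in> {R \<times> S |R S. R \<in> rects \<and> S \<in> sets (borel :: (real ^ 'n) measure)}" by blast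
qed

text \<open>A Dynkin system argument. The bounded set \<open>V\<close> keeps the norms finite, which makes
  complements and disjoint unions accessible to dominated convergence.\<close>

lemma approximable_set:
 assumes V: "bounded V" "V \<in> sets borel"
 shows "H' \<in> sets PB \<Longrightarrow> approximable (\<lambda>p. indicator H' p * indicator V (snd p))"
 unfolding sets_PB
proof (induction rule: sigma_sets_induct_disjoint[OF Int_stable_PB_generator PB_generator_Pow, consumes 1, case_names basic empty compl union])
 case (basic A)
 then obtain R S where "A = R \<times> S" "R \<in> rects" "S \<in> sets borel" by blast
 then show ?case using approximable_rect[OF _ _ V] by blast
next
 case empty
 have "approximable (field (simple_field_fun []))" by (intro approximable_simple) (simp add: simple_field_def)
 then show ?case by (rule approximable_cong) (auto simp: field_def simple_field_fun_def)
next
 case (compl A)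
 have [measurable]: "A \<in> sets PB" "V \<in> sets borel" using compl(1) V unfolding sets_PB by auto
 have full: "approximable (\<lambda>p. indicator V (snd p))"
 proof -
  have "space P \<times> {0<..T} \<in> rects" using T_pos sets.top[of "G 0"] by (intro rectI) auto
  then have "approximable (\<lambda>p. indicator ((space P \<times> {0<..T}) \<times> UNIV) p * indicator V (snd p))"
   by (intro approximable_rect V) auto
  then show ?thesis by (rule approximable_cong) (auto simp: space_pair_measure split: split_indicator)
 qed
 have "approximable (\<lambda>p. indicator V (snd p) + (- 1) * (indicator A p * indicator V (snd p)))"
  by (intro approximable_add approximable_scale full compl(2)) measurable
 then show ?case by (rule approximable_cong) (auto split: split_indicator)
next
 case (union A)
 have A: "A i \<in> sets PB" for i using union(2) unfolding sets_PB by auto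
 have [measurable]: "V \<in> sets borel" by (rule V)
 let ?U = "\<lambda>n. \<Union>i<n. A i"
 have U [measurable]: "?U n \<in> sets PB" for n using A by auto
 have UA [measurable]: "(\<Union>i. A i) \<in> sets PB" using A by auto
 have app: "approximable (\<lambda>p. indicator (?U n) p * indicator V (snd p))" for n
 proof (induction n)
  case 0
  show ?case using approximable_scale[of "\<lambda>p. indicator V (snd p)" 0] by (simp add: approximable_cong)
 next
  case (Suc n)
  note [measurable] = A[of n]
  have "approximable (\<lambda>p. indicator (?U n) p * indicator V (snd p) + indicator (A n) p * indicator V (snd p))"
   by (intro approximable_add Suc union(3)) measurable
  then show ?case
  proof (rule approximable_cong)
   fix p
   have "A i \<inter> A n = {}" if "i < n" for i using union(1) that by (simp add: disjoint_family_on_def)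
   then have "p \<in> A n \<Longrightarrow> p \<notin> ?U n" by blast
   moreover have "?U (Suc n) = ?U n \<union> A n" by (auto simp: less_Suc_eq)
   ultimately show "indicator (?U n) p * indicator V (snd p) + indicator (A n) p * indicator V (snd p) = indicator (?U (Suc n)) p * (indicator V (snd p) :: real)"
    by (auto split: split_indicator)
  qed
 qed
 show ?case
 proof (rule approximable_limit[OF _ _ app])
  show "(\<lambda>p. indicator (\<Union>i. A i) p * indicator V (snd p) :: real) \<in> borel_measurable PB" by measurable
  show "(\<lambda>p. indicator (?U n) p * indicator V (snd p) :: real) \<in> borel_measurable PB" for n by measurable
  show "(\<lambda>n. Dsq (\<lambda>p. indicator (?U n) p * indicator V (snd p) - indicator (\<Union>i. A i) p * indicator V (snd p))) \<longlonglongrightarrow> 0"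
  proof (rule Dsq_dominated)
   show "Dsq (\<lambda>p. indicator V (snd p)) < \<infinity>" by (rule Dsq_bounded_set[OF V])
   fix p
   have "(\<lambda>n. indicator (?U n) p :: real) \<longlonglongrightarrow> indicator (\<Union>i. A i) p" by (rule LIMSEQ_indicator_UN)
   from tendsto_mult_right[OF this, of "indicator V (snd p)"]
   show "(\<lambda>n. indicator (?U n) p * indicator V (snd p) - indicator (\<Union>i. A i) p * (indicator V (snd p) :: real)) \<longlonglongrightarrow> 0"
    by (rule LIM_zero)
  qed (measurable, auto split: split_indicator)
 qed
qed

text \<open>Finiteness of the norm is part of the statement proved by induction, so that it can be passed down
  from a function to the smaller ones from which it is built.\<close>

lemma approximable_nonneg_bounded_support:
 assumes V: "bounded V" "V \<in> sets borel" and u: "u \<in> borel_measurable PB" "\<And>p. 0 \<le> u p"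
 shows "Dsq (\<lambda>p. u p * indicator V (snd p)) < \<infinity> \<longrightarrow> approximable (\<lambda>p. u p * indicator V (snd p))"
 using u
proof (induction rule: borel_measurable_induct_real)
 case (set A)
 then show ?case using approximable_set[OF V] by blast
next
 case (mult u c)
 note [measurable] = mult(2) V(2)
 have m: "(\<lambda>p. u p * indicator V (snd p)) \<in> borel_measurable PB" by measurable
 show ?case
 proof
  assume fin: "Dsq (\<lambda>p. c * u p * indicator V (snd p)) < \<infinity>"
  have "Dsq (\<lambda>p. u p * indicator V (snd p)) < \<infinity>" if "c \<noteq> 0"
  proof -
   have "ennreal (c^2) * Dsq (\<lambda>p. u p * indicator V (snd p)) < \<infinity>"
    using fin Dsq_scale[OF m, of c] by (simp add: mult.assoc)
   then show ?thesis using that by (auto simp: ennreal_mult_less_top)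
  qed
  then show "approximable (\<lambda>p. c * u p * indicator V (snd p))"
   using approximable_scale[OF m, of c] mult(4) by (simp add: mult.assoc)
 qed
next
 case (add u v)
 note [measurable] = add(1,3) V(2)
 have mu: "(\<lambda>p. u p * indicator V (snd p)) \<in> borel_measurable PB" by measurable
 have mv: "(\<lambda>p. v p * indicator V (snd p)) \<in> borel_measurable PB" using add by measurable
 show ?case
 proof
  assume fin: "Dsq (\<lambda>p. (v p + u p) * indicator V (snd p)) < \<infinity>"
  have "Dsq (\<lambda>p. u p * indicator V (snd p)) \<le> Dsq (\<lambda>p. (v p + u p) * indicator V (snd p))"
   "Dsq (\<lambda>p. v p * indicator V (snd p)) \<le> Dsq (\<lambda>p. (v p + u p) * indicator V (snd p))"
   using add by (auto intro!: Dsq_mono split: split_indicator)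
  then have "Dsq (\<lambda>p. u p * indicator V (snd p)) < \<infinity>" "Dsq (\<lambda>p. v p * indicator V (snd p)) < \<infinity>" using fin by auto
  then have "approximable (\<lambda>p. v p * indicator V (snd p) + u p * indicator V (snd p))"
   using add mu mv by (intro approximable_add) auto
  then show "approximable (\<lambda>p. (v p + u p) * indicator V (snd p))" by (simp add: distrib_right)
 qed
next
 case (seq U')
 note [measurable] = seq(1) V(2) u(1)
 have le: "U' i p \<le> u p" if "p \<in> space PB" for i p
 proof (rule incseq_le[OF _ seq.hyps(4)[OF that]])
  show "incseq (\<lambda>i. U' i p)" using seq.hyps(3) unfolding incseq_def le_fun_def by blast
 qed
 show ?case
 proof
  assume fin: "Dsq (\<lambda>p. u p * indicator V (snd p)) < \<infinity>"
  have "Dsq (\<lambda>p. U' i p * indicator V (snd p)) \<le> Dsq (\<lambda>p. u p * indicator V (snd p))" for i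
   using le seq.hyps(2) u(2) by (intro Dsq_mono) (auto split: split_indicator)
  then have app: "approximable (\<lambda>p. U' i p * indicator V (snd p))" for i
   using seq.IH fin by (meson le_less_trans)
  show "approximable (\<lambda>p. u p * indicator V (snd p))"
  proof (rule approximable_limit[OF _ _ app])
   show "(\<lambda>n. Dsq (\<lambda>p. U' n p * indicator V (snd p) - u p * indicator V (snd p))) \<longlonglongrightarrow> 0"
   proof (rule Dsq_dominated[OF _ _ _ fin])
    fix n p assume p: "p \<in> space PB"
    show "\<bar>U' n p * indicator V (snd p) - u p * indicator V (snd p)\<bar> \<le> \<bar>u p * indicator V (snd p)\<bar>"
     using le[OF p, of n] seq.hyps(2)[of n p] u(2)[of p] by (auto split: split_indicator)
   next
    fix p assume p: "p \<in> space PB"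
    have "(\<lambda>i. U' i p) \<longlonglongrightarrow> u p" using seq.hyps(4)[OF p] .
    from tendsto_mult_right[OF this, of "indicator V (snd p)"]
    show "(\<lambda>n. U' n p * indicator V (snd p) - u p * indicator V (snd p)) \<longlonglongrightarrow> 0" by (rule LIM_zero)
   qed measurable
  qed measurable
 qed
qed

lemma approximable_nonneg:
 assumes u: "u \<in> borel_measurable PB" "\<And>p. 0 \<le> u p" and fin: "Dsq u < \<infinity>"
 shows "approximable u"
proof -
 note [measurable] = u(1)
 have app: "approximable (\<lambda>p. u p * indicator (ball 0 (real n)) (snd p))" for n
 proof -
  have "Dsq (\<lambda>p. u p * indicator (ball 0 (real n)) (snd p)) \<le> Dsq u" using u by (intro Dsq_mono) (auto split: split_indicator)
  then show ?thesis using approximable_nonneg_bounded_support[of "ball 0 (real n)", OF _ _ u] fin by auto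
 qed
 show ?thesis
 proof (rule approximable_limit[OF u(1) _ app])
  have [measurable]: "ball (0 :: real ^ 'n) (real n) \<in> sets borel" for n by simp
  show "(\<lambda>p. u p * indicator (ball 0 (real n)) (snd p)) \<in> borel_measurable PB" for n by measurable
  show "(\<lambda>n. Dsq (\<lambda>p. u p * indicator (ball 0 (real n)) (snd p) - u p)) \<longlonglongrightarrow> 0"
  proof (rule Dsq_dominated[OF _ u(1) _ fin])
   show "(\<lambda>p. u p * indicator (ball 0 (real n)) (snd p) - u p) \<in> borel_measurable PB" for n by measurable
   show "\<bar>u p * indicator (ball 0 (real n)) (snd p) - u p\<bar> \<le> \<bar>u p\<bar>" for n p
    by (auto split: split_indicator)
   fix p :: "('a \<times> real) \<times> (real ^ 'n)"
   obtain N :: nat where "norm (snd p) < real N" using reals_Archimedean2 by blast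
   then have "eventually (\<lambda>n. u p * indicator (ball 0 (real n)) (snd p) - u p = 0) sequentially"
    by (intro eventually_sequentiallyI[of N]) auto
   then show "(\<lambda>n. u p * indicator (ball 0 (real n)) (snd p) - u p) \<longlonglongrightarrow> 0" by (rule tendsto_eventually)
  qed
 qed
qed

lemma approximable_finite:
 assumes u: "u \<in> borel_measurable PB" and fin: "Dsq u < \<infinity>"
 shows "approximable u"
proof -
 note [measurable] = u(1)
 have "Dsq (\<lambda>p. max (u p) 0) \<le> Dsq u" "Dsq (\<lambda>p. max (- u p) 0) \<le> Dsq u" by (auto intro!: Dsq_mono)
 then have "approximable (\<lambda>p. max (u p) 0)" "approximable (\<lambda>p. max (- u p) 0)"
  using fin by (auto intro!: approximable_nonneg)
 then have "approximable (\<lambda>p. max (u p) 0 + (- 1) * max (- u p) 0)"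
  by (intro approximable_add approximable_scale) measurable
 then show ?thesis by (rule approximable_cong) (auto simp: max_def)
qed

lemma simple_fields_dense:
 assumes g: "g \<in> P_dagger P G E f T"
 obtains gs where "\<And>n::nat. simple_field P G T (gs n)"
  "(\<lambda>n. Dsq (\<lambda>p. step_field (gs n) p - field g p)) \<longlonglongrightarrow> 0"
proof -
 have m: "field g \<in> borel_measurable PB" and "dagger_sq P E f T g < \<infinity>"
  using g by (auto simp: P_dagger_def field_def)
 then have "approximable (field g)" using approximable_finite dagger_sq_eq[OF m] by simp
 then have "\<exists>gs. simple_field P G T gs \<and> Dsq (\<lambda>p. step_field gs p - field g p) \<le> ennreal (1 / real (Suc n))" for n
  unfolding approximable_def by (meson divide_pos_pos of_nat_0_less_iff zero_less_Suc zero_less_one)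
 then obtain gs where gs: "\<And>n. simple_field P G T (gs n)" "\<And>n. Dsq (\<lambda>p. step_field (gs n) p - field g p) \<le> ennreal (1 / real (Suc n))"
  by metis
 have "(\<lambda>n. ennreal (1 / real (Suc n))) \<longlonglongrightarrow> 0"
  using tendsto_ennrealI[OF LIMSEQ_inverse_real_of_nat] by (simp add: inverse_eq_divide del: of_nat_Suc)
 then have "(\<lambda>n. Dsq (\<lambda>p. step_field (gs n) p - field g p)) \<longlonglongrightarrow> 0"
  by (rule ennreal_squeeze_0[OF gs(2)])
 with gs(1) that show ?thesis by blast
qed

end

section \<open>Integrals as limits of step integrals\<close>

lemma L2_limit_close:
 assumes lim: "L2_limit M X Z" and Y: "\<And>n. Y n \<in> borel_measurable M"
  and close: "(\<lambda>n. nn2 M (\<lambda>w. Y n w - X n w)) \<longlonglongrightarrow> 0"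
 shows "L2_limit M Y Z"
proof -
 have le: "(nn2 M (\<lambda>w. Y n w - Z w))
   \<le> 2 * (nn2 M (\<lambda>w. Y n w - X n w)) + 2 * (nn2 M (\<lambda>w. X n w - Z w))" for n
  using nn2_triangle[of "\<lambda>w. Y n w - X n w" M "\<lambda>w. X n w - Z w"] borel_measurable_diff[OF Y L2_limitD(2)[OF lim]] borel_measurable_diff[OF L2_limitD(2)[OF lim] L2_limitD(1)[OF lim]] by simp
 have "(\<lambda>n. 2 * (nn2 M (\<lambda>w. Y n w - X n w)) + 2 * (nn2 M (\<lambda>w. X n w - Z w))) \<longlonglongrightarrow> 2 * 0 + 2 * 0"
  by (intro tendsto_add ennreal_tendsto_cmult close L2_limitD(3)[OF lim]) auto
 then have "(\<lambda>n. 2 * (nn2 M (\<lambda>w. Y n w - X n w)) + 2 * (nn2 M (\<lambda>w. X n w - Z w))) \<longlonglongrightarrow> 0" by simp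
 then have "(\<lambda>n. nn2 M (\<lambda>w. Y n w - Z w)) \<longlonglongrightarrow> 0" by (rule ennreal_squeeze_0[OF le])
 then show ?thesis using L2_limitD(1)[OF lim] Y by (simp add: L2_limit_def)
qed

lemma norm_diff_sq_le:
 fixes x y v :: "'k::real_normed_vector"
 shows "(norm (x - y))^2 \<le> 2 * (norm (x - v))^2 + 2 * (norm (y - v))^2"
proof -
 have "norm (x - y) \<le> norm (x - v) + norm (y - v)" using norm_triangle_ineq4[of "x - v" "y - v"] by simp
 then have "(norm (x - y))^2 \<le> (norm (x - v) + norm (y - v))^2" by (rule power_mono) simp
 also have "\<dots> \<le> 2 * (norm (x - v))^2 + 2 * (norm (y - v))^2"
  using sum_squares_bound[of "norm (x - v)" "norm (y - v)"] by (simp add: power2_sum)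
 finally show ?thesis .
qed

lemma ennreal_norm_diff_sq_le:
 fixes x y v :: "'k::real_normed_vector"
 assumes "ennreal ((norm (x - v))^2) \<le> a" "ennreal ((norm (y - v))^2) \<le> b"
 shows "ennreal ((norm (x - y))^2) \<le> 2 * a + 2 * b"
proof -
 have "ennreal ((norm (x - y))^2) \<le> ennreal (2 * (norm (x - v))^2 + 2 * (norm (y - v))^2)"
  by (rule ennreal_leI[OF norm_diff_sq_le])
 also have "\<dots> = 2 * ennreal ((norm (x - v))^2) + 2 * ennreal ((norm (y - v))^2)"
  using ennreal_mult[of 2 "(norm (x - v))^2"] ennreal_mult[of 2 "(norm (y - v))^2"] by (subst ennreal_plus) simp_all
 also have "\<dots> \<le> 2 * a + 2 * b" using assms by (intro add_mono mult_left_mono) auto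
 finally show ?thesis .
qed

context integration
begin

text \<open>The measurable majorants \<open>d\<close> stand in for the distance of \<open>v\<close> to the
  step functions.\<close>

lemma Kint_close:
 assumes ok: "list_all ok hs" "list_all ok hs'" and d: "d \<in> borel_measurable \<nu>" "d' \<in> borel_measurable \<nu>"
  and le: "\<And>z. z \<in> space \<nu> \<Longrightarrow> ennreal ((norm (Kfun hs z - v z))^2) \<le> d z"
   "\<And>z. z \<in> space \<nu> \<Longrightarrow> ennreal ((norm (Kfun hs' z - v z))^2) \<le> d' z"
 shows "(nn2 P (\<lambda>w. Kint hs w - Kint hs' w)) \<le> 2 * (\<integral>\<^sup>+z. d z \<partial>\<nu>) + 2 * (\<integral>\<^sup>+z. d' z \<partial>\<nu>)"
proof -
 have "(\<integral>\<^sup>+z. ennreal ((norm (Kfun hs z - Kfun hs' z))^2) \<partial>\<nu>) \<le> (\<integral>\<^sup>+z. 2 * d z + 2 * d' z \<partial>\<nu>)"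
  using le by (intro nn_integral_mono ennreal_norm_diff_sq_le)
 also have "\<dots> = 2 * (\<integral>\<^sup>+z. d z \<partial>\<nu>) + 2 * (\<integral>\<^sup>+z. d' z \<partial>\<nu>)" using d by (simp add: nn_integral_add nn_integral_cmult)
 finally show ?thesis unfolding Kint_diff_isometry[OF ok] .
qed

lemma Kint_converges:
 assumes ok: "\<And>n::nat. list_all ok (hs n)" and d: "\<And>n. d n \<in> borel_measurable \<nu>"
  and le: "\<And>n z. z \<in> space \<nu> \<Longrightarrow> ennreal ((norm (Kfun (hs n) z - v z))^2) \<le> d n z"
  and lim: "(\<lambda>n. \<integral>\<^sup>+z. d n z \<partial>\<nu>) \<longlonglongrightarrow> 0"
 shows "\<exists>Z. L2_limit P (\<lambda>n. Kint (hs n)) Z"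
proof (rule L2_complete)
 show "Kint (hs n) \<in> borel_measurable P" for n using Kint_square_integrable[OF ok] by (rule square_integrable_borel)
 fix \<epsilon> :: real assume \<epsilon>: "0 < \<epsilon>"
 then have "eventually (\<lambda>n. (\<integral>\<^sup>+z. d n z \<partial>\<nu>) < ennreal (\<epsilon> / 4)) sequentially" by (intro order_tendstoD(2)[OF lim]) simp
 then obtain N where N: "\<And>n. N \<le> n \<Longrightarrow> (\<integral>\<^sup>+z. d n z \<partial>\<nu>) < ennreal (\<epsilon> / 4)" unfolding eventually_sequentially by blast
 have "(nn2 P (\<lambda>w. Kint (hs m) w - Kint (hs n) w)) \<le> ennreal \<epsilon>" if "N \<le> m" "N \<le> n" for m n
 proof -
  have "(nn2 P (\<lambda>w. Kint (hs m) w - Kint (hs n) w)) \<le> 2 * (\<integral>\<^sup>+z. d m z \<partial>\<nu>) + 2 * (\<integral>\<^sup>+z. d n z \<partial>\<nu>)"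
   by (rule Kint_close[OF ok ok d d le le])
  also have "\<dots> \<le> 2 * ennreal (\<epsilon> / 4) + 2 * ennreal (\<epsilon> / 4)"
   using N[OF that(1)] N[OF that(2)] by (intro add_mono mult_left_mono) auto
  finally show ?thesis unfolding two_quarters[OF \<epsilon>] .
 qed
 then show "\<exists>N. \<forall>m\<ge>N. \<forall>n\<ge>N. (nn2 P (\<lambda>w. Kint (hs m) w - Kint (hs n) w)) \<le> ennreal \<epsilon>" by blast
qed

text \<open>The limit depends only on the process that is approximated and not on the approximating
  sequence.\<close>

lemma Kint_limit_transfer:
 assumes ok: "\<And>n::nat. list_all ok (hs n)" "\<And>n::nat. list_all ok (hs' n)"
  and d: "\<And>n. d n \<in> borel_measurable \<nu>" "\<And>n. d' n \<in> borel_measurable \<nu>"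
  and le: "\<And>n z. z \<in> space \<nu> \<Longrightarrow> ennreal ((norm (Kfun (hs n) z - v z))^2) \<le> d n z"
   "\<And>n z. z \<in> space \<nu> \<Longrightarrow> ennreal ((norm (Kfun (hs' n) z - v z))^2) \<le> d' n z"
  and lim: "(\<lambda>n. \<integral>\<^sup>+z. d n z \<partial>\<nu>) \<longlonglongrightarrow> 0" "(\<lambda>n. \<integral>\<^sup>+z. d' n z \<partial>\<nu>) \<longlonglongrightarrow> 0"
  and Z: "L2_limit P (\<lambda>n. Kint (hs n)) Z"
 shows "L2_limit P (\<lambda>n. Kint (hs' n)) Z"
proof (rule L2_limit_close[OF Z])
 show "Kint (hs' n) \<in> borel_measurable P" for n using Kint_square_integrable[OF ok(2)] by (rule square_integrable_borel)
 have "(\<lambda>n. 2 * (\<integral>\<^sup>+z. d' n z \<partial>\<nu>) + 2 * (\<integral>\<^sup>+z. d n z \<partial>\<nu>)) \<longlonglongrightarrow> 2 * 0 + 2 * 0"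
  by (intro tendsto_add ennreal_tendsto_cmult lim) auto
 then have "(\<lambda>n. 2 * (\<integral>\<^sup>+z. d' n z \<partial>\<nu>) + 2 * (\<integral>\<^sup>+z. d n z \<partial>\<nu>)) \<longlonglongrightarrow> 0" by simp
 then show "(\<lambda>n. nn2 P (\<lambda>w. Kint (hs' n) w - Kint (hs n) w)) \<longlonglongrightarrow> 0"
 proof (rule ennreal_squeeze_0[rotated])
  show "(nn2 P (\<lambda>w. Kint (hs' n) w - Kint (hs n) w)) \<le> 2 * (\<integral>\<^sup>+z. d' n z \<partial>\<nu>) + 2 * (\<integral>\<^sup>+z. d n z \<partial>\<nu>)" for n
   by (rule Kint_close[OF ok(2) ok(1) d(2) d(1) le(2) le(1)])
 qed
qed

definition Kfield :: "('n, 'a) simple_field \<Rightarrow> (real \<times> real \<times> 'k \<times> ('a \<Rightarrow> real)) list" where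
 "Kfield gs = map (\<lambda>(a, b, A, X). (a, b, K_elem f \<iota> (indicator A), X)) gs"

definition Kproc :: "'k \<Rightarrow> (real \<times> real \<times> ('a \<Rightarrow> real)) list \<Rightarrow> (real \<times> real \<times> 'k \<times> ('a \<Rightarrow> real)) list" where
 "Kproc k hs = map (\<lambda>(a, b, X). (a, b, k, X)) hs"

text \<open>The coefficients of the \<open>j\<close>-th coordinate of the step function of an elementary
  field.\<close>

definition coord :: "nat \<Rightarrow> ('n, 'a) simple_field \<Rightarrow> (real \<times> real \<times> ('a \<Rightarrow> real)) list" where
 "coord j gs = map (\<lambda>(a, b, A, X). (a, b, \<lambda>w. X w * (K_elem f \<iota> (indicator A) \<bullet> e j))) gs"

definition kg :: "(real \<Rightarrow> real ^ 'n \<Rightarrow> 'a \<Rightarrow> real) \<Rightarrow> 'a \<times> real \<Rightarrow> 'k" where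
 "kg g z = K_elem f \<iota> (\<lambda>x. field g (z, x))"

lemma ok_Kfield: "simple_field P G T gs \<Longrightarrow> list_all ok (Kfield gs)"
 by (fastforce simp: simple_field_def Kfield_def list_all_iff)

lemma ok_Kproc: "list_all ok (Kproc k hs) \<longleftrightarrow> simple_process P G T hs"
 by (auto simp: simple_process_def Kproc_def list_all_iff)

lemma coord_simple: "simple_field P G T gs \<Longrightarrow> simple_process P G T (coord j gs)"
proof -
 have "\<exists>C'. \<forall>w\<in>space P. \<bar>X w * c\<bar> \<le> C'" if "\<forall>w\<in>space P. \<bar>X w\<bar> \<le> C" for X and C c :: real
  using that by (intro exI[of _ "C * \<bar>c\<bar>"]) (auto simp: abs_mult intro: mult_right_mono)
 then show "simple_field P G T gs \<Longrightarrow> simple_process P G T (coord j gs)"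
  by (fastforce simp: simple_field_def simple_process_def coord_def)
qed

lemma Kint_Kfield: "Kint (Kfield gs) = simple_field_integral (time_changed_martingale_measure f \<iota> B E) gs"
proof
 show "Kint (Kfield gs) w = simple_field_integral (time_changed_martingale_measure f \<iota> B E) gs w" for w
  by (induction gs) (auto simp: Kint_def Kfield_def simple_field_integral_def time_changed_martingale_measure_def M_def)
qed

lemma Kint_Kproc: "Kint (Kproc k hs) = simple_process_integral (M k) hs"
proof
 show "Kint (Kproc k hs) w = simple_process_integral (M k) hs w" for w
  by (induction hs) (auto simp: Kint_def Kproc_def simple_process_integral_def)
qed

lemma Kfun_Kproc: "Kfun (Kproc k hs) z = simple_process_fun hs (snd z) (fst z) *\<^sub>R k"
 by (induction hs) (auto simp: Kfun_def Kproc_def simple_process_fun_def scaleR_add_left)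

lemma Kfun_coord: "simple_process_fun (coord j gs) (snd z) (fst z) = Kfun (Kfield gs) z \<bullet> e j"
 by (induction gs) (auto simp: Kfun_def Kfield_def coord_def simple_process_fun_def inner_add_left)

lemma
 assumes "simple_field P G T gs"
 shows fin_simple_field: "ker.fin (\<lambda>x. step_field gs (z, x))"
  and Kfun_Kfield: "Kfun (Kfield gs) z = K_elem f \<iota> (\<lambda>x. step_field gs (z, x))"
proof (atomize (full), use assms in \<open>induction gs\<close>)
 case Nil
 have "field (simple_field_fun []) (z, x) = 0" for x by (simp add: field_def simple_field_fun_def case_prod_beta')
 moreover have "K_elem f \<iota> (\<lambda>x. 0) = 0" using K_elem_scale[OF ker.fin_zero, of 0] by simp
 ultimately show ?case using ker.fin_zero by (simp add: Kfun_def Kfield_def)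
next
 case (Cons h gs)
 obtain a b A X where h: "h = (a, b, A, X)" by (metis prod_cases4)
 have gs: "simple_field P G T gs" and A: "bounded A" "A \<in> sets borel" using Cons(2) by (auto simp: simple_field_def h)
 let ?c = "indicator {a<..b} (snd z) * X (fst z)"
 have eq: "(\<lambda>x. step_field (h # gs) (z, x)) = (\<lambda>x. ?c * indicator A x + step_field gs (z, x))"
  by (simp add: h field_Cons fun_eq_iff)
 have 1: "ker.fin (\<lambda>x. ?c * indicator A x)" by (intro ker.fin_scale fin_bounded_set A)
 have 2: "ker.fin (\<lambda>x. step_field gs (z, x))" and IH: "Kfun (Kfield gs) z = K_elem f \<iota> (\<lambda>x. step_field gs (z, x))"
  using Cons(1)[OF gs] by auto
 have "Kfun (Kfield (h # gs)) z = ?c *\<^sub>R K_elem f \<iota> (indicator A) + Kfun (Kfield gs) z"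
  by (simp add: Kfun_def Kfield_def h)
 also have "\<dots> = K_elem f \<iota> (\<lambda>x. ?c * indicator A x + step_field gs (z, x))"
  unfolding K_elem_add[OF 1 2] K_elem_scale[OF fin_bounded_set[OF A]] IH ..
 finally show ?case unfolding eq using ker.fin_add[OF 1 2] by simp
qed

text \<open>The inequality that transfers approximation in the norm of \<open>P_dagger\<close> to
  approximation in \<open>K\<close>.\<close>

lemma Kfun_minus_kg:
 assumes gs: "simple_field P G T gs" and g: "field g \<in> borel_measurable PB" and z: "z \<in> space \<nu>"
 shows "ennreal ((norm (Kfun (Kfield gs) z - kg g z))^2) \<le> abs_form f (\<lambda>x. step_field gs (z, x) - field g (z, x))"
 unfolding kg_def Kfun_Kfield[OF gs] by (rule K_elem_diff_norm_le[OF fin_simple_field[OF gs] section_borel[OF g z]])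

lemma kg_coordinate_measurable: "field g \<in> borel_measurable PB \<Longrightarrow> j \<in> I \<Longrightarrow> (\<lambda>z. kg g z \<bullet> e j) \<in> borel_measurable PS"
 unfolding kg_def by (rule K_elem_coordinate_measurable) simp_all

lemma kg_norm_le: "ennreal ((norm (kg g z))^2) \<le> abs_form f (\<lambda>x. field g (z, x))"
 unfolding kg_def by (rule K_elem_norm_le)

lemma L2_sq_eq:
 assumes "(\<lambda>(w, t). h t w) \<in> borel_measurable PS"
 shows "L2_sq P E T h = (\<integral>\<^sup>+z. ennreal ((h (snd z) (fst z))^2) \<partial>\<nu>)"
proof -
 have "(\<lambda>z. ennreal ((h (snd z) (fst z))^2)) \<in> borel_measurable PS" using assms by (simp add: case_prod_beta')
 from nn_integral_nu[OF this] show ?thesis by (simp add: L2_sq_def kern_def)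
qed

lemma simple_process_measurable:
 "simple_process P G T hs \<Longrightarrow> (\<lambda>(w, t). simple_process_fun hs t w) \<in> borel_measurable PS"
proof (induction hs)
 case Nil
 then show ?case by (simp add: simple_process_fun_def case_prod_beta')
next
 case (Cons h hs)
 obtain a b X where h: "h = (a, b, X)" by (metis prod_cases3)
 have "(\<lambda>z. indicator {a<..b} (snd z) * X (fst z)) \<in> borel_measurable PS" "(\<lambda>(w, t). simple_process_fun hs t w) \<in> borel_measurable PS"
  using Cons by (auto simp: simple_process_def h intro!: rect_function_measurable)
 then show ?case by (simp add: simple_process_fun_def case_prod_beta' h)
qed

section \<open>Coordinate integrals sum to the martingale measure integral\<close>

abbreviation ME :: "(real ^ 'n) set \<Rightarrow> real \<Rightarrow> 'a \<Rightarrow> real" where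
 "ME \<equiv> time_changed_martingale_measure f \<iota> B E"

abbreviation coordinate :: "(real \<Rightarrow> real ^ 'n \<Rightarrow> 'a \<Rightarrow> real) \<Rightarrow> nat \<Rightarrow> real \<Rightarrow> 'a \<Rightarrow> real" where
 "coordinate g j \<equiv> \<lambda>t w. K_elem f \<iota> (\<lambda>x. g t x w) \<bullet> e j"

lemma coordinate_eq: "coordinate g j (snd z) (fst z) = kg g z \<bullet> e j"
 by (simp add: kg_def field_def case_prod_beta')

lemma P_daggerD:
 assumes "g \<in> P_dagger P G E f T"
 shows "field g \<in> borel_measurable PB" "Dsq (field g) < \<infinity>"
proof -
 show m: "field g \<in> borel_measurable PB" using assms by (auto simp: P_dagger_def field_def)
 show "Dsq (field g) < \<infinity>" using assms dagger_sq_eq[OF m] by (auto simp: P_dagger_def)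
qed

lemma coordinate_measurable:
 assumes "field g \<in> borel_measurable PB" "j \<in> I"
 shows "(\<lambda>(w, t). coordinate g j t w) \<in> borel_measurable PS"
 using kg_coordinate_measurable[OF assms] unfolding coordinate_eq[symmetric] by (simp add: case_prod_beta')

lemma diff_measurable: "simple_field P G T gs \<Longrightarrow> field g \<in> borel_measurable PB \<Longrightarrow>
  (\<lambda>p. step_field gs p - field g p) \<in> borel_measurable PB"
 using simple_field_measurable by simp

lemma dagger_sq_diff:
 assumes "simple_field P G T gs" "field g \<in> borel_measurable PB"
 shows "dagger_sq P E f T (\<lambda>t x w. simple_field_fun gs t x w - g t x w) = Dsq (\<lambda>p. step_field gs p - field g p)"
proof -
 have "field (\<lambda>t x w. simple_field_fun gs t x w - g t x w) = (\<lambda>p. step_field gs p - field g p)"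
  by (auto simp: field_def fun_eq_iff)
 then show ?thesis using dagger_sq_eq[of "\<lambda>t x w. simple_field_fun gs t x w - g t x w"] diff_measurable[OF assms] by simp
qed

lemma martingale_measure_integral_exists:
 assumes g: "g \<in> P_dagger P G E f T"
 shows "\<exists>Z. has_martingale_measure_integral P G E f T ME g Z"
proof -
 note m = P_daggerD(1)[OF g]
 obtain gs where gs: "\<And>n::nat. simple_field P G T (gs n)" and lim: "(\<lambda>n. Dsq (\<lambda>p. step_field (gs n) p - field g p)) \<longlonglongrightarrow> 0"
  using simple_fields_dense[OF g] by blast
 have "\<exists>Z. L2_limit P (\<lambda>n. Kint (Kfield (gs n))) Z"
  by (rule Kint_converges[OF ok_Kfield[OF gs] abs_form_section_measurable'[OF diff_measurable[OF gs m]] Kfun_minus_kg[OF gs m] lim[unfolded Dsq_def]])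
 then obtain Z where "L2_limit P (\<lambda>n. simple_field_integral ME (gs n)) Z" unfolding Kint_Kfield by blast
 then have "has_martingale_measure_integral P G E f T ME g Z"
  unfolding has_martingale_measure_integral_def
  using g gs lim dagger_sq_diff[OF gs m] by (intro conjI exI[of _ gs]) simp_all
 then show ?thesis by blast
qed

lemma L2_sq_coordinate:
 assumes gs: "simple_field P G T gs" and m: "field g \<in> borel_measurable PB" and j: "j \<in> I"
 shows "L2_sq P E T (\<lambda>t w. simple_process_fun (coord j gs) t w - coordinate g j t w)
   \<le> Dsq (\<lambda>p. step_field gs p - field g p)"
proof -
 have "(\<lambda>(w, t). simple_process_fun (coord j gs) t w - coordinate g j t w) \<in> borel_measurable PS"
  using borel_measurable_diff[OF simple_process_measurable[OF coord_simple[OF gs]] coordinate_measurable[OF m j]]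
  by (simp add: case_prod_beta')
 then have "L2_sq P E T (\<lambda>t w. simple_process_fun (coord j gs) t w - coordinate g j t w)
   = (\<integral>\<^sup>+z. ennreal (((Kfun (Kfield gs) z - kg g z) \<bullet> e j)^2) \<partial>\<nu>)"
  by (subst L2_sq_eq) (simp_all add: Kfun_coord coordinate_eq inner_diff_left)
 also have "\<dots> \<le> Dsq (\<lambda>p. step_field gs p - field g p)"
  unfolding Dsq_def
 proof (rule nn_integral_mono)
  fix z assume z: "z \<in> space \<nu>"
  have "((Kfun (Kfield gs) z - kg g z) \<bullet> e j)^2 \<le> (norm (Kfun (Kfield gs) z - kg g z))^2"
   using Bessel[of "{j}" "Kfun (Kfield gs) z - kg g z"] j by simp
  then show "ennreal (((Kfun (Kfield gs) z - kg g z) \<bullet> e j)^2) \<le> abs_form f (\<lambda>x. step_field gs (z, x) - field g (z, x))"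
   using Kfun_minus_kg[OF gs m z] by (meson ennreal_leI order_trans)
 qed
 finally show ?thesis .
qed

lemma L2_sq_coordinate_finite:
 assumes g: "g \<in> P_dagger P G E f T" and j: "j \<in> I"
 shows "L2_sq P E T (coordinate g j) < \<infinity>"
proof -
 have "L2_sq P E T (coordinate g j) = (\<integral>\<^sup>+z. ennreal ((kg g z \<bullet> e j)^2) \<partial>\<nu>)"
  by (subst L2_sq_eq[OF coordinate_measurable[OF P_daggerD(1)[OF g] j]]) (simp only: coordinate_eq)
 also have "\<dots> \<le> Dsq (field g)"
  unfolding Dsq_def
 proof (rule nn_integral_mono)
  fix z
  have "(kg g z \<bullet> e j)^2 \<le> (norm (kg g z))^2" using Bessel[of "{j}" "kg g z"] j by simp
  then show "ennreal ((kg g z \<bullet> e j)^2) \<le> abs_form f (\<lambda>x. field g (z, x))"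
   using kg_norm_le by (meson ennreal_leI order_trans)
 qed
 finally show ?thesis using P_daggerD(2)[OF g] by (rule le_less_trans)
qed

text \<open>Every approximating sequence yields the same integral.\<close>

lemma ito_limit:
 assumes j: "j \<in> I" and Z: "has_ito_integral P G E T (M (e j)) h Z"
  and hs: "\<And>n::nat. simple_process P G T (hs n)"
  and lim: "(\<lambda>n. L2_sq P E T (\<lambda>t w. simple_process_fun (hs n) t w - h t w)) \<longlonglongrightarrow> 0"
 shows "L2_limit P (\<lambda>n. simple_process_integral (M (e j)) (hs n)) Z"
proof -
 have hm: "(\<lambda>(w, t). h t w) \<in> borel_measurable PS" using Z by (simp add: has_ito_integral_def)
 obtain hs' where hs': "\<And>n::nat. simple_process P G T (hs' n)"
  and lim': "(\<lambda>n. L2_sq P E T (\<lambda>t w. simple_process_fun (hs' n) t w - h t w)) \<longlonglongrightarrow> 0"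
  and Z': "L2_limit P (\<lambda>n. simple_process_integral (M (e j)) (hs' n)) Z"
  using Z unfolding has_ito_integral_def by blast
 let ?d = "\<lambda>hs z. ennreal ((simple_process_fun hs (snd z) (fst z) - h (snd z) (fst z))^2)"
 have dm: "(\<lambda>(w, t). simple_process_fun hs t w - h t w) \<in> borel_measurable PS" if "simple_process P G T hs" for hs
  using borel_measurable_diff[OF simple_process_measurable[OF that] hm] by (simp add: case_prod_beta')
 have d: "?d hs \<in> borel_measurable \<nu>" if "simple_process P G T hs" for hs
  using dm[OF that] by (simp add: case_prod_beta')
 have le: "ennreal ((norm (Kfun (Kproc (e j) hs) z - h (snd z) (fst z) *\<^sub>R e j))^2) \<le> ?d hs z" for hs z
  using j by (simp add: Kfun_Kproc flip: scaleR_diff_left)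
 have "L2_limit P (\<lambda>n. Kint (Kproc (e j) (hs n))) Z"
 proof (rule Kint_limit_transfer[where v="\<lambda>z. h (snd z) (fst z) *\<^sub>R e j"])
  show "list_all ok (Kproc (e j) (hs' n))" "list_all ok (Kproc (e j) (hs n))" for n
   using hs hs' by (simp_all add: ok_Kproc)
  show "?d (hs' n) \<in> borel_measurable \<nu>" "?d (hs n) \<in> borel_measurable \<nu>" for n using d hs hs' by auto
  show "ennreal ((norm (Kfun (Kproc (e j) (hs' n)) z - h (snd z) (fst z) *\<^sub>R e j))^2) \<le> ?d (hs' n) z"
   "ennreal ((norm (Kfun (Kproc (e j) (hs n)) z - h (snd z) (fst z) *\<^sub>R e j))^2) \<le> ?d (hs n) z" for n z
   by (rule le)+
  show "(\<lambda>n. \<integral>\<^sup>+z. ?d (hs' n) z \<partial>\<nu>) \<longlonglongrightarrow> 0" "(\<lambda>n. \<integral>\<^sup>+z. ?d (hs n) z \<partial>\<nu>) \<longlonglongrightarrow> 0"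
   using lim' lim unfolding L2_sq_eq[OF dm[OF hs]] L2_sq_eq[OF dm[OF hs']] .
  show "L2_limit P (\<lambda>n. Kint (Kproc (e j) (hs' n))) Z" unfolding Kint_Kproc by (rule Z')
 qed
 then show ?thesis unfolding Kint_Kproc .
qed

lemma coordinate_ito_limit:
 assumes m: "field g \<in> borel_measurable PB" and j: "j \<in> I" and gs: "\<And>n::nat. simple_field P G T (gs n)"
  and lim: "(\<lambda>n. Dsq (\<lambda>p. step_field (gs n) p - field g p)) \<longlonglongrightarrow> 0"
 shows "(\<lambda>n. L2_sq P E T (\<lambda>t w. simple_process_fun (coord j (gs n)) t w - coordinate g j t w)) \<longlonglongrightarrow> 0"
 by (rule ennreal_squeeze_0[OF L2_sq_coordinate[OF gs m j] lim])

lemma coordinate_ito_exists: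
 assumes g: "g \<in> P_dagger P G E f T" and j: "j \<in> I"
 shows "\<exists>Y. has_ito_integral P G E T (M (e j)) (coordinate g j) Y"
proof -
 note m = P_daggerD(1)[OF g]
 obtain gs where gs: "\<And>n::nat. simple_field P G T (gs n)" and lim: "(\<lambda>n. Dsq (\<lambda>p. step_field (gs n) p - field g p)) \<longlonglongrightarrow> 0"
  using simple_fields_dense[OF g] by blast
 have "\<exists>Z. L2_limit P (\<lambda>n. Kint (Kproc (e j) (coord j (gs n)))) Z"
 proof (rule Kint_converges[where v="\<lambda>z. (kg g z \<bullet> e j) *\<^sub>R e j"])
  show "list_all ok (Kproc (e j) (coord j (gs n)))" for n by (simp add: ok_Kproc coord_simple[OF gs])
  show "(\<lambda>z. abs_form f (\<lambda>x. step_field (gs n) (z, x) - field g (z, x))) \<in> borel_measurable \<nu>" for n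
   by (rule abs_form_section_measurable'[OF diff_measurable[OF gs m]])
  show "(\<lambda>n. \<integral>\<^sup>+z. abs_form f (\<lambda>x. step_field (gs n) (z, x) - field g (z, x)) \<partial>\<nu>) \<longlonglongrightarrow> 0"
   using lim by (simp add: Dsq_def)
  fix n z assume z: "z \<in> space \<nu>"
  have "((Kfun (Kfield (gs n)) z - kg g z) \<bullet> e j)^2 \<le> (norm (Kfun (Kfield (gs n)) z - kg g z))^2"
   using Bessel[of "{j}" "Kfun (Kfield (gs n)) z - kg g z"] j by simp
  then have "ennreal (((Kfun (Kfield (gs n)) z - kg g z) \<bullet> e j)^2) \<le> abs_form f (\<lambda>x. step_field (gs n) (z, x) - field g (z, x))"
   using Kfun_minus_kg[OF gs m z, of n] by (meson ennreal_leI order_trans)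
  then show "ennreal ((norm (Kfun (Kproc (e j) (coord j (gs n))) z - (kg g z \<bullet> e j) *\<^sub>R e j))^2)
    \<le> abs_form f (\<lambda>x. step_field (gs n) (z, x) - field g (z, x))"
   using j by (simp add: Kfun_Kproc Kfun_coord inner_diff_left flip: scaleR_diff_left)
 qed
 then obtain Z where "L2_limit P (\<lambda>n. simple_process_integral (M (e j)) (coord j (gs n))) Z" unfolding Kint_Kproc by blast
 then have "has_ito_integral P G E T (M (e j)) (coordinate g j) Z"
  unfolding has_ito_integral_def
  using coordinate_measurable[OF m j] L2_sq_coordinate_finite[OF g j] coord_simple[OF gs] coordinate_ito_limit[OF m j gs lim]
  by (intro conjI exI[of _ "\<lambda>n. coord j (gs n)"]) auto
 then show ?thesis by blast
qed

text \<open>The steps of all coordinate processes below \<open>N\<close>, each with its basis vector. This is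
  the projection of the step function of \<open>gs\<close>, written so that its integral is literally the sum
  of the coordinate integrals.\<close>

definition proj_list :: "nat \<Rightarrow> ('n, 'a) simple_field \<Rightarrow> (real \<times> real \<times> 'k \<times> ('a \<Rightarrow> real)) list" where
 "proj_list N gs = concat (map (\<lambda>j. Kproc (e j) (coord j gs)) (filter (\<lambda>j. j \<in> I) [0..<N]))"

lemma ok_proj_list: "simple_field P G T gs \<Longrightarrow> list_all ok (proj_list N gs)"
 using coord_simple by (auto simp: proj_list_def list_all_iff ok_Kproc[unfolded list_all_iff])

lemma proj_list_Suc: "proj_list (Suc N) gs = proj_list N gs @ (if N \<in> I then Kproc (e N) (coord N gs) else [])"
 by (simp add: proj_list_def)

lemma I_Suc: "I \<inter> {..<Suc N} = (if N \<in> I then insert N (I \<inter> {..<N}) else I \<inter> {..<N})"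
 by (auto simp: lessThan_Suc)

lemma Kfun_proj_list: "Kfun (proj_list N gs) z = proj N (Kfun (Kfield gs) z)"
proof (induction N)
 case 0
 show ?case by (simp add: proj_list_def Kfun_def proj_def)
next
 case (Suc N)
 have "Kfun [] z = 0" by (simp add: Kfun_def)
 then show ?case using Suc
  by (simp add: proj_list_Suc Kfun_append Kfun_Kproc Kfun_coord proj_def I_Suc)
qed

lemma Kint_proj_list: "Kint (proj_list N gs) w = (\<Sum>j\<in>I \<inter> {..<N}. simple_process_integral (M (e j)) (coord j gs) w)"
proof (induction N)
 case 0
 show ?case by (simp add: proj_list_def Kint_def)
next
 case (Suc N)
 have "Kint [] w = 0" by (simp add: Kint_def)
 then show ?case using Suc
  by (simp add: proj_list_Suc Kint_append Kint_Kproc I_Suc)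
qed

definition tail :: "(real \<Rightarrow> real ^ 'n \<Rightarrow> 'a \<Rightarrow> real) \<Rightarrow> nat \<Rightarrow> ennreal" where
 "tail g N = (\<integral>\<^sup>+z. ennreal ((norm (kg g z - proj N (kg g z)))^2) \<partial>\<nu>)"

lemma tail_measurable:
 assumes m: "field g \<in> borel_measurable PB"
 shows "(\<lambda>z. (norm (kg g z - proj N (kg g z)))^2) \<in> borel_measurable \<nu>"
proof -
 have c: "(\<lambda>z. (\<Sum>j\<in>I \<inter> {..<K}. (kg g z \<bullet> e j)^2)) \<in> borel_measurable \<nu>" for K
  using kg_coordinate_measurable[OF m] by (intro borel_measurable_sum borel_measurable_power) auto
 have "(\<lambda>z. (norm (kg g z))^2) \<in> borel_measurable \<nu>"
 proof (rule borel_measurable_LIMSEQ_real[OF _ c])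
  fix z
  show "(\<lambda>K. \<Sum>j\<in>I \<inter> {..<K}. (kg g z \<bullet> e j)^2) \<longlonglongrightarrow> (norm (kg g z))^2"
   unfolding norm_proj_sum[symmetric] by (intro tendsto_power tendsto_norm proj_tendsto)
 qed
 then have "(\<lambda>z. (norm (kg g z))^2 - (\<Sum>j\<in>I \<inter> {..<N}. (kg g z \<bullet> e j)^2)) \<in> borel_measurable \<nu>"
  using c by (rule borel_measurable_diff)
 moreover have "(norm (kg g z - proj N (kg g z)))^2 = (norm (kg g z))^2 - (\<Sum>j\<in>I \<inter> {..<N}. (kg g z \<bullet> e j)^2)" for z
  using norm_proj[of "kg g z" N] norm_proj_sum[of N "kg g z"] by linarith
 ultimately show ?thesis by simp
qed

text \<open>The squared norm of \<open>g(t)\<close>, which is at most the absolute form, serves as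
  majorant.\<close>

lemma tail_tendsto_0:
 assumes g: "g \<in> P_dagger P G E f T"
 shows "tail g \<longlonglongrightarrow> 0"
proof -
 note m = P_daggerD(1)[OF g]
 have "(\<lambda>N. \<integral>\<^sup>+z. ennreal ((norm (kg g z - proj N (kg g z)))^2) \<partial>\<nu>) \<longlonglongrightarrow> (\<integral>\<^sup>+z. 0 \<partial>\<nu>)"
 proof (rule nn_integral_dominated_convergence[where w="\<lambda>z. abs_form f (\<lambda>x. field g (z, x))"])
  show "(\<lambda>z. ennreal ((norm (kg g z - proj N (kg g z)))^2)) \<in> borel_measurable \<nu>" for N
   using tail_measurable[OF m] by simp
  show "(\<integral>\<^sup>+z. abs_form f (\<lambda>x. field g (z, x)) \<partial>\<nu>) < \<infinity>" using P_daggerD(2)[OF g] by (simp add: Dsq_def)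
  show "AE z in \<nu>. ennreal ((norm (kg g z - proj N (kg g z)))^2) \<le> abs_form f (\<lambda>x. field g (z, x))" for N
  proof (rule AE_I2)
   fix z
   have "ennreal ((norm (kg g z - proj N (kg g z)))^2) \<le> ennreal ((norm (kg g z))^2)"
    by (intro ennreal_leI power_mono norm_minus_proj_le) simp
   then show "ennreal ((norm (kg g z - proj N (kg g z)))^2) \<le> abs_form f (\<lambda>x. field g (z, x))"
    using kg_norm_le by (rule order_trans)
  qed
  show "AE z in \<nu>. (\<lambda>N. ennreal ((norm (kg g z - proj N (kg g z)))^2)) \<longlonglongrightarrow> 0"
  proof (rule AE_I2)
   fix z
   have "(\<lambda>N. (norm (kg g z - proj N (kg g z)))^2) \<longlonglongrightarrow> (norm (kg g z - kg g z))^2"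
    by (intro tendsto_power tendsto_norm tendsto_diff tendsto_const proj_tendsto)
   then show "(\<lambda>N. ennreal ((norm (kg g z - proj N (kg g z)))^2)) \<longlonglongrightarrow> 0"
    using tendsto_ennrealI by fastforce
  qed
 qed (use abs_form_section_measurable'[OF m] in simp_all)
 then show ?thesis by (simp add: tail_def[abs_def])
qed

lemma proj_diff: "proj N (k - l) = proj N k - proj N l"
 by (simp add: proj_def inner_diff_left scaleR_diff_left sum_subtractf)

lemma proj_list_distance:
 assumes m: "field g \<in> borel_measurable PB" and gs: "simple_field P G T gs"
 shows "(nn2 P (\<lambda>w. Kint (Kfield gs) w - Kint (proj_list N gs) w))
  \<le> 2 * Dsq (\<lambda>p. step_field gs p - field g p) + 2 * tail g N"
proof -
 have "(nn2 P (\<lambda>w. Kint (Kfield gs) w - Kint (proj_list N gs) w))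
   = (\<integral>\<^sup>+z. ennreal ((norm (Kfun (Kfield gs) z - proj N (Kfun (Kfield gs) z)))^2) \<partial>\<nu>)"
  unfolding Kint_diff_isometry[OF ok_Kfield[OF gs] ok_proj_list[OF gs]] Kfun_proj_list ..
 also have "\<dots> \<le> (\<integral>\<^sup>+z. 2 * abs_form f (\<lambda>x. step_field gs (z, x) - field g (z, x)) + 2 * ennreal ((norm (kg g z - proj N (kg g z)))^2) \<partial>\<nu>)"
 proof (rule nn_integral_mono)
  fix z assume z: "z \<in> space \<nu>"
  let ?s = "Kfun (Kfield gs) z"
  have 1: "ennreal ((norm ((?s - kg g z) - proj N (?s - kg g z) - 0))^2) \<le> abs_form f (\<lambda>x. step_field gs (z, x) - field g (z, x))"
  proof -
   have "ennreal ((norm ((?s - kg g z) - proj N (?s - kg g z)))^2) \<le> ennreal ((norm (?s - kg g z))^2)"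
    by (intro ennreal_leI power_mono norm_minus_proj_le) simp
   then show ?thesis unfolding diff_zero using Kfun_minus_kg[OF gs m z] by (rule order_trans)
  qed
  have 2: "ennreal ((norm (proj N (kg g z) - kg g z - 0))^2) \<le> ennreal ((norm (kg g z - proj N (kg g z)))^2)"
   by (simp add: norm_minus_commute)
  have eq: "(?s - kg g z) - proj N (?s - kg g z) - (proj N (kg g z) - kg g z) = ?s - proj N ?s" by (simp add: proj_diff)
  show "ennreal ((norm (?s - proj N ?s))^2) \<le> 2 * abs_form f (\<lambda>x. step_field gs (z, x) - field g (z, x)) + 2 * ennreal ((norm (kg g z - proj N (kg g z)))^2)"
   using ennreal_norm_diff_sq_le[OF 1 2] unfolding eq .
 qed
 also have "\<dots> = 2 * Dsq (\<lambda>p. step_field gs p - field g p) + 2 * tail g N"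
  using tail_measurable[OF m] abs_form_section_measurable'[OF diff_measurable[OF gs m]]
  by (simp add: nn_integral_add nn_integral_cmult Dsq_def tail_def)
 finally show ?thesis .
qed

text \<open>For fixed \<open>N\<close> the distance is computed along the approximating elementary fields,
  where the isometry applies; the approximation error disappears in the limit and the tail remains.\<close>

theorem coordinate_sum_limit:
 assumes Z: "has_martingale_measure_integral P G E f T ME g Z"
  and Y: "\<And>j. j \<in> I \<Longrightarrow> has_ito_integral P G E T (M (e j)) (coordinate g j) (Y j)"
 shows "L2_limit P (\<lambda>N w. \<Sum>j\<in>I \<inter> {..<N}. Y j w) Z"
proof -
 have g: "g \<in> P_dagger P G E f T" using Z by (simp add: has_martingale_measure_integral_def)
 note m = P_daggerD(1)[OF g]
 obtain gs where gs: "\<And>n::nat. simple_field P G T (gs n)"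
  and lim': "(\<lambda>n. dagger_sq P E f T (\<lambda>t x w. simple_field_fun (gs n) t x w - g t x w)) \<longlonglongrightarrow> 0"
  and Zl: "L2_limit P (\<lambda>n. Kint (Kfield (gs n))) Z"
  using Z unfolding has_martingale_measure_integral_def Kint_Kfield by blast
 have lim: "(\<lambda>n. Dsq (\<lambda>p. step_field (gs n) p - field g p)) \<longlonglongrightarrow> 0"
  using lim' unfolding dagger_sq_diff[OF gs m] .
 let ?S = "\<lambda>N w. \<Sum>j\<in>I \<inter> {..<N}. Y j w"
 have S: "L2_limit P (\<lambda>n. Kint (proj_list N (gs n))) (?S N)" for N
  unfolding Kint_proj_list[abs_def]
  using ito_limit[OF _ Y coord_simple[OF gs] coordinate_ito_limit[OF m _ gs lim]] by (intro L2_limit_sum) auto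
 have le: "(nn2 P (\<lambda>w. ?S N w - Z w)) \<le> 4 * tail g N" for N
 proof -
  let ?X = "\<lambda>n w. Kint (proj_list N (gs n)) w + (- 1) * Kint (Kfield (gs n)) w"
  let ?W = "\<lambda>w. ?S N w + (- 1) * Z w"
  have X: "L2_limit P ?X ?W" by (intro L2_limit_add S L2_limit_scale Zl)
  note Xm = L2_limitD(1,2)[OF X]
  let ?r = "\<lambda>n. \<integral>\<^sup>+w. ennreal ((?X n w - ?W w)^2) \<partial>P"
  let ?D = "\<lambda>n. Dsq (\<lambda>p. step_field (gs n) p - field g p)"
  have bound: "(nn2 P (\<lambda>w. ?W w)) \<le> 2 * ?r n + (4 * ?D n + 4 * tail g N)" for n
  proof -
   have "(nn2 P (\<lambda>w. ?W w)) = (nn2 P (\<lambda>w. (?W w - ?X n w) + ?X n w))" by simp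
   also have "\<dots> \<le> 2 * (nn2 P (\<lambda>w. ?W w - ?X n w)) + 2 * (nn2 P (\<lambda>w. ?X n w))"
    by (rule nn2_triangle[OF borel_measurable_diff[OF Xm] Xm(2)])
   also have "(nn2 P (\<lambda>w. ?W w - ?X n w)) = ?r n" by (simp only: power2_commute)
   also have "(nn2 P (\<lambda>w. ?X n w)) = (nn2 P (\<lambda>w. Kint (Kfield (gs n)) w - Kint (proj_list N (gs n)) w))"
    by (simp add: power2_commute)
   also have "2 * ?r n + 2 * \<dots> \<le> 2 * ?r n + 2 * (2 * ?D n + 2 * tail g N)"
    by (intro add_mono mult_left_mono proj_list_distance[OF m gs]) auto
   also have "\<dots> = 2 * ?r n + (4 * ?D n + 4 * tail g N)" by (simp add: distrib_left mult.assoc[symmetric])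
   finally show ?thesis .
  qed
  have "(\<lambda>n. 2 * ?r n + (4 * ?D n + 4 * tail g N)) \<longlonglongrightarrow> 2 * 0 + (4 * 0 + 4 * tail g N)"
   by (intro tendsto_add ennreal_tendsto_cmult tendsto_const L2_limitD(3)[OF X] lim) auto
  then have "(nn2 P (\<lambda>w. ?W w)) \<le> 2 * 0 + (4 * 0 + 4 * tail g N)"
   by (rule LIMSEQ_le_const) (use bound in blast)
  then show ?thesis by simp
 qed
 have "(\<lambda>N. 4 * tail g N) \<longlonglongrightarrow> 4 * 0" by (intro ennreal_tendsto_cmult tail_tendsto_0[OF g]) auto
 then have "(\<lambda>N. \<integral>\<^sup>+w. ennreal ((?S N w - Z w)^2) \<partial>P) \<longlonglongrightarrow> 0" by (intro ennreal_squeeze_0[OF le]) simp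
 then show ?thesis using L2_limitD(1)[OF Zl] L2_limitD(1)[OF S] by (simp add: L2_limit_def)
qed

end

section \<open>The Q-Wiener process\<close>

lemma (in orthonormal_basis) J_op_basis:
 assumes "j \<in> I"
 shows "J_op I lam e (e j) = sqrt (lam j) *\<^sub>R e j"
proof -
 have "J_op I lam e (e j) = (\<Sum>\<^sub>\<infinity>i\<in>{j}. (sqrt (lam i) * (e j \<bullet> e i)) *\<^sub>R e i)"
  unfolding J_op_def using assms by (intro infsum_cong_neutral) (auto simp: orth)
 then show ?thesis using assms by (simp add: orth)
qed

locale weights = orthonormal_basis I e
 for I :: "nat set" and e :: "nat \<Rightarrow> 'k::{real_inner, complete_space}" +
 fixes lam :: "nat \<Rightarrow> real"
 assumes lam_pos: "\<And>j. j \<in> I \<Longrightarrow> 0 < lam j" and lam_summable: "lam summable_on I"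
begin

abbreviation J :: "'k \<Rightarrow> 'k" where "J \<equiv> J_op I lam e"

lemma lam_bounded: obtains C where "\<And>j. j \<in> I \<Longrightarrow> lam j \<le> C" "0 \<le> C"
proof
 show "lam j \<le> infsum lam I" if "j \<in> I" for j
  using infsum_mono_neutral[of lam "{j}" lam I] lam_summable lam_pos that by (auto intro: less_imp_le)
 show "0 \<le> infsum lam I" using lam_pos by (intro infsum_nonneg) (auto intro: less_imp_le)
qed

lemma J_has_sum: "((\<lambda>j. (sqrt (lam j) * (h \<bullet> e j)) *\<^sub>R e j) has_sum J h) I"
proof -
 obtain C where C: "\<And>j. j \<in> I \<Longrightarrow> lam j \<le> C" by (rule lam_bounded) blast
 have "(\<lambda>j. C * (h \<bullet> e j)^2) summable_on I" by (intro summable_on_cmult_right coordinates_square_summable)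
 then have "(\<lambda>j. (sqrt (lam j) * (h \<bullet> e j))^2) summable_on I"
 proof (rule summable_on_comparison_test)
  show "(sqrt (lam j) * (h \<bullet> e j))^2 \<le> C * (h \<bullet> e j)^2" if "j \<in> I" for j
   using C[OF that] lam_pos[OF that] by (simp add: power_mult_distrib mult_right_mono)
 qed simp
 then show ?thesis
  unfolding J_op_def by (intro has_sum_infsum orthonormal_summable) (auto simp: orth)
qed

lemma J_coordinate: "j \<in> I \<Longrightarrow> J h \<bullet> e j = sqrt (lam j) * (h \<bullet> e j)"
 by (rule coordinate_of_sum[OF J_has_sum])

lemma inj_J: "inj J"
proof (rule injI)
 fix h h' assume "J h = J h'"
 then have "h \<bullet> e j = h' \<bullet> e j" if "j \<in> I" for j
  using J_coordinate[OF that, of h] J_coordinate[OF that, of h'] lam_pos[OF that] by simp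
 then show "h = h'" by (rule coordinates_eq_imp_eq)
qed

lemma inv_J_basis: "j \<in> I \<Longrightarrow> inv J (sqrt (lam j) *\<^sub>R e j) = e j"
 using inv_f_f[OF inj_J, of "e j"] by (simp add: J_op_basis)

text \<open>On the basis \<open>sqrt (lam j) e\<^sub>j\<close> of the range of \<open>J\<close> the functional
  has the coordinates of \<open>k\<close>.\<close>

lemma inner_inv_J_hilbert_schmidt: "hilbert_schmidt_KQ I lam e (((\<bullet>) k) \<circ> inv J)"
proof -
 have "((\<bullet>) k \<circ> inv J) \<circ> J = (\<lambda>h. k \<bullet> h)" using inv_f_f[OF inj_J] by (simp add: fun_eq_iff)
 moreover have "(\<lambda>j. (((\<bullet>) k \<circ> inv J) (sqrt (lam j) *\<^sub>R e j))^2) summable_on I \<longleftrightarrow> (\<lambda>j. (k \<bullet> e j)^2) summable_on I"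
  by (rule summable_on_cong) (simp add: inv_J_basis)
 ultimately show ?thesis
  unfolding hilbert_schmidt_KQ_def using coordinates_square_summable[of k] by (simp add: bounded_linear_inner_right)
qed

lemma J_expansion_coordinate:
 assumes "((\<lambda>j. b j *\<^sub>R J (e j)) has_sum p) I" "j \<in> I"
 shows "p \<bullet> e j = b j * sqrt (lam j)"
proof -
 have "((\<lambda>j. (b j * sqrt (lam j)) *\<^sub>R e j) has_sum p) I \<longleftrightarrow> ((\<lambda>j. b j *\<^sub>R J (e j)) has_sum p) I"
  by (rule has_sum_cong) (simp add: J_op_basis)
 then have "((\<lambda>j. (b j * sqrt (lam j)) *\<^sub>R e j) has_sum p) I" using assms(1) by simp
 from coordinate_of_sum[OF this assms(2)] show ?thesis .
qed

text \<open>All weights are positive, so coordinates can be divided by their square roots.\<close>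

lemma J_expansion_unique:
 assumes "((\<lambda>j. b j *\<^sub>R J (e j)) has_sum p) I" "((\<lambda>j. c j *\<^sub>R J (e j)) has_sum p) I" "j \<in> I"
 shows "b j = c j"
 using J_expansion_coordinate[OF assms(1,3)] J_expansion_coordinate[OF assms(2,3)] lam_pos[OF assms(3)] by simp

end

text \<open>Only finitely many values of the integrator enter each elementary integral.\<close>

lemma has_ito_integral_cong_integrator:
 assumes P: "complete_measure P" and eq: "\<And>t. 0 \<le> t \<Longrightarrow> t \<le> T \<Longrightarrow> AE w in P. Y t w = Y' t w"
  and Z: "has_ito_integral P G A T Y h Z"
 shows "has_ito_integral P G A T Y' h Z"
proof -
 obtain hs where hs: "\<And>n::nat. simple_process P G T (hs n)"
  and lim: "(\<lambda>n. L2_sq P A T (\<lambda>t w. simple_process_fun (hs n) t w - h t w)) \<longlonglongrightarrow> 0"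
  and Zl: "L2_limit P (\<lambda>n. simple_process_integral Y (hs n)) Z"
  using Z unfolding has_ito_integral_def by blast
 have ae: "AE w in P. simple_process_integral Y hs w = simple_process_integral Y' hs w" if "simple_process P G T hs" for hs
  using that
 proof (induction hs)
  case Nil
  show ?case by (simp add: simple_process_integral_def)
 next
  case (Cons h hs)
  obtain a b X where h: "h = (a, b, X)" by (metis prod_cases3)
  have ab: "0 \<le> a" "a \<le> T" "0 \<le> b" "b \<le> T" and "simple_process P G T hs" using Cons(2) by (auto simp: simple_process_def h)
  from Cons(1)[OF this(5)] eq[OF ab(1,2)] eq[OF ab(3,4)] show ?case
   by eventually_elim (simp add: simple_process_integral_def h)
 qed
 have "L2_limit P (\<lambda>n. simple_process_integral Y' (hs n)) Z"
 proof (rule L2_limit_close[OF Zl])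
  show "simple_process_integral Y' (hs n) \<in> borel_measurable P" for n
   by (rule complete_measure.borel_measurable_cong_AE[OF P L2_limitD(2)[OF Zl] ae[OF hs]])
  have "(nn2 P (\<lambda>w. simple_process_integral Y' (hs n) w - simple_process_integral Y (hs n) w)) = (\<integral>\<^sup>+w. 0 \<partial>P)" for n
  proof (rule nn_integral_cong_AE)
   show "AE w in P. ennreal ((simple_process_integral Y' (hs n) w - simple_process_integral Y (hs n) w)^2) = 0"
    using ae[OF hs[of n]] by eventually_elim simp
  qed
  then show "(\<lambda>n. nn2 P (\<lambda>w. simple_process_integral Y' (hs n) w - simple_process_integral Y (hs n) w)) \<longlonglongrightarrow> 0"
   by simp
 qed
 then show ?thesis using Z hs lim unfolding has_ito_integral_def by blast
qed

context time_changed
begin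

text \<open>Comparison with the zeroth discretisation, in which the random time is constantly 1.\<close>

lemma M_second_moment:
 assumes t: "0 \<le> t"
 obtains C where "\<And>k. (nn2 P (\<lambda>w. M k t w)) \<le> ennreal (C * (k \<bullet> k))" "0 \<le> C"
proof
 \<comment> \<open>From \<open>\<bar>\<tau> n t - 1\<bar> \<le> 2 * E t + 2\<close> and \<open>(x + y)\<^sup>2 \<le> 2 * x\<^sup>2 + 2 * y\<^sup>2\<close>.\<close>
 let ?D = "2 * (\<E> w. 2 * E t w + 2) + 2"
 have E: "integrable P (E t)" by (rule E_integrable[OF t])
 have "0 \<le> (\<E> w. 2 * E t w + 2)" using AE_E_nonneg[of t] by (intro integral_nonneg_AE) (auto elim: eventually_mono)
 then show "0 \<le> ?D" by simp
 fix k
 have \<tau>0: "\<tau> 0 t w = 1" for w using idx_le[of 0 t w] by (simp add: \<tau>_def gt_def L_def)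
 have M0: "(\<E> w. (Mn 0 k t w)^2) = k \<bullet> k"
  unfolding Mn_def \<tau>0 using B_covariance[where s=1 and t=1 and k=k and l=k] by (simp add: power2_eq_square)
 have bound: "(norm2 P (Mn n k t))^2 \<le> ?D * (k \<bullet> k)" for n
 proof -
  have d: "square_integrable P (\<lambda>w. Mn n k t w - Mn 0 k t w)" by (intro square_integrable_diff Mn_square_integrable t)
  have sq: "integrable P (\<lambda>w. (Mn n k t w - Mn 0 k t w)^2)" "integrable P (\<lambda>w. (Mn m k t w)^2)" for m
   using d Mn_square_integrable[OF t] by (simp_all add: square_integrable_def)
  have "(\<E> w. \<bar>\<tau> n t w - \<tau> 0 t w\<bar>) \<le> (\<E> w. 2 * E t w + 2)"
  proof (rule integral_mono_AE)
   show "integrable P (\<lambda>w. \<bar>\<tau> n t w - \<tau> 0 t w\<bar>)" using \<tau>_L1(2)[OF t] by simp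
   show "AE w in P. \<bar>\<tau> n t w - \<tau> 0 t w\<bar> \<le> 2 * E t w + 2"
    using AE_good
   proof eventually_elim
    fix w assume "good w"
    from \<tau>_bound[OF this, of n t] E_nonneg[OF this, of t] show "\<bar>\<tau> n t w - \<tau> 0 t w\<bar> \<le> 2 * E t w + 2"
     unfolding \<tau>0 by linarith
   qed
  qed (use E in simp)
  then have dist: "(\<E> w. (Mn n k t w - Mn 0 k t w)^2) \<le> (k \<bullet> k) * (\<E> w. 2 * E t w + 2)"
   unfolding Mn_distance[OF t] by (intro mult_left_mono) auto
  have "(\<E> w. (Mn n k t w)^2) \<le> (\<E> w. 2 * (Mn n k t w - Mn 0 k t w)^2 + 2 * (Mn 0 k t w)^2)"
  proof (rule integral_mono)
   fix w
   show "(Mn n k t w)^2 \<le> 2 * (Mn n k t w - Mn 0 k t w)^2 + 2 * (Mn 0 k t w)^2"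
    using sum_squares_bound[of "Mn n k t w - Mn 0 k t w" "Mn 0 k t w"] by (simp add: power2_eq_square algebra_simps)
  qed (use sq in simp_all)
  also have "\<dots> = 2 * (\<E> w. (Mn n k t w - Mn 0 k t w)^2) + 2 * (k \<bullet> k)" using sq by (simp add: M0)
  also have "\<dots> \<le> 2 * ((k \<bullet> k) * (\<E> w. 2 * E t w + 2)) + 2 * (k \<bullet> k)" using dist by simp
  also have "\<dots> = ?D * (k \<bullet> k)" by (simp add: algebra_simps)
  finally show ?thesis by (simp add: norm2_sq)
 qed
 have "(\<lambda>n. (norm2 P (Mn n k t))^2) \<longlonglongrightarrow> (norm2 P (M k t))^2"
  by (intro tendsto_power L2_limit_norm2[OF M_limit[OF t]] Mn_square_integrable t)
 then have "(norm2 P (M k t))^2 \<le> ?D * (k \<bullet> k)" by (rule LIMSEQ_le_const2) (use bound in blast)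
 then show "(nn2 P (\<lambda>w. M k t w)) \<le> ennreal (?D * (k \<bullet> k))"
  unfolding square_integrable_nn_eq[OF M_square_integrable[OF t]] norm2_sq by (rule ennreal_leI)
qed

text \<open>The expected sum of the squared coefficients is at most a multiple of the sum of the weights, so
  the series converges in \<open>K\<close> almost surely.\<close>

lemma Q_wiener_has_sum:
 assumes lam: "weights I e lam" and t: "0 \<le> t"
 shows "AE w in P. ((\<lambda>j. M (e j) t w *\<^sub>R J_op I lam e (e j)) has_sum Q_wiener I e (J_op I lam e) M t w) I"
proof -
 interpret weights I e lam by (rule lam)
 obtain C where C: "\<And>k. (nn2 P (\<lambda>w. M k t w)) \<le> ennreal (C * (k \<bullet> k))" "0 \<le> C" using M_second_moment[OF t] by blast
 let ?S = "\<lambda>n w. \<Sum>j\<in>I \<inter> {..<n}. ennreal (lam j * (M (e j) t w)^2)"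
 have [measurable]: "M k t \<in> borel_measurable P" for k using M_square_integrable[OF t] by (rule square_integrable_borel)
 have "(\<integral>\<^sup>+w. (SUP n. ?S n w) \<partial>P) = (SUP n. \<integral>\<^sup>+w. ?S n w \<partial>P)"
  by (intro nn_integral_monotone_convergence_SUP) (auto simp: incseq_def le_fun_def intro!: sum_mono2)
 also have "\<dots> \<le> ennreal (C * infsum lam I)"
 proof (rule SUP_least)
  fix n
  have "(\<integral>\<^sup>+w. ?S n w \<partial>P) = (\<Sum>j\<in>I \<inter> {..<n}. \<integral>\<^sup>+w. ennreal (lam j) * ennreal ((M (e j) t w)^2) \<partial>P)"
   using lam_pos by (subst nn_integral_sum[symmetric]) (auto intro!: nn_integral_cong sum.cong simp: ennreal_mult' less_imp_le)
  also have "\<dots> \<le> (\<Sum>j\<in>I \<inter> {..<n}. ennreal (lam j * C))"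
  proof (rule sum_mono)
   fix j assume j: "j \<in> I \<inter> {..<n}"
   have "(\<integral>\<^sup>+w. ennreal (lam j) * ennreal ((M (e j) t w)^2) \<partial>P) = ennreal (lam j) * (nn2 P (\<lambda>w. M (e j) t w))"
    by (rule nn_integral_cmult) measurable
   also have "\<dots> \<le> ennreal (lam j) * ennreal C" using C(1)[of "e j"] j by (intro mult_left_mono) (auto simp: orth)
   finally show "(\<integral>\<^sup>+w. ennreal (lam j) * ennreal ((M (e j) t w)^2) \<partial>P) \<le> ennreal (lam j * C)"
    using j lam_pos C(2) by (auto simp: ennreal_mult less_imp_le)
  qed
  also have "\<dots> = ennreal (C * (\<Sum>j\<in>I \<inter> {..<n}. lam j))"
   using lam_pos C(2) by (subst sum_ennreal) (auto simp: sum_distrib_left mult.commute less_imp_le)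
  also have "\<dots> \<le> ennreal (C * infsum lam I)"
   using lam_pos C(2) lam_summable
   by (intro ennreal_leI mult_left_mono finite_sum_le_infsum) (auto intro: less_imp_le)
  finally show "(\<integral>\<^sup>+w. ?S n w \<partial>P) \<le> ennreal (C * infsum lam I)" .
 qed
 finally have "(\<integral>\<^sup>+w. (SUP n. ?S n w) \<partial>P) < \<infinity>" by (rule le_less_trans) simp
 then have "(\<integral>\<^sup>+w. (SUP n. ?S n w) \<partial>P) \<noteq> \<infinity>" by simp
 then have "AE w in P. (SUP n. ?S n w) \<noteq> \<infinity>" by (intro nn_integral_noteq_infinite) auto
 then show ?thesis
 proof eventually_elim
  fix w assume "(SUP n. ?S n w) \<noteq> \<infinity>"
  then obtain D where D: "(SUP n. ?S n w) = ennreal D" "0 \<le> D" by (cases "SUP n. ?S n w") auto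
  have "(\<Sum>j\<in>F. (M (e j) t w * sqrt (lam j))^2) \<le> D" if F: "finite F" "F \<subseteq> I" for F
  proof -
   obtain n where n: "F \<subseteq> {..<n}" using finite_nat_iff_bounded F(1) by blast
   have "ennreal (\<Sum>j\<in>F. (M (e j) t w * sqrt (lam j))^2) = (\<Sum>j\<in>F. ennreal (lam j * (M (e j) t w)^2))"
    using lam_pos F by (subst sum_ennreal) (auto intro!: arg_cong[of _ _ ennreal] sum.cong simp: power_mult_distrib mult.commute less_imp_le subset_eq)
   also have "\<dots> \<le> ?S n w" using n F by (intro sum_mono2) auto
   also have "\<dots> \<le> ennreal D" unfolding D(1)[symmetric] by (rule SUP_upper) simp
   finally show ?thesis using D(2) by simp
  qed
  then have "(\<lambda>j. (M (e j) t w * sqrt (lam j))^2) summable_on I"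
   by (intro nonneg_bdd_above_summable_on bdd_aboveI2[of _ _ D]) auto
  from orthonormal_summable[OF orth this]
  have "(\<lambda>j. (M (e j) t w * sqrt (lam j)) *\<^sub>R e j) summable_on I" by simp
  also have "?this \<longleftrightarrow> (\<lambda>j. M (e j) t w *\<^sub>R J (e j)) summable_on I"
   by (rule summable_on_cong) (simp add: J_op_basis)
  finally show "((\<lambda>j. M (e j) t w *\<^sub>R J (e j)) has_sum Q_wiener I e J M t w) I"
   unfolding Q_wiener_def by (rule has_sum_infsum)
 qed
qed

end

section \<open>Equality of the three integrals\<close>

theorem corollary4p15:
  fixes P :: "'a measure"
    and f :: "real ^ 'n \<Rightarrow> real"
    and \<iota> :: "(real ^ 'n \<Rightarrow> real) \<Rightarrow> 'k::{real_inner, complete_space}"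
    and F :: "(real \<times> (real ^ 'n) \<Rightarrow> real) \<Rightarrow> 'a \<Rightarrow> real"
    and B :: "'k \<Rightarrow> real \<Rightarrow> 'a \<Rightarrow> real"
    and I :: "nat set"
    and fj :: "nat \<Rightarrow> real ^ 'n \<Rightarrow> real"
    and e :: "nat \<Rightarrow> 'k"
    and lam :: "nat \<Rightarrow> real"
    and U E :: "real \<Rightarrow> 'a \<Rightarrow> real"
    and G :: "real \<Rightarrow> 'a measure"
    and J :: "'k \<Rightarrow> 'k"
    and ME :: "(real ^ 'n) set \<Rightarrow> real \<Rightarrow> 'a \<Rightarrow> real"
    and Wt :: "'k \<Rightarrow> real \<Rightarrow> 'a \<Rightarrow> real"
    and W :: "real \<Rightarrow> 'a \<Rightarrow> 'k"
    and g :: "real \<Rightarrow> real ^ 'n \<Rightarrow> 'a \<Rightarrow> real"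
    and gK :: "real \<Rightarrow> 'a \<Rightarrow> 'k"
    and \<Phi> :: "real \<Rightarrow> 'a \<Rightarrow> 'k \<Rightarrow> real"
    and \<beta> T :: real
  assumes "prob_space P" and "complete_measure P"
    and "covariance_kernel f"
    and "schwartz_completion f \<iota>"
    and "gaussian_noise P f F"
    and "noise_process P \<iota> F B"
    and "\<And>j. j \<in> I \<Longrightarrow> fj j \<in> schwartz"
    and "e = (\<lambda>j. \<iota> (fj j))"
    and "complete_orthonormal_basis I e"
    and "\<And>j. j \<in> I \<Longrightarrow> 0 < lam j" and "lam summable_on I"
    and "0 < \<beta>" and "\<beta> < 1"
    and "stable_subordinator P \<beta> U"
    and "E = inverse_process U"
    and "independent_families P {0..} E test_functions F"
    and "G = time_changed_filtration P I (\<lambda>j. B (e j)) E"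
    and "0 < T"
    and "ME = time_changed_martingale_measure f \<iota> B E"
    and "Wt = time_changed_cylindrical_wiener B E"
    and "J = J_op I lam e"
    and "W = Q_wiener I e J Wt"
    and "g \<in> P_dagger P G E f T"
    and "gK = (\<lambda>t \<omega>. K_elem f \<iota> (\<lambda>x. g t x \<omega>))"
    and "\<Phi> = (\<lambda>t \<omega> \<eta>. gK t \<omega> \<bullet> \<eta>)"
  shows "(\<exists>Z. has_martingale_measure_integral P G E f T ME g Z) \<and>
    (\<exists>Z. has_cylindrical_integral P G E T I e Wt gK Z) \<and>
    (\<exists>Z. has_Q_wiener_integral P G E T I lam e W (\<lambda>t \<omega>. \<Phi> t \<omega> \<circ> inv J) Z) \<and>
    (\<forall>Z1 Z2 Z3. has_martingale_measure_integral P G E f T ME g Z1 \<longrightarrow>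
       has_cylindrical_integral P G E T I e Wt gK Z2 \<longrightarrow>
       has_Q_wiener_integral P G E T I lam e W (\<lambda>t \<omega>. \<Phi> t \<omega> \<circ> inv J) Z3 \<longrightarrow>
       (AE \<omega> in P. Z1 \<omega> = Z2 \<omega> \<and> Z2 \<omega> = Z3 \<omega>))"
proof -
 interpret basis: orthonormal_basis I e by unfold_locales (rule assms)
 interpret integration I e f \<iota> fj P F B E \<beta> U G T
 proof -
  interpret prob_space P by fact
  interpret complete_measure P by fact
  show "integration I e f \<iota> fj P F B E \<beta> U G T"
   by unfold_locales (fact assms | simp only: assms(8))+
 qed
 have wt: "weights I e lam" by unfold_locales (fact assms)+
 interpret weights I e lam by (rule wt)
 note g = \<open>g \<in> P_dagger P G E f T\<close>
 note defs = \<open>ME = _\<close> \<open>Wt = _\<close> \<open>J = _\<close> \<open>W = _\<close> \<open>gK = _\<close> \<open>\<Phi> = _\<close>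
 have Wt: "Wt = M" unfolding defs(2) by (simp add: fun_eq_iff time_changed_cylindrical_wiener_def M_def)
 have h: "gK t w \<bullet> e j = coordinate g j t w" for t w j by (simp add: defs)
 have \<Phi>h: "(\<Phi> t w \<circ> inv J) (sqrt (lam j) *\<^sub>R e j) = coordinate g j t w" if "j \<in> I" for t w j
  using inv_J_basis[OF that] by (simp add: defs)
 have HS: "hilbert_schmidt_KQ I lam e (\<Phi> t w \<circ> inv J)" for t w
 proof -
  have "\<Phi> t w = (\<bullet>) (gK t w)" by (simp add: defs fun_eq_iff)
  then show ?thesis using inner_inv_J_hilbert_schmidt[of "gK t w"] by (simp add: defs(3))
 qed
 have Wsum: "AE w in P. ((\<lambda>j. M (e j) t w *\<^sub>R J_op I lam e (e j)) has_sum W t w) I" if "0 \<le> t" for t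
  using Q_wiener_has_sum[OF wt that] by (simp add: defs(4) Wt defs(3))
 have cyl: "L2_limit P (\<lambda>N w. \<Sum>j\<in>I \<inter> {..<N}. Y j w) Z1"
  if "has_martingale_measure_integral P G E f T ME g Z1" "\<And>j. j \<in> I \<Longrightarrow> has_ito_integral P G E T (M (e j)) (coordinate g j) (Y j)" for Y Z1
  using coordinate_sum_limit that by (simp add: defs(1))
 have cylindrical: "has_cylindrical_integral P G E T I e Wt gK Z \<longleftrightarrow>
   (\<exists>Y. (\<forall>j\<in>I. has_ito_integral P G E T (M (e j)) (coordinate g j) (Y j)) \<and> L2_limit P (\<lambda>n w. \<Sum>j\<in>I \<inter> {..<n}. Y j w) Z)" for Z
  unfolding has_cylindrical_integral_def Wt h ..
 have Q_wiener: "has_Q_wiener_integral P G E T I lam e W (\<lambda>t w. \<Phi> t w \<circ> inv J) Z \<longleftrightarrow>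
   (\<exists>Y. (\<forall>j\<in>I. has_ito_integral P G E T (M (e j)) (coordinate g j) (Y j)) \<and> L2_limit P (\<lambda>n w. \<Sum>j\<in>I \<inter> {..<n}. Y j w) Z)" for Z
 proof
  assume "has_Q_wiener_integral P G E T I lam e W (\<lambda>t w. \<Phi> t w \<circ> inv J) Z"
  then obtain b Y where b: "\<And>t. t \<in> {0..T} \<Longrightarrow> AE w in P. ((\<lambda>j. b j t w *\<^sub>R J_op I lam e (e j)) has_sum W t w) I"
   and Y: "\<And>j. j \<in> I \<Longrightarrow> has_ito_integral P G E T (b j) (\<lambda>t w. (\<Phi> t w \<circ> inv J) (sqrt (lam j) *\<^sub>R e j)) (Y j)"
   and lim: "L2_limit P (\<lambda>n w. \<Sum>j\<in>I \<inter> {..<n}. Y j w) Z"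
   unfolding has_Q_wiener_integral_def by blast
  have "has_ito_integral P G E T (M (e j)) (coordinate g j) (Y j)" if j: "j \<in> I" for j
  proof (rule has_ito_integral_cong_integrator[OF \<open>complete_measure P\<close>])
   show "has_ito_integral P G E T (b j) (coordinate g j) (Y j)" using Y[OF j] unfolding \<Phi>h[OF j] .
   fix t assume t: "0 \<le> t" "t \<le> T"
   then have "t \<in> {0..T}" by simp
   from b[OF this] Wsum[OF t(1)] show "AE w in P. b j t w = M (e j) t w"
    by eventually_elim (rule J_expansion_unique[OF _ _ j])
  qed
  then show "\<exists>Y. (\<forall>j\<in>I. has_ito_integral P G E T (M (e j)) (coordinate g j) (Y j)) \<and> L2_limit P (\<lambda>n w. \<Sum>j\<in>I \<inter> {..<n}. Y j w) Z"
   using lim by blast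
 next
  assume "\<exists>Y. (\<forall>j\<in>I. has_ito_integral P G E T (M (e j)) (coordinate g j) (Y j)) \<and> L2_limit P (\<lambda>n w. \<Sum>j\<in>I \<inter> {..<n}. Y j w) Z"
  then obtain Y where Y: "\<And>j. j \<in> I \<Longrightarrow> has_ito_integral P G E T (M (e j)) (coordinate g j) (Y j)"
   "L2_limit P (\<lambda>n w. \<Sum>j\<in>I \<inter> {..<n}. Y j w) Z" by blast
  have "has_ito_integral P G E T (M (e j)) (\<lambda>t w. (\<Phi> t w \<circ> inv J) (sqrt (lam j) *\<^sub>R e j)) (Y j)" if "j \<in> I" for j
   using Y(1)[OF that] unfolding \<Phi>h[OF that] .
  moreover have "\<forall>t\<in>{0..T}. AE w in P. ((\<lambda>j. M (e j) t w *\<^sub>R J_op I lam e (e j)) has_sum W t w) I" using Wsum by simp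
  ultimately show "has_Q_wiener_integral P G E T I lam e W (\<lambda>t w. \<Phi> t w \<circ> inv J) Z"
   unfolding has_Q_wiener_integral_def using HS Y(2)
   by (intro conjI exI[of _ "\<lambda>j. M (e j)"] exI[of _ Y]) auto
 qed
 obtain Z where Z: "has_martingale_measure_integral P G E f T ME g Z"
  using martingale_measure_integral_exists[OF g] by (auto simp: defs(1))
 obtain Y where Y: "\<And>j. j \<in> I \<Longrightarrow> has_ito_integral P G E T (M (e j)) (coordinate g j) (Y j)"
  using coordinate_ito_exists[OF g] by metis
 have ex: "has_cylindrical_integral P G E T I e Wt gK Z"
  unfolding cylindrical using cyl[OF Z Y] Y by blast
 have unique: "AE w in P. Z1 w = Z2 w"
  if Z1: "has_martingale_measure_integral P G E f T ME g Z1" and Z2: "has_cylindrical_integral P G E T I e Wt gK Z2" for Z1 Z2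
 proof -
  obtain Y where "\<And>j. j \<in> I \<Longrightarrow> has_ito_integral P G E T (M (e j)) (coordinate g j) (Y j)"
   "L2_limit P (\<lambda>n w. \<Sum>j\<in>I \<inter> {..<n}. Y j w) Z2" using Z2 unfolding cylindrical by blast
  then show ?thesis using L2_limit_unique[OF cyl[OF Z1]] by blast
 qed
 have same: "has_Q_wiener_integral P G E T I lam e W (\<lambda>t w. \<Phi> t w \<circ> inv J) Z \<longleftrightarrow> has_cylindrical_integral P G E T I e Wt gK Z" for Z
  unfolding Q_wiener cylindrical ..
 show ?thesis
 proof (intro conjI allI impI)
  show "\<exists>Z. has_martingale_measure_integral P G E f T ME g Z" using Z by blast
  show "\<exists>Z. has_cylindrical_integral P G E T I e Wt gK Z" using ex by blast
  show "\<exists>Z. has_Q_wiener_integral P G E T I lam e W (\<lambda>t w. \<Phi> t w \<circ> inv J) Z" unfolding same using ex by blast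
  fix Z1 Z2 Z3
  assume 1: "has_martingale_measure_integral P G E f T ME g Z1" and 2: "has_cylindrical_integral P G E T I e Wt gK Z2"
   and 3: "has_Q_wiener_integral P G E T I lam e W (\<lambda>t w. \<Phi> t w \<circ> inv J) Z3"
  show "AE w in P. Z1 w = Z2 w \<and> Z2 w = Z3 w"
   using unique[OF 1 2] unique[OF 1 3[unfolded same]] by eventually_elim simp
 qed
qed

end
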